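(* Let $D$ be a positive non-square discriminant. (i) If $D\equiv5\bmod8$, then the group $\mathrm{SL}(L_D)=\mathrm{SL}(L_D^1)$ is pseudo parabolic maximal. (ii) If $D\equiv1\bmod8$, then the group $\mathrm{SL}(L_D^1)$ is $\mathfrak{p}_2$-pseudo parabolic maximal, where $\mathfrak{p}_2$ is the (unique) common prime ideal divisor of $(2)$ and $(w)$.
   Context: $D\equiv 1\bmod 4$ positive, non-square; $K=\mathbb{Q}(\sqrt D)$, $w=\frac{1+\sqrt D}{2}$, $\mathcal{O}_D=\mathbb{Z}\oplus\mathbb{Z}w$ the real quadratic order of discriminant $D$. Veech group: for $a,b>1$ let $P(a,b)$ be the L-shaped polygon with vertices $(0,0),(b,0),(b,a),(b-1,a),(b-1,1),(0,1)$; gluing opposite parallel sides by translations gives a genus 2 translation surface. Its Veech group is the group of derivatives in $\mathrm{SL}_2(\mathbb{R})$ of its orientation-preserving affine homeomorphisms. $\mathrm{SL}(L_D^1)$ is the Veech group of $P(w,w)$; it is a lattice in $\mathrm{SL}_2(\mathbb{R})$ contained in $\mathrm{SL}_2(\mathcal{O}_D)$. A Fuchsian group $\Gamma\subset\mathrm{SL}_2(\mathcal{O}_D)$ is pseudo parabolic maximal if there is no Fuchsian group $\Gamma'$ containing $\Gamma$ with finite index and also containing a parabolic element in $\mathrm{SL}_2(K)\smallsetminus\mathrm{SL}_2(\mathcal{O}_D)$. For an ideal $\mathfrak{n}\subset\mathcal{O}_D$, $\Gamma$ is $\mathfrak{n}$-pseudo parabolic maximal if there is no Fuchsian group $\Gamma'$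 containing $\Gamma$ with finite index and also containing a parabolic element in $\mathrm{SL}_2(K)\smallsetminus(\mathrm{SL}_2(K)\cap\mathrm{Mat}^{2\times2}(\mathfrak{n}^{-1}))$, where $\mathfrak{n}^{-1}$ is the inverse fractional ideal. *)

theory Defs
  imports "HOL-Analysis.Analysis" "HOL-Algebra.Ideal_Product"
begin

section \<open>Surfaces glued from a planar region by translations\<close>

text \<open>
  \<open>P\<close> is a closed region of the plane, \<open>G\<close> the set of pairs of boundary points to be glued
  and \<open>V\<close> a finite set of points of \<open>P\<close> whose images are the marked (cone) points.
  Points of the glued surface are equivalence classes of points of \<open>P\<close>.
\<close>

definition glue_rel :: "'a set \<Rightarrow> ('a \<times> 'a) set \<Rightarrow> ('a \<times> 'a) set" where
  "glue_rel P G = (G \<union> G\<inverse>)\<^sup>* \<inter> P \<times> P"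

definition glue_class :: "'a set \<Rightarrow> ('a \<times> 'a) set \<Rightarrow> 'a \<Rightarrow> 'a set" where
  "glue_class P G x = glue_rel P G `` {x}"

definition glued_space :: "'a::topological_space set \<Rightarrow> ('a \<times> 'a) set \<Rightarrow> 'a set topology" where
  "glued_space P G = topology (\<lambda>U. U \<subseteq> P // glue_rel P G \<and>
     openin (top_of_set P) {x \<in> P. glue_class P G x \<in> U})"

lemma equiv_glue_rel: "equiv P (glue_rel P G)"
proof (rule equivI)
  have "sym ((G \<union> G\<inverse>)\<^sup>*)"
    by (intro sym_rtrancl sym_Un_converse)
  then show "sym (glue_rel P G)"
    unfolding glue_rel_def sym_def by blast
  have "trans ((G \<union> G\<inverse>)\<^sup>*)"
    by (rule trans_rtrancl)
  then show "trans (glue_rel P G)"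
    unfolding glue_rel_def trans_def by blast
qed (auto simp: glue_rel_def refl_on_def)

lemma glue_class_image: "glue_class P G ` P = P // glue_rel P G"
  by (auto simp: glue_class_def quotient_def)

lemma openin_glued_space:
  "openin (glued_space P G) U \<longleftrightarrow>
     U \<subseteq> P // glue_rel P G \<and> openin (top_of_set P) {x \<in> P. glue_class P G x \<in> U}"
proof -
  have "istopology (\<lambda>U. U \<subseteq> P // glue_rel P G \<and>
      openin (top_of_set P) {x \<in> P. glue_class P G x \<in> U})" (is "istopology ?L")
    unfolding istopology_def
  proof (intro conjI allI impI)
    fix S T assume S: "?L S" and T: "?L T"
    then show "S \<inter> T \<subseteq> P // glue_rel P G" by blast
    have "{x \<in> P. glue_class P G x \<in> S \<inter> T} =
        {x \<in> P. glue_class P G x \<in> S} \<inter> {x \<in> P. glue_class P G x \<in> T}" by blast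
    with S T show "openin (top_of_set P) {x \<in> P. glue_class P G x \<in> S \<inter> T}"
      by (simp only: openin_Int)
  next
    fix \<K> assume K: "\<forall>K\<in>\<K>. ?L K"
    then show "\<Union>\<K> \<subseteq> P // glue_rel P G" by blast
    have "{x \<in> P. glue_class P G x \<in> \<Union>\<K>} = (\<Union>K\<in>\<K>. {x \<in> P. glue_class P G x \<in> K})" by blast
    with K show "openin (top_of_set P) {x \<in> P. glue_class P G x \<in> \<Union>\<K>}"
      by (auto intro!: openin_Union)
  qed
  then show ?thesis
    unfolding glued_space_def by (simp add: topology_inverse')
qed

lemma topspace_glued_space: "topspace (glued_space P G) = P // glue_rel P G"
proof -
  have "{x \<in> P. glue_class P G x \<in> P // glue_rel P G} = P"
    using glue_class_image[of P G] by blast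
  then have "openin (glued_space P G) (P // glue_rel P G)"
    by (simp add: openin_glued_space)
  then show ?thesis
    by (meson openin_glued_space openin_subset openin_topspace subset_antisym)
qed

lemma quotient_map_glue_class:
  "quotient_map (top_of_set P) (glued_space P G) (glue_class P G)"
  by (auto simp: quotient_map_def topspace_glued_space glue_class_image openin_glued_space)

text \<open>
  A chart is a homeomorphism from an open set avoiding the marked points onto an open subset
  of the plane which is locally a translation in the coordinate of \<open>P\<close>. This is required
  only over the interior of \<open>P\<close>; for regions glued along sides by translations,
  continuity of the chart determines it on the glued sides.
\<close>

definition translation_chart ::
  "(real^2) set \<Rightarrow> ((real^2) \<times> (real^2)) set \<Rightarrow> (real^2) set \<Rightarrow>
     (real^2) set set \<Rightarrow> ((real^2) set \<Rightarrow> real^2) \<Rightarrow> bool" where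
  "translation_chart P G V U c \<longleftrightarrow>
     openin (glued_space P G) U \<and> U \<inter> glue_class P G ` V = {} \<and>
     open (c ` U) \<and>
     homeomorphic_map (subtopology (glued_space P G) U) (top_of_set (c ` U)) c \<and>
     (\<forall>x\<in>interior P. glue_class P G x \<in> U \<longrightarrow>
        (\<exists>v. \<forall>\<^sub>F y in nhds x. c (glue_class P G y) = y + v))"

definition affine_homeo ::
  "(real^2) set \<Rightarrow> ((real^2) \<times> (real^2)) set \<Rightarrow> (real^2) set \<Rightarrow>
     ((real^2) set \<Rightarrow> (real^2) set) \<Rightarrow> real^2^2 \<Rightarrow> bool" where
  "affine_homeo P G V \<phi> A \<longleftrightarrow>
     homeomorphic_map (glued_space P G) (glued_space P G) \<phi> \<and>
     \<phi> ` (glue_class P G ` V) = glue_class P G ` V \<and>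
     (\<forall>p \<in> topspace (glued_space P G) - glue_class P G ` V.
        \<exists>U c U' c' v. translation_chart P G V U c \<and> translation_chart P G V U' c' \<and>
          p \<in> U \<and> \<phi> ` U \<subseteq> U' \<and> (\<forall>q\<in>U. c' (\<phi> q) = A *v c q + v))"

definition SL2 :: "real set \<Rightarrow> (real^2^2) set" where
  "SL2 S = {A. det A = 1 \<and> (\<forall>i j. A $ i $ j \<in> S)}"

text \<open>Affine homeomorphisms with derivative in \<open>SL2 UNIV\<close> are automatically
  orientation preserving, the determinant being positive.\<close>

definition veech_group ::
  "(real^2) set \<Rightarrow> ((real^2) \<times> (real^2)) set \<Rightarrow> (real^2) set \<Rightarrow> (real^2^2) set" where
  "veech_group P G V = {A \<in> SL2 UNIV. \<exists>\<phi>. affine_homeo P G V \<phi> A}"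


section \<open>The L-shaped surfaces \<open>P(a,b)\<close>\<close>

definition L_polygon :: "real \<Rightarrow> real \<Rightarrow> (real^2) set" where
  "L_polygon a b =
     cbox (vector [0, 0]) (vector [b, 1]) \<union> cbox (vector [b - 1, 0]) (vector [b, a])"

definition L_vertices :: "real \<Rightarrow> real \<Rightarrow> (real^2) set" where
  "L_vertices a b = {vector [0, 0], vector [b, 0], vector [b, a],
     vector [b - 1, a], vector [b - 1, 1], vector [0, 1]}"

text \<open>The sides of length \<open>b\<close> and \<open>a\<close> are each subdivided into two segments, which are
  glued to the two opposite parallel sides.\<close>

definition L_gluing :: "real \<Rightarrow> real \<Rightarrow> ((real^2) \<times> (real^2)) set" where
  "L_gluing a b =
     {(vector [x, 0], vector [x, 1]) | x. 0 \<le> x \<and> x \<le> b - 1} \<union>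
     {(vector [x, 0], vector [x, a]) | x. b - 1 \<le> x \<and> x \<le> b} \<union>
     {(vector [0, y], vector [b, y]) | y. 0 \<le> y \<and> y \<le> 1} \<union>
     {(vector [b - 1, y], vector [b, y]) | y. 1 \<le> y \<and> y \<le> a}"

definition L_veech_group :: "real \<Rightarrow> real \<Rightarrow> (real^2^2) set" where
  "L_veech_group a b = veech_group (L_polygon a b) (L_gluing a b) (L_vertices a b)"


section \<open>Real quadratic orders\<close>

text \<open>\<open>\<rat>(\<surd>D)\<close> and its order of discriminant \<open>D \<equiv> 1\<close> (mod 4) are regarded as subsets of the
  reals through the embedding with \<open>\<surd>D > 0\<close>.\<close>

definition quad_field :: "int \<Rightarrow> real set" where
  "quad_field D = {x + y * sqrt (of_int D) | x y. x \<in> \<rat> \<and> y \<in> \<rat>}"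

definition quad_w :: "int \<Rightarrow> real" where
  "quad_w D = (1 + sqrt (of_int D)) / 2"

definition quad_order :: "int \<Rightarrow> real set" where
  "quad_order D = {of_int m + of_int n * quad_w D | m n. True}"

definition quad_order_ring :: "int \<Rightarrow> real ring" where
  "quad_order_ring D =
     \<lparr>carrier = quad_order D, mult = (*), one = 1, zero = 0, add = (+)\<rparr>"

definition inv_ideal :: "int \<Rightarrow> real set \<Rightarrow> real set" where
  "inv_ideal D I = {x \<in> quad_field D. \<forall>y\<in>I. x * y \<in> quad_order D}"

definition ideal_divides :: "int \<Rightarrow> real set \<Rightarrow> real set \<Rightarrow> bool" where
  "ideal_divides D I J \<longleftrightarrow>
     (\<exists>H. ideal H (quad_order_ring D) \<and> J = I \<cdot>\<^bsub>quad_order_ring D\<^esub> H)"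

definition common_prime_divisor :: "int \<Rightarrow> real set \<Rightarrow> bool" where
  "common_prime_divisor D \<pp> \<longleftrightarrow>
     primeideal \<pp> (quad_order_ring D) \<and>
     ideal_divides D \<pp> (PIdl\<^bsub>quad_order_ring D\<^esub> 2) \<and>
     ideal_divides D \<pp> (PIdl\<^bsub>quad_order_ring D\<^esub> (quad_w D))"

lemma quad_w_square:
  assumes "D \<ge> 0" "D mod 4 = 1"
  shows "quad_w D * quad_w D = of_int ((D - 1) div 4) + quad_w D"
proof -
  have "4 * ((D - 1) div 4) = D - 1"
    using assms(2) by presburger
  then have "4 * real_of_int ((D - 1) div 4) = real_of_int D - 1"
    by (metis of_int_1 of_int_diff of_int_mult of_int_numeral)
  moreover have "sqrt (of_int D) * sqrt (of_int D) = real_of_int D"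
    using assms(1) by simp
  ultimately show ?thesis
    by (simp add: quad_w_def field_simps)
qed

lemma cring_quad_order_ring:
  assumes "D \<ge> 0" "D mod 4 = 1"
  shows "cring (quad_order_ring D)"
proof -
  have add: "x + y \<in> quad_order D" if xy: "x \<in> quad_order D" "y \<in> quad_order D" for x y
  proof -
    obtain m n m' n' where "x = of_int m + of_int n * quad_w D" "y = of_int m' + of_int n' * quad_w D"
      using xy unfolding quad_order_def by blast
    then have "x + y = of_int (m + m') + of_int (n + n') * quad_w D" by (simp add: algebra_simps)
    then show ?thesis unfolding quad_order_def by blast
  qed
  have mult: "x * y \<in> quad_order D" if xy: "x \<in> quad_order D" "y \<in> quad_order D" for x y
  proof -
    obtain m n m' n' where x: "x = of_int m + of_int n * quad_w D"
      and y: "y = of_int m' + of_int n' * quad_w D"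
      using xy unfolding quad_order_def by blast
    have "x * y = of_int m * of_int m' + (of_int m * of_int n' + of_int n * of_int m') * quad_w D
        + of_int n * of_int n' * (quad_w D * quad_w D)"
      by (simp add: x y algebra_simps)
    also have "\<dots> = of_int (m * m' + n * n' * ((D - 1) div 4))
        + of_int (m * n' + n * m' + n * n') * quad_w D"
      unfolding quad_w_square[OF assms] by (simp add: algebra_simps)
    finally show ?thesis unfolding quad_order_def by blast
  qed
  have int: "of_int k \<in> quad_order D" for k
  proof -
    have "(of_int k :: real) = of_int k + of_int 0 * quad_w D" by simp
    then show ?thesis unfolding quad_order_def by blast
  qed
  have zero: "0 \<in> quad_order D" and one: "1 \<in> quad_order D" and "-1 \<in> quad_order D"
    using int[of 0] int[of 1] int[of "-1"] by simp_all
  then have minus: "- x \<in> quad_order D" if "x \<in> quad_order D" for x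
    using mult[of "-1" x] that by simp
  show ?thesis
  proof (rule cringI)
    show "abelian_group (quad_order_ring D)"
      by (rule abelian_groupI)
        (auto simp: quad_order_ring_def add zero intro: minus exI[of _ "- _"] bexI[of _ "- _"])
    show "Group.comm_monoid (quad_order_ring D)"
      by (rule comm_monoidI) (auto simp: quad_order_ring_def mult one)
  qed (auto simp: quad_order_ring_def algebra_simps)
qed


section \<open>Fuchsian groups and parabolic maximality\<close>

definition SL2R :: "(real^2^2) monoid" where
  "SL2R = \<lparr>carrier = SL2 UNIV, mult = (**), one = mat 1\<rparr>"

lemma group_SL2R: "group SL2R"
proof (rule groupI)
  fix A assume "A \<in> carrier SL2R"
  then have det: "det A = 1" by (simp add: SL2R_def SL2_def)
  then have "invertible A" by (simp add: invertible_det_nz)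
  then obtain B where B: "B ** A = mat 1" unfolding invertible_def by blast
  then have "det B * det A = 1" by (metis det_I det_mul)
  with B det show "\<exists>B\<in>carrier SL2R. B \<otimes>\<^bsub>SL2R\<^esub> A = \<one>\<^bsub>SL2R\<^esub>"
    by (auto simp: SL2R_def SL2_def)
qed (auto simp: SL2R_def SL2_def det_mul matrix_mul_assoc)

definition fuchsian :: "(real^2^2) set \<Rightarrow> bool" where
  "fuchsian \<Gamma> \<longleftrightarrow> subgroup \<Gamma> SL2R \<and> discrete \<Gamma>"

definition finite_index_in :: "(real^2^2) set \<Rightarrow> (real^2^2) set \<Rightarrow> bool" where
  "finite_index_in \<Gamma> \<Gamma>' \<longleftrightarrow> \<Gamma> \<subseteq> \<Gamma>' \<and> finite (rcosets\<^bsub>SL2R\<lparr>carrier := \<Gamma>'\<rparr>\<^esub> \<Gamma>)"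

definition parabolic :: "real^2^2 \<Rightarrow> bool" where
  "parabolic A \<longleftrightarrow> det A = 1 \<and> \<bar>trace A\<bar> = 2 \<and> A \<noteq> mat 1 \<and> A \<noteq> - mat 1"

definition Mat2 :: "real set \<Rightarrow> (real^2^2) set" where
  "Mat2 S = {A. \<forall>i j. A $ i $ j \<in> S}"

text \<open>Parabolic maximality is a property of Fuchsian groups contained in \<open>SL2 (quad_order D)\<close>;
  this domain is part of the predicates, so that they are not vacuously true outside it.\<close>

definition pseudo_parabolic_maximal :: "int \<Rightarrow> (real^2^2) set \<Rightarrow> bool" where
  "pseudo_parabolic_maximal D \<Gamma> \<longleftrightarrow>
     fuchsian \<Gamma> \<and> \<Gamma> \<subseteq> SL2 (quad_order D) \<and>
     \<not> (\<exists>\<Gamma>'. fuchsian \<Gamma>' \<and> finite_index_in \<Gamma> \<Gamma>' \<and>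
          (\<exists>A\<in>\<Gamma>'. parabolic A \<and> A \<in> SL2 (quad_field D) - SL2 (quad_order D)))"

definition ideal_pseudo_parabolic_maximal ::
  "int \<Rightarrow> real set \<Rightarrow> (real^2^2) set \<Rightarrow> bool" where
  "ideal_pseudo_parabolic_maximal D \<nn> \<Gamma> \<longleftrightarrow>
     fuchsian \<Gamma> \<and> \<Gamma> \<subseteq> SL2 (quad_order D) \<and>
     \<not> (\<exists>\<Gamma>'. fuchsian \<Gamma>' \<and> finite_index_in \<Gamma> \<Gamma>' \<and>
          (\<exists>A\<in>\<Gamma>'. parabolic A \<and>
             A \<in> SL2 (quad_field D) - (SL2 (quad_field D) \<inter> Mat2 (inv_ideal D \<nn>))))"

definition SL_L1 :: "int \<Rightarrow> (real^2^2) set" where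
  "SL_L1 D = L_veech_group (quad_w D) (quad_w D)"

end

theory Submission
  imports Defs
begin

text \<open>
  Let \<open>A\<close> be a parabolic element of a finite extension of the Veech group \<open>\<Gamma>\<close> and put
  \<open>\<epsilon> A = 1 + n\<close>. Elements of the extension over \<open>K\<close> have bounded denominators, so their traces are
  almost integral; the traces of the products of \<open>A\<close> with the two obvious parabolic elements of
  \<open>\<Gamma>\<close>, with the multitwist in the direction \<open>(2, w)\<close> and with its mirror image show that \<open>w n\<close> and
  \<open>h n\<close> are almost integral, where \<open>h\<close> is \<open>1\<close> or \<open>2\<close> as \<open>w (w - 1)\<close> is odd or even. To descend to the
  order itself, conjugate the horizontal parabolic element by \<open>A\<close>: a power of the result is in
  \<open>\<Gamma>\<close>, hence a multitwist of a decomposition into exactly two cylinders, whose areas and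
  core holonomies lie in the order. Comparing norms bounds the denominator of \<open>w v v\<^sup>T\<close> for the first
  column \<open>v\<close> of \<open>A\<close>.
\<close>

section \<open>The surface and displacements on it\<close>

text \<open>\<open>Or\<close> need not be the maximal order, since \<open>D\<close> may have square
  factors. Trace arguments only see the maximal order, whose elements lie in \<open>Or\<close> after
  multiplication by \<open>D\<close>; so the remaining difficulty sits at the primes dividing
  \<open>D\<close>, and the later multipliers \<open>2\<close>, \<open>8\<close> and
  \<open>NN\<close> are all prime to \<open>D = 4 * NN + 1\<close>. The two obvious parabolic
  elements leave denominators at divisors of \<open>om\<close>. The direction \<open>(2, om)\<close>
  helps because its twist constant \<open>(om + 1) * om\<^sup>2 / h\<close> cancels the denominator
  in the square of the slope \<open>2 / om\<close> and leaves the coefficient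
  \<open>4 * (om + 1) / h\<close>, whose \<open>4\<close> is prime to \<open>NN\<close> exactly when
  \<open>NN\<close> is odd. For even \<open>NN\<close> a single factor 2 survives: it is the origin
  of the prime ideal in part (ii). For \<open>D = 5\<close>, where \<open>om < 2\<close> rules this
  direction out, \<open>om\<close> is a unit. A second obstacle is topological: charts are
  prescribed only over the interior of the polygon. The Veech group is therefore first rewritten as
  the set of derivatives of bijections of the punctured surface that are affine for small
  displacements.\<close>

definition pt :: "real \<Rightarrow> real \<Rightarrow> real^2" where "pt x y = vector [x, y]"

lemma pt_nth [simp]: "pt x y $ 1 = x" "pt x y $ 2 = y" by (simp_all add: pt_def)

lemma pt_eq_iff: "p = q \<longleftrightarrow> p $ 1 = q $ 1 \<and> p $ 2 = (q::real^2) $ 2"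
  by (simp add: vec_eq_iff forall_2)

lemma pt_collapse [simp]: "pt (p $ 1) (p $ 2) = p" by (simp add: pt_eq_iff)

lemma pt_inject [simp]: "pt x y = pt x' y' \<longleftrightarrow> x = x' \<and> y = y'" by (simp add: pt_eq_iff)

lemma pt_add [simp]: "pt x y + pt x' y' = pt (x + x') (y + y')" by (simp add: pt_eq_iff)

lemma pt_diff [simp]: "pt x y - pt x' y' = pt (x - x') (y - y')" by (simp add: pt_eq_iff)

lemma abs_nth_le_norm: "\<bar>h $ 1\<bar> \<le> norm h" "\<bar>h $ 2\<bar> \<le> norm (h::real^2)"
  using component_le_norm_cart[of h] by auto

lemma norm_le_sum2: "norm (h::real^2) \<le> \<bar>h $ 1\<bar> + \<bar>h $ 2\<bar>"
  using norm_le_l1_cart[of h] by (simp add: sum_2)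

lemma norm_pt_le: "norm (pt x y) \<le> \<bar>x\<bar> + \<bar>y\<bar>" using norm_le_sum2[of "pt x y"] by simp

lemma continuous_on_pt:
  assumes "continuous_on A f" "continuous_on A g"
  shows "continuous_on A (\<lambda>x. pt (f x) (g x))"
proof -
  have eq: "pt (f x) (g x) = f x *\<^sub>R pt 1 0 + g x *\<^sub>R pt 0 1" for x by (simp add: pt_eq_iff)
  show ?thesis unfolding eq by (intro continuous_intros assms)
qed

lemma glue_class_eq_iff:
  assumes "p \<in> P" "q \<in> P"
  shows "glue_class P G p = glue_class P G q \<longleftrightarrow> (p, q) \<in> glue_rel P G"
  unfolding glue_class_def using eq_equiv_class_iff[OF equiv_glue_rel assms] .

lemma mem_glue_class:
  "q \<in> glue_class P G p \<longleftrightarrow> (p, q) \<in> glue_rel P G" by (simp add: glue_class_def)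

section \<open>The gluing relation of the polygon and a normal form for its classes\<close>

locale lsurf =
  fixes w :: real
  assumes w1: "w > 1"
begin

definition P :: "(real^2) set" where "P = L_polygon w w"
definition G :: "((real^2) \<times> (real^2)) set" where "G = L_gluing w w"
definition cls :: "real^2 \<Rightarrow> (real^2) set" where "cls = glue_class P G"
definition S :: "(real^2) set topology" where "S = glued_space P G"

lemma mem_P: "p \<in> P \<longleftrightarrow>
    0 \<le> p $ 1 \<and> p $ 1 \<le> w \<and> 0 \<le> p $ 2 \<and> p $ 2 \<le> 1 \<or>
    w - 1 \<le> p $ 1 \<and> p $ 1 \<le> w \<and> 0 \<le> p $ 2 \<and> p $ 2 \<le> w"
  by (auto simp: P_def L_polygon_def mem_box_cart forall_2)

text \<open>A representative of each gluing class; the eight corners form one class, the cone point.\<close>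
definition kap :: "real^2 \<Rightarrow> real^2" where
  "kap p = (let x = p $ 1; y = p $ 2 in
     if x \<in> {0, w - 1, w} \<and> y \<in> {0, 1, w} then pt 0 0
     else if y = 1 \<and> x < w - 1 then pt x 0
     else if y = w then pt x 0
     else if x = w \<and> y < 1 then pt 0 y
     else if x = w then pt (w - 1) y
     else pt x y)"

lemma mem_G: "(p, q) \<in> G \<longleftrightarrow>
   (p $ 1 = q $ 1 \<and> 0 \<le> p $ 1 \<and> p $ 1 \<le> w - 1 \<and> p $ 2 = 0 \<and> q $ 2 = 1) \<or>
   (p $ 1 = q $ 1 \<and> w - 1 \<le> p $ 1 \<and> p $ 1 \<le> w \<and> p $ 2 = 0 \<and> q $ 2 = w) \<or>
   (p $ 2 = q $ 2 \<and> 0 \<le> p $ 2 \<and> p $ 2 \<le> 1 \<and> p $ 1 = 0 \<and> q $ 1 = w) \<or>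
   (p $ 2 = q $ 2 \<and> 1 \<le> p $ 2 \<and> p $ 2 \<le> w \<and> p $ 1 = w - 1 \<and> q $ 1 = w)"
proof -
  have 1: "(p, q) \<in> {(vector [x, a], vector [x, b]) | x. c \<le> x \<and> x \<le> d} \<longleftrightarrow>
      p $ 1 = q $ 1 \<and> c \<le> p $ 1 \<and> p $ 1 \<le> d \<and> p $ 2 = a \<and> q $ 2 = b" for a b c d :: real
    by (auto simp: pt_eq_iff)
  have 2: "(p, q) \<in> {(vector [a, x], vector [b, x]) | x. c \<le> x \<and> x \<le> d} \<longleftrightarrow>
      p $ 2 = q $ 2 \<and> c \<le> p $ 2 \<and> p $ 2 \<le> d \<and> p $ 1 = a \<and> q $ 1 = b" for a b c d :: real
    by (auto simp: pt_eq_iff)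
  show ?thesis unfolding G_def L_gluing_def Un_iff 1 2 by blast
qed

lemma G_subset: "(p, q) \<in> G \<Longrightarrow> p \<in> P \<and> q \<in> P" using w1 by (auto simp: mem_G mem_P)

text \<open>Besides the six vertices of the polygon this accepts \<open>(w - 1, 0)\<close> and
  \<open>(w, 1)\<close>, which are glued to vertices. It also accepts \<open>(0, w)\<close>, which
  lies outside \<open>P\<close>.\<close>

definition corner :: "real^2 \<Rightarrow> bool" where
  "corner p \<longleftrightarrow> p $ 1 \<in> {0, w - 1, w} \<and> p $ 2 \<in> {0, 1, w}"

lemma kap_corner1: "corner p \<Longrightarrow> kap p = pt 0 0" by (simp add: kap_def corner_def Let_def)

lemma kap_noncorner: "\<not> corner p \<Longrightarrow> kap p = (
     if p $ 2 = 1 \<and> p $ 1 < w - 1 then pt (p $ 1) 0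
     else if p $ 2 = w then pt (p $ 1) 0
     else if p $ 1 = w \<and> p $ 2 < 1 then pt 0 (p $ 2)
     else if p $ 1 = w then pt (w - 1) (p $ 2)
     else p)" by (simp only: kap_def corner_def Let_def pt_collapse if_False)

lemma corner_G:
  assumes "(p, q) \<in> G" shows "corner p \<longleftrightarrow> corner q"
proof -
  consider "p $ 1 = q $ 1" "p $ 2 \<in> {0,1,w}" "q $ 2 \<in> {0,1,w}"
    | "p $ 2 = q $ 2" "p $ 1 \<in> {0,w-1,w}" "q $ 1 \<in> {0,w-1,w}" using assms unfolding mem_G by blast
  then show ?thesis by cases (simp_all add: corner_def)
qed

lemma kap_G: assumes "(p, q) \<in> G" shows "kap p = kap q"
proof (cases "corner p")
  case True
  then show ?thesis using corner_G[OF assms] by (simp add: kap_corner1)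
next
  case False
  then have F: "\<not> corner p" "\<not> corner q" using corner_G[OF assms] by auto
  have nw: "w \<noteq> 0" "w \<noteq> 1" "w - 1 \<noteq> w" "0 < w" "1 < w" using w1 by auto
  note k = kap_noncorner[OF F(1)] kap_noncorner[OF F(2)]
  from assms[unfolded mem_G] show ?thesis
  proof (elim disjE conjE)
    assume a: "p $ 1 = q $ 1" "0 \<le> p $ 1" "p $ 1 \<le> w - 1" "p $ 2 = 0" "q $ 2 = 1"
    then have "p $ 1 < w - 1" using F by (auto simp: corner_def)
    then show ?thesis using a nw k by (simp add: pt_eq_iff)
  next
    assume a: "p $ 1 = q $ 1" "w - 1 \<le> p $ 1" "p $ 1 \<le> w" "p $ 2 = 0" "q $ 2 = w"
    then have "p $ 1 \<noteq> w" using F by (auto simp: corner_def)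
    then show ?thesis using a nw k by (simp add: pt_eq_iff)
  next
    assume a: "p $ 2 = q $ 2" "0 \<le> p $ 2" "p $ 2 \<le> 1" "p $ 1 = 0" "q $ 1 = w"
    then have "p $ 2 \<noteq> 1" using F by (auto simp: corner_def)
    then show ?thesis using a nw k by (simp add: pt_eq_iff)
  next
    assume a: "p $ 2 = q $ 2" "1 \<le> p $ 2" "p $ 2 \<le> w" "p $ 1 = w - 1" "q $ 1 = w"
    then have "p $ 2 \<noteq> 1" "p $ 2 \<noteq> w" using F by (auto simp: corner_def)
    then show ?thesis using a nw k by (simp add: pt_eq_iff)
  qed
qed

lemma corner_cases:
  assumes "p \<in> P" "corner p"
  shows "p = pt 0 0 \<or> p = pt 0 1 \<or> p = pt w 0 \<or> p = pt w 1 \<or> p = pt (w-1) 1 \<or>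
    p = pt (w-1) 0 \<or> p = pt (w-1) w \<or> p = pt w w"
proof -
  have "p $ 1 = 0 \<or> p $ 1 = w - 1 \<or> p $ 1 = w" "p $ 2 = 0 \<or> p $ 2 = 1 \<or> p $ 2 = w"
    using assms(2) by (auto simp: corner_def)
  moreover have "\<not> (p $ 1 = 0 \<and> p $ 2 = w)" using assms(1) w1 by (auto simp: mem_P)
  ultimately show ?thesis unfolding pt_eq_iff pt_nth by argo
qed

text \<open>Only corners need chains of several gluings: \<open>v1\<close> to \<open>v7\<close> lead
  each of them to the origin, later chains reusing earlier ones. This is why the surface has a
  single cone point.\<close>

lemma kap_cases_G:
  assumes p: "p \<in> P"
  shows "(p, kap p) \<in> (G \<union> G\<inverse>)\<^sup>*"
proof -
  let ?R = "(G \<union> G\<inverse>)\<^sup>*"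
  have st: "(a, b) \<in> ?R" if "(a, b) \<in> G \<or> (b, a) \<in> G" for a b using that by auto
  have tr: "(a, b) \<in> ?R \<Longrightarrow> (b, c) \<in> ?R \<Longrightarrow> (a, c) \<in> ?R" for a b c by (rule rtrancl_trans)
  have v1: "(pt 0 1, pt 0 0) \<in> ?R" by (rule st) (use w1 in \<open>simp add: mem_G\<close>)
  have v2: "(pt w 0, pt 0 0) \<in> ?R" by (rule st) (use w1 in \<open>simp add: mem_G\<close>)
  have "(pt w 1, pt 0 1) \<in> ?R" by (rule st) (use w1 in \<open>simp add: mem_G\<close>)
  from tr[OF this v1] have v3: "(pt w 1, pt 0 0) \<in> ?R" .
  have "(pt (w-1) 1, pt w 1) \<in> ?R" by (rule st) (use w1 in \<open>simp add: mem_G\<close>)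
  from tr[OF this v3] have v4: "(pt (w-1) 1, pt 0 0) \<in> ?R" .
  have "(pt (w-1) 0, pt (w-1) 1) \<in> ?R" by (rule st) (use w1 in \<open>simp add: mem_G\<close>)
  from tr[OF this v4] have v5: "(pt (w-1) 0, pt 0 0) \<in> ?R" .
  have "(pt (w-1) w, pt (w-1) 0) \<in> ?R" by (rule st) (use w1 in \<open>simp add: mem_G\<close>)
  from tr[OF this v5] have v6: "(pt (w-1) w, pt 0 0) \<in> ?R" .
  have "(pt w w, pt w 0) \<in> ?R" by (rule st) (use w1 in \<open>simp add: mem_G\<close>)
  from tr[OF this v2] have v7: "(pt w w, pt 0 0) \<in> ?R" .
  show ?thesis
  proof (cases "corner p")
    case True
    show ?thesis using corner_cases[OF p True]
      unfolding kap_corner1[OF True] by (elim disjE) (simp_all only: v1 v2 v3 v4 v5 v6 v7 rtrancl.rtrancl_refl)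
  next
    case False
    have b: "p $ 2 \<le> w" "p $ 1 \<le> w" "0 \<le> p $ 1" "0 \<le> p $ 2" using p w1 by (auto simp: mem_P)
    have "kap p = p" if "\<not> (p $ 2 = 1 \<and> p $ 1 < w - 1)" "p $ 2 \<noteq> w" "p $ 1 \<noteq> w"
      using kap_noncorner[OF False] that by simp
    moreover have "p $ 2 \<noteq> 1" if "p $ 1 = w" using that False by (simp add: corner_def)
    ultimately consider "p $ 2 = 1 \<and> p $ 1 < w - 1" | "p $ 2 = w" "p $ 2 \<noteq> 1"
      | "p $ 1 = w" "p $ 2 < 1" | "p $ 1 = w" "p $ 2 > 1" "p $ 2 \<noteq> w" | "kap p = p" using w1 by force
    then have "kap p = p \<or> (p, kap p) \<in> G \<or> (kap p, p) \<in> G"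
    proof cases
      case 1
      then show ?thesis using kap_noncorner[OF False] b w1 by (simp add: mem_G)
    next
      case 2
      then have "w - 1 \<le> p $ 1" using p w1 by (auto simp: mem_P)
      then show ?thesis using 2 kap_noncorner[OF False] b w1 by (simp add: mem_G)
    next
      case 3
      then show ?thesis using kap_noncorner[OF False] b w1 by (simp add: mem_G)
    next
      case 4
      then show ?thesis using kap_noncorner[OF False] b w1 by (simp add: mem_G)
    qed simp
    then show ?thesis using st[of p "kap p"] by auto
  qed
qed

text \<open>\<open>kap\<close> is constant along every gluing and each point is joined to its
  \<open>kap\<close>, so \<open>kap\<close> decides the generated equivalence relation.\<close>

lemma rel_kap:
  assumes "p \<in> P" "q \<in> P"
  shows "(p, q) \<in> glue_rel P G \<longleftrightarrow> kap p = kap q"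
proof
  assume "(p, q) \<in> glue_rel P G"
  then have "(p, q) \<in> (G \<union> G\<inverse>)\<^sup>*" by (simp add: glue_rel_def)
  then show "kap p = kap q" by (induction rule: rtrancl_induct) (auto dest: kap_G)
next
  assume e: "kap p = kap q"
  have s: "sym ((G \<union> G\<inverse>)\<^sup>*)" by (intro sym_rtrancl sym_Un_converse)
  have "(p, kap p) \<in> (G \<union> G\<inverse>)\<^sup>*" "(kap q, q) \<in> (G \<union> G\<inverse>)\<^sup>*"
    using kap_cases_G assms symD[OF s] by auto
  then show "(p, q) \<in> glue_rel P G" using assms e by (auto simp: glue_rel_def)
qed

lemma cls_eq: "p \<in> P \<Longrightarrow> q \<in> P \<Longrightarrow> cls p = cls q \<longleftrightarrow> kap p = kap q"
  by (simp add: cls_def glue_class_eq_iff rel_kap)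

lemma mem_cls: "p \<in> P \<Longrightarrow> q \<in> cls p \<longleftrightarrow> q \<in> P \<and> kap q = kap p"
proof -
  assume p: "p \<in> P"
  have "q \<in> cls p \<Longrightarrow> q \<in> P" by (auto simp: cls_def mem_glue_class glue_rel_def)
  then show ?thesis using p rel_kap[of p q] by (auto simp: cls_def mem_glue_class)
qed

lemma cls_self: "p \<in> P \<Longrightarrow> p \<in> cls p" by (simp add: mem_cls)

lemma cls_eqI: "p \<in> P \<Longrightarrow> q \<in> cls p \<Longrightarrow> cls q = cls p"
  using mem_cls cls_eq by auto

definition cone :: "(real^2) set" where "cone = cls (pt 0 0)"

definition Sp :: "(real^2) set set" where "Sp = cls ` P - {cone}"

lemma origin_P: "pt 0 0 \<in> P" using w1 by (simp add: mem_P)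

lemma kap_corner:
  assumes "p \<in> P" shows "kap p = pt 0 0 \<longleftrightarrow> corner p"
proof
  assume k: "kap p = pt 0 0"
  show "corner p"
  proof (rule ccontr)
    assume F: "\<not> corner p"
    note k' = kap_noncorner[OF F, unfolded k]
    show False
    proof (cases "p $ 2 = 1 \<and> p $ 1 < w - 1 \<or> p $ 2 = w")
      case True
      with k' have "p $ 1 = 0" by (auto split: if_splits)
      with True F show False by (auto simp: corner_def)
    next
      case nt: False
      show False
      proof (cases "p $ 1 = w")
        case True
        with nt k' w1 have "p $ 2 = 0" by (auto split: if_splits)
        with True F show False by (auto simp: corner_def)
      next
        case False
        with nt k' have "p = pt 0 0" by auto
        with F show False by (auto simp: corner_def)
      qed
    qed
  qed
qed (simp add: kap_corner1)

lemma cls_cone: "p \<in> P \<Longrightarrow> cls p = cone \<longleftrightarrow> corner p"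
  using kap_corner[of p] kap_corner[OF origin_P] by (simp add: cone_def cls_eq origin_P corner_def)

lemma cls_Sp: "p \<in> P \<Longrightarrow> cls p \<in> Sp \<longleftrightarrow> \<not> corner p"
  by (simp add: Sp_def cls_cone)

lemma Sp_cases:
  assumes "q \<in> Sp" obtains p where "p \<in> P" "\<not> corner p" "q = cls p"
  using assms cls_cone unfolding Sp_def by blast

lemma Sp_mem: "q \<in> Sp \<Longrightarrow> r \<in> q \<Longrightarrow> r \<in> P \<and> cls r = q \<and> \<not> corner r"
  by (elim Sp_cases) (metis cls_Sp cls_eqI mem_cls)

lemma Sp_ne: "q \<in> Sp \<Longrightarrow> \<exists>r. r \<in> q" by (elim Sp_cases) (use cls_self in blast)

lemma vertices_P: "v \<in> L_vertices w w \<Longrightarrow> v \<in> P \<and> corner v"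
  unfolding L_vertices_def pt_def[symmetric] insert_iff empty_iff
  by (elim disjE) (use w1 in \<open>simp_all add: mem_P corner_def\<close>)

lemma cone_vertices: "cls ` L_vertices w w = {cone}"
proof -
  have "pt 0 0 \<in> L_vertices w w" by (simp add: L_vertices_def pt_def)
  moreover have "cls v = cone" if "v \<in> L_vertices w w" for v using vertices_P[OF that] cls_cone by blast
  ultimately show ?thesis by blast
qed

lemma topspace_S: "topspace S = cls ` P" by (simp add: S_def cls_def topspace_glued_space glue_class_image)

lemma Sp_subset: "Sp \<subseteq> topspace S" by (auto simp: topspace_S Sp_def)

lemma topspace_minus: "topspace S - {cone} = Sp" by (simp add: topspace_S Sp_def)

lemma openin_S: "openin S U \<longleftrightarrow> U \<subseteq> cls ` P \<and> openin (top_of_set P) {x \<in> P. cls x \<in> U}"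
  by (simp add: S_def cls_def openin_glued_space glue_class_image)

lemma quot_cls: "quotient_map (top_of_set P) S cls" using quotient_map_glue_class by (simp add: S_def cls_def)

lemma P_eq: "P = cbox (pt 0 0) (pt w 1) \<union> cbox (pt (w-1) 0) (pt w w)" by (simp add: P_def L_polygon_def pt_def)

lemma compact_P: "compact P" unfolding P_eq by (intro compact_Un compact_cbox)

lemma compact_S: "compact_space S"
  using compact_P image_compactin[of "top_of_set P" P S cls] quotient_imp_continuous_map[OF quot_cls]
  unfolding compact_space_def topspace_S by (simp add: compactin_subtopology)

lemma closed_G: "compact (G::((real^2)\<times>(real^2)) set)"
proof -
  have pc: "continuous_on A (\<lambda>x. (pt (f x) (g x), pt (f' x) (g' x)))"
    if "continuous_on A f" "continuous_on A g" "continuous_on A f'" "continuous_on A g'"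
    for A :: "real set" and f g f' g'
    by (intro continuous_on_Pair continuous_on_pt that)
  have "G = (\<lambda>x. (pt x 0, pt x 1)) ` {0..w-1} \<union> (\<lambda>x. (pt x 0, pt x w)) ` {w-1..w}
     \<union> (\<lambda>y. (pt 0 y, pt w y)) ` {0..1} \<union> (\<lambda>y. (pt (w-1) y, pt w y)) ` {1..w}"
    unfolding G_def L_gluing_def pt_def[symmetric] image_def by (intro arg_cong2[where f = "(\<union>)"]) auto
  then show ?thesis by (simp only:) (intro compact_Un compact_continuous_image pc continuous_intros compact_Icc)
qed

text \<open>\<open>tI\<close> covers the open segment at height 1 over \<open>w - 1 < x < w\<close>,
  which is interior to the polygon although it separates the two horizontal cylinders. The other
  four types are the pairs of glued open sides, horizontal (H) and vertical (V).\<close>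

definition tI where "tI p \<longleftrightarrow> (0 < p $ 1 \<and> p $ 1 < w \<and> 0 < p $ 2 \<and> p $ 2 < 1) \<or>
   (w - 1 < p $ 1 \<and> p $ 1 < w \<and> 0 < p $ 2 \<and> p $ 2 < w)" for p :: "real^2"
definition tH1 where "tH1 p \<longleftrightarrow> 0 < p $ 1 \<and> p $ 1 < w - 1 \<and> p $ 2 \<in> {0, 1}" for p :: "real^2"
definition tH2 where "tH2 p \<longleftrightarrow> w - 1 < p $ 1 \<and> p $ 1 < w \<and> p $ 2 \<in> {0, w}" for p :: "real^2"
definition tV1 where "tV1 p \<longleftrightarrow> 0 < p $ 2 \<and> p $ 2 < 1 \<and> p $ 1 \<in> {0, w}" for p :: "real^2"
definition tV2 where "tV2 p \<longleftrightarrow> 1 < p $ 2 \<and> p $ 2 < w \<and> p $ 1 \<in> {w - 1, w}" for p :: "real^2"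

lemmas t_defs = tI_def tH1_def tH2_def tV1_def tV2_def

lemma type_cases:
  assumes "p \<in> P"
  obtains "corner p" | "tI p" | "tH1 p" | "tH2 p" | "tV1 p" | "tV2 p"
proof (cases "corner p")
  case F: False
  define x y where "x = p $ 1" and "y = p $ 2"
  have P: "0 \<le> x \<and> x \<le> w \<and> 0 \<le> y \<and> y \<le> 1 \<or> w - 1 \<le> x \<and> x \<le> w \<and> 0 \<le> y \<and> y \<le> w"
    using assms by (simp add: mem_P x_def y_def)
  have C: "\<not> ((x = 0 \<or> x = w - 1 \<or> x = w) \<and> (y = 0 \<or> y = 1 \<or> y = w))"
    using F by (simp add: corner_def x_def y_def)
  have b: "0 \<le> x" "x \<le> w" "0 \<le> y" "y \<le> w" "y > 1 \<longrightarrow> w - 1 \<le> x" using P w1 by auto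
  have "tI p \<or> tH1 p \<or> tH2 p \<or> tV1 p \<or> tV2 p"
  proof (cases "x = 0 \<or> x = w - 1 \<or> x = w")
    case True
    then have n: "y \<noteq> 0" "y \<noteq> 1" "y \<noteq> w" using C by auto
    from True show ?thesis
    proof (elim disjE)
      assume "x = 0"
      then have "y < 1" using b w1 n by (cases "y > 1") auto
      then show ?thesis using \<open>x = 0\<close> n b by (simp add: tV1_def x_def y_def)
    next
      assume x: "x = w - 1"
      show ?thesis
      proof (cases "y < 1")
        case True then show ?thesis using x n b w1 by (simp add: tI_def x_def y_def)
      next
        case False then show ?thesis using x n b w1 by (simp add: tV2_def x_def y_def)
      qed
    next
      assume x: "x = w"
      show ?thesis
      proof (cases "y < 1")
        case True then show ?thesis using x n b w1 by (simp add: tV1_def x_def y_def)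
      next
        case False then show ?thesis using x n b w1 by (simp add: tV2_def x_def y_def)
      qed
    qed
  next
    case False
    then have n: "0 < x" "x < w" "x \<noteq> w - 1" using b by auto
    consider "y = 0" | "0 < y" "y < 1" | "y = 1" | "1 < y" "y < w" | "y = w" using b by linarith
    then show ?thesis
    proof cases
      case 1
      then show ?thesis using n by (cases "x < w - 1") (simp_all add: tH1_def tH2_def x_def y_def)
    next
      case 2
      then show ?thesis using n by (simp add: tI_def x_def y_def)
    next
      case 3
      then show ?thesis using n w1 by (cases "x < w - 1") (simp_all add: tH1_def tI_def x_def y_def)
    next
      case 4
      then show ?thesis using n b by (simp add: tI_def x_def y_def)
    next
      case 5
      then show ?thesis using n b w1 by (simp add: tH2_def x_def y_def)
    qed
  qed
  then show ?thesis using that by blast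
qed

lemma kap_tI: "tI p \<Longrightarrow> kap p = p" using w1 by (subst kap_noncorner) (auto simp: tI_def corner_def)
lemma kap_tH1: "tH1 p \<Longrightarrow> kap p = pt (p $ 1) 0"
  using w1 by (subst kap_noncorner) (auto simp: tH1_def corner_def pt_eq_iff)
lemma kap_tH2: "tH2 p \<Longrightarrow> kap p = pt (p $ 1) 0"
  using w1 by (subst kap_noncorner) (auto simp: tH2_def corner_def pt_eq_iff)
lemma kap_tV1: "tV1 p \<Longrightarrow> kap p = pt 0 (p $ 2)"
  using w1 by (subst kap_noncorner) (auto simp: tV1_def corner_def pt_eq_iff)
lemma kap_tV2: "tV2 p \<Longrightarrow> kap p = pt (w - 1) (p $ 2)"
  using w1 by (subst kap_noncorner) (auto simp: tV2_def corner_def pt_eq_iff)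

lemma tI_P: "tI p \<Longrightarrow> p \<in> P" and tH1_P: "tH1 p \<Longrightarrow> p \<in> P" and tH2_P: "tH2 p \<Longrightarrow> p \<in> P"
  and tV1_P: "tV1 p \<Longrightarrow> p \<in> P" and tV2_P: "tV2 p \<Longrightarrow> p \<in> P"
  using w1 by (auto simp: t_defs mem_P)

lemma t_not_corner: "tI p \<or> tH1 p \<or> tH2 p \<or> tV1 p \<or> tV2 p \<Longrightarrow> \<not> corner p"
  using w1 by (auto simp: t_defs corner_def)

text \<open>The six types have disjoint images under \<open>kap\<close>, which makes the type an
  invariant of the gluing class in \<open>kap_type\<close>.\<close>

lemma kap_range:
  "corner p \<Longrightarrow> kap p $ 1 = 0 \<and> kap p $ 2 = 0"
  "tI p \<Longrightarrow> 0 < kap p $ 1 \<and> 0 < kap p $ 2 \<and> kap p $ 1 < w \<and> (kap p $ 1 \<le> w - 1 \<longrightarrow> kap p $ 2 < 1)"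
  "tH1 p \<Longrightarrow> 0 < kap p $ 1 \<and> kap p $ 1 < w - 1 \<and> kap p $ 2 = 0"
  "tH2 p \<Longrightarrow> w - 1 < kap p $ 1 \<and> kap p $ 1 < w \<and> kap p $ 2 = 0"
  "tV1 p \<Longrightarrow> 0 < kap p $ 2 \<and> kap p $ 2 < 1 \<and> kap p $ 1 = 0"
  "tV2 p \<Longrightarrow> 1 < kap p $ 2 \<and> kap p $ 2 < w \<and> kap p $ 1 = w - 1"
proof -
  show "kap p $ 1 = 0 \<and> kap p $ 2 = 0" if "corner p" by (simp add: kap_corner1[OF that])
  show "0 < kap p $ 1 \<and> 0 < kap p $ 2 \<and> kap p $ 1 < w \<and> (kap p $ 1 \<le> w - 1 \<longrightarrow> kap p $ 2 < 1)" if "tI p"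
    using that w1 unfolding kap_tI[OF that] tI_def by linarith
  show "0 < kap p $ 1 \<and> kap p $ 1 < w - 1 \<and> kap p $ 2 = 0" if "tH1 p"
    using that unfolding kap_tH1[OF that] tH1_def by simp
  show "w - 1 < kap p $ 1 \<and> kap p $ 1 < w \<and> kap p $ 2 = 0" if "tH2 p"
    using that unfolding kap_tH2[OF that] tH2_def by simp
  show "0 < kap p $ 2 \<and> kap p $ 2 < 1 \<and> kap p $ 1 = 0" if "tV1 p"
    using that unfolding kap_tV1[OF that] tV1_def by simp
  show "1 < kap p $ 2 \<and> kap p $ 2 < w \<and> kap p $ 1 = w - 1" if "tV2 p"
    using that unfolding kap_tV2[OF that] tV2_def by simp
qed

lemma kap_type:
  assumes "q \<in> P" "kap q = kap p"
  shows "tI p \<Longrightarrow> q = p" "tH1 p \<Longrightarrow> tH1 q" "tH2 p \<Longrightarrow> tH2 q" "tV1 p \<Longrightarrow> tV1 q" "tV2 p \<Longrightarrow> tV2 q"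
proof -
  note R = kap_range[of p, folded assms(2)]
  note Q = kap_range[of q]
  show "q = p" if "tI p" using assms(1)
  proof (cases q rule: type_cases)
    assume "tI q" then show ?thesis using that assms(2) kap_tI by metis
  qed (use R(2)[OF that] Q w1 in \<open>linarith+\<close>)
  show "tH1 q" if "tH1 p"
    using assms(1) by (cases q rule: type_cases) (use R(3)[OF that] Q w1 in \<open>linarith+\<close>)
  show "tH2 q" if "tH2 p"
    using assms(1) by (cases q rule: type_cases) (use R(4)[OF that] Q w1 in \<open>linarith+\<close>)
  show "tV1 q" if "tV1 p"
    using assms(1) by (cases q rule: type_cases) (use R(5)[OF that] Q w1 in \<open>linarith+\<close>)
  show "tV2 q" if "tV2 p"
    using assms(1) by (cases q rule: type_cases) (use R(6)[OF that] Q w1 in \<open>linarith+\<close>)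
qed

lemma cls_tI: "tI p \<Longrightarrow> cls p = {p}" using mem_cls[OF tI_P] kap_type(1) cls_self[OF tI_P] by blast

lemma cls_tH1: assumes "tH1 p" shows "cls p = {pt (p $ 1) 0, pt (p $ 1) 1}"
proof -
  have "q \<in> cls p \<longleftrightarrow> tH1 q \<and> q $ 1 = p $ 1" for q
    using mem_cls[OF tH1_P[OF assms]] kap_type(2)[OF _ _ assms] tH1_P kap_tH1 assms by (metis pt_inject)
  then show ?thesis using assms unfolding set_eq_iff insert_iff empty_iff pt_eq_iff pt_nth tH1_def by metis
qed

lemma cls_tH2: assumes "tH2 p" shows "cls p = {pt (p $ 1) 0, pt (p $ 1) w}"
proof -
  have "q \<in> cls p \<longleftrightarrow> tH2 q \<and> q $ 1 = p $ 1" for q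
    using mem_cls[OF tH2_P[OF assms]] kap_type(3)[OF _ _ assms] tH2_P kap_tH2 assms by (metis pt_inject)
  then show ?thesis using assms unfolding set_eq_iff insert_iff empty_iff pt_eq_iff pt_nth tH2_def by metis
qed

lemma cls_tV1: assumes "tV1 p" shows "cls p = {pt 0 (p $ 2), pt w (p $ 2)}"
proof -
  have "q \<in> cls p \<longleftrightarrow> tV1 q \<and> q $ 2 = p $ 2" for q
    using mem_cls[OF tV1_P[OF assms]] kap_type(4)[OF _ _ assms] tV1_P kap_tV1 assms by (metis pt_inject)
  then show ?thesis using assms unfolding set_eq_iff insert_iff empty_iff pt_eq_iff pt_nth tV1_def by metis
qed

lemma cls_tV2: assumes "tV2 p" shows "cls p = {pt (w-1) (p $ 2), pt w (p $ 2)}"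
proof -
  have "q \<in> cls p \<longleftrightarrow> tV2 q \<and> q $ 2 = p $ 2" for q
    using mem_cls[OF tV2_P[OF assms]] kap_type(5)[OF _ _ assms] tV2_P kap_tV2 assms by (metis pt_inject)
  then show ?thesis using assms unfolding set_eq_iff insert_iff empty_iff pt_eq_iff pt_nth tV2_def by metis
qed

lemma open_tI: "open (Collect tI)"
proof -
  have "Collect tI = box (pt 0 0) (pt w 1) \<union> box (pt (w-1) 0) (pt w w)"
    by (auto simp: tI_def mem_box_cart forall_2)
  then show ?thesis by (simp only: open_Un open_box)
qed

lemma tI_interior: "tI p \<Longrightarrow> p \<in> interior P" using interior_maximal[OF _ open_tI, of P] tI_P by auto

text \<open>Displacements of \<open>q\<close> by vectors shorter than \<open>e\<close> are well defined and stay away from the cone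
  point; off a line through the origin they end in the interior of the polygon.\<close>
definition nice :: "(real^2) set \<Rightarrow> real \<Rightarrow> bool" where
  "nice q e \<longleftrightarrow> e > 0 \<and>
    (\<forall>h. norm h < e \<longrightarrow> (\<exists>r\<in>q. r + h \<in> P)) \<and>
    (\<forall>h r r'. norm h < e \<longrightarrow> r \<in> q \<longrightarrow> r' \<in> q \<longrightarrow> r + h \<in> P \<longrightarrow> r' + h \<in> P \<longrightarrow> cls (r + h) = cls (r' + h)) \<and>
    (\<forall>h r s. norm h < e \<longrightarrow> r \<in> q \<longrightarrow> r + h \<in> P \<longrightarrow> s \<in> cls (r + h) \<longrightarrow> s - h \<in> q) \<and>
    (\<forall>r\<in>q. \<forall>r'\<in>q. r \<noteq> r' \<longrightarrow> norm (r - r') \<ge> 2 * e) \<and>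
    (\<forall>h r. norm h < e \<longrightarrow> r \<in> q \<longrightarrow> r + h \<in> P \<longrightarrow> \<not> corner (r + h)) \<and>
    (\<exists>n. n \<noteq> 0 \<and> (\<forall>h r. norm h < e \<longrightarrow> h \<bullet> n \<noteq> 0 \<longrightarrow> r \<in> q \<longrightarrow> r + h \<in> P \<longrightarrow> r + h \<in> interior P))"

lemma nice_mono: "nice q e \<Longrightarrow> 0 < e' \<Longrightarrow> e' \<le> e \<Longrightarrow> nice q e'"
  unfolding nice_def by (meson less_le_trans order_trans mult_left_mono zero_le_numeral)

lemma nice_tI: assumes "tI r" shows "\<exists>e. nice (cls r) e"
proof -
  obtain e where e: "e > 0" "ball r e \<subseteq> Collect tI"
    using open_tI assms open_contains_ball by (metis mem_Collect_eq)
  have t: "tI (r + h)" if "norm h < e" for h using e(2) that by (auto simp: subset_iff dist_norm)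
  have "nice (cls r) e" unfolding nice_def cls_tI[OF assms]
  proof (intro conjI allI impI ballI)
    show "\<exists>n. n \<noteq> 0 \<and> (\<forall>h ra. norm h < e \<longrightarrow> h \<bullet> n \<noteq> 0 \<longrightarrow> ra \<in> {r} \<longrightarrow> ra + h \<in> P \<longrightarrow> ra + h \<in> interior P)"
      using t tI_interior by (intro exI[of _ "pt 1 0"]) (simp_all add: pt_eq_iff[of "pt 1 0"])
  qed (use e(1) t cls_tI tI_P t_not_corner in simp_all)
  then show ?thesis ..
qed

text \<open>One argument for the four kinds of sides: \<open>n\<close> is normal to the side and
  \<open>r0\<close>, \<open>r1\<close> are its two copies. Off the side a displacement stays in the
  polygon from exactly one copy; along the side both copies work and remain glued.\<close>

lemma nice_edge:
  assumes e: "e > 0" and q: "q = {r0, r1}" and n: "n \<noteq> 0" and d: "norm (r1 - r0) \<ge> 2 * e"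
    and pos: "\<And>h. norm h < e \<Longrightarrow> h \<bullet> n > 0 \<Longrightarrow> tI (r0 + h) \<and> r1 + h \<notin> P"
    and neg: "\<And>h. norm h < e \<Longrightarrow> h \<bullet> n < 0 \<Longrightarrow> tI (r1 + h) \<and> r0 + h \<notin> P"
    and zer: "\<And>h. norm h < e \<Longrightarrow> h \<bullet> n = 0 \<Longrightarrow> r0 + h \<in> P \<and> r1 + h \<in> P \<and>
      cls (r0 + h) = {r0 + h, r1 + h} \<and> cls (r1 + h) = {r0 + h, r1 + h} \<and> \<not> corner (r0 + h) \<and> \<not> corner (r1 + h)"
  shows "nice q e"
proof -
  have A: "\<exists>r\<in>q. r + h \<in> P" if "norm h < e" for h
    using pos[OF that] neg[OF that] zer[OF that] tI_P unfolding q
    by (metis insertI1 insertI2 linorder_neqE_linordered_idom)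
  have B: "(r \<in> q \<and> r + h \<in> P \<and> h \<bullet> n \<noteq> 0 \<longrightarrow> tI (r + h)) \<and> 
    (r \<in> q \<longrightarrow> r' \<in> q \<longrightarrow> r + h \<in> P \<longrightarrow> r' + h \<in> P \<longrightarrow> cls (r + h) = cls (r' + h)) \<and>
    (r \<in> q \<longrightarrow> r + h \<in> P \<longrightarrow> s \<in> cls (r + h) \<longrightarrow> s - h \<in> q) \<and>
    (r \<in> q \<longrightarrow> r + h \<in> P \<longrightarrow> \<not> corner (r + h))" if h: "norm h < e" for h r r' s
  proof -
    consider "h \<bullet> n > 0" | "h \<bullet> n < 0" | "h \<bullet> n = 0" by linarith
    then show ?thesis
    proof cases
      case 1
      show ?thesis using pos[OF h 1] cls_tI[of "r0 + h"] t_not_corner unfolding q by auto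
    next
      case 2
      show ?thesis using neg[OF h 2] cls_tI[of "r1 + h"] t_not_corner unfolding q by auto
    next
      case 3
      show ?thesis using zer[OF h 3] 3 unfolding q by auto
    qed
  qed
  have C: "\<exists>n. n \<noteq> 0 \<and> (\<forall>h r. norm h < e \<longrightarrow> h \<bullet> n \<noteq> 0 \<longrightarrow> r \<in> q \<longrightarrow> r + h \<in> P \<longrightarrow> r + h \<in> interior P)"
    using n B tI_interior by blast
  have E: "\<forall>r\<in>q. \<forall>r'\<in>q. r \<noteq> r' \<longrightarrow> norm (r - r') \<ge> 2 * e"
    using d unfolding q by (auto simp: norm_minus_commute)
  show ?thesis unfolding nice_def using e A B C E by blast
qed

lemma pt_plus: "pt a b + h = pt (a + h $ 1) (b + h $ 2)" by (simp add: pt_eq_iff)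

lemma inner_pt: "h \<bullet> pt a b = h $ 1 * a + h $ 2 * b" by (simp add: inner_vec_def sum_2)

lemma norm_pt_axis: "norm (pt 0 a) = \<bar>a\<bar>" "norm (pt a 0) = \<bar>a\<bar>"
  by (simp_all add: norm_vec_def L2_set_def sum_2)

lemma nice_tH1: assumes "tH1 r" shows "\<exists>e. nice (cls r) e"
proof -
  define x where "x = r $ 1"
  have x: "0 < x" "x < w - 1" using assms by (auto simp: tH1_def x_def)
  obtain e where e: "e > 0" "e \<le> x" "e \<le> w - 1 - x" "e \<le> 1/2"
    using that[of "min x (min (w - 1 - x) (1/2))"] x by (simp add: min_def)
  have "nice (cls r) e"
  proof (rule nice_edge[where n = "pt 0 1" and ?r0.0 = "pt x 0" and ?r1.0 = "pt x 1"])
    fix h :: "real^2" assume h: "norm h < e"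
    then have b: "- e < h $ 1" "h $ 1 < e" "- e < h $ 2" "h $ 2 < e" using abs_nth_le_norm[of h] by auto
    { assume "h \<bullet> pt 0 1 > 0" then show "tI (pt x 0 + h) \<and> pt x 1 + h \<notin> P"
        using b e x w1 unfolding inner_pt tI_def mem_P vector_add_component pt_nth by linarith }
    { assume "h \<bullet> pt 0 1 < 0" then show "tI (pt x 1 + h) \<and> pt x 0 + h \<notin> P"
        using b e x w1 unfolding inner_pt tI_def mem_P vector_add_component pt_nth by linarith }
    { assume "h \<bullet> pt 0 1 = 0"
      then have h2: "h $ 2 = 0" by (simp add: inner_pt)
      have "tH1 (pt x 0 + h)" "tH1 (pt x 1 + h)" using b e x h2 by (auto simp: tH1_def)
      then show "pt x 0 + h \<in> P \<and> pt x 1 + h \<in> P \<and>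
          cls (pt x 0 + h) = {pt x 0 + h, pt x 1 + h} \<and> cls (pt x 1 + h) = {pt x 0 + h, pt x 1 + h}
          \<and> \<not> corner (pt x 0 + h) \<and> \<not> corner (pt x 1 + h)"
        using t_not_corner tH1_P cls_tH1 h2 by (simp add: pt_plus) }
  qed (use e x w1 cls_tH1[OF assms] in \<open>auto simp: x_def pt_eq_iff norm_pt_axis\<close>)
  then show ?thesis ..
qed

lemma nice_tH2: assumes "tH2 r" shows "\<exists>e. nice (cls r) e"
proof -
  define x where "x = r $ 1"
  have x: "w - 1 < x" "x < w" using assms by (auto simp: tH2_def x_def)
  obtain e where e: "e > 0" "e \<le> x - (w - 1)" "e \<le> w - x" "e \<le> 1/2"
    using that[of "min (x - (w - 1)) (min (w - x) (1/2))"] x by (simp add: min_def)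
  have "nice (cls r) e"
  proof (rule nice_edge[where n = "pt 0 1" and ?r0.0 = "pt x 0" and ?r1.0 = "pt x w"])
    fix h :: "real^2" assume h: "norm h < e"
    then have b: "- e < h $ 1" "h $ 1 < e" "- e < h $ 2" "h $ 2 < e" using abs_nth_le_norm[of h] by auto
    { assume "h \<bullet> pt 0 1 > 0" then show "tI (pt x 0 + h) \<and> pt x w + h \<notin> P"
        using b e x w1 unfolding inner_pt tI_def mem_P vector_add_component pt_nth by linarith }
    { assume "h \<bullet> pt 0 1 < 0" then show "tI (pt x w + h) \<and> pt x 0 + h \<notin> P"
        using b e x w1 unfolding inner_pt tI_def mem_P vector_add_component pt_nth by linarith }
    { assume "h \<bullet> pt 0 1 = 0"
      then have h2: "h $ 2 = 0" by (simp add: inner_pt)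
      have "tH2 (pt x 0 + h)" "tH2 (pt x w + h)" using b e x h2 by (auto simp: tH2_def)
      then show "pt x 0 + h \<in> P \<and> pt x w + h \<in> P \<and>
          cls (pt x 0 + h) = {pt x 0 + h, pt x w + h} \<and> cls (pt x w + h) = {pt x 0 + h, pt x w + h}
          \<and> \<not> corner (pt x 0 + h) \<and> \<not> corner (pt x w + h)"
        using t_not_corner tH2_P cls_tH2 h2 by (simp add: pt_plus) }
  qed (use e x w1 cls_tH2[OF assms] in \<open>auto simp: x_def pt_eq_iff norm_pt_axis\<close>)
  then show ?thesis ..
qed

lemma nice_tV1: assumes "tV1 r" shows "\<exists>e. nice (cls r) e"
proof -
  define y where "y = r $ 2"
  have y: "0 < y" "y < 1" using assms by (auto simp: tV1_def y_def)
  obtain e where e: "e > 0" "e \<le> y" "e \<le> 1 - y" "e \<le> 1/2"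
    using that[of "min y (min (1 - y) (1/2))"] y by (simp add: min_def)
  have "nice (cls r) e"
  proof (rule nice_edge[where n = "pt 1 0" and ?r0.0 = "pt 0 y" and ?r1.0 = "pt w y"])
    fix h :: "real^2" assume h: "norm h < e"
    then have b: "- e < h $ 1" "h $ 1 < e" "- e < h $ 2" "h $ 2 < e" using abs_nth_le_norm[of h] by auto
    { assume "h \<bullet> pt 1 0 > 0" then show "tI (pt 0 y + h) \<and> pt w y + h \<notin> P"
        using b e y w1 unfolding inner_pt tI_def mem_P vector_add_component pt_nth by linarith }
    { assume "h \<bullet> pt 1 0 < 0" then show "tI (pt w y + h) \<and> pt 0 y + h \<notin> P"
        using b e y w1 unfolding inner_pt tI_def mem_P vector_add_component pt_nth by linarith }
    { assume "h \<bullet> pt 1 0 = 0"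
      then have h2: "h $ 1 = 0" by (simp add: inner_pt)
      have "tV1 (pt 0 y + h)" "tV1 (pt w y + h)" using b e y h2 by (auto simp: tV1_def)
      then show "pt 0 y + h \<in> P \<and> pt w y + h \<in> P \<and>
          cls (pt 0 y + h) = {pt 0 y + h, pt w y + h} \<and> cls (pt w y + h) = {pt 0 y + h, pt w y + h}
          \<and> \<not> corner (pt 0 y + h) \<and> \<not> corner (pt w y + h)"
        using t_not_corner tV1_P cls_tV1 h2 by (simp add: pt_plus) }
  qed (use e y w1 cls_tV1[OF assms] in \<open>auto simp: y_def pt_eq_iff norm_pt_axis\<close>)
  then show ?thesis ..
qed

lemma nice_tV2: assumes "tV2 r" shows "\<exists>e. nice (cls r) e"
proof -
  define y where "y = r $ 2"
  have y: "1 < y" "y < w" using assms by (auto simp: tV2_def y_def)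
  obtain e where e: "e > 0" "e \<le> y - 1" "e \<le> w - y" "e \<le> 1/2"
    using that[of "min (y - 1) (min (w - y) (1/2))"] y by (simp add: min_def)
  have "nice (cls r) e"
  proof (rule nice_edge[where n = "pt 1 0" and ?r0.0 = "pt (w-1) y" and ?r1.0 = "pt w y"])
    fix h :: "real^2" assume h: "norm h < e"
    then have b: "- e < h $ 1" "h $ 1 < e" "- e < h $ 2" "h $ 2 < e" using abs_nth_le_norm[of h] by auto
    { assume "h \<bullet> pt 1 0 > 0" then show "tI (pt (w-1) y + h) \<and> pt w y + h \<notin> P"
        using b e y w1 unfolding inner_pt tI_def mem_P vector_add_component pt_nth by linarith }
    { assume "h \<bullet> pt 1 0 < 0" then show "tI (pt w y + h) \<and> pt (w-1) y + h \<notin> P"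
        using b e y w1 unfolding inner_pt tI_def mem_P vector_add_component pt_nth by linarith }
    { assume "h \<bullet> pt 1 0 = 0"
      then have h2: "h $ 1 = 0" by (simp add: inner_pt)
      have "tV2 (pt (w-1) y + h)" "tV2 (pt w y + h)" using b e y h2 by (auto simp: tV2_def)
      then show "pt (w-1) y + h \<in> P \<and> pt w y + h \<in> P \<and>
          cls (pt (w-1) y + h) = {pt (w-1) y + h, pt w y + h} \<and> cls (pt w y + h) = {pt (w-1) y + h, pt w y + h}
          \<and> \<not> corner (pt (w-1) y + h) \<and> \<not> corner (pt w y + h)"
        using t_not_corner tV2_P cls_tV2 h2 by (simp add: pt_plus) }
  qed (use e y w1 cls_tV2[OF assms] in \<open>auto simp: y_def pt_eq_iff norm_pt_axis\<close>)
  then show ?thesis ..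
qed

lemma Sp_nice: "q \<in> Sp \<Longrightarrow> \<exists>e. nice q e"
  by (elim Sp_cases) (metis type_cases nice_tI nice_tH1 nice_tH2 nice_tV1 nice_tV2)

lemma Sp_finite: "q \<in> Sp \<Longrightarrow> finite q"
proof (elim Sp_cases)
  fix p assume "p \<in> P" "\<not> corner p" "q = cls p"
  then show "finite q" by (cases p rule: type_cases) (auto simp: cls_tI cls_tH1 cls_tH2 cls_tV1 cls_tV2)
qed

text \<open>The point reached from \<open>q\<close> by a short displacement \<open>h\<close>.\<close>
definition ex :: "(real^2) set \<Rightarrow> real^2 \<Rightarrow> (real^2) set" where
  "ex q h = (SOME q'. \<exists>r\<in>q. r + h \<in> P \<and> q' = cls (r + h))"

lemma nice_pos: "nice q e \<Longrightarrow> e > 0"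
  and nice_ex: "nice q e \<Longrightarrow> norm h < e \<Longrightarrow> \<exists>r\<in>q. r + h \<in> P"
  and nice_wd: "nice q e \<Longrightarrow> norm h < e \<Longrightarrow> r \<in> q \<Longrightarrow> r' \<in> q \<Longrightarrow> r + h \<in> P \<Longrightarrow> r' + h \<in> P
     \<Longrightarrow> cls (r + h) = cls (r' + h)"
  and nice_back: "nice q e \<Longrightarrow> norm h < e \<Longrightarrow> r \<in> q \<Longrightarrow> r + h \<in> P \<Longrightarrow> s \<in> cls (r + h) \<Longrightarrow> s - h \<in> q"
  and nice_dist: "nice q e \<Longrightarrow> r \<in> q \<Longrightarrow> r' \<in> q \<Longrightarrow> r \<noteq> r' \<Longrightarrow> norm (r - r') \<ge> 2 * e"
  and nice_nc: "nice q e \<Longrightarrow> norm h < e \<Longrightarrow> r \<in> q \<Longrightarrow> r + h \<in> P \<Longrightarrow> \<not> corner (r + h)"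
  and nice_int: "nice q e \<Longrightarrow> \<exists>n. n \<noteq> 0 \<and> (\<forall>h r. norm h < e \<longrightarrow> h \<bullet> n \<noteq> 0 \<longrightarrow> r \<in> q \<longrightarrow> r + h \<in> P \<longrightarrow> r + h \<in> interior P)"
  unfolding nice_def by blast+

lemma ex_rep:
  assumes "nice q e" "norm h < e" shows "\<exists>r\<in>q. r + h \<in> P \<and> ex q h = cls (r + h)"
  unfolding ex_def using nice_ex[OF assms] by (rule_tac someI_ex) blast

lemma ex_eq:
  assumes "nice q e" "norm h < e" "r \<in> q" "r + h \<in> P" shows "ex q h = cls (r + h)"
  using ex_rep[OF assms(1,2)] nice_wd[OF assms(1,2)] assms(3,4) by metis

lemma ex_Sp: "nice q e \<Longrightarrow> norm h < e \<Longrightarrow> ex q h \<in> Sp"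
  using ex_rep nice_nc cls_Sp by metis

lemma ex_0 [simp]: "q \<in> Sp \<Longrightarrow> ex q 0 = q"
  by (metis Sp_nice Sp_ne Sp_mem ex_eq nice_pos norm_zero add.right_neutral)

text \<open>\<open>nice_back\<close> turns any representative of the intermediate point into one of
  \<open>q\<close> by subtracting \<open>h\<close>, so both displacements can be carried out on the
  same representative.\<close>

lemma ex_add_nice:
  assumes "nice q e" "norm h < e" "nice (ex q h) e'" "norm k < e'" "norm (h + k) < e"
  shows "ex (ex q h) k = ex q (h + k)"
proof -
  obtain r where r: "r \<in> q" "r + h \<in> P" "ex q h = cls (r + h)" using ex_rep assms by blast
  obtain s where s: "s \<in> ex q h" "s + k \<in> P" "ex (ex q h) k = cls (s + k)" using ex_rep assms by blast
  have "s - h \<in> q" using nice_back[OF assms(1,2) r(1,2)] s(1) r(3) by simp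
  then show ?thesis using ex_eq[OF assms(1) assms(5), of "s - h"] s by simp
qed

lemma ev_norm_less: "e > 0 \<Longrightarrow> \<forall>\<^sub>F h in nhds (0::real^2). norm h < e"
  by (auto simp: eventually_nhds_metric intro!: exI[of _ e])

lemma ex_add:
  assumes "nice q e" "norm h < e"
  shows "\<forall>\<^sub>F k in nhds 0. ex (ex q h) k = ex q (h + k)"
proof -
  obtain e' where e': "nice (ex q h) e'" using Sp_nice[OF ex_Sp[OF assms]] by blast
  have "\<forall>\<^sub>F k in nhds (0::real^2). norm k < e'" "\<forall>\<^sub>F k in nhds (0::real^2). norm k < e - norm h"
    using ev_norm_less nice_pos[OF e'] assms(2) by auto
  then show ?thesis
  proof eventually_elim
    case (elim k)
    have "norm (h + k) < e" using elim(2) norm_triangle_ineq[of h k] by linarith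
    then show ?case using ex_add_nice[OF assms e'] elim(1) by blast
  qed
qed

text \<open>Two short displacements with the same end point would give representatives of
  \<open>q\<close> closer together than the distance \<open>2 * e\<close> guaranteed by
  \<open>nice\<close>.\<close>

lemma ex_inj:
  assumes "nice q e" "norm h < e" "norm h' < e" "ex q h = ex q h'" shows "h = h'"
proof (rule ccontr)
  assume ne: "h \<noteq> h'"
  obtain r where r: "r \<in> q" "r + h \<in> P" "ex q h = cls (r + h)" using ex_rep assms by blast
  obtain r' where r': "r' \<in> q" "r' + h' \<in> P" "ex q h' = cls (r' + h')" using ex_rep assms by blast
  have "r' + h' - h \<in> q" using nice_back[OF assms(1,2) r(1,2)] cls_self[OF r'(2)] assms(4) r r' by simp
  moreover have "r' + h' - h \<noteq> r'" using ne by (simp add: algebra_simps)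
  ultimately have "norm (r' + h' - h - r') \<ge> 2 * e" using nice_dist[OF assms(1) _ r'(1)] by blast
  moreover have "norm (r' + h' - h - r') \<le> norm h' + norm h" using norm_triangle_ineq4[of h' h] by simp
  ultimately show False using assms by simp
qed

text \<open>Translates the quotient topology away from the cone point into small displacements; the
  later continuity arguments on the punctured surface rest on it.\<close>

lemma open_Sp_iff:
  assumes U: "U \<subseteq> Sp"
  shows "openin S U \<longleftrightarrow> (\<forall>q\<in>U. \<forall>\<^sub>F h in nhds 0. ex q h \<in> U)"
proof
  assume o: "openin S U"
  show "\<forall>q\<in>U. \<forall>\<^sub>F h in nhds 0. ex q h \<in> U"
  proof
    fix q assume q: "q \<in> U"
    then have qS: "q \<in> Sp" using U by blast
    obtain e where e: "nice q e" using Sp_nice[OF qS] by blast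
    have op: "openin (top_of_set P) {x \<in> P. cls x \<in> U}" using o by (simp add: openin_S)
    have "\<forall>\<^sub>F h in nhds 0. r + h \<in> P \<longrightarrow> cls (r + h) \<in> U" if "r \<in> q" for r
    proof -
      have "r \<in> P" "cls r = q" using Sp_mem[OF qS that] by auto
      then obtain d where "d > 0" "\<forall>x\<in>P. dist x r < d \<longrightarrow> cls x \<in> U"
        using op q unfolding openin_euclidean_subtopology_iff by blast
      then show ?thesis unfolding eventually_nhds_metric by (intro exI[of _ d]) (simp add: dist_norm)
    qed
    \<comment> \<open>A class has finitely many representatives, so their neighbourhoods can be
      intersected.\<close>
    then have "\<forall>\<^sub>F h in nhds 0. \<forall>r\<in>q. r + h \<in> P \<longrightarrow> cls (r + h) \<in> U"
      using Sp_finite[OF qS] by (simp add: eventually_ball_finite_distrib)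
    then show "\<forall>\<^sub>F h in nhds 0. ex q h \<in> U" using ev_norm_less[OF nice_pos[OF e]]
    proof eventually_elim
      case (elim h)
      then show ?case using ex_rep[OF e elim(2)] by auto
    qed
  qed
next
  assume A: "\<forall>q\<in>U. \<forall>\<^sub>F h in nhds 0. ex q h \<in> U"
  have "\<exists>d>0. \<forall>x\<in>P. dist x r < d \<longrightarrow> cls x \<in> U" if r: "r \<in> P" "cls r \<in> U" for r
  proof -
    obtain e where e: "nice (cls r) e" using Sp_nice r U by blast
    have "\<forall>\<^sub>F h in nhds 0. ex (cls r) h \<in> U \<and> norm h < e"
      using A r ev_norm_less[OF nice_pos[OF e]] eventually_conj by blast
    then obtain d where d: "d > 0" "\<And>h. dist h 0 < d \<Longrightarrow> ex (cls r) h \<in> U \<and> norm h < e"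
      unfolding eventually_nhds_metric by blast
    have "cls x \<in> U" if "x \<in> P" "dist x r < d" for x
      using d(2)[of "x - r"] that ex_eq[OF e _ cls_self[OF r(1)], of "x - r"] by (simp add: dist_norm)
    then show ?thesis using d by blast
  qed
  then show "openin S U" unfolding openin_S openin_euclidean_subtopology_iff using U unfolding Sp_def by auto
qed

lemma openin_Sp: "openin S Sp"
proof -
  have "\<forall>\<^sub>F h in nhds 0. ex q h \<in> Sp" if q: "q \<in> Sp" for q
  proof -
    obtain e where e: "nice q e" using Sp_nice[OF q] by blast
    show ?thesis using ev_norm_less[OF nice_pos[OF e]] by eventually_elim (rule ex_Sp[OF e])
  qed
  then show ?thesis by (simp add: open_Sp_iff)
qed

section \<open>The surface is a Hausdorff space\<close>

lemma finite_corner: "finite {p \<in> P. corner p}"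
  by (rule finite_subset[of _ "{pt 0 0, pt 0 1, pt w 0, pt w 1, pt (w-1) 1, pt (w-1) 0, pt (w-1) w, pt w w}"])
    (use corner_cases in \<open>blast\<close>, simp)

text \<open>The relation is a finite union of compact pieces: the diagonal, the gluings in both
  directions, and all pairs of corners.\<close>

lemma rel_compact: "compact {(p, q). p \<in> P \<and> q \<in> P \<and> kap p = kap q}"
proof -
  let ?Z = "{p \<in> P. corner p}"
  have sub: "(p, q) \<in> (\<lambda>x. (x, x)) ` P \<union> G \<union> prod.swap ` G \<union> ?Z \<times> ?Z"
    if "p \<in> P" "q \<in> P" "kap p = kap q" for p q using that(1)
  proof (cases p rule: type_cases)
    assume "corner p" then have "corner q" using that kap_corner by metis
    then show ?thesis using \<open>corner p\<close> that by blast
  next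
    assume "tI p" then show ?thesis using that kap_type(1)[of q p] by auto
  next
    assume t: "tH1 p"
    then have "q \<in> {pt (p $ 1) 0, pt (p $ 1) 1}" using mem_cls[OF that(1)] cls_tH1[OF t] that by auto
    moreover have "p \<in> {pt (p $ 1) 0, pt (p $ 1) 1}" using t unfolding tH1_def by (metis insert_iff singletonD pt_collapse)
    moreover have "(pt (p $ 1) 0, pt (p $ 1) 1) \<in> G" using t w1 by (auto simp: tH1_def mem_G)
    ultimately have "q = p \<or> (p, q) \<in> G \<or> (q, p) \<in> G" by (metis insert_iff singletonD)
    then show ?thesis using that(1) by force
  next
    assume t: "tH2 p"
    then have "q \<in> {pt (p $ 1) 0, pt (p $ 1) w}" using mem_cls[OF that(1)] cls_tH2[OF t] that by auto
    moreover have "p \<in> {pt (p $ 1) 0, pt (p $ 1) w}" using t unfolding tH2_def by (metis insert_iff singletonD pt_collapse)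
    moreover have "(pt (p $ 1) 0, pt (p $ 1) w) \<in> G" using t w1 by (auto simp: tH2_def mem_G)
    ultimately have "q = p \<or> (p, q) \<in> G \<or> (q, p) \<in> G" by (metis insert_iff singletonD)
    then show ?thesis using that(1) by force
  next
    assume t: "tV1 p"
    then have "q \<in> {pt 0 (p $ 2), pt w (p $ 2)}" using mem_cls[OF that(1)] cls_tV1[OF t] that by auto
    moreover have "p \<in> {pt 0 (p $ 2), pt w (p $ 2)}" using t unfolding tV1_def by (metis insert_iff singletonD pt_collapse)
    moreover have "(pt 0 (p $ 2), pt w (p $ 2)) \<in> G" using t w1 by (auto simp: tV1_def mem_G)
    ultimately have "q = p \<or> (p, q) \<in> G \<or> (q, p) \<in> G" by (metis insert_iff singletonD)
    then show ?thesis using that(1) by force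
  next
    assume t: "tV2 p"
    then have "q \<in> {pt (w-1) (p $ 2), pt w (p $ 2)}" using mem_cls[OF that(1)] cls_tV2[OF t] that by auto
    moreover have "p \<in> {pt (w-1) (p $ 2), pt w (p $ 2)}" using t unfolding tV2_def by (metis insert_iff singletonD pt_collapse)
    moreover have "(pt (w-1) (p $ 2), pt w (p $ 2)) \<in> G" using t w1 by (auto simp: tV2_def mem_G)
    ultimately have "q = p \<or> (p, q) \<in> G \<or> (q, p) \<in> G" by (metis insert_iff singletonD)
    then show ?thesis using that(1) by force
  qed
  have "{(p, q). p \<in> P \<and> q \<in> P \<and> kap p = kap q} = (\<lambda>x. (x, x)) ` P \<union> G \<union> prod.swap ` G \<union> ?Z \<times> ?Z"
  proof (rule equalityI; rule subrelI)
    fix p q assume "(p, q) \<in> {(p, q). p \<in> P \<and> q \<in> P \<and> kap p = kap q}"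
    then show "(p, q) \<in> (\<lambda>x. (x, x)) ` P \<union> G \<union> prod.swap ` G \<union> ?Z \<times> ?Z" using sub by blast
  next
    fix p q assume "(p, q) \<in> (\<lambda>x. (x, x)) ` P \<union> G \<union> prod.swap ` G \<union> ?Z \<times> ?Z"
    then consider "p = q" "p \<in> P" | "(p, q) \<in> G" | "(q, p) \<in> G" | "p \<in> ?Z" "q \<in> ?Z" by auto
    then have "p \<in> P \<and> q \<in> P \<and> kap p = kap q" by cases (use G_subset kap_G kap_corner1 in auto)
    then show "(p, q) \<in> {(p, q). p \<in> P \<and> q \<in> P \<and> kap p = kap q}" by blast
  qed
  moreover have "compact (prod.swap ` G)" by (intro compact_continuous_image closed_G continuous_on_swap)
  moreover have "compact ((\<lambda>x. (x, x)) ` P)" by (intro compact_continuous_image compact_P continuous_intros)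
  moreover have "compact ?Z" using finite_corner by (rule finite_imp_compact)
  ultimately show ?thesis using closed_G by (auto intro!: compact_Un compact_Times)
qed

lemma continuous_cls: "continuous_map (top_of_set P) S cls" using quot_cls by (rule quotient_imp_continuous_map)

text \<open>Saturations of closed sets are projections of compact slices of the relation, so
  \<open>cls\<close> is a closed map; a closed continuous image of a normal Hausdorff space is
  Hausdorff.\<close>

lemma Hausdorff_S: "Hausdorff_space S"
proof -
  have "closed_map (top_of_set P) S cls" unfolding closed_map_def
  proof (intro allI impI)
    fix C assume "closedin (top_of_set P) C"
    then have C: "compact C" "C \<subseteq> P" using compact_P closedin_compact closedin_imp_subset by blast+
    have "compact ({(p, q). p \<in> P \<and> q \<in> P \<and> kap p = kap q} \<inter> C \<times> P)"
      using rel_compact C compact_P by (intro compact_Int_closed closed_Times compact_imp_closed)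
    then have "compact (snd ` ({(p, q). p \<in> P \<and> q \<in> P \<and> kap p = kap q} \<inter> C \<times> P))"
      by (intro compact_continuous_image continuous_intros)
    also have "snd ` ({(p, q). p \<in> P \<and> q \<in> P \<and> kap p = kap q} \<inter> C \<times> P) = {x \<in> P. cls x \<in> cls ` C}"
    proof (rule equalityI; rule subsetI)
      fix x assume "x \<in> snd ` ({(p, q). p \<in> P \<and> q \<in> P \<and> kap p = kap q} \<inter> C \<times> P)"
      then obtain p where "p \<in> C" "x \<in> P" "p \<in> P" "kap p = kap x" by auto
      then show "x \<in> {x \<in> P. cls x \<in> cls ` C}" using cls_eq[of x p] by auto
    next
      fix x assume "x \<in> {x \<in> P. cls x \<in> cls ` C}"
      then obtain p where p: "p \<in> C" "x \<in> P" "cls x = cls p" by auto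
      then have "kap p = kap x" using cls_eq[of x p] C by auto
      with p C have "(p, x) \<in> {(p, q). p \<in> P \<and> q \<in> P \<and> kap p = kap q} \<inter> C \<times> P" by auto
      then show "x \<in> snd ` ({(p, q). p \<in> P \<and> q \<in> P \<and> kap p = kap q} \<inter> C \<times> P)" by force
    qed
    finally have "closedin (top_of_set P) {x \<in> P. cls x \<in> cls ` C}"
      by (intro closed_subset compact_imp_closed) auto
    moreover have "cls ` C \<subseteq> topspace S" using C topspace_S by blast
    ultimately show "closedin S (cls ` C)" using quot_cls unfolding quotient_map_closedin by simp
  qed
  moreover have "normal_space (top_of_set P)" "Hausdorff_space (top_of_set P)"
    using compact_P by (auto intro!: compact_Hausdorff_or_regular_imp_normal_space Hausdorff_space_subtopology simp: compact_space_subtopology)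
  ultimately show ?thesis
    using normal_Hausdorff_space_closed_continuous_map_image continuous_cls topspace_S by fastforce
qed

lemma cone_top: "cone \<in> topspace S" using origin_P by (auto simp: topspace_S cone_def)

section \<open>Affine maps of the punctured surface\<close>

text \<open>Charts, continuity and the cone point do not appear; \<open>veech_iff\<close> recovers
  them. In this form composition and inversion are computations with small displacements. The
  determinant of \<open>A\<close> is left free, so that the reflection \<open>Rm\<close> is
  covered.\<close>

definition loc_aff :: "real^2^2 \<Rightarrow> ((real^2) set \<Rightarrow> (real^2) set) \<Rightarrow> bool" where
  "loc_aff A \<phi> \<longleftrightarrow> bij_betw \<phi> Sp Sp \<and>
     (\<forall>q\<in>Sp. \<forall>\<^sub>F h in nhds 0. \<phi> (ex q h) = ex (\<phi> q) (A *v h))"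

lemma loc_affD:
  assumes "loc_aff A \<phi>"
  shows "bij_betw \<phi> Sp Sp" "q \<in> Sp \<Longrightarrow> \<phi> q \<in> Sp"
    "q \<in> Sp \<Longrightarrow> \<forall>\<^sub>F h in nhds 0. \<phi> (ex q h) = ex (\<phi> q) (A *v h)"
  using assms bij_betwE unfolding loc_aff_def by blast+

lemma ev_matrix:
  fixes A :: "real^2^2"
  assumes "eventually Q (nhds 0)" shows "\<forall>\<^sub>F h in nhds 0. Q (A *v h)"
proof -
  have "((\<lambda>h. A *v h) \<longlongrightarrow> A *v 0) (at 0)"
    using linear_continuous_at[OF matrix_vector_mul_bounded_linear, of 0 A] by (simp add: continuous_at)
  then have "((\<lambda>h. A *v h) \<longlongrightarrow> A *v 0) (nhds 0)"
    by (rule tendsto_at_iff_tendsto_nhds[THEN iffD1])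
  then show ?thesis using assms unfolding filterlim_iff by simp
qed

lemma ev_ex_Sp: assumes q: "q \<in> Sp" shows "\<forall>\<^sub>F h in nhds 0. ex q h \<in> Sp"
proof -
  obtain e where e: "nice q e" using Sp_nice[OF q] by blast
  show ?thesis using ev_norm_less[OF nice_pos[OF e]] by eventually_elim (rule ex_Sp[OF e])
qed

lemma loc_aff_id: "loc_aff (mat 1) id" by (simp add: loc_aff_def)

lemma loc_aff_comp:
  assumes A: "loc_aff A \<phi>" and B: "loc_aff B \<psi>" shows "loc_aff (B ** A) (\<psi> \<circ> \<phi>)"
  unfolding loc_aff_def
proof (intro conjI ballI)
  show "bij_betw (\<psi> \<circ> \<phi>) Sp Sp" using A B bij_betw_trans unfolding loc_aff_def by blast
  fix q assume q: "q \<in> Sp"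
  show "\<forall>\<^sub>F h in nhds 0. (\<psi> \<circ> \<phi>) (ex q h) = ex ((\<psi> \<circ> \<phi>) q) (B ** A *v h)"
    using loc_affD(3)[OF A q] ev_matrix[OF loc_affD(3)[OF B loc_affD(2)[OF A q]], of A]
    by eventually_elim (simp add: matrix_vector_mul_assoc)
qed

lemma loc_aff_inv:
  assumes A: "loc_aff A \<phi>" and AB: "A ** B = mat 1" shows "loc_aff B (inv_into Sp \<phi>)" unfolding loc_aff_def
proof (intro conjI ballI)
  note bij = loc_affD(1)[OF A]
  show "bij_betw (inv_into Sp \<phi>) Sp Sp" using bij by (rule bij_betw_inv_into)
  fix q assume q: "q \<in> Sp"
  define p where "p = inv_into Sp \<phi> q"
  have p: "p \<in> Sp" "\<phi> p = q"
    using bij q unfolding p_def bij_betw_def by (auto simp: f_inv_into_f inv_into_into)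
  show "\<forall>\<^sub>F h in nhds 0. inv_into Sp \<phi> (ex q h) = ex (inv_into Sp \<phi> q) (B *v h)"
    using ev_matrix[OF loc_affD(3)[OF A p(1)], of B] ev_matrix[OF ev_ex_Sp[OF p(1)], of B]
  proof eventually_elim
    case (elim h)
    have "\<phi> (ex p (B *v h)) = ex q h" using elim(1) p(2) AB by (simp add: matrix_vector_mul_assoc)
    then show ?case using elim(2) bij unfolding p_def[symmetric] bij_betw_def by (metis inv_into_f_f)
  qed
qed

lemma ex_continuous:
  assumes e: "nice q e"
  shows "continuous_map (top_of_set (ball 0 e)) S (ex q)" unfolding continuous_map_def
proof (intro conjI allI impI)
  show "ex q \<in> topspace (top_of_set (ball 0 e)) \<rightarrow> topspace S"
    using ex_Sp[OF e] Sp_subset by (auto simp: subset_iff)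
  fix U assume U: "openin S U"
  have U': "openin S (U \<inter> Sp)" using U openin_Sp by blast
  have "open {h \<in> ball 0 e. ex q h \<in> U}" unfolding open_dist
  proof
    fix h assume "h \<in> {h \<in> ball 0 e. ex q h \<in> U}"
    then have h: "norm h < e" "ex q h \<in> U \<inter> Sp" using ex_Sp[OF e] by auto
    have "\<forall>\<^sub>F k in nhds 0. ex (ex q h) k \<in> U \<inter> Sp"
      using U' h(2) open_Sp_iff[of "U \<inter> Sp"] by blast
    moreover have "\<forall>\<^sub>F k in nhds (0::real^2). norm k < e - norm h" using ev_norm_less h by simp
    ultimately have "\<forall>\<^sub>F k in nhds 0. ex q (h + k) \<in> U \<and> norm (h + k) < e"
      using ex_add[OF e h(1)]
    proof eventually_elim
      case (elim k)
      then show ?case using norm_triangle_ineq[of h k] by auto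
    qed
    then obtain d where d: "d > 0" "\<And>k. norm k < d \<Longrightarrow> ex q (h + k) \<in> U \<and> norm (h + k) < e"
      unfolding eventually_nhds_metric by (auto simp: dist_norm)
    show "\<exists>d>0. \<forall>y. dist y h < d \<longrightarrow> y \<in> {h \<in> ball 0 e. ex q h \<in> U}"
      using d(1) d(2)[of "y - h" for y] by (intro exI[of _ d]) (auto simp: dist_norm)
  qed
  then have "open ({h \<in> ball 0 e. ex q h \<in> U})" .
  then have "openin (top_of_set (ball 0 e)) {h \<in> ball 0 e. ex q h \<in> U}"
    by (intro openin_open_eq[THEN iffD2]) auto
  then show "openin (top_of_set (ball 0 e)) {x \<in> topspace (top_of_set (ball 0 e)). ex q x \<in> U}" by simp
qed

lemma ex_open:
  assumes e: "nice q e" and W: "open W" "W \<subseteq> ball 0 e"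
  shows "openin S (ex q ` W)"
proof -
  have "ex q ` W \<subseteq> Sp" using W ex_Sp[OF e] by (auto simp: subset_iff)
  moreover have "\<forall>\<^sub>F k in nhds 0. ex (ex q h) k \<in> ex q ` W" if h: "h \<in> W" for h
  proof -
    obtain d where d: "d > 0" "\<And>y. dist y h < d \<Longrightarrow> y \<in> W" using W(1) h unfolding open_dist by blast
    have "norm h < e" using W h by auto
    then show ?thesis using ex_add[OF e] ev_norm_less[OF d(1)]
    proof (elim eventually_elim2)
      fix k assume "ex (ex q h) k = ex q (h + k)" "norm k < d"
      then show "ex (ex q h) k \<in> ex q ` W" using d(2)[of "h + k"] by (simp add: dist_norm)
    qed
  qed
  ultimately show ?thesis by (subst open_Sp_iff) auto
qed

lemma openin_top_ball: "openin (top_of_set (ball a e)) W \<longleftrightarrow> open W \<and> W \<subseteq> ball a e" for a :: "real^2"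
  by (rule openin_open_eq[OF open_ball])

lemma ex_inj_on: "nice q e \<Longrightarrow> inj_on (ex q) (ball 0 e)" by (intro inj_onI) (auto intro: ex_inj)

text \<open>Inverses of \<open>ex\<close> are the charts needed to return from
  \<open>loc_aff\<close> to the definition of affine homeomorphisms; they are local translations
  because displacements add up by \<open>ex_add\<close>.\<close>

lemma chart_ex:
  assumes e: "nice q e"
  shows "translation_chart P G (L_vertices w w) (ex q ` ball 0 e) (inv_into (ball 0 e) (ex q))"
    (is "translation_chart P G _ ?U ?c")
proof -
  have ci: "?c (ex q h) = h" if "norm h < e" for h using inv_into_f_f[OF ex_inj_on[OF e], of h] that by simp
  have U: "openin S ?U" by (rule ex_open[OF e]) auto
  have USp: "?U \<subseteq> Sp" using ex_Sp[OF e] by (auto simp: subset_iff)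
  have cU: "?c ` ?U = ball 0 e" using inv_into_image_cancel[OF ex_inj_on[OF e] subset_refl] .
  have hm: "homeomorphic_maps (subtopology S ?U) (top_of_set (ball 0 e)) ?c (ex q)" unfolding homeomorphic_maps_def
  proof (intro conjI ballI)
    show "continuous_map (subtopology S ?U) (top_of_set (ball 0 e)) ?c" unfolding continuous_map_def
    proof (intro conjI allI impI)
      show "?c \<in> topspace (subtopology S ?U) \<rightarrow> topspace (top_of_set (ball 0 e))"
        using ci by (auto simp: subset_iff)
      fix W :: "(real^2) set" assume "openin (top_of_set (ball 0 e)) W"
      then have W: "open W" "W \<subseteq> ball 0 e" by (auto simp: openin_top_ball)
      have tU: "topspace (subtopology S ?U) = ?U" using USp Sp_subset by auto
      have "{x \<in> topspace (subtopology S ?U). ?c x \<in> W} = ex q ` W" unfolding tU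
      proof (rule equalityI; rule subsetI)
        fix x assume "x \<in> {x \<in> ?U. ?c x \<in> W}"
        then obtain h where "norm h < e" "x = ex q h" "?c x \<in> W" by auto
        then show "x \<in> ex q ` W" using ci[of h] by simp
      next
        fix x assume "x \<in> ex q ` W"
        then obtain h where h: "h \<in> W" "x = ex q h" by blast
        then have "norm h < e" using W(2) by auto
        then show "x \<in> {x \<in> ?U. ?c x \<in> W}" using h ci[of h] by simp
      qed
      then show "openin (subtopology S ?U) {x \<in> topspace (subtopology S ?U). ?c x \<in> W}"
        using ex_open[OF e W] U W by (simp add: openin_open_subtopology image_mono)
    qed
    show "continuous_map (top_of_set (ball 0 e)) (subtopology S ?U) (ex q)"
      using ex_continuous[OF e] by (auto simp: continuous_map_in_subtopology)
    show "ex q (?c x) = x" if "x \<in> topspace (subtopology S ?U)" for x using that ci by auto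
    show "?c (ex q h) = h" if "h \<in> topspace (top_of_set (ball 0 e))" for h using that ci by simp
  qed
  have loc: "\<exists>v. \<forall>\<^sub>F y in nhds x. ?c (cls y) = y + v" if x: "x \<in> interior P" "cls x \<in> ?U" for x
  proof -
    obtain h0 where h0: "norm h0 < e" "cls x = ex q h0" using x by auto
    have xP: "x \<in> P" using x interior_subset by blast
    obtain d where d: "d > 0" "\<And>y. dist y x < d \<Longrightarrow> y \<in> P"
      using x(1) unfolding mem_interior by (auto simp: subset_iff dist_commute)
    obtain e' where e': "nice (cls x) e'" using Sp_nice x USp by blast
    have "\<forall>\<^sub>F k in nhds 0. ex (cls x) k = ex q (h0 + k) \<and> norm k < d \<and> norm k < e' \<and> norm k < e - norm h0"
      using ex_add[OF e h0(1)] ev_norm_less[OF d(1)] ev_norm_less[OF nice_pos[OF e']] ev_norm_less[of "e - norm h0"] h0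
      by (auto simp: eventually_conj_iff)
    then obtain d' where d': "d' > 0" "\<And>k. norm k < d' \<Longrightarrow> ex (cls x) k = ex q (h0 + k) \<and> norm k < d \<and> norm k < e' \<and> norm k < e - norm h0"
      unfolding eventually_nhds_metric by (auto simp: dist_norm)
    have "?c (cls y) = y + (h0 - x)" if y: "dist y x < d'" for y
    proof -
      have k: "ex (cls x) (y - x) = ex q (h0 + (y - x))" "norm (y - x) < d" "norm (y - x) < e'" "norm (y - x) < e - norm h0"
        using d'(2)[of "y - x"] y by (auto simp: dist_norm)
      have "ex (cls x) (y - x) = cls y"
        using ex_eq[OF e' k(3) cls_self[OF xP]] d(2)[of y] k(2) by (simp add: dist_norm)
      moreover have "norm (h0 + (y - x)) < e" using k(4) norm_triangle_ineq[of h0 "y - x"] by linarith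
      ultimately show ?thesis using k(1) ci[of "h0 + (y - x)"] by (simp add: algebra_simps)
    qed
    then show ?thesis using d'(1) unfolding eventually_nhds_metric by blast
  qed
  show ?thesis unfolding translation_chart_def using U hm USp cone_vertices cU loc unfolding S_def cls_def
    by (auto simp: homeomorphic_map_maps Sp_def cls_def)
qed

lemma ball_halfspace_connected: "connected {h \<in> ball (0::real^2) d. h \<bullet> n > 0}"
proof -
  have "{h \<in> ball (0::real^2) d. h \<bullet> n > 0} = ball 0 d \<inter> {h. n \<bullet> h > 0}" by (auto simp: inner_commute)
  then show ?thesis by (auto intro!: convex_connected convex_Int convex_halfspace_gt)
qed

text \<open>Near an edge point a chart is known to be a translation only off one line. On each open
  half of the ball \<open>g h - h\<close> is locally constant, hence constant; continuity extends
  both constants to the line, where they agree at the centre.\<close>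

lemma continuous_locally_translation:
  fixes g :: "real^2 \<Rightarrow> real^2"
  assumes d: "d > 0" and n: "n \<noteq> 0" and g: "continuous_on (ball 0 d) g"
    and loc: "\<And>h. norm h < d \<Longrightarrow> h \<bullet> n \<noteq> 0 \<Longrightarrow> \<forall>\<^sub>F k in nhds 0. g (h + k) = g h + k"
    and h: "norm h < d"
  shows "g h = g 0 + h"
proof -
  define D where "D = (\<lambda>h. g h - h)"
  have cD: "continuous_on (ball 0 d) D" unfolding D_def using continuous_on_diff[OF g continuous_on_id] by simp
  have side: "D x = D ((d / (2 * norm m)) *\<^sub>R m)"
    if m: "m \<noteq> 0" "\<And>h. h \<bullet> m > 0 \<Longrightarrow> h \<bullet> n \<noteq> 0" and x: "norm x < d" "x \<bullet> m \<ge> 0" for m x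
  proof -
    let ?H = "{h \<in> ball (0::real^2) d. h \<bullet> m > 0}"
    have "D constant_on ?H"
    proof (rule locally_constant_imp_constant[OF ball_halfspace_connected])
      fix a assume a: "a \<in> ?H"
      then have "norm a < d" "a \<bullet> n \<noteq> 0" using m by auto
      from loc[OF this] obtain r where r: "r > 0" "\<And>k. norm k < r \<Longrightarrow> g (a + k) = g a + k"
        unfolding eventually_nhds_metric by (auto simp: dist_norm)
      have "D y = D a" if "dist y a < r" for y using r(2)[of "y - a"] that by (simp add: D_def dist_norm)
      then have "\<forall>y\<in>?H \<inter> ball a r. D y = D a" by (simp add: dist_commute)
      moreover have "openin (top_of_set ?H) (?H \<inter> ball a r)" by (simp add: openin_open_Int)
      moreover have "a \<in> ?H \<inter> ball a r" using a r(1) by simp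
      ultimately show "\<exists>T. openin (top_of_set ?H) T \<and> a \<in> T \<and> (\<forall>x\<in>T. D x = D a)" by blast
    qed
    then obtain c where c: "\<And>h. h \<in> ?H \<Longrightarrow> D h = c" unfolding constant_on_def by blast
    \<comment> \<open>A reference point in the open half ball. Approaching \<open>x\<close> from the
      side of \<open>m\<close> then carries the constant to points on the boundary line.\<close>
    have b: "(d / (2 * norm m)) *\<^sub>R m \<in> ?H" using d m by (simp add: inner_commute)
    have "((\<lambda>s. D (x + s *\<^sub>R m)) \<longlongrightarrow> D (x + 0 *\<^sub>R m)) (at_right 0)"
    proof (rule continuous_on_tendsto_compose[OF cD])
      show "((\<lambda>s. x + s *\<^sub>R m) \<longlongrightarrow> x + 0 *\<^sub>R m) (at_right 0)" by (intro tendsto_intros)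
      then show "\<forall>\<^sub>F s in at_right 0. x + s *\<^sub>R m \<in> ball 0 d"
        using x by (intro topological_tendstoD[where S = "ball 0 d"]) auto
    qed (use x in simp)
    then have 1: "((\<lambda>s. D (x + s *\<^sub>R m)) \<longlongrightarrow> D x) (at_right 0)" by simp
    have "((\<lambda>s. x + s *\<^sub>R m) \<longlongrightarrow> x + 0 *\<^sub>R m) (at_right 0)" by (intro tendsto_intros)
    then have "\<forall>\<^sub>F s in at_right 0. x + s *\<^sub>R m \<in> ball 0 d"
        using x by (intro topological_tendstoD[where S = "ball 0 d"]) auto
    moreover have "\<forall>\<^sub>F s in at_right (0::real). s > 0" by (rule eventually_at_right_less)
    ultimately have "\<forall>\<^sub>F s in at_right 0. D (x + s *\<^sub>R m) = c"
    proof eventually_elim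
      case (elim s)
      have "(x + s *\<^sub>R m) \<bullet> m = x \<bullet> m + s * (m \<bullet> m)" by (simp add: inner_add_left)
      also have "\<dots> > 0" using x(2) elim(2) m(1) by (simp add: add_nonneg_pos)
      finally show ?case using c elim by simp
    qed
    then have "((\<lambda>s. D (x + s *\<^sub>R m)) \<longlongrightarrow> c) (at_right 0)" by (simp add: tendsto_eventually)
    with 1 have "D x = c" using tendsto_unique trivial_limit_at_right_real by blast
    then show ?thesis using c[OF b] by simp
  qed
  have p: "D x = D ((d / (2 * norm n)) *\<^sub>R n)" if "norm x < d" "x \<bullet> n \<ge> 0" for x
    by (rule side) (use n that in auto)
  have q: "D x = D ((d / (2 * norm (-n))) *\<^sub>R (-n))" if "norm x < d" "x \<bullet> n \<le> 0" for x
    by (rule side) (use n that in auto)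
  have "D h = D 0" using p[OF h] q[OF h] p[of 0] q[of 0] d by (cases "h \<bullet> n \<ge> 0") auto
  then show ?thesis by (simp add: D_def algebra_simps)
qed

text \<open>Shows that the condition over the interior determines a chart on the glued sides too:
  there the displacement formula follows by continuity from both sides.\<close>

lemma chart_translation:
  assumes ch: "translation_chart P G (L_vertices w w) U c" and q: "q \<in> U"
  shows "\<forall>\<^sub>F h in nhds 0. ex q h \<in> U \<and> c (ex q h) = c q + h" and "U \<subseteq> Sp"
proof -
  have U: "openin S U" "cone \<notin> U" "homeomorphic_map (subtopology S U) (top_of_set (c ` U)) c"
    and loc: "\<And>x. x \<in> interior P \<Longrightarrow> cls x \<in> U \<Longrightarrow> \<exists>v. \<forall>\<^sub>F y in nhds x. c (cls y) = y + v"
    using ch cone_vertices unfolding translation_chart_def S_def cls_def by auto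
  show USp: "U \<subseteq> Sp" using U(1,2) openin_subset[OF U(1)] topspace_minus by blast
  then have qS: "q \<in> Sp" using q by blast
  obtain e where e: "nice q e" using Sp_nice[OF qS] by blast
  have "\<forall>\<^sub>F h in nhds 0. ex q h \<in> U" using open_Sp_iff[OF USp] U(1) q by blast
  then have "\<forall>\<^sub>F h in nhds 0. ex q h \<in> U \<and> norm h < e"
    using ev_norm_less[OF nice_pos[OF e]] by (rule eventually_conj)
  then obtain d0 where d0: "d0 > 0" "\<And>h. norm h < d0 \<Longrightarrow> ex q h \<in> U \<and> norm h < e"
    unfolding eventually_nhds_metric by (auto simp: dist_norm)
  define d where "d = min d0 e"
  have d: "d > 0" "d \<le> e" "\<And>h. norm h < d \<Longrightarrow> ex q h \<in> U"
    using d0 nice_pos[OF e] by (auto simp: d_def)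
  have nd: "nice q d" using nice_mono[OF e d(1,2)] .
  obtain n where n: "n \<noteq> 0" "\<And>h r. norm h < d \<Longrightarrow> h \<bullet> n \<noteq> 0 \<Longrightarrow> r \<in> q \<Longrightarrow> r + h \<in> P \<Longrightarrow> r + h \<in> interior P"
    using nice_int[OF nd] by blast
  have "continuous_map (top_of_set (ball 0 d)) (subtopology S U) (ex q)"
    using ex_continuous[OF nd] d(3) by (auto simp: continuous_map_in_subtopology)
  moreover have "continuous_map (subtopology S U) euclidean c"
    using homeomorphic_imp_continuous_map[OF U(3)] continuous_map_in_subtopology by blast
  ultimately have cg: "continuous_on (ball 0 d) (\<lambda>h. c (ex q h))"
    using continuous_map_compose[of "top_of_set (ball 0 d)" "subtopology S U" "ex q" euclidean c] by (simp add: o_def)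
  have "c (ex q h) = c (ex q 0) + h" if h: "norm h < d" for h
  proof (rule continuous_locally_translation[OF d(1) n(1) cg _ h])
    fix h assume h: "norm h < d" "h \<bullet> n \<noteq> 0"
    obtain r where r: "r \<in> q" "r + h \<in> P" "ex q h = cls (r + h)" using ex_rep[OF nd h(1)] by blast
    have int: "r + h \<in> interior P" using n(2) h r by blast
    obtain v where v: "\<forall>\<^sub>F y in nhds (r + h). c (cls y) = y + v" using loc[OF int] d(3)[OF h(1)] r(3) by auto
    have "\<forall>\<^sub>F y in nhds (r + h). y \<in> interior P" using int eventually_nhds_in_open open_interior by blast
    with v have "\<forall>\<^sub>F y in nhds (r + h). c (cls y) = y + v \<and> y \<in> interior P" by (rule eventually_conj)
    then obtain s where s: "s > 0" "\<And>y. dist y (r + h) < s \<Longrightarrow> c (cls y) = y + v \<and> y \<in> interior P"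
      unfolding eventually_nhds_metric by blast
    have "c (ex q (h + k)) = c (ex q h) + k" if k: "norm k < s" "norm k < d - norm h" for k
    proof -
      have a: "c (cls (r + h + k)) = r + h + k + v" "r + h + k \<in> P"
        using s(2)[of "r + h + k"] k interior_subset[of P] by (auto simp: dist_norm)
      have b: "c (cls (r + h)) = r + h + v" using s(2)[of "r + h"] s(1) by simp
      have "norm (h + k) < d" using k(2) norm_triangle_ineq[of h k] by linarith
      then have "ex q (h + k) = cls (r + h + k)" using ex_eq[OF nd _ r(1), of "h + k"] a(2) by (simp add: add.assoc)
      then show ?thesis using a b r(3) by simp
    qed
    then show "\<forall>\<^sub>F k in nhds 0. c (ex q (h + k)) = c (ex q h) + k"
      using s(1) h(1) unfolding eventually_nhds_metric by (intro exI[of _ "min s (d - norm h)"]) (simp add: dist_norm)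
  qed
  then show "\<forall>\<^sub>F h in nhds 0. ex q h \<in> U \<and> c (ex q h) = c q + h"
    using d qS unfolding eventually_nhds_metric by (intro exI[of _ d]) (auto simp: dist_norm)
qed

lemma loc_aff_continuous:
  assumes A: "loc_aff A \<phi>"
  shows "continuous_map (subtopology S Sp) (subtopology S Sp) \<phi>"
proof -
  have tS: "topspace (subtopology S Sp) = Sp" using Sp_subset by auto
  show ?thesis unfolding continuous_map_def tS
  proof (intro conjI allI impI)
    show "\<phi> \<in> Sp \<rightarrow> Sp" using loc_affD(2)[OF A] by blast
    fix U assume "openin (subtopology S Sp) U"
    then have U: "openin S U" "U \<subseteq> Sp" using openin_Sp by (auto simp: openin_open_subtopology)
    have "openin S {x \<in> Sp. \<phi> x \<in> U}"
    proof (subst open_Sp_iff; clarify?)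
      fix q assume q: "q \<in> Sp" "\<phi> q \<in> U"
      have "\<forall>\<^sub>F h in nhds 0. ex (\<phi> q) h \<in> U" using open_Sp_iff[OF U(2)] U(1) q(2) by blast
      from ev_matrix[OF this, of A] show "\<forall>\<^sub>F h in nhds 0. ex q h \<in> {x \<in> Sp. \<phi> x \<in> U}"
        using loc_affD(3)[OF A q(1)] ev_ex_Sp[OF q(1)] by eventually_elim simp
    qed
    then show "openin (subtopology S Sp) {x \<in> Sp. \<phi> x \<in> U}"
      using openin_Sp by (auto simp: openin_open_subtopology)
  qed
qed

definition extend :: "((real^2) set \<Rightarrow> (real^2) set) \<Rightarrow> (real^2) set \<Rightarrow> (real^2) set" where
  "extend \<phi> q = (if q = cone then cone else \<phi> q)"

lemma top_cases: "q \<in> topspace S \<longleftrightarrow> q = cone \<or> q \<in> Sp"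
  using topspace_minus cone_top by blast

lemma cone_notin: "cone \<notin> Sp" by (simp add: Sp_def)

lemma extend_Sp: "q \<in> Sp \<Longrightarrow> extend \<phi> q = \<phi> q" using cone_notin by (auto simp: extend_def)

text \<open>The surface is the one-point compactification of the complement of the cone point, so
  continuity at the cone point is automatic.\<close>
lemma extend_continuous:
  assumes A: "loc_aff A \<phi>" and AB: "A ** B = mat 1"
  shows "continuous_map S S (extend \<phi>)" unfolding continuous_map_def
proof (intro conjI allI impI)
  show "extend \<phi> \<in> topspace S \<rightarrow> topspace S"
    using loc_affD(2)[OF A] top_cases by (auto simp: extend_def)
  define \<psi> where "\<psi> = inv_into Sp \<phi>"
  note B = loc_aff_inv[OF A AB, folded \<psi>_def]
  have tS: "topspace (subtopology S Sp) = Sp" using Sp_subset by auto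
  fix U assume U: "openin S U"
  show "openin S {x \<in> topspace S. extend \<phi> x \<in> U}"
  proof (cases "cone \<in> U")
    case False
    then have "{x \<in> topspace S. extend \<phi> x \<in> U} = {x \<in> Sp. \<phi> x \<in> U \<inter> Sp}"
      using top_cases cone_notin loc_affD(2)[OF A] by (auto simp: extend_def)
    moreover have "openin (subtopology S Sp) (U \<inter> Sp)" using U by (rule openin_subtopology_Int)
    then have "openin (subtopology S Sp) {x \<in> topspace (subtopology S Sp). \<phi> x \<in> U \<inter> Sp}"
      using loc_aff_continuous[OF A] openin_continuous_map_preimage by blast
    ultimately show ?thesis using openin_Sp unfolding tS by (simp add: openin_open_subtopology)
  next
    case True
    define C where "C = topspace S - U"
    have C: "C \<subseteq> Sp" "closedin S C" using True top_cases U unfolding C_def by auto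
    have "compactin S C" using compact_S C(2) closedin_compact_space by blast
    then have "compactin (subtopology S Sp) C" using C(1) by (simp add: compactin_subtopology)
    then have "compactin (subtopology S Sp) (\<psi> ` C)" using loc_aff_continuous[OF B] image_compactin by blast
    then have "compactin S (\<psi> ` C)" by (simp add: compactin_subtopology)
    then have cl: "closedin S (\<psi> ` C)" using Hausdorff_S compactin_imp_closedin by blast
    have "{x \<in> topspace S. extend \<phi> x \<in> U} = topspace S - \<psi> ` C"
    proof (rule equalityI; rule subsetI)
      fix x assume x: "x \<in> {x \<in> topspace S. extend \<phi> x \<in> U}"
      have "x \<notin> \<psi> ` C"
      proof
        assume "x \<in> \<psi> ` C"
        then obtain c where c: "c \<in> C" "x = \<psi> c" by blast
        have cS: "c \<in> Sp" using c(1) C(1) by blast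
        then have "\<phi> x = c" "x \<in> Sp" using c(2) loc_affD(1)[OF A] loc_affD(2)[OF B cS]
          unfolding \<psi>_def by (simp_all add: bij_betw_def f_inv_into_f)
        then show False using x c extend_Sp unfolding C_def by auto
      qed
      then show "x \<in> topspace S - \<psi> ` C" using x by blast
    next
      fix x assume x: "x \<in> topspace S - \<psi> ` C"
      show "x \<in> {x \<in> topspace S. extend \<phi> x \<in> U}"
      proof (cases "x = cone")
        case True then show ?thesis using \<open>cone \<in> U\<close> x by (simp add: extend_def)
      next
        case False
        then have xS: "x \<in> Sp" using x top_cases by blast
        have "\<psi> (\<phi> x) = x" using xS loc_affD(1)[OF A] unfolding \<psi>_def bij_betw_def by simp
        then have "\<phi> x \<notin> C" using x by force
        then show ?thesis using x xS loc_affD(2)[OF A] Sp_subset extend_Sp unfolding C_def by auto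
      qed
    qed
    then show ?thesis using cl by (simp add: openin_diff)
  qed
qed

lemma invertible_ex:
  fixes A :: "real^2^2"
  assumes "det A = 1"
  shows "\<exists>B. A ** B = mat 1 \<and> B ** A = mat 1 \<and> det B = 1"
proof -
  have "invertible A" using assms by (simp add: invertible_det_nz)
  then obtain B where B: "A ** B = mat 1" "B ** A = mat 1" unfolding invertible_def by blast
  then have "det A * det B = 1" by (metis det_I det_mul)
  then show ?thesis using B assms by auto
qed

text \<open>Forward, charts are injective and turn displacements into translations, so the affine
  formula descends to \<open>ex\<close>. Backward, the map is extended by fixing the cone point, and
  the inverses of \<open>ex\<close> serve as charts.\<close>

lemma veech_iff: "A \<in> L_veech_group w w \<longleftrightarrow> det A = 1 \<and> (\<exists>\<phi>. loc_aff A \<phi>)"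
proof
  assume "A \<in> L_veech_group w w"
  then obtain \<phi> where d: "det A = 1" and \<phi>: "affine_homeo P G (L_vertices w w) \<phi> A"
    unfolding L_veech_group_def veech_group_def SL2_def P_def G_def by auto
  have hom: "homeomorphic_map S S \<phi>" and c: "\<phi> cone = cone"
    and loc: "\<And>p. p \<in> Sp \<Longrightarrow> \<exists>U c U' c' v. translation_chart P G (L_vertices w w) U c \<and>
        translation_chart P G (L_vertices w w) U' c' \<and> p \<in> U \<and> \<phi> ` U \<subseteq> U' \<and> (\<forall>q\<in>U. c' (\<phi> q) = A *v c q + v)"
    using \<phi> cone_vertices topspace_minus unfolding affine_homeo_def S_def cls_def by auto
  have bij: "bij_betw \<phi> (topspace S) (topspace S)"
    using hom homeomorphic_imp_surjective_map homeomorphic_imp_injective_map unfolding bij_betw_def by blast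
  then have "bij_betw \<phi> (topspace S - {cone}) (topspace S - {cone})"
    using bij_betw_DiffI[OF bij, of "{cone}" "{cone}"] cone_top c by (simp add: bij_betw_def)
  then have bS: "bij_betw \<phi> Sp Sp" by (simp add: topspace_minus)
  have "\<forall>\<^sub>F h in nhds 0. \<phi> (ex q h) = ex (\<phi> q) (A *v h)" if q: "q \<in> Sp" for q
  proof -
    obtain U c U' c' v where U: "translation_chart P G (L_vertices w w) U c"
      and U': "translation_chart P G (L_vertices w w) U' c'"
      and qU: "q \<in> U" and sub: "\<phi> ` U \<subseteq> U'" and f: "\<forall>q\<in>U. c' (\<phi> q) = A *v c q + v"
      using loc[OF q] by (elim exE conjE) (rule that)
    have qU': "\<phi> q \<in> U'" using qU sub by blast
    have inj: "inj_on c' U'"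
    proof -
      have "homeomorphic_map (subtopology S U') (top_of_set (c' ` U')) c'"
        using U' by (simp only: translation_chart_def S_def)
      moreover have "topspace (subtopology S U') = U'" using chart_translation(2)[OF U' qU'] Sp_subset by auto
      ultimately show ?thesis using homeomorphic_imp_injective_map by metis
    qed
    from ev_matrix[OF chart_translation(1)[OF U' qU'], of A]
    show ?thesis using chart_translation(1)[OF U qU]
    proof eventually_elim
      case (elim h)
      have "c' (\<phi> (ex q h)) = A *v (c q + h) + v" using f elim(2) by simp
      also have "\<dots> = c' (\<phi> q) + A *v h" using f qU by (simp add: matrix_vector_right_distrib)
      also have "\<dots> = c' (ex (\<phi> q) (A *v h))" using elim(1) by simp
      finally show ?case using inj elim sub unfolding inj_on_def by blast
    qed
  qed
  then show "det A = 1 \<and> (\<exists>\<phi>. loc_aff A \<phi>)" using d bS unfolding loc_aff_def by blast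
next
  assume "det A = 1 \<and> (\<exists>\<phi>. loc_aff A \<phi>)"
  then obtain \<phi> where d: "det A = 1" and A: "loc_aff A \<phi>" by blast
  obtain B where B: "A ** B = mat 1" "B ** A = mat 1" using invertible_ex[OF d] by blast
  define \<psi> where "\<psi> = inv_into Sp \<phi>"
  note B' = loc_aff_inv[OF A B(1), folded \<psi>_def]
  have "homeomorphic_maps S S (extend \<phi>) (extend \<psi>)" unfolding homeomorphic_maps_def
  proof (intro conjI ballI)
    show "continuous_map S S (extend \<phi>)" by (rule extend_continuous[OF A B(1)])
    show "continuous_map S S (extend \<psi>)" by (rule extend_continuous[OF B' B(2)])
    fix x assume "x \<in> topspace S"
    then show "extend \<psi> (extend \<phi> x) = x" "extend \<phi> (extend \<psi> x) = x"
      using top_cases extend_Sp loc_affD(1)[OF A] loc_affD(2)[OF A] loc_affD(2)[OF B']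
      unfolding \<psi>_def by (auto simp: bij_betw_def extend_def[of _ cone] f_inv_into_f)
  qed
  then have hom: "homeomorphic_map S S (extend \<phi>)" using homeomorphic_map_maps by blast
  have "\<exists>U c U' c' v. translation_chart P G (L_vertices w w) U c \<and>
      translation_chart P G (L_vertices w w) U' c' \<and> p \<in> U \<and> extend \<phi> ` U \<subseteq> U' \<and>
      (\<forall>q\<in>U. c' (extend \<phi> q) = A *v c q + v)" if p: "p \<in> Sp" for p
  proof -
    obtain e where e: "nice p e" using Sp_nice[OF p] by blast
    obtain e' where e': "nice (\<phi> p) e'" using Sp_nice[OF loc_affD(2)[OF A p]] by blast
    have "\<forall>\<^sub>F h in nhds 0. \<phi> (ex p h) = ex (\<phi> p) (A *v h) \<and> norm (A *v h) < e'"
      using loc_affD(3)[OF A p] ev_matrix[OF ev_norm_less[OF nice_pos[OF e']], of A] by (rule eventually_conj)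
    then obtain d0 where d0: "d0 > 0" "\<And>h. norm h < d0 \<Longrightarrow> \<phi> (ex p h) = ex (\<phi> p) (A *v h) \<and> norm (A *v h) < e'"
      unfolding eventually_nhds_metric by (auto simp: dist_norm)
    define d where "d = min d0 e"
    have d: "d > 0" "d \<le> e" "\<And>h. norm h < d \<Longrightarrow> \<phi> (ex p h) = ex (\<phi> p) (A *v h) \<and> norm (A *v h) < e'"
      using d0 nice_pos[OF e] by (auto simp: d_def)
    have nd: "nice p d" by (rule nice_mono[OF e d(1,2)])
    let ?c = "inv_into (ball 0 d) (ex p)" and ?c' = "inv_into (ball 0 e') (ex (\<phi> p))"
    have ci: "?c (ex p h) = h" if "norm h < d" for h using inv_into_f_f[OF ex_inj_on[OF nd], of h] that by simp
    have ci': "?c' (ex (\<phi> p) h) = h" if "norm h < e'" for h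
      using inv_into_f_f[OF ex_inj_on[OF e'], of h] that by simp
    have ext: "extend \<phi> (ex p h) = ex (\<phi> p) (A *v h)" if "norm h < d" for h
      using extend_Sp[OF ex_Sp[OF nd that]] d(3)[OF that] by simp
    show ?thesis
    proof (intro exI conjI)
      show "translation_chart P G (L_vertices w w) (ex p ` ball 0 d) ?c" by (rule chart_ex[OF nd])
      show "translation_chart P G (L_vertices w w) (ex (\<phi> p) ` ball 0 e') ?c'" by (rule chart_ex[OF e'])
      show "p \<in> ex p ` ball 0 d" using ex_0[OF p] d(1) by (metis centre_in_ball image_eqI)
      show "extend \<phi> ` ex p ` ball 0 d \<subseteq> ex (\<phi> p) ` ball 0 e'" using ext d(3) by auto
      show "\<forall>q\<in>ex p ` ball 0 d. ?c' (extend \<phi> q) = A *v ?c q + 0" using ext ci ci' d(3) by auto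
    qed
  qed
  then have "affine_homeo P G (L_vertices w w) (extend \<phi>) A"
    using hom cone_vertices topspace_minus unfolding affine_homeo_def S_def cls_def by (simp add: extend_def cls_def)
  then show "A \<in> L_veech_group w w"
    using d unfolding L_veech_group_def veech_group_def SL2_def P_def G_def by auto
qed

lemma veech_subgroup: "subgroup (L_veech_group w w) SL2R"
proof (rule group.subgroupI[OF group_SL2R])
  show "L_veech_group w w \<subseteq> carrier SL2R" by (auto simp: veech_iff SL2R_def SL2_def)
  show "L_veech_group w w \<noteq> {}" using veech_iff[of "mat 1"] loc_aff_id by auto
next
  fix A assume A: "A \<in> L_veech_group w w"
  then obtain \<phi> where \<phi>: "det A = 1" "loc_aff A \<phi>" using veech_iff by blast
  obtain B where B: "A ** B = mat 1" "B ** A = mat 1" "det B = 1" using invertible_ex[OF \<phi>(1)] by blast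
  have "B \<in> L_veech_group w w" using B loc_aff_inv[OF \<phi>(2) B(1)] veech_iff by blast
  moreover have "inv\<^bsub>SL2R\<^esub> A = B"
    using B \<phi> by (intro group.inv_equality[OF group_SL2R]) (auto simp: SL2R_def SL2_def)
  ultimately show "inv\<^bsub>SL2R\<^esub> A \<in> L_veech_group w w" by simp
next
  fix A B assume "A \<in> L_veech_group w w" "B \<in> L_veech_group w w"
  then obtain \<phi> \<psi> where "det A = 1" "loc_aff A \<phi>" "det B = 1" "loc_aff B \<psi>" using veech_iff by blast
  then have "det (A ** B) = 1" "loc_aff (A ** B) (\<phi> \<circ> \<psi>)" using loc_aff_comp by (auto simp: det_mul)
  then show "A \<otimes>\<^bsub>SL2R\<^esub> B \<in> L_veech_group w w" using veech_iff by (auto simp: SL2R_def)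
qed

section \<open>Straight paths and their holonomy\<close>

lemma ev_scaleR:
  assumes "eventually Q (nhds (0::real^2))" shows "\<forall>\<^sub>F s in nhds 0. Q (s *\<^sub>R u)"
proof -
  have "((\<lambda>s. s *\<^sub>R u) \<longlongrightarrow> 0 *\<^sub>R u) (at 0)" by (intro tendsto_intros)
  then have "((\<lambda>s. s *\<^sub>R u) \<longlongrightarrow> 0 *\<^sub>R u) (nhds 0)" by (rule tendsto_at_iff_tendsto_nhds[THEN iffD1])
  then show ?thesis using assms unfolding filterlim_iff by simp
qed

text \<open>Geodesics of velocity \<open>u\<close> in the punctured surface. Only times inside
  \<open>I\<close> are compared, so closed and half-open intervals are allowed; this matters for
  paths that would continue into the cone point.\<close>

definition straight :: "real set \<Rightarrow> (real \<Rightarrow> (real^2) set) \<Rightarrow> real^2 \<Rightarrow> bool" where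
  "straight I p u \<longleftrightarrow> (\<forall>\<tau>\<in>I. p \<tau> \<in> Sp \<and> (\<forall>\<^sub>F s in nhds 0. \<tau> + s \<in> I \<longrightarrow> p (\<tau> + s) = ex (p \<tau>) (s *\<^sub>R u)))"

lemma straightD:
  assumes "straight I p u" "\<tau> \<in> I"
  shows "p \<tau> \<in> Sp" "\<forall>\<^sub>F s in nhds 0. \<tau> + s \<in> I \<longrightarrow> p (\<tau> + s) = ex (p \<tau>) (s *\<^sub>R u)"
  using assms unfolding straight_def by blast+

lemma straight_subset: "straight I p u \<Longrightarrow> J \<subseteq> I \<Longrightarrow> straight J p u"
  unfolding straight_def by (fastforce elim: eventually_mono)

lemma straight_cong: "straight I p u \<Longrightarrow> (\<And>\<tau>. \<tau> \<in> I \<Longrightarrow> p \<tau> = p' \<tau>) \<Longrightarrow> straight I p' u"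
  unfolding straight_def by (simp cong: imp_cong)

lemma straight_aff:
  assumes A: "loc_aff A \<phi>" and p: "straight I p u"
  shows "straight I (\<lambda>\<tau>. \<phi> (p \<tau>)) (A *v u)" unfolding straight_def
proof (intro ballI conjI)
  fix \<tau> assume t: "\<tau> \<in> I"
  note D = straightD[OF p t]
  show "\<phi> (p \<tau>) \<in> Sp" using loc_affD(2)[OF A D(1)] .
  show "\<forall>\<^sub>F s in nhds 0. \<tau> + s \<in> I \<longrightarrow> \<phi> (p (\<tau> + s)) = ex (\<phi> (p \<tau>)) (s *\<^sub>R (A *v u))"
    using ev_scaleR[OF loc_affD(3)[OF A D(1)], of u] D(2) by eventually_elim (simp add: matrix_vector_mult_scaleR)
qed

lemma ev_nhds0_real: "eventually Q (nhds (0::real)) \<longleftrightarrow> (\<exists>d>0. \<forall>s. \<bar>s\<bar> < d \<longrightarrow> Q s)"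
  by (simp add: eventually_nhds_metric)

lemma locally_constantI:
  fixes f :: "real \<Rightarrow> 'c"
  assumes "connected I" "\<And>\<tau>. \<tau> \<in> I \<Longrightarrow> \<forall>\<^sub>F s in nhds 0. \<tau> + s \<in> I \<longrightarrow> f (\<tau> + s) = f \<tau>" "a \<in> I" "b \<in> I"
  shows "f a = f b"
proof -
  have "f constant_on I"
  proof (rule locally_constant_imp_constant[OF assms(1)])
    fix \<tau> assume t: "\<tau> \<in> I"
    obtain d where d: "d > 0" "\<And>s. \<bar>s\<bar> < d \<Longrightarrow> \<tau> + s \<in> I \<Longrightarrow> f (\<tau> + s) = f \<tau>"
      using assms(2)[OF t] unfolding ev_nhds0_real by blast
    have "f x = f \<tau>" if "x \<in> I \<inter> ball \<tau> d" for x
      using d(2)[of "x - \<tau>"] that by (auto simp: dist_real_def abs_minus_commute)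
    moreover have "openin (top_of_set I) (I \<inter> ball \<tau> d)" by (simp add: openin_open_Int)
    moreover have "\<tau> \<in> I \<inter> ball \<tau> d" using t d(1) by simp
    ultimately show "\<exists>T. openin (top_of_set I) T \<and> \<tau> \<in> T \<and> (\<forall>x\<in>T. f x = f \<tau>)" by blast
  qed
  then show ?thesis using assms(3,4) unfolding constant_on_def by auto
qed

lemma Sp_separate:
  assumes "q \<in> Sp" "q' \<in> Sp" "q \<noteq> q'"
  shows "\<forall>\<^sub>F s in nhds 0. ex q (s *\<^sub>R u) \<noteq> ex q' (s *\<^sub>R u)"
proof -
  have "q \<in> topspace S \<and> q' \<in> topspace S \<and> q \<noteq> q'" using assms Sp_subset by blast
  from Hausdorff_S[unfolded Hausdorff_space_def, rule_format, OF this]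
  obtain U V where UV: "openin S U" "openin S V" "q \<in> U" "q' \<in> V" "disjnt U V" by (elim exE conjE)
  have "openin S (U \<inter> Sp)" "openin S (V \<inter> Sp)" using UV(1,2) openin_Sp openin_Int by blast+
  moreover have "q \<in> U \<inter> Sp" "q' \<in> V \<inter> Sp" using UV(3,4) assms(1,2) by blast+
  ultimately have "\<forall>\<^sub>F h in nhds 0. ex q h \<in> U \<inter> Sp" "\<forall>\<^sub>F h in nhds 0. ex q' h \<in> V \<inter> Sp"
    using open_Sp_iff[OF Int_lower2] by metis+
  from this(1)[THEN ev_scaleR, of u] this(2)[THEN ev_scaleR, of u] show ?thesis
    by eventually_elim (use UV(5) in \<open>auto simp: disjnt_def\<close>)
qed

text \<open>Agreement of the two paths is an open condition by the displacement formula, and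
  disagreement is open by the Hausdorff property.\<close>

lemma straight_unique:
  assumes p: "straight I p u" and p': "straight I p' u" and I: "connected I"
    and t0: "t0 \<in> I" "p t0 = p' t0" and t: "t \<in> I"
  shows "p t = p' t"
proof -
  have "(p t = p' t) = (p t0 = p' t0)"
  proof (rule locally_constantI[OF I _ t t0(1), of "\<lambda>t. p t = p' t"])
    fix \<tau> assume \<tau>: "\<tau> \<in> I"
    note D = straightD[OF p \<tau>] and D' = straightD[OF p' \<tau>]
    show "\<forall>\<^sub>F s in nhds 0. \<tau> + s \<in> I \<longrightarrow> (p (\<tau> + s) = p' (\<tau> + s)) = (p \<tau> = p' \<tau>)"
    proof (cases "p \<tau> = p' \<tau>")
      case True
      from D(2) D'(2) show ?thesis by eventually_elim (use True in simp)
    next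
      case False
      from D(2) D'(2) Sp_separate[OF D(1) D'(1) False, of u] show ?thesis by eventually_elim (use False in auto)
    qed
  qed
  then show ?thesis using t0 by simp
qed

definition ZW :: "real set" where "ZW = {of_int m + of_int n * w | m n. True}"

lemma ZW_I: "of_int m + of_int n * w \<in> ZW" unfolding ZW_def by blast

lemma ZW_0 [simp]: "0 \<in> ZW" and ZW_1 [simp]: "1 \<in> ZW" and ZW_w [simp]: "w \<in> ZW"
  and ZW_int [simp]: "of_int k \<in> ZW" using ZW_I[of 0 0] ZW_I[of 1 0] ZW_I[of 0 1] ZW_I[of k 0] by simp_all

lemma ZW_add [simp]: "x \<in> ZW \<Longrightarrow> y \<in> ZW \<Longrightarrow> x + y \<in> ZW"
proof -
  assume "x \<in> ZW" "y \<in> ZW"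
  then obtain m n m' n' where "x = of_int m + of_int n * w" "y = of_int m' + of_int n' * w" unfolding ZW_def by blast
  then have "x + y = of_int (m + m') + of_int (n + n') * w" by (simp add: algebra_simps)
  then show ?thesis unfolding ZW_def by blast
qed

lemma ZW_minus [simp]: "x \<in> ZW \<Longrightarrow> - x \<in> ZW"
proof -
  assume "x \<in> ZW"
  then obtain m n where "x = of_int m + of_int n * w" unfolding ZW_def by blast
  then have "- x = of_int (- m) + of_int (- n) * w" by simp
  then show ?thesis unfolding ZW_def by blast
qed

lemma ZW_diff [simp]: "x \<in> ZW \<Longrightarrow> y \<in> ZW \<Longrightarrow> x - y \<in> ZW"
  using ZW_add[of x "- y"] by simp

lemma ZW_int_w [simp]: "of_int k * w \<in> ZW" "w * of_int k \<in> ZW"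
  using ZW_I[of 0 k] by (simp_all add: mult.commute)

definition Lam :: "(real^2) set" where "Lam = {h. h $ 1 \<in> ZW \<and> h $ 2 \<in> ZW}"

lemma Lam_add: "x \<in> Lam \<Longrightarrow> y \<in> Lam \<Longrightarrow> x + y \<in> Lam"
  and Lam_minus: "x \<in> Lam \<Longrightarrow> - x \<in> Lam" and Lam_diff: "x \<in> Lam \<Longrightarrow> y \<in> Lam \<Longrightarrow> x - y \<in> Lam"
  and Lam_0: "0 \<in> Lam" by (auto simp: Lam_def)

text \<open>Glued points differ by a translation of length \<open>1\<close> or \<open>w\<close> in
  one coordinate; hence all holonomies lie in \<open>Lam\<close>.\<close>

lemma Sp_Lam:
  assumes "q \<in> Sp" "r \<in> q" "r' \<in> q" shows "r - r' \<in> Lam"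
proof -
  have r: "r \<in> P" "cls r = q" "\<not> corner r" using Sp_mem[OF assms(1,2)] by auto
  have r': "r' \<in> cls r" "r \<in> cls r" using r assms by auto
  have d: "u - v \<in> ZW" if "u \<in> {0, 1, w - 1, w}" "v \<in> {0, 1, w - 1, w}" for u v
  proof -
    have "w - 1 \<in> ZW" by simp
    then have "u \<in> ZW" "v \<in> ZW" using that ZW_0 ZW_1 ZW_w by blast+
    then show ?thesis by simp
  qed
  show ?thesis using r(1)
  proof (cases r rule: type_cases)
    assume "corner r" then show ?thesis using r by simp
  next
    assume "tI r" then show ?thesis using r' cls_tI Lam_0 by simp
  next
    assume t: "tH1 r"
    have "r $ 2 \<in> {0,1,w-1,w}" "r' $ 2 \<in> {0,1,w-1,w}" "r $ 1 = r' $ 1" using r' unfolding cls_tH1[OF t] by (metis insert_iff empty_iff pt_nth)+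
    then show ?thesis using d by (simp add: Lam_def)
  next
    assume t: "tH2 r"
    have "r $ 2 \<in> {0,1,w-1,w}" "r' $ 2 \<in> {0,1,w-1,w}" "r $ 1 = r' $ 1" using r' unfolding cls_tH2[OF t] by (metis insert_iff empty_iff pt_nth)+
    then show ?thesis using d by (simp add: Lam_def)
  next
    assume t: "tV1 r"
    have "r $ 1 \<in> {0,1,w-1,w}" "r' $ 1 \<in> {0,1,w-1,w}" "r $ 2 = r' $ 2" using r' unfolding cls_tV1[OF t] by (metis insert_iff empty_iff pt_nth)+
    then show ?thesis using d by (simp add: Lam_def)
  next
    assume t: "tV2 r"
    have "r $ 1 \<in> {0,1,w-1,w}" "r' $ 1 \<in> {0,1,w-1,w}" "r $ 2 = r' $ 2" using r' unfolding cls_tV2[OF t] by (metis insert_iff empty_iff pt_nth)+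
    then show ?thesis using d by (simp add: Lam_def)
  qed
qed

text \<open>The developing map: \<open>r - \<tau> *\<^sub>R u\<close> modulo \<open>Lam\<close> does
  not depend on the representative \<open>r\<close> and is locally constant along the path.\<close>

lemma straight_dev:
  assumes p: "straight I p u" and I: "connected I" "a \<in> I" "b \<in> I"
    and r: "r \<in> p a" "r' \<in> p b"
  shows "r' - r - (b - a) *\<^sub>R u \<in> Lam"
proof -
  define f where "f = (\<lambda>\<tau>. {x. \<exists>r\<in>p \<tau>. r - \<tau> *\<^sub>R u - x \<in> Lam})"
  have f: "f \<tau> = {x. r - \<tau> *\<^sub>R u - x \<in> Lam}" if "\<tau> \<in> I" "r \<in> p \<tau>" for \<tau> r
  proof -
    have "r' - \<tau> *\<^sub>R u - x \<in> Lam \<Longrightarrow> r - \<tau> *\<^sub>R u - x \<in> Lam" if "r' \<in> p \<tau>" for r' x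
      using Lam_add[OF _ Sp_Lam[OF straightD(1)[OF p \<open>\<tau> \<in> I\<close>] \<open>r \<in> p \<tau>\<close> that], of "r' - \<tau> *\<^sub>R u - x"]
      by (simp add: algebra_simps)
    then show ?thesis using that unfolding f_def by blast
  qed
  have "f a = f b"
  proof (rule locally_constantI[OF I(1) _ I(2,3)])
    fix \<tau> assume \<tau>: "\<tau> \<in> I"
    note D = straightD[OF p \<tau>]
    obtain e where e: "nice (p \<tau>) e" using Sp_nice[OF D(1)] by blast
    show "\<forall>\<^sub>F s in nhds 0. \<tau> + s \<in> I \<longrightarrow> f (\<tau> + s) = f \<tau>"
      using D(2) ev_scaleR[OF ev_norm_less[OF nice_pos[OF e]], of u]
    proof eventually_elim
      case (elim s)
      show ?case
      proof
        assume i: "\<tau> + s \<in> I"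
        obtain r where r: "r \<in> p \<tau>" "r + s *\<^sub>R u \<in> P" "ex (p \<tau>) (s *\<^sub>R u) = cls (r + s *\<^sub>R u)"
          using ex_rep[OF e elim(2)] by blast
        have "r + s *\<^sub>R u \<in> p (\<tau> + s)" using elim(1) i r cls_self by simp
        then show "f (\<tau> + s) = f \<tau>" using f[OF i] f[OF \<tau> r(1)] by (simp add: algebra_simps)
      qed
    qed
  qed
  moreover have "r - a *\<^sub>R u \<in> f a" using f[OF I(2) r(1)] Lam_0 by simp
  ultimately have "r' - b *\<^sub>R u - (r - a *\<^sub>R u) \<in> Lam" using f[OF I(3) r(2)] by simp
  then show ?thesis by (simp add: algebra_simps)
qed

text \<open>The lower and the upper horizontal cylinder have circumferences \<open>w\<close> and \<open>1\<close>; the horizontal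
  coordinate is taken modulo the circumference.\<close>
definition low :: "real \<Rightarrow> real \<Rightarrow> (real^2) set" where
  "low x y = cls (pt (x - w * of_int \<lfloor>x / w\<rfloor>) y)"
definition up :: "real \<Rightarrow> real \<Rightarrow> (real^2) set" where
  "up x y = cls (pt (w - 1 + frac (x - (w - 1))) y)"

lemma wrap_range: "0 \<le> x - w * of_int \<lfloor>x / w\<rfloor>" "x - w * of_int \<lfloor>x / w\<rfloor> < w"
proof -
  show "0 \<le> x - w * of_int \<lfloor>x / w\<rfloor>" "x - w * of_int \<lfloor>x / w\<rfloor> < w"
    using floor_divide_lower[of w x] floor_divide_upper[of w x] w1 by (simp_all add: algebra_simps)
qed

lemma wrap_eq:
  assumes "0 \<le> x0" "x0 < w" "x = x0 + w * of_int k" shows "x - w * of_int \<lfloor>x / w\<rfloor> = x0"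
proof -
  have "x / w = x0 / w + of_int k" using assms w1 by (simp add: field_simps)
  moreover have "\<lfloor>x0 / w\<rfloor> = 0" using assms w1 by (simp add: floor_eq_iff)
  ultimately have "\<lfloor>x / w\<rfloor> = k" by simp
  then show ?thesis using assms by simp
qed

lemma low_rep:
  assumes "0 < y" "y < 1" "0 \<le> x0" "x0 \<le> w" "x = x0 + w * of_int k"
  shows "low x y = cls (pt x0 y)"
proof (cases "x0 < w")
  case True
  then show ?thesis using wrap_eq[OF assms(3) True assms(5)] by (simp add: low_def)
next
  case False
  then have "x0 = w" "x = 0 + w * of_int (k + 1)" using assms by (auto simp: algebra_simps)
  then have "low x y = cls (pt 0 y)" using wrap_eq[of 0 x "k + 1"] w1 by (simp add: low_def)
  also have "\<dots> = cls (pt w y)" using cls_tV1[of "pt 0 y"] cls_tV1[of "pt w y"] assms by (simp add: tV1_def)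
  finally show ?thesis using \<open>x0 = w\<close> by simp
qed

lemma up_rep:
  assumes "1 < y" "y < w" "w - 1 \<le> x0" "x0 \<le> w" "x = x0 + of_int k"
  shows "up x y = cls (pt x0 y)"
proof (cases "x0 < w")
  case True
  have "frac (x - (w - 1)) = x0 - (w - 1)"
    using assms True frac_unique_iff[of "x - (w - 1)" "x0 - (w - 1)"] by (simp add: algebra_simps)
  then show ?thesis by (simp add: up_def)
next
  case False
  then have "x0 = w" using assms by simp
  have "frac (x - (w - 1)) = 0" using assms \<open>x0 = w\<close> frac_unique_iff[of "x - (w - 1)" 0] by simp
  then have "up x y = cls (pt (w - 1) y)" unfolding up_def by (simp only: add_0_right)
  also have "\<dots> = cls (pt w y)" using cls_tV2[of "pt (w-1) y"] cls_tV2[of "pt w y"] assms by (simp add: tV2_def)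
  finally show ?thesis using \<open>x0 = w\<close> by simp
qed

lemma low_ex_rep: "\<exists>x0 k. 0 \<le> x0 \<and> x0 < w \<and> x = x0 + w * of_int k"
  using wrap_range[of x] by (intro exI[of _ "x - w * of_int \<lfloor>x / w\<rfloor>"] exI[of _ "\<lfloor>x / w\<rfloor>"]) simp

lemma up_ex_rep: "\<exists>x0 k. w - 1 \<le> x0 \<and> x0 < w \<and> x = x0 + of_int k"
proof (intro exI conjI)
  show "w - 1 \<le> w - 1 + frac (x - (w - 1))" "w - 1 + frac (x - (w - 1)) < w"
    using frac_ge_0[of "x - (w-1)"] frac_lt_1[of "x - (w-1)"] by simp_all
  show "x = w - 1 + frac (x - (w - 1)) + of_int \<lfloor>x - (w - 1)\<rfloor>" by (simp add: frac_def)
qed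

lemma low_Sp: assumes "0 < y" "y < 1" shows "low x y \<in> Sp"
proof -
  obtain x0 k where x0: "0 \<le> x0" "x0 < w" "x = x0 + w * of_int k" using low_ex_rep by blast
  then show ?thesis using low_rep[OF assms x0(1) _ x0(3)] assms w1 by (simp add: cls_Sp mem_P corner_def)
qed

lemma up_Sp: assumes "1 < y" "y < w" shows "up x y \<in> Sp"
proof -
  obtain x0 k where x0: "w - 1 \<le> x0" "x0 < w" "x = x0 + of_int k" using up_ex_rep by blast
  then show ?thesis using up_rep[OF assms x0(1) _ x0(3)] assms w1 by (simp add: cls_Sp mem_P corner_def)
qed

lemma ev_lt: "c > 0 \<Longrightarrow> \<forall>\<^sub>F h in nhds (0::real^2). \<bar>h $ 1\<bar> < c \<and> \<bar>h $ 2\<bar> < c"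
proof -
  assume "c > 0"
  from ev_norm_less[OF this] show ?thesis
    by eventually_elim (use abs_nth_le_norm in \<open>blast intro: le_less_trans\<close>)
qed

lemma ex_low:
  assumes "0 < y" "y < 1"
  shows "\<forall>\<^sub>F h in nhds 0. ex (low x y) h = low (x + h $ 1) (y + h $ 2)"
proof -
  obtain x0 k where x0: "0 \<le> x0" "x0 < w" "x = x0 + w * of_int k" using low_ex_rep by blast
  obtain e where e: "nice (low x y) e" using Sp_nice[OF low_Sp[OF assms]] by blast
  define c where "c = min (min y (1 - y)) (w - x0)"
  have c: "c > 0" "c \<le> y" "c \<le> 1 - y" "c \<le> w - x0" using assms x0 by (auto simp: c_def)
  \<comment> \<open>At the seam \<open>x0 = 0\<close> a displacement to the left is read at the copy
    \<open>x0 = w\<close>, so no lower bound on the displacement is imposed there.\<close>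
  define c' where "c' = (if x0 = 0 then c else min c x0)"
  have c': "c' > 0" "c' \<le> c" "x0 = 0 \<or> c' \<le> x0" using c x0 by (auto simp: c'_def)
  show ?thesis using ev_norm_less[OF nice_pos[OF e]] ev_lt[OF c'(1)]
  proof eventually_elim
    case (elim h)
    have y': "0 < y + h $ 2" "y + h $ 2 < 1" using elim c c' by auto
    obtain x1 k1 where x1: "0 \<le> x1" "x1 \<le> w" "x = x1 + w * of_int k1" "0 \<le> x1 + h $ 1" "x1 + h $ 1 \<le> w"
    proof (cases "0 \<le> x0 + h $ 1")
      case True
      then show ?thesis using that[of x0 k] x0 c c' elim by auto
    next
      case False
      then have "x0 = 0" using c' elim by auto
      then show ?thesis using that[of w "k - 1"] x0 False c c' elim w1 by (auto simp: algebra_simps)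
    qed
    have l: "low x y = cls (pt x1 y)" using low_rep[OF assms x1(1,2,3)] .
    have m: "pt x1 y \<in> P" "pt x1 y + h \<in> P" using x1 y' assms by (auto simp: mem_P)
    have "ex (low x y) h = cls (pt x1 y + h)" using ex_eq[OF e elim(1) _ m(2)] l cls_self[OF m(1)] by simp
    also have "\<dots> = low (x + h $ 1) (y + h $ 2)"
      using low_rep[OF y' x1(4,5), of "x + h $ 1" k1] x1(3) by (simp add: pt_plus)
    finally show ?case .
  qed
qed

lemma ex_up:
  assumes "1 < y" "y < w"
  shows "\<forall>\<^sub>F h in nhds 0. ex (up x y) h = up (x + h $ 1) (y + h $ 2)"
proof -
  obtain x0 k where x0: "w - 1 \<le> x0" "x0 < w" "x = x0 + of_int k" using up_ex_rep by blast
  obtain e where e: "nice (up x y) e" using Sp_nice[OF up_Sp[OF assms]] by blast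
  define c where "c = min (min (y - 1) (w - y)) (min (w - x0) 1)"
  have c: "c > 0" "c \<le> y - 1" "c \<le> w - y" "c \<le> w - x0" "c \<le> 1" using assms x0 by (auto simp: c_def)
  define c' where "c' = (if x0 = w - 1 then c else min c (x0 - (w - 1)))"
  have c': "c' > 0" "c' \<le> c" "x0 = w - 1 \<or> c' \<le> x0 - (w - 1)" using c x0 by (auto simp: c'_def)
  show ?thesis using ev_norm_less[OF nice_pos[OF e]] ev_lt[OF c'(1)]
  proof eventually_elim
    case (elim h)
    have y': "1 < y + h $ 2" "y + h $ 2 < w" using elim c c' by auto
    obtain x1 k1 where x1: "w - 1 \<le> x1" "x1 \<le> w" "x = x1 + of_int k1" "w - 1 \<le> x1 + h $ 1" "x1 + h $ 1 \<le> w"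
    proof (cases "w - 1 \<le> x0 + h $ 1")
      case True
      then show ?thesis using that[of x0 k] x0 c c' elim by auto
    next
      case False
      then have "x0 = w - 1" using c' elim by auto
      then show ?thesis using that[of w "k - 1"] x0 False c c' elim w1 by (auto simp: algebra_simps)
    qed
    have l: "up x y = cls (pt x1 y)" using up_rep[OF assms x1(1,2,3)] .
    have m: "pt x1 y \<in> P" "pt x1 y + h \<in> P" using x1 y' assms w1 by (auto simp: mem_P)
    have "ex (up x y) h = cls (pt x1 y + h)" using ex_eq[OF e elim(1) _ m(2)] l cls_self[OF m(1)] by simp
    also have "\<dots> = up (x + h $ 1) (y + h $ 2)"
      using up_rep[OF y' x1(4,5), of "x + h $ 1" k1] x1(3) by (simp add: pt_plus)
    finally show ?case .
  qed
qed

lemma low_straight: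
  assumes "\<And>\<tau>. \<tau> \<in> I \<Longrightarrow> 0 < y + b * \<tau> \<and> y + b * \<tau> < 1"
  shows "straight I (\<lambda>\<tau>. low (x + a * \<tau>) (y + b * \<tau>)) (pt a b)" unfolding straight_def
proof (intro ballI conjI)
  fix \<tau> assume "\<tau> \<in> I"
  then have y: "0 < y + b * \<tau>" "y + b * \<tau> < 1" using assms by auto
  show "low (x + a * \<tau>) (y + b * \<tau>) \<in> Sp" by (rule low_Sp[OF y])
  show "\<forall>\<^sub>F s in nhds 0. \<tau> + s \<in> I \<longrightarrow> low (x + a * (\<tau> + s)) (y + b * (\<tau> + s)) = ex (low (x + a * \<tau>) (y + b * \<tau>)) (s *\<^sub>R pt a b)"
    using ev_scaleR[OF ex_low[OF y, of "x + a * \<tau>"], of "pt a b"] by eventually_elim (simp add: algebra_simps)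
qed

lemma up_straight:
  assumes "\<And>\<tau>. \<tau> \<in> I \<Longrightarrow> 1 < y + b * \<tau> \<and> y + b * \<tau> < w"
  shows "straight I (\<lambda>\<tau>. up (x + a * \<tau>) (y + b * \<tau>)) (pt a b)" unfolding straight_def
proof (intro ballI conjI)
  fix \<tau> assume "\<tau> \<in> I"
  then have y: "1 < y + b * \<tau>" "y + b * \<tau> < w" using assms by auto
  show "up (x + a * \<tau>) (y + b * \<tau>) \<in> Sp" by (rule up_Sp[OF y])
  show "\<forall>\<^sub>F s in nhds 0. \<tau> + s \<in> I \<longrightarrow> up (x + a * (\<tau> + s)) (y + b * (\<tau> + s)) = ex (up (x + a * \<tau>) (y + b * \<tau>)) (s *\<^sub>R pt a b)"
    using ev_scaleR[OF ex_up[OF y, of "x + a * \<tau>"], of "pt a b"] by eventually_elim (simp add: algebra_simps)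
qed

lemma low_eq:
  assumes "0 < y" "y < 1" "0 < y'" "y' < 1"
  shows "low x y = low x' y' \<longleftrightarrow> y = y' \<and> (\<exists>k. x = x' + w * of_int k)"
proof -
  obtain x0 k0 where x0: "0 \<le> x0" "x0 < w" "x = x0 + w * of_int k0" using low_ex_rep by blast
  obtain x1 k1 where x1: "0 \<le> x1" "x1 < w" "x' = x1 + w * of_int k1" using low_ex_rep by blast
  have kap: "kap (pt x y) = pt x y" if "0 \<le> x" "x < w" "0 < y" "y < 1" for x y
    using that w1 by (subst kap_noncorner) (auto simp: corner_def)
  have "low x y = low x' y' \<longleftrightarrow> cls (pt x0 y) = cls (pt x1 y')"
    using low_rep[OF assms(1,2) x0(1) _ x0(3)] low_rep[OF assms(3,4) x1(1) _ x1(3)] x0 x1 by simp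
  also have "\<dots> \<longleftrightarrow> pt x0 y = pt x1 y'"
    using kap[OF x0(1,2) assms(1,2)] kap[OF x1(1,2) assms(3,4)] x0 x1 assms by (simp add: cls_eq mem_P)
  also have "\<dots> \<longleftrightarrow> y = y' \<and> (\<exists>k. x = x' + w * of_int k)"
  proof -
    have "x0 = x1" if "x = x' + w * of_int k" for k
      using wrap_eq[OF x0(1,2,3)] wrap_eq[OF x1(1,2), of x "k1 + k"] that x1(3) by (simp add: algebra_simps)
    moreover have "\<exists>k. x = x' + w * of_int k" if "x0 = x1"
      using x0 x1 that by (intro exI[of _ "k0 - k1"]) (simp add: algebra_simps)
    ultimately show ?thesis by auto
  qed
  finally show ?thesis .
qed

lemma up_eq:
  assumes "1 < y" "y < w" "1 < y'" "y' < w" "up x y = up x' y'"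
  shows "y = y'" "\<exists>k. x = x' + of_int k"
proof -
  obtain x0 k0 where x0: "w - 1 \<le> x0" "x0 < w" "x = x0 + of_int k0" using up_ex_rep by blast
  obtain x1 k1 where x1: "w - 1 \<le> x1" "x1 < w" "x' = x1 + of_int k1" using up_ex_rep by blast
  have kap: "kap (pt x y) = pt x y" if "w - 1 \<le> x" "x < w" "1 < y" "y < w" for x y
    using that w1 by (subst kap_noncorner) (auto simp: corner_def)
  have "cls (pt x0 y) = cls (pt x1 y')"
    using up_rep[OF assms(1,2) x0(1) _ x0(3)] up_rep[OF assms(3,4) x1(1) _ x1(3)] x0 x1 assms(5) by simp
  then have "pt x0 y = pt x1 y'"
    using kap[OF x0(1,2) assms(1,2)] kap[OF x1(1,2) assms(3,4)] x0 x1 assms w1 by (simp add: cls_eq mem_P)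
  then show "y = y'" "\<exists>k. x = x' + of_int k" using x0 x1 by (auto intro!: exI[of _ "k0 - k1"])
qed

lemma low_not_up:
  assumes "0 < y" "y < 1" "1 < y'" "y' < w" shows "low x y \<noteq> up x' y'"
proof -
  obtain x0 k0 where x0: "0 \<le> x0" "x0 < w" "x = x0 + w * of_int k0" using low_ex_rep by blast
  obtain x1 k1 where x1: "w - 1 \<le> x1" "x1 < w" "x' = x1 + of_int k1" using up_ex_rep by blast
  have "kap (pt x0 y) = pt x0 y" using x0 assms w1 by (subst kap_noncorner) (auto simp: corner_def)
  moreover have "kap (pt x1 y') = pt x1 y'" using x1 assms w1 by (subst kap_noncorner) (auto simp: corner_def)
  ultimately have "cls (pt x0 y) \<noteq> cls (pt x1 y')" using x0 x1 assms w1 by (simp add: cls_eq mem_P)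
  then show ?thesis using low_rep[OF assms(1,2) x0(1) _ x0(3)] up_rep[OF assms(3,4) x1(1) _ x1(3)] x0 x1 by simp
qed

text \<open>The core curve of the upper cylinder closes up after length 1 in direction
  \<open>(1, 0)\<close>. Its image closes up as well, so the holonomy \<open>A *v pt 1 0\<close> of
  the image lies in \<open>Lam\<close>.\<close>

lemma veech_column:
  assumes "A \<in> L_veech_group w w" shows "A $ 1 $ 1 \<in> ZW" "A $ 2 $ 1 \<in> ZW"
proof -
  obtain \<phi> where \<phi>: "loc_aff A \<phi>" using assms veech_iff by blast
  define p where "p = (\<lambda>\<tau>::real. up (0 + 1 * \<tau>) ((1 + w) / 2 + 0 * \<tau>))"
  have "straight UNIV p (pt 1 0)" unfolding p_def by (rule up_straight) (use w1 in simp)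
  from straight_aff[OF \<phi> this] have st: "straight UNIV (\<lambda>\<tau>. \<phi> (p \<tau>)) (A *v pt 1 0)" .
  obtain x0 k where x0: "w - 1 \<le> x0" "x0 < w" "0 = x0 + of_int k" using up_ex_rep by blast
  have "p 0 = cls (pt x0 ((1 + w) / 2))" using up_rep[of "(1+w)/2" x0 0 k] x0 w1 by (simp add: p_def)
  moreover have "p 1 = cls (pt x0 ((1 + w) / 2))" using up_rep[of "(1+w)/2" x0 1 "k + 1"] x0 w1 by (simp add: p_def)
  ultimately have "p 1 = p 0" by simp
  obtain r where r: "r \<in> \<phi> (p 0)" using Sp_ne[OF straightD(1)[OF st, of 0]] by auto
  have "r - r - (1 - 0) *\<^sub>R (A *v pt 1 0) \<in> Lam"
    by (rule straight_dev[OF st _ _ _ r]) (use r \<open>p 1 = p 0\<close> in auto)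
  then have "A *v pt 1 0 \<in> Lam" using Lam_minus by fastforce
  then show "A $ 1 $ 1 \<in> ZW" "A $ 2 $ 1 \<in> ZW" by (simp_all add: Lam_def matrix_vector_mult_def sum_2)
qed

end

section \<open>The reflection exchanging the horizontal and the vertical direction\<close>

definition Rm :: "real^2^2" where "Rm = vector [vector [0, -1], vector [-1, 0]]"

definition swapm :: "real^2^2 \<Rightarrow> real^2^2" where "swapm A = Rm ** A ** Rm"

lemma Rm_mult: "Rm *v h = pt (- h $ 2) (- h $ 1)" by (simp add: Rm_def pt_eq_iff matrix_vector_mult_def sum_2)

lemma swapm_nth [simp]: "swapm A $ 1 $ 1 = A $ 2 $ 2" "swapm A $ 1 $ 2 = A $ 2 $ 1"
  "swapm A $ 2 $ 1 = A $ 1 $ 2" "swapm A $ 2 $ 2 = A $ 1 $ 1"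
  by (simp_all add: swapm_def Rm_def matrix_matrix_mult_def sum_2)

lemma det_swapm [simp]: "det (swapm A) = det A" by (simp add: det_2)

context lsurf begin

text \<open>Reflection in the line \<open>x + y = w\<close>, a symmetry because both long sides have
  length \<open>w\<close>. It reverses orientation; conjugation by it preserves the Veech group and
  transfers statements about the first column to the second.\<close>

definition rho :: "real^2 \<Rightarrow> real^2" where "rho p = pt (w - p $ 2) (w - p $ 1)"

lemma rho_nth [simp]: "rho p $ 1 = w - p $ 2" "rho p $ 2 = w - p $ 1" by (simp_all add: rho_def)

lemma rho_rho [simp]: "rho (rho p) = p" by (simp add: pt_eq_iff)

lemma rho_P: "p \<in> P \<Longrightarrow> rho p \<in> P" using w1 unfolding mem_P rho_nth by linarith

lemma rho_G: "(p, q) \<in> G \<Longrightarrow> (rho p, rho q) \<in> G \<or> (rho q, rho p) \<in> G"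
  unfolding mem_G rho_nth by (elim disjE conjE) simp_all

lemma rho_corner: "corner (rho p) \<longleftrightarrow> corner p"
proof -
  have "w - b \<in> {0, w - 1, w} \<longleftrightarrow> b \<in> {0, 1, w}" "w - a \<in> {0, 1, w} \<longleftrightarrow> a \<in> {0, w - 1, w}" for a b :: real
    unfolding insert_iff empty_iff by linarith+
  then show ?thesis unfolding corner_def rho_nth by blast
qed

lemma kap_rho_path: "(p, q) \<in> (G \<union> G\<inverse>)\<^sup>* \<Longrightarrow> kap (rho p) = kap (rho q)"
proof (induction rule: rtrancl_induct)
  case (step y z)
  then have "(y, z) \<in> G \<or> (z, y) \<in> G" by auto
  then have "kap (rho y) = kap (rho z)" using rho_G kap_G by metis
  then show ?case using step by simp
qed simp

lemma kap_rho: "p \<in> P \<Longrightarrow> q \<in> P \<Longrightarrow> kap p = kap q \<Longrightarrow> kap (rho p) = kap (rho q)"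
  using kap_rho_path kap_cases_G by metis

definition sw :: "(real^2) set \<Rightarrow> (real^2) set" where "sw q = rho ` q"

lemma sw_cls: assumes "p \<in> P" shows "sw (cls p) = cls (rho p)"
proof -
  have *: "rho q \<in> cls (rho p)" if p: "p \<in> P" and q: "q \<in> cls p" for p q
  proof -
    have "q \<in> P" "kap q = kap p" using q mem_cls[OF p] by auto
    then show ?thesis using mem_cls[OF rho_P[OF p]] rho_P kap_rho[OF _ p] by simp
  qed
  have 1: "rho ` cls p \<subseteq> cls (rho p)" using *[OF assms] by blast
  have "rho ` cls (rho p) \<subseteq> cls p" using *[OF rho_P[OF assms]] by auto
  then have "rho ` rho ` cls (rho p) \<subseteq> rho ` cls p" by (rule image_mono)
  then have "cls (rho p) \<subseteq> rho ` cls p" by (simp add: image_image)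
  with 1 show ?thesis by (simp add: sw_def)
qed

lemma sw_sw: "sw (sw q) = q" by (simp add: sw_def image_image)

lemma sw_Sp: "q \<in> Sp \<Longrightarrow> sw q \<in> Sp"
  by (elim Sp_cases) (simp add: sw_cls cls_Sp rho_P rho_corner)

lemma loc_aff_sw: "loc_aff Rm sw" unfolding loc_aff_def
proof (intro conjI ballI)
  show "bij_betw sw Sp Sp" by (rule bij_betw_byWitness[where f' = sw]) (use sw_Sp sw_sw in auto)
  fix q assume q: "q \<in> Sp"
  obtain e where e: "nice q e" using Sp_nice[OF q] by blast
  obtain e' where e': "nice (sw q) e'" using Sp_nice[OF sw_Sp[OF q]] by blast
  show "\<forall>\<^sub>F h in nhds 0. sw (ex q h) = ex (sw q) (Rm *v h)"
    using ev_norm_less[OF nice_pos[OF e]] ev_matrix[OF ev_norm_less[OF nice_pos[OF e']], of Rm]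
  proof eventually_elim
    case (elim h)
    obtain r where r: "r \<in> q" "r + h \<in> P" "ex q h = cls (r + h)" using ex_rep[OF e elim(1)] by blast
    have eq: "rho (r + h) = rho r + Rm *v h" by (simp add: pt_eq_iff Rm_mult)
    have "ex (sw q) (Rm *v h) = cls (rho r + Rm *v h)"
      using ex_eq[OF e' elim(2), of "rho r"] r rho_P[OF r(2)] eq by (simp add: sw_def)
    then show ?case using r(3) sw_cls[OF r(2)] eq by simp
  qed
qed

lemma veech_swap: assumes "A \<in> L_veech_group w w" shows "swapm A \<in> L_veech_group w w"
proof -
  obtain \<phi> where "det A = 1" "loc_aff A \<phi>" using assms veech_iff by blast
  then have "loc_aff (Rm ** (A ** Rm)) (sw \<circ> (\<phi> \<circ> sw))"
    using loc_aff_comp[OF loc_aff_comp[OF loc_aff_sw] loc_aff_sw] by blast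
  moreover have "Rm ** (A ** Rm) = swapm A" by (simp add: swapm_def matrix_mul_assoc)
  ultimately show ?thesis using \<open>det A = 1\<close> veech_iff[of "swapm A"] by auto
qed

lemma veech_entries:
  assumes "A \<in> L_veech_group w w" shows "A $ i $ j \<in> ZW"
proof -
  have "\<forall>i j. A $ i $ j \<in> ZW"
    using veech_column[OF assms] veech_column[OF veech_swap[OF assms]] by (simp add: forall_2)
  then show ?thesis by blast
qed

text \<open>A base point \<open>x \<in> {0<..w}\<close> lies on the bottom of the lower horizontal cylinder; the bottom of
  the upper one is coded by \<open>{w<..w + 1}\<close>. In the same way \<open>Y\<close> codes the tops of the cylinders, and
  \<open>ppi\<close> translates a top into the base point it is glued to.\<close>
definition base :: "real \<Rightarrow> (real^2) set" where
  "base y = (if y \<le> w then cls (pt y 0) else cls (pt (y - 1) 1))"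
definition abv :: "real \<Rightarrow> real \<Rightarrow> (real^2) set" where
  "abv x h = (if x \<le> w then low x h else up (x - 1) (1 + h))"
definition bel :: "real \<Rightarrow> real \<Rightarrow> (real^2) set" where
  "bel Y h = (if Y \<le> w then low Y (1 + h) else up (Y - 1) (w + h))"
definition ppi :: "real \<Rightarrow> real" where
  "ppi Y = (if Y \<le> w - 1 then Y else if Y \<le> w then Y + 1 else Y - 1)"
definition roof :: "real \<Rightarrow> real" where "roof x = (if x \<le> w then 1 else w - 1)"

lemma roof_pos: "roof x > 0" using w1 by (simp add: roof_def)

lemma base_Sp:
  assumes "0 < y" "y < w + 1" "y \<noteq> w - 1" "y \<noteq> w" shows "base y \<in> Sp"
proof (cases "y \<le> w")
  case True
  then have "tH1 (pt y 0) \<or> tH2 (pt y 0)" using assms unfolding t_defs pt_nth by auto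
  then show ?thesis using True tH1_P tH2_P t_not_corner by (auto simp: base_def cls_Sp)
next
  case False
  then have "tI (pt (y - 1) 1)" using assms w1 unfolding t_defs pt_nth by auto
  then show ?thesis using False tI_P t_not_corner by (auto simp: base_def cls_Sp)
qed

text \<open>The three cases are the three open horizontal segments cut out by the cone point: going
  up from \<open>y\<close> enters the cylinder based there, going down enters the cylinder whose top
  \<open>Y\<close> is glued to \<open>y\<close>.\<close>

lemma cross:
  assumes Y: "0 < Y" "Y < w + 1" "Y \<noteq> w - 1" "Y \<noteq> w" and y: "y = ppi Y"
  shows "\<forall>\<^sub>F h in nhds 0. ex (base y) h =
    (if h $ 2 > 0 then abv (y + h $ 1) (h $ 2) else if h $ 2 < 0 then bel (Y + h $ 1) (h $ 2) else base (y + h $ 1))"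
proof -
  consider "Y < w - 1" | "w - 1 < Y" "Y < w" | "w < Y" using Y by linarith
  then show ?thesis
  proof cases
    case 1
    then have yY: "y = Y" by (simp add: y ppi_def)
    have t: "tH1 (pt y 0)" using 1 Y yY by (simp add: tH1_def)
    have b: "base y = cls (pt y 0)" using 1 yY by (simp add: base_def)
    obtain e where e: "nice (cls (pt y 0)) e" using nice_tH1[OF t] by blast
    define c where "c = min (min y (w - 1 - y)) 1"
    have c: "c > 0" "c \<le> y" "c \<le> w - 1 - y" "c \<le> 1" using 1 Y yY by (auto simp: c_def)
    show ?thesis using ev_norm_less[OF nice_pos[OF e]] ev_lt[OF c(1)]
    proof eventually_elim
      case (elim h)
      have hb: "- c < h $ 1" "h $ 1 < c" "- c < h $ 2" "h $ 2 < c" using elim(2) by auto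
      then have r: "y + h $ 1 \<le> w" "0 \<le> y + h $ 1" "Y + h $ 1 \<le> w" using c yY 1 by linarith+
      have m: "pt y 0 \<in> cls (pt y 0)" "pt y 1 \<in> cls (pt y 0)" using cls_tH1[OF t] by auto
      show ?case
      proof (cases "h $ 2 \<ge> 0")
        case True
        have "pt y 0 + h \<in> P" using True hb r c by (auto simp: mem_P)
        from ex_eq[OF e elim(1) m(1) this]
        have *: "ex (base y) h = cls (pt (y + h $ 1) (h $ 2))" unfolding b by (simp add: pt_plus)
        show ?thesis
        proof (cases "h $ 2 = 0")
          case True then show ?thesis using * hb r c by (simp add: base_def)
        next
          case False
          then have "h $ 2 > 0" using \<open>h $ 2 \<ge> 0\<close> by simp
          moreover have "low (y + h $ 1) (h $ 2) = cls (pt (y + h $ 1) (h $ 2))"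
            by (rule low_rep[where k = 0]) (use hb r c \<open>h $ 2 > 0\<close> in auto)
          ultimately show ?thesis using * hb r c by (simp add: abv_def)
        qed
      next
        case False
        have "pt y 1 + h \<in> P" using False hb r c by (auto simp: mem_P)
        from ex_eq[OF e elim(1) m(2) this]
        have *: "ex (base y) h = cls (pt (y + h $ 1) (1 + h $ 2))" unfolding b by (simp add: pt_plus)
        moreover have "low (y + h $ 1) (1 + h $ 2) = cls (pt (y + h $ 1) (1 + h $ 2))"
          by (rule low_rep[where k = 0]) (use hb r c False in auto)
        ultimately show ?thesis using False hb r c yY by (simp add: bel_def)
      qed
    qed
  next
    case 2
    then have yY: "y = Y + 1" by (simp add: y ppi_def)
    have t: "tI (pt Y 1)" using 2 Y w1 by (simp add: tI_def)
    have b: "base y = cls (pt Y 1)" using 2 yY by (simp add: base_def)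
    obtain e where e: "nice (cls (pt Y 1)) e" using nice_tI[OF t] by blast
    define c where "c = min (min (w - Y) (Y - (w - 1))) (min 1 (w - 1))"
    have c: "c > 0" "c \<le> w - Y" "c \<le> Y - (w - 1)" "c \<le> 1" "c \<le> w - 1" using 2 w1 by (auto simp: c_def)
    show ?thesis using ev_norm_less[OF nice_pos[OF e]] ev_lt[OF c(1)]
    proof eventually_elim
      case (elim h)
      have hb: "- c < h $ 1" "h $ 1 < c" "- c < h $ 2" "h $ 2 < c" using elim(2) by auto
      then have r: "\<not> y + h $ 1 \<le> w" "Y + h $ 1 \<le> w" "w - 1 \<le> Y + h $ 1" "0 \<le> Y + h $ 1" using c yY 2 w1 by linarith+
      have m: "pt Y 1 \<in> cls (pt Y 1)" using cls_tI[OF t] by auto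
      have "pt Y 1 + h \<in> P" using hb r c by (auto simp: mem_P)
      from ex_eq[OF e elim(1) m(1) this]
      have *: "ex (base y) h = cls (pt (Y + h $ 1) (1 + h $ 2))" unfolding b by (simp add: pt_plus)
      consider "h $ 2 > 0" | "h $ 2 < 0" | "h $ 2 = 0" by linarith
      then show ?case
      proof cases
        case 1
        moreover have "up (Y + h $ 1) (1 + h $ 2) = cls (pt (Y + h $ 1) (1 + h $ 2))"
          by (rule up_rep[where k = 0]) (use hb r c 1 in auto)
        ultimately show ?thesis using * hb r c yY by (simp add: abv_def)
      next
        case 2
        moreover have "low (Y + h $ 1) (1 + h $ 2) = cls (pt (Y + h $ 1) (1 + h $ 2))"
          by (rule low_rep[where k = 0]) (use hb r c 2 w1 in auto)
        ultimately show ?thesis using * hb r c yY by (simp add: bel_def)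
      next
        case 3
        then show ?thesis using * hb r c yY by (simp add: base_def)
      qed
    qed
  next
    case 3
    then have yY: "y = Y - 1" by (simp add: y ppi_def)
    have t: "tH2 (pt y 0)" using 3 Y yY by (simp add: tH2_def)
    have b: "base y = cls (pt y 0)" using 3 Y yY by (simp add: base_def)
    obtain e where e: "nice (cls (pt y 0)) e" using nice_tH2[OF t] by blast
    define c where "c = min (min (w - y) (y - (w - 1))) (min 1 (w - 1))"
    have c: "c > 0" "c \<le> w - y" "c \<le> y - (w - 1)" "c \<le> 1" "c \<le> w - 1" using 3 Y yY w1 by (auto simp: c_def)
    show ?thesis using ev_norm_less[OF nice_pos[OF e]] ev_lt[OF c(1)]
    proof eventually_elim
      case (elim h)
      have hb: "- c < h $ 1" "h $ 1 < c" "- c < h $ 2" "h $ 2 < c" using elim(2) by auto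
      then have r: "y + h $ 1 \<le> w" "0 \<le> y + h $ 1" "w - 1 \<le> y + h $ 1" "\<not> Y + h $ 1 \<le> w" using c yY 3 w1 by linarith+
      have m: "pt y 0 \<in> cls (pt y 0)" "pt y w \<in> cls (pt y 0)" using cls_tH2[OF t] by auto
      show ?case
      proof (cases "h $ 2 \<ge> 0")
        case True
        have "pt y 0 + h \<in> P" using True hb r c by (auto simp: mem_P)
        from ex_eq[OF e elim(1) m(1) this]
        have *: "ex (base y) h = cls (pt (y + h $ 1) (h $ 2))" unfolding b by (simp add: pt_plus)
        show ?thesis
        proof (cases "h $ 2 = 0")
          case True then show ?thesis using * hb r c by (simp add: base_def)
        next
          case False
          then have "h $ 2 > 0" using \<open>h $ 2 \<ge> 0\<close> by simp
          moreover have "low (y + h $ 1) (h $ 2) = cls (pt (y + h $ 1) (h $ 2))"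
            by (rule low_rep[where k = 0]) (use hb r c \<open>h $ 2 > 0\<close> w1 in auto)
          ultimately show ?thesis using * hb r c by (simp add: abv_def)
        qed
      next
        case False
        have "pt y w + h \<in> P" using False hb r c by (auto simp: mem_P)
        from ex_eq[OF e elim(1) m(2) this]
        have *: "ex (base y) h = cls (pt (y + h $ 1) (w + h $ 2))" unfolding b by (simp add: pt_plus)
        moreover have "up (y + h $ 1) (w + h $ 2) = cls (pt (y + h $ 1) (w + h $ 2))"
          by (rule up_rep[where k = 0]) (use hb r c False in auto)
        moreover have "Y + h $ 1 - 1 = y + h $ 1" using yY by simp
        ultimately show ?thesis using False r(4) by (simp only: bel_def if_False not_less) simp
      qed
    qed
  qed
qed

definition level :: "(real^2) set \<Rightarrow> bool" where
  "level q \<longleftrightarrow> (\<exists>Y. 0 < Y \<and> Y < w + 1 \<and> Y \<noteq> w - 1 \<and> Y \<noteq> w \<and> q = base (ppi Y))"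

lemma ppi_range: "0 < Y \<Longrightarrow> Y < w + 1 \<Longrightarrow> Y \<noteq> w - 1 \<Longrightarrow> Y \<noteq> w \<Longrightarrow>
    0 < ppi Y \<and> ppi Y < w + 1 \<and> ppi Y \<noteq> w - 1 \<and> ppi Y \<noteq> w"
  using w1 unfolding ppi_def by (cases "Y \<le> w - 1"; cases "Y \<le> w") simp_all

lemma ppi_surj:
  assumes "0 < y" "y < w + 1" "y \<noteq> w - 1" "y \<noteq> w"
  shows "\<exists>Y. 0 < Y \<and> Y < w + 1 \<and> Y \<noteq> w - 1 \<and> Y \<noteq> w \<and> y = ppi Y"
proof -
  consider "y < w - 1" | "w - 1 < y" "y < w" | "w < y" using assms by linarith
  then show ?thesis
  proof cases
    case 1 then show ?thesis using assms w1 by (intro exI[of _ y]) (simp add: ppi_def)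
  next
    case 2 then show ?thesis using assms w1 by (intro exI[of _ "y + 1"]) (simp add: ppi_def)
  next
    case 3 then show ?thesis using assms w1 by (intro exI[of _ "y - 1"]) (simp add: ppi_def)
  qed
qed

lemma level_base: "0 < y \<Longrightarrow> y < w + 1 \<Longrightarrow> y \<noteq> w - 1 \<Longrightarrow> y \<noteq> w \<Longrightarrow> level (base y)"
  using ppi_surj unfolding level_def by metis

lemma Sp_class:
  assumes "q \<in> Sp"
  obtains (low) x y where "0 < y" "y < 1" "q = low x y"
    | (up) x y where "1 < y" "y < w" "q = up x y" | (level) "level q"
proof -
  obtain p where p: "p \<in> P" "\<not> corner p" "q = cls p" using Sp_cases[OF assms] by blast
  define x y where "x = p $ 1" and "y = p $ 2"
  have pq: "p = pt x y" by (simp add: x_def y_def)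
  have b: "0 \<le> x" "x \<le> w" "0 \<le> y" "y \<le> w" "y > 1 \<longrightarrow> w - 1 \<le> x"
    using p(1) w1 unfolding mem_P x_def y_def by auto
  have c: "\<not> (x \<in> {0, w - 1, w} \<and> y \<in> {0, 1, w})" using p(2) by (simp add: corner_def x_def y_def)
  consider "0 < y" "y < 1" | "1 < y" "y < w" | "y = 0" | "y = 1" | "y = w" using b by linarith
  then show ?thesis
  proof cases
    case 1
    then show ?thesis using low(1)[OF 1, of x] low_rep[OF 1 b(1,2), of x 0] p(3) pq by simp
  next
    case 2
    then show ?thesis using up(1)[OF 2, of x] up_rep[OF 2 _ b(2), of x 0] b p(3) pq by simp
  next
    case 3
    have "q = base x" using 3 b p(3) pq by (simp add: base_def)
    then show ?thesis using level level_base[of x] 3 c b by force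
  next
    case 4
    show ?thesis
    proof (cases "x < w - 1")
      case True
      then have t: "tH1 p" using 4 c b pq by (auto simp: tH1_def)
      then have "q = base x" using p(3) cls_tH1[OF t] cls_tH1[of "pt x 0"] True pq t b by (simp add: base_def tH1_def)
      then show ?thesis using level level_base[of x] True c 4 b w1 by force
    next
      case False
      then have "q = base (x + 1)" "w < x + 1" "x < w" using 4 b p(3) pq c by (auto simp: base_def)
      then show ?thesis using level level_base[of "x + 1"] w1 by force
    qed
  next
    case 5
    then have "y > 1" using w1 by simp
    then have t: "tH2 p" using 5 c b pq by (auto simp: tH2_def)
    then have "q = base x" using p(3) cls_tH2[OF t] cls_tH2[of "pt x 0"] pq t b by (simp add: base_def tH2_def)
    then show ?thesis using level level_base[of x] c 5 b \<open>y > 1\<close> by force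
  qed
qed

lemma level_not_low: assumes "level q" "0 < y" "y < 1" shows "q \<noteq> low x y"
proof
  assume q: "q = low x y"
  obtain Y where Y: "0 < Y" "Y < w + 1" "Y \<noteq> w - 1" "Y \<noteq> w" "q = base (ppi Y)" using assms(1) level_def by blast
  obtain x0 k where x0: "0 \<le> x0" "x0 < w" "x = x0 + w * of_int k" using low_ex_rep by blast
  have l: "low x y = cls (pt x0 y)" using low_rep[OF assms(2,3) x0(1) _ x0(3)] x0 by simp
  have "kap (pt x0 y) = pt x0 y" using x0 assms w1 by (subst kap_noncorner) (auto simp: corner_def)
  moreover have "pt x0 y \<in> P" using x0 assms w1 by (simp add: mem_P)
  moreover have "base (ppi Y) = cls (pt (ppi Y) 0) \<and> ppi Y \<le> w \<or> base (ppi Y) = cls (pt (ppi Y - 1) 1) \<and> w < ppi Y"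
    by (auto simp: base_def)
  moreover have "kap (pt (ppi Y) 0) $ 2 = 0" if "ppi Y \<le> w"
    using ppi_range[OF Y(1-4)] that w1 by (subst kap_noncorner) (auto simp: corner_def)
  moreover have "pt (ppi Y) 0 \<in> P" if "ppi Y \<le> w" using ppi_range[OF Y(1-4)] that w1 by (simp add: mem_P)
  moreover have "kap (pt (ppi Y - 1) 1) $ 2 = 1" if "ppi Y > w"
    using ppi_range[OF Y(1-4)] that w1 by (subst kap_noncorner) (auto simp: corner_def)
  moreover have "pt (ppi Y - 1) 1 \<in> P" if "ppi Y > w" using ppi_range[OF Y(1-4)] that w1 by (simp add: mem_P)
  ultimately show False using q l Y(5) assms cls_eq pt_nth(2) by (metis less_irrefl)
qed

lemma level_not_up: assumes "level q" "1 < y" "y < w" shows "q \<noteq> up x y"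
proof
  assume q: "q = up x y"
  obtain Y where Y: "0 < Y" "Y < w + 1" "Y \<noteq> w - 1" "Y \<noteq> w" "q = base (ppi Y)" using assms(1) level_def by blast
  obtain x0 k where x0: "w - 1 \<le> x0" "x0 < w" "x = x0 + of_int k" using up_ex_rep by blast
  have l: "up x y = cls (pt x0 y)" using up_rep[OF assms(2,3) x0(1) _ x0(3)] x0 by simp
  have "kap (pt x0 y) = pt x0 y" using x0 assms w1 by (subst kap_noncorner) (auto simp: corner_def)
  moreover have "pt x0 y \<in> P" using x0 assms w1 by (simp add: mem_P)
  moreover have "base (ppi Y) = cls (pt (ppi Y) 0) \<and> ppi Y \<le> w \<or> base (ppi Y) = cls (pt (ppi Y - 1) 1) \<and> w < ppi Y"
    by (auto simp: base_def)
  moreover have "kap (pt (ppi Y) 0) $ 2 = 0" if "ppi Y \<le> w"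
    using ppi_range[OF Y(1-4)] that w1 by (subst kap_noncorner) (auto simp: corner_def)
  moreover have "pt (ppi Y) 0 \<in> P" if "ppi Y \<le> w" using ppi_range[OF Y(1-4)] that w1 by (simp add: mem_P)
  moreover have "kap (pt (ppi Y - 1) 1) $ 2 = 1" if "ppi Y > w"
    using ppi_range[OF Y(1-4)] that w1 by (subst kap_noncorner) (auto simp: corner_def)
  moreover have "pt (ppi Y - 1) 1 \<in> P" if "ppi Y > w" using ppi_range[OF Y(1-4)] that w1 by (simp add: mem_P)
  ultimately show False using q l Y(5) assms cls_eq pt_nth(2) zero_less_one by (metis less_irrefl less_trans)
qed

lemma straight_shift: "straight UNIV p u \<Longrightarrow> straight UNIV (\<lambda>s. p (t + s)) u"
  unfolding straight_def by (simp add: add.assoc[symmetric])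

text \<open>A rising path agrees with an explicit line until the time \<open>t\<close> at which that
  line reaches the top. At time \<open>t\<close> it can be in neither open cylinder, since slightly
  earlier its position would contradict the explicit one.\<close>

lemma straight_reaches_level:
  assumes p: "straight UNIV p (pt a c)" and c: "c > 0"
  shows "\<exists>\<tau>. level (p \<tau>)" using straightD(1)[OF p UNIV_I, of 0]
proof (cases rule: Sp_class)
  case level then show ?thesis by blast
next
  case (low x y)
  note 1 = low
  define t where "t = (1 - y) / c"
  have t: "t > 0" "y + c * t = 1" using c 1 by (auto simp: t_def)
  have e: "p \<tau> = low (x + a * \<tau>) (y + c * \<tau>)" if "0 \<le> \<tau>" "\<tau> < t" for \<tau>
  proof (rule straight_unique[where p = p and p' = "\<lambda>\<tau>. low (x + a * \<tau>) (y + c * \<tau>)" and I = "{0..<t}" and ?t0.0 = 0])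
    show "straight {0..<t} p (pt a c)" using p straight_subset by blast
    have "0 < y + c * \<tau> \<and> y + c * \<tau> < 1" if "\<tau> \<in> {0..<t}" for \<tau>
    proof -
      have "c * \<tau> < c * t" "0 \<le> c * \<tau>" using that c by auto
      then show ?thesis using 1 t(2) by linarith
    qed
    then show "straight {0..<t} (\<lambda>\<tau>. low (x + a * \<tau>) (y + c * \<tau>)) (pt a c)" by (rule low_straight)
    show "p 0 = low (x + a * 0) (y + c * 0)" using 1 by simp
  qed (use t that in auto)
  have n1: "p t \<noteq> low x' y'" if y': "0 < y'" "y' < 1" for x' y'
  proof
    assume q: "p t = low x' y'"
    have "\<forall>\<^sub>F s in nhds 0. p (t + s) = low (x' + s * a) (y' + s * c)"
      using straightD(2)[OF p UNIV_I, of t] ev_scaleR[OF ex_low[OF y', of x'], of "pt a c"]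
      by eventually_elim (use q in simp)
    then obtain d where d: "d > 0" "\<And>s. \<bar>s\<bar> < d \<Longrightarrow> p (t + s) = low (x' + s * a) (y' + s * c)"
      unfolding ev_nhds0_real by blast
    \<comment> \<open>Negative, so that \<open>t + s\<close> falls into the range where the path is
      known, and small enough to stay inside the cylinder containing the supposed position.\<close>
    define s where "s = - (min (min (d/2) t) (y' / (2 * c)))"
    have s: "s < 0" "\<bar>s\<bar> < d" "0 \<le> t + s" using d(1) t(1) y' c by (auto simp: s_def)
    have "- s \<le> y' / (2 * c)" by (simp add: s_def)
    then have "- s * c \<le> y' / 2" using c by (simp add: field_simps)
    moreover have "s * c < 0" using s(1) c by (simp add: mult_neg_pos)
    ultimately have ys: "0 < y' + s * c" "y' + s * c < 1" using y' by auto
    have "0 \<le> c * (t + s)" "c * (t + s) < c * t" using s c by auto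
    then have yt: "0 < y + c * (t + s)" "y + c * (t + s) < 1" using 1 t(2) by auto
    have "low (x' + s * a) (y' + s * c) = low (x + a * (t + s)) (y + c * (t + s))"
      using e[of "t + s"] d(2)[OF s(2)] s(1,3) by simp
    then have "y' + s * c = y + c * (t + s)" using low_eq[OF ys yt] by blast
    then show False using t(2) y' by (simp add: algebra_simps)
  qed
  have n2: "p t \<noteq> up x' y'" if y': "1 < y'" "y' < w" for x' y'
  proof
    assume q: "p t = up x' y'"
    have "\<forall>\<^sub>F s in nhds 0. p (t + s) = up (x' + s * a) (y' + s * c)"
      using straightD(2)[OF p UNIV_I, of t] ev_scaleR[OF ex_up[OF y', of x'], of "pt a c"]
      by eventually_elim (use q in simp)
    then obtain d where d: "d > 0" "\<And>s. \<bar>s\<bar> < d \<Longrightarrow> p (t + s) = up (x' + s * a) (y' + s * c)"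
      unfolding ev_nhds0_real by blast
    define s where "s = - (min (min (d/2) t) ((y' - 1) / (2 * c)))"
    have s: "s < 0" "\<bar>s\<bar> < d" "0 \<le> t + s" using d(1) t(1) y' c by (auto simp: s_def)
    have "- s \<le> (y' - 1) / (2 * c)" by (simp add: s_def)
    then have "- s * c \<le> (y' - 1) / 2" using c by (simp add: field_simps)
    moreover have "s * c < 0" using s(1) c by (simp add: mult_neg_pos)
    ultimately have ys: "1 < y' + s * c" "y' + s * c < w" using y' by auto
    have "0 \<le> c * (t + s)" "c * (t + s) < c * t" using s c by auto
    then have yt: "0 < y + c * (t + s)" "y + c * (t + s) < 1" using 1 t(2) by auto
    have "up (x' + s * a) (y' + s * c) = low (x + a * (t + s)) (y + c * (t + s))"
      using e[of "t + s"] d(2)[OF s(2)] s(1,3) by simp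
    then show False using low_not_up[OF yt ys] by metis
  qed
  show ?thesis using Sp_class[OF straightD(1)[OF p UNIV_I, of t]] n1 n2 by metis
next
  case (up x y)
  note 2 = up
  define t where "t = (w - y) / c"
  have t: "t > 0" "y + c * t = w" using c 2 by (auto simp: t_def)
  have e: "p \<tau> = up (x + a * \<tau>) (y + c * \<tau>)" if "0 \<le> \<tau>" "\<tau> < t" for \<tau>
  proof (rule straight_unique[where p = p and p' = "\<lambda>\<tau>. up (x + a * \<tau>) (y + c * \<tau>)" and I = "{0..<t}" and ?t0.0 = 0])
    show "straight {0..<t} p (pt a c)" using p straight_subset by blast
    have "1 < y + c * \<tau> \<and> y + c * \<tau> < w" if "\<tau> \<in> {0..<t}" for \<tau>
    proof -
      have "c * \<tau> < c * t" "0 \<le> c * \<tau>" using that c by auto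
      then show ?thesis using 2 t(2) by linarith
    qed
    then show "straight {0..<t} (\<lambda>\<tau>. up (x + a * \<tau>) (y + c * \<tau>)) (pt a c)" by (rule up_straight)
    show "p 0 = up (x + a * 0) (y + c * 0)" using 2 by simp
  qed (use t that in auto)
  have n1: "p t \<noteq> low x' y'" if y': "0 < y'" "y' < 1" for x' y'
  proof
    assume q: "p t = low x' y'"
    have "\<forall>\<^sub>F s in nhds 0. p (t + s) = low (x' + s * a) (y' + s * c)"
      using straightD(2)[OF p UNIV_I, of t] ev_scaleR[OF ex_low[OF y', of x'], of "pt a c"]
      by eventually_elim (use q in simp)
    then obtain d where d: "d > 0" "\<And>s. \<bar>s\<bar> < d \<Longrightarrow> p (t + s) = low (x' + s * a) (y' + s * c)"
      unfolding ev_nhds0_real by blast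
    define s where "s = - (min (min (d/2) t) (y' / (2 * c)))"
    have s: "s < 0" "\<bar>s\<bar> < d" "0 \<le> t + s" using d(1) t(1) y' c by (auto simp: s_def)
    have "- s \<le> y' / (2 * c)" by (simp add: s_def)
    then have "- s * c \<le> y' / 2" using c by (simp add: field_simps)
    moreover have "s * c < 0" using s(1) c by (simp add: mult_neg_pos)
    ultimately have ys: "0 < y' + s * c" "y' + s * c < 1" using y' by auto
    have "0 \<le> c * (t + s)" "c * (t + s) < c * t" using s c by auto
    then have yt: "1 < y + c * (t + s)" "y + c * (t + s) < w" using 2 t(2) by auto
    have "low (x' + s * a) (y' + s * c) = up (x + a * (t + s)) (y + c * (t + s))"
      using e[of "t + s"] d(2)[OF s(2)] s(1,3) by simp
    then show False using low_not_up[OF ys yt] by metis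
  qed
  have n2: "p t \<noteq> up x' y'" if y': "1 < y'" "y' < w" for x' y'
  proof
    assume q: "p t = up x' y'"
    have "\<forall>\<^sub>F s in nhds 0. p (t + s) = up (x' + s * a) (y' + s * c)"
      using straightD(2)[OF p UNIV_I, of t] ev_scaleR[OF ex_up[OF y', of x'], of "pt a c"]
      by eventually_elim (use q in simp)
    then obtain d where d: "d > 0" "\<And>s. \<bar>s\<bar> < d \<Longrightarrow> p (t + s) = up (x' + s * a) (y' + s * c)"
      unfolding ev_nhds0_real by blast
    define s where "s = - (min (min (d/2) t) ((y' - 1) / (2 * c)))"
    have s: "s < 0" "\<bar>s\<bar> < d" "0 \<le> t + s" using d(1) t(1) y' c by (auto simp: s_def)
    have "- s \<le> (y' - 1) / (2 * c)" by (simp add: s_def)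
    then have "- s * c \<le> (y' - 1) / 2" using c by (simp add: field_simps)
    moreover have "s * c < 0" using s(1) c by (simp add: mult_neg_pos)
    ultimately have ys: "1 < y' + s * c" "y' + s * c < w" using y' by auto
    have "0 \<le> c * (t + s)" "c * (t + s) < c * t" using s c by auto
    then have yt: "1 < y + c * (t + s)" "y + c * (t + s) < w" using 2 t(2) by auto
    have "up (x' + s * a) (y' + s * c) = up (x + a * (t + s)) (y + c * (t + s))"
      using e[of "t + s"] d(2)[OF s(2)] s(1,3) by simp
    then have "y' + s * c = y + c * (t + s)" using up_eq[OF ys yt] by blast
    then show False using t(2) y' by (simp add: algebra_simps)
  qed
  show ?thesis using Sp_class[OF straightD(1)[OF p UNIV_I, of t]] n1 n2 by metis
qed

lemma level_start:
  assumes p: "straight UNIV p (pt a c)" and c: "c > 0" and l: "level (p t)"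
  shows "\<exists>y. (\<forall>s. 0 < s \<and> s * c < 1 \<longrightarrow> p (t + s) = low (y + a * s) (c * s)) \<or>
     (\<forall>s. 0 < s \<and> s * c < w - 1 \<longrightarrow> p (t + s) = up (y + a * s) (1 + c * s))"
proof -
  obtain Y where Y: "0 < Y" "Y < w + 1" "Y \<noteq> w - 1" "Y \<noteq> w" "p t = base (ppi Y)"
    using l level_def by blast
  define y where "y = ppi Y"
  have yr: "0 < y" "y < w + 1" "y \<noteq> w" using ppi_range[OF Y(1-4)] by (auto simp: y_def)
  have "\<forall>\<^sub>F s in nhds 0. s > 0 \<longrightarrow> p (t + s) = abv (y + s * a) (s * c)"
    using straightD(2)[OF p UNIV_I, of t] ev_scaleR[OF cross[OF Y(1-4) y_def], of "pt a c"]
    by eventually_elim (use Y(5) c in \<open>auto simp: y_def\<close>)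
  \<comment> \<open>The code of the base point decides which cylinder is entered, so it must not
    cross \<open>w\<close>; since \<open>y \<noteq> w\<close> this holds for small times.\<close>
  moreover have "\<forall>\<^sub>F s in nhds 0. y + s * a \<le> w \<longleftrightarrow> y \<le> w"
  proof -
    have "\<forall>\<^sub>F s in nhds 0. \<bar>s * a\<bar> < \<bar>w - y\<bar>" unfolding ev_nhds0_real
    proof (intro exI conjI allI impI)
      show "\<bar>w - y\<bar> / (1 + \<bar>a\<bar>) > 0" using yr by (simp add: add_pos_nonneg)
      fix s :: real assume "\<bar>s\<bar> < \<bar>w - y\<bar> / (1 + \<bar>a\<bar>)"
      then have "\<bar>s\<bar> * (1 + \<bar>a\<bar>) < \<bar>w - y\<bar>" by (simp add: field_simps)
      moreover have "\<bar>s * a\<bar> \<le> \<bar>s\<bar> * (1 + \<bar>a\<bar>)" by (simp add: abs_mult algebra_simps)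
      ultimately show "\<bar>s * a\<bar> < \<bar>w - y\<bar>" by linarith
    qed
    then show ?thesis by eventually_elim (use yr in \<open>auto simp: abs_if split: if_splits\<close>)
  qed
  ultimately have "\<forall>\<^sub>F s in nhds 0. s > 0 \<longrightarrow> p (t + s) = (if y \<le> w then low (y + s * a) (s * c) else up (y - 1 + s * a) (1 + s * c))"
    by eventually_elim (auto simp: abv_def algebra_simps)
  then obtain d where d: "d > 0" "\<And>s. s > 0 \<Longrightarrow> s < d \<Longrightarrow> p (t + s) = (if y \<le> w then low (y + s * a) (s * c) else up (y - 1 + s * a) (1 + s * c))"
    unfolding ev_nhds0_real by force
  show ?thesis
  proof (cases "y \<le> w")
    case True
    have "p (t + s) = low (y + a * s) (0 + c * s)" if "0 < s \<and> s * c < 1" for s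
    proof (rule straight_unique[where p = "\<lambda>s. p (t + s)" and p' = "\<lambda>s. low (y + a * s) (0 + c * s)" and I = "{0<..<1/c}" and u = "pt a c"])
      show "straight {0<..<1/c} (\<lambda>s. p (t + s)) (pt a c)" using straight_shift[OF p] straight_subset by blast
      show "straight {0<..<1/c} (\<lambda>s. low (y + a * s) (0 + c * s)) (pt a c)"
        by (rule low_straight) (use c in \<open>auto simp: field_simps\<close>)
      define s0 where "s0 = min (d / 2) (1 / (2 * c))"
      have "0 < s0" "s0 \<le> 1 / (2 * c)" "s0 < d" using d c by (auto simp: s0_def)
      moreover have "1 / (2 * c) < 1 / c" using c by (simp add: field_simps)
      ultimately show "s0 \<in> {0<..<1/c}" by auto
      show "p (t + s0) = low (y + a * s0) (0 + c * s0)"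
        using d(2)[OF \<open>0 < s0\<close> \<open>s0 < d\<close>] True by (simp add: mult.commute)
      show "s \<in> {0<..<1/c}" using that c by (simp add: field_simps)
    qed auto
    then show ?thesis by auto
  next
    case False
    have "p (t + s) = up (y - 1 + a * s) (1 + c * s)" if "0 < s \<and> s * c < w - 1" for s
    proof (rule straight_unique[where p = "\<lambda>s. p (t + s)" and p' = "\<lambda>s. up (y - 1 + a * s) (1 + c * s)" and I = "{0<..<(w-1)/c}"])
      show "straight {0<..<(w-1)/c} (\<lambda>s. p (t + s)) (pt a c)" using straight_shift[OF p] straight_subset by blast
      show "straight {0<..<(w-1)/c} (\<lambda>s. up (y - 1 + a * s) (1 + c * s)) (pt a c)"
        by (rule up_straight) (use c in \<open>auto simp: field_simps\<close>)
      define s0 where "s0 = min (d / 2) ((w-1) / (2 * c))"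
      have "0 < s0" "s0 \<le> (w-1) / (2 * c)" "s0 < d" using d c w1 by (auto simp: s0_def)
      moreover have "(w-1) / (2 * c) < (w-1) / c" using c w1 by (simp add: field_simps)
      ultimately show "s0 \<in> {0<..<(w-1)/c}" by auto
      show "p (t + s0) = up (y - 1 + a * s0) (1 + c * s0)"
        using d(2)[OF \<open>0 < s0\<close> \<open>s0 < d\<close>] False by (simp add: mult.commute)
      show "s \<in> {0<..<(w-1)/c}" using that c by (simp add: field_simps)
    qed auto
    then show ?thesis by blast
  qed
qed

text \<open>A closed path has to cross a whole horizontal cylinder.\<close>
lemma no_short_closed:
  assumes p: "straight UNIV p (pt a c)" and c: "c > 0" and per: "\<And>t. p (t + 1) = p t"
  shows "c \<ge> min 1 (w - 1)"
proof (rule ccontr)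
  assume "\<not> c \<ge> min 1 (w - 1)"
  then have c': "c < 1" "c < w - 1" by auto
  obtain t where t: "level (p t)" using straight_reaches_level[OF p c] by blast
  from level_start[OF p c t] obtain y where "p (t + 1) = low (y + a) c \<or> p (t + 1) = up (y + a) (1 + c)"
    using c' by (metis mult_1 mult.right_neutral zero_less_one)
  then show False using per level_not_low[OF t c c'(1)] level_not_up[OF t, of "1 + c"] c c' by auto
qed

text \<open>The image of the core curve of the upper cylinder is closed and rises by the lower left
  entry per period; \<open>s\<close> orients it upwards, so that \<open>no_short_closed\<close>
  applies. This bound is the source of discreteness.\<close>

lemma veech_c_bound:
  assumes A: "A \<in> L_veech_group w w" and c: "A $ 2 $ 1 \<noteq> 0"
  shows "\<bar>A $ 2 $ 1\<bar> \<ge> min 1 (w - 1)"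
proof -
  obtain \<phi> where \<phi>: "loc_aff A \<phi>" using A veech_iff by blast
  define s where "s = sgn (A $ 2 $ 1)"
  have s: "s = 1 \<or> s = -1" "s * A $ 2 $ 1 = \<bar>A $ 2 $ 1\<bar>" using c by (auto simp: s_def sgn_if)
  define p where "p = (\<lambda>\<tau>::real. up (0 + s * \<tau>) ((1 + w) / 2 + 0 * \<tau>))"
  have "straight UNIV p (pt s 0)" unfolding p_def by (rule up_straight) (use w1 in simp)
  from straight_aff[OF \<phi> this]
  have st: "straight UNIV (\<lambda>\<tau>. \<phi> (p \<tau>)) (pt (s * A $ 1 $ 1) (\<bar>A $ 2 $ 1\<bar>))"
  proof -
    have "A *v pt s 0 = pt (s * A $ 1 $ 1) (\<bar>A $ 2 $ 1\<bar>)"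
      using s(2) by (simp add: pt_eq_iff matrix_vector_mult_def sum_2 mult.commute)
    then show ?thesis using \<open>straight UNIV (\<lambda>\<tau>. \<phi> (p \<tau>)) (A *v pt s 0)\<close> by simp
  qed
  have "p (t + 1) = p t" for t
  proof -
    obtain x0 k where x0: "w - 1 \<le> x0" "x0 < w" "s * t = x0 + of_int k" using up_ex_rep by blast
    have "p t = cls (pt x0 ((1 + w) / 2))" using up_rep[of "(1+w)/2" x0 "s * t" k] x0 w1 by (simp add: p_def)
    moreover have "\<exists>j::int. s * (t + 1) = x0 + of_int j"
      using s(1) x0(3) by (auto simp: algebra_simps intro: exI[of _ "k + 1"] exI[of _ "k - 1"])
    then have "p (t + 1) = cls (pt x0 ((1 + w) / 2))" using up_rep[of "(1+w)/2" x0] x0 w1 by (auto simp: p_def)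
    ultimately show ?thesis by simp
  qed
  then show ?thesis using no_short_closed[OF st] c by simp
qed

end

section \<open>The flow of a given slope and its multitwists\<close>

text \<open>Reduction modulo \<open>L\<close> into \<open>{0<..L}\<close>, matching the right-closed
  intervals used for the return map.\<close>

definition wrapL :: "real \<Rightarrow> real \<Rightarrow> real" where
  "wrapL L y = y - L * (of_int \<lceil>y / L\<rceil> - 1)"

lemma wrapL_range: assumes "L > 0" shows "0 < wrapL L y" "wrapL L y \<le> L"
proof -
  show "0 < wrapL L y" "wrapL L y \<le> L"
    using ceiling_divide_upper[OF assms, of y] ceiling_divide_lower[OF assms, of y]
    by (simp_all add: wrapL_def algebra_simps)
qed

lemma wrapL_ex: "\<exists>k::int. wrapL L y = y + L * of_int k"
  by (intro exI[of _ "1 - \<lceil>y / L\<rceil>"]) (simp add: wrapL_def algebra_simps)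

lemma wrapL_eq:
  assumes "L > 0" "0 < y0" "y0 \<le> L" "y = y0 + L * of_int k" shows "wrapL L y = y0"
proof -
  have "y / L = y0 / L + of_int k" using assms by (simp add: field_simps)
  moreover have "\<lceil>y0 / L\<rceil> = 1" using assms by (intro ceiling_unique) (auto simp: field_simps)
  ultimately have "\<lceil>y / L\<rceil> = 1 + k" by (simp add: ceiling_add_of_int)
  then show ?thesis using assms(4) by (simp add: wrapL_def algebra_simps)
qed

context lsurf begin

text \<open>Intervals are closed on the right, so that \<open>iet\<close> is the left-continuous version of the first
  return map of the flow of slope \<open>1 / sg\<close>; the three separatrices start at \<open>w - 1\<close>, \<open>w\<close>
  and \<open>w + 1\<close>.\<close>

definition Dom :: "real set" where "Dom = {0<..w + 1}"

definition rot :: "real \<Rightarrow> real \<Rightarrow> real" where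
  "rot sg x = (if x \<le> w then wrapL w (x + sg) else w + wrapL 1 (x - w + sg * (w - 1)))"

definition iet :: "real \<Rightarrow> real \<Rightarrow> real" where "iet sg x = ppi (rot sg x)"

abbreviation itr :: "real \<Rightarrow> nat \<Rightarrow> real \<Rightarrow> real" where "itr sg n \<equiv> iet sg ^^ n"

lemma rot_low:
  assumes "0 < x" "x \<le> w"
  shows "0 < rot sg x" "rot sg x \<le> w" "\<exists>k::int. rot sg x = x + sg + w * of_int k"
proof -
  have w0: "w > 0" using w1 by simp
  have r: "rot sg x = wrapL w (x + sg)" using assms by (simp add: rot_def)
  show "0 < rot sg x" "rot sg x \<le> w" unfolding r using wrapL_range[OF w0] by blast+
  show "\<exists>k::int. rot sg x = x + sg + w * of_int k" unfolding r by (rule wrapL_ex)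
qed

lemma rot_up:
  assumes "w < x"
  shows "w < rot sg x" "rot sg x \<le> w + 1" "\<exists>k::int. rot sg x = x + sg * (w - 1) + of_int k"
proof -
  have r: "rot sg x = w + wrapL 1 (x - w + sg * (w - 1))" using assms by (simp add: rot_def)
  show "w < rot sg x" "rot sg x \<le> w + 1" unfolding r using wrapL_range[of 1 "x - w + sg * (w - 1)"] by simp_all
  obtain k :: int where "wrapL 1 (x - w + sg * (w - 1)) = x - w + sg * (w - 1) + 1 * of_int k" using wrapL_ex by blast
  then have "rot sg x = x + sg * (w - 1) + of_int k" unfolding r by simp
  then show "\<exists>k::int. rot sg x = x + sg * (w - 1) + of_int k" ..
qed

lemma rot_low_eq:
  assumes "x \<le> w" "0 < y" "y \<le> w" "y = x + sg + w * of_int k"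
  shows "rot sg x = y"
proof -
  have "x + sg = y + w * of_int (- k)" using assms(4) by simp
  then have "wrapL w (x + sg) = y" using assms(2,3) w1 by (intro wrapL_eq[of w y "x + sg" "- k"]) simp_all
  then show ?thesis using assms(1) by (simp only: rot_def if_True)
qed

lemma rot_up_eq:
  assumes "w < x" "w < y" "y \<le> w + 1" "y = x + sg * (w - 1) + of_int k"
  shows "rot sg x = y"
proof -
  have "x - w + sg * (w - 1) = y - w + 1 * of_int (- k)" using assms(4) by simp
  then have "wrapL 1 (x - w + sg * (w - 1)) = y - w" by (rule wrapL_eq[rotated -1]) (use assms(2,3) in simp_all)
  then show ?thesis using assms(1) by (simp add: rot_def)
qed

lemma rot_Dom:
  assumes x: "x \<in> Dom"
  shows "rot sg x \<in> Dom" "rot sg x \<le> w \<longleftrightarrow> x \<le> w"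
proof -
  have "rot sg x \<in> Dom \<and> (rot sg x \<le> w \<longleftrightarrow> x \<le> w)"
  proof (cases "x \<le> w")
    case True
    then show ?thesis using x rot_low(1,2)[of x sg] w1 by (simp add: Dom_def)
  next
    case False
    then show ?thesis using x rot_up(1,2)[of x sg] w1 by (simp add: Dom_def)
  qed
  then show "rot sg x \<in> Dom" "rot sg x \<le> w \<longleftrightarrow> x \<le> w" by blast+
qed

lemma ppi_Dom: "x \<in> Dom \<Longrightarrow> ppi x \<in> Dom"
  using w1 unfolding Dom_def ppi_def greaterThanAtMost_iff by (cases "x \<le> w - 1"; cases "x \<le> w") simp_all

lemma ppi_inj: "x \<in> Dom \<Longrightarrow> y \<in> Dom \<Longrightarrow> ppi x = ppi y \<Longrightarrow> x = y"
  using w1 unfolding Dom_def ppi_def greaterThanAtMost_iff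
  by (cases "x \<le> w - 1"; cases "x \<le> w"; cases "y \<le> w - 1"; cases "y \<le> w") simp_all

lemma rot_inj: assumes "x \<in> Dom" "y \<in> Dom" "rot sg x = rot sg y" shows "x = y"
proof (cases "x \<le> w")
  case True
  then have y: "y \<le> w" using rot_Dom(2) assms by metis
  obtain k k' :: int where k: "rot sg x = x + sg + w * of_int k" "rot sg y = y + sg + w * of_int k'"
    using rot_low(3) True y assms unfolding Dom_def by (metis greaterThanAtMost_iff)
  then have "x = y + w * of_int (k' - k)" using assms(3) by (simp add: algebra_simps)
  then show ?thesis using wrapL_eq[of w x x 0] wrapL_eq[of w y x "k' - k"] True y assms w1 unfolding Dom_def by simp
next
  case False
  then have y: "w < y" using rot_Dom(2) assms by (metis not_le)
  obtain k k' :: int where k: "rot sg x = x + sg * (w - 1) + of_int k" "rot sg y = y + sg * (w - 1) + of_int k'"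
    using rot_up(3) False y by (metis not_le)
  then have "x = y + of_int (k' - k)" using assms(3) by (simp add: algebra_simps)
  then show ?thesis
    using wrapL_eq[of 1 "x - w" "x - w" 0] wrapL_eq[of 1 "y - w" "x - w" "k' - k"] False y assms unfolding Dom_def by simp
qed

lemma iet_Dom: "x \<in> Dom \<Longrightarrow> iet sg x \<in> Dom" unfolding iet_def using rot_Dom(1) ppi_Dom by blast

lemma iet_inj: "inj_on (iet sg) Dom" unfolding iet_def by (intro inj_onI) (metis ppi_inj rot_inj rot_Dom(1))

lemma iet_pow_Dom: "x \<in> Dom \<Longrightarrow> itr sg n x \<in> Dom" by (induction n) (auto simp: iet_Dom)

definition sing :: "real set" where "sing = {w - 1, w, w + 1}"

text \<open>The gaps of a finite invariant set \<open>F\<close> are the cross sections of cylinders of the flow.\<close>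
definition good :: "real \<Rightarrow> real set \<Rightarrow> bool" where
  "good sg F \<longleftrightarrow> finite F \<and> F \<subseteq> Dom \<and> sing \<subseteq> F \<and> iet sg ` F \<subseteq> F"

text \<open>The default \<open>0\<close> is the excluded left end of \<open>Dom\<close>: the first
  gap starts there although \<open>0\<close> is not a point of a good set.\<close>

definition prv :: "real set \<Rightarrow> real \<Rightarrow> real" where "prv F z = Max (insert 0 {y \<in> F. y < z})"
definition gap :: "real set \<Rightarrow> real \<Rightarrow> real" where "gap F z = z - prv F z"

lemma goodD:
  assumes "good sg F"
  shows "finite F" "F \<subseteq> Dom" "w - 1 \<in> F" "w \<in> F" "w + 1 \<in> F" "iet sg ` F = F" "bij_betw (iet sg) F F"
    "\<And>z. z \<in> F \<Longrightarrow> iet sg z \<in> F"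
    "\<And>x. x \<in> Dom \<Longrightarrow> iet sg x \<in> F \<Longrightarrow> x \<in> F"
proof -
  show 1: "finite F" "F \<subseteq> Dom" "w - 1 \<in> F" "w \<in> F" "w + 1 \<in> F" and s: "\<And>z. z \<in> F \<Longrightarrow> iet sg z \<in> F"
    using assms unfolding good_def sing_def by auto
  have i: "inj_on (iet sg) F" using inj_on_subset[OF iet_inj 1(2)] .
  show im: "iet sg ` F = F" using endo_inj_surj[OF 1(1) _ i] s by blast
  then show "bij_betw (iet sg) F F" using i by (simp add: bij_betw_def)
  fix x assume x: "x \<in> Dom" "iet sg x \<in> F"
  then obtain y where "y \<in> F" "iet sg x = iet sg y" using im by blast
  then show "x \<in> F" using inj_onD[OF iet_inj _ x(1), of sg y] 1(2) by auto
qed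

lemma prv_props:
  assumes "finite F" "z > 0"
  shows "0 \<le> prv F z" "prv F z < z" "\<And>y. y \<in> F \<Longrightarrow> prv F z < y \<Longrightarrow> z \<le> y" "prv F z = 0 \<or> prv F z \<in> F"
    "\<And>y. y \<in> F \<Longrightarrow> y < z \<Longrightarrow> y \<le> prv F z"
proof -
  let ?A = "insert 0 {y \<in> F. y < z}"
  have f: "finite ?A" "?A \<noteq> {}" using assms by auto
  note M = Max_in[OF f, folded prv_def]
  show "0 \<le> prv F z" unfolding prv_def by (rule Max_ge[OF f(1)]) simp
  show "prv F z < z" "prv F z = 0 \<or> prv F z \<in> F" using M assms by auto
  show ge: "y \<le> prv F z" if "y \<in> F" "y < z" for y unfolding prv_def by (rule Max_ge[OF f(1)]) (use that in simp)
  show "z \<le> y" if "y \<in> F" "prv F z < y" for y using ge[of y] that by (meson not_le)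
qed

lemma gap_pos: "finite F \<Longrightarrow> z > 0 \<Longrightarrow> gap F z > 0"
  using prv_props(2) by (simp add: gap_def)

text \<open>If a discontinuity of \<open>iet\<close> fell inside a gap, some interior point of the
  gap would be mapped to \<open>w - 1\<close>, \<open>w\<close> or \<open>w + 1\<close>, hence into
  \<open>F\<close>; but \<open>iet\<close> permutes \<open>F\<close> and is injective, so that point
  would itself lie in \<open>F\<close>.\<close>

lemma gap_shift:
  assumes g: "good sg F" and z: "z \<in> F" and e: "0 \<le> e" "e < gap F z"
  shows "iet sg (z - e) = iet sg z - e" "z - e \<in> Dom" "z - e \<le> w \<longleftrightarrow> z \<le> w" "e > 0 \<Longrightarrow> z - e \<notin> F"
proof -
  note D = goodD[OF g]
  have zD: "0 < z" "z \<le> w + 1" using z D(2) by (auto simp: Dom_def)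
  note PR = prv_props[OF D(1) zD(1)]
  have in_gap: "x \<in> Dom \<and> (x \<le> w \<longleftrightarrow> z \<le> w) \<and> (x < z \<longrightarrow> x \<notin> F)" if "prv F z < x" "x \<le> z" for x
  proof (intro conjI)
    show "x \<in> Dom" using that PR(1) zD by (auto simp: Dom_def)
    show "x \<le> w \<longleftrightarrow> z \<le> w" using that PR(5)[OF D(4)] by (cases "w < z") auto
    show "x < z \<longrightarrow> x \<notin> F" using that PR(5) by force
  qed
  have pe: "prv F z < z - e" using e by (simp add: gap_def)
  from in_gap[OF pe] e(1) show "z - e \<in> Dom" "z - e \<le> w \<longleftrightarrow> z \<le> w" "e > 0 \<Longrightarrow> z - e \<notin> F" by auto
  let ?R = "rot sg z"
  have zDom: "z \<in> Dom" using z D(2) by blast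
  \<comment> \<open>Left end of the interval of continuity of \<open>ppi\<close> containing the
    image: \<open>?R - lb\<close> is the room left before a discontinuity.\<close>
  define lb where "lb = (if ?R \<le> w - 1 then 0 else if ?R \<le> w then w - 1 else w)"
  have RD: "0 < ?R" "?R \<le> w + 1" using rot_Dom(1)[OF zDom] by (auto simp: Dom_def)
  have lb: "lb < ?R" using RD w1 by (auto simp: lb_def)
  have shift: "rot sg (z - d) = ?R - d" if "0 \<le> d" "d < gap F z" "(if z \<le> w then 0 else w) < ?R - d" for d
  proof -
    have d: "z - d \<le> w \<longleftrightarrow> z \<le> w" using in_gap[of "z - d"] that by (auto simp: gap_def)
    show ?thesis
    proof (cases "z \<le> w")
      case True
      obtain k :: int where "?R = z + sg + w * of_int k" using rot_low(3)[OF zD(1) True] by blast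
      then show ?thesis using True d that rot_low(2)[OF zD(1) True, of sg] by (intro rot_low_eq[where k = k]) auto
    next
      case False
      obtain k :: int where "?R = z + sg * (w - 1) + of_int k" using rot_up(3)[of z] False by auto
      then show ?thesis using False d that rot_up(2)[of z sg] by (intro rot_up_eq[where k = k]) auto
    qed
  qed
  have lbz: "(if z \<le> w then 0 else w) \<le> lb" "z \<le> w \<Longrightarrow> ?R \<le> w" "\<not> z \<le> w \<Longrightarrow> \<not> ?R \<le> w"
    using rot_Dom(2)[OF zDom, of sg] w1 by (auto simp: lb_def)
  have "gap F z \<le> ?R - lb"
  proof (rule ccontr)
    define d where "d = ?R - lb"
    assume "\<not> gap F z \<le> ?R - lb"
    then have d: "0 < d" "d < gap F z" using lb by (auto simp: d_def)
    have zd: "z - d \<in> Dom" "z - d \<le> w \<longleftrightarrow> z \<le> w" "z - d \<notin> F" using in_gap[of "z - d"] d by (auto simp: gap_def)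
    have "iet sg (z - d) \<in> F"
    proof (cases "z \<le> w")
      case True
      obtain k :: int where k: "?R = z + sg + w * of_int k" using rot_low(3)[OF zD(1) True] by blast
      show ?thesis
      proof (cases "?R \<le> w - 1")
        case T: True
        then have "lb = 0" by (simp add: lb_def)
        then have "rot sg (z - d) = w"
          using True zd k w1 by (intro rot_low_eq[where k = "k + 1"]) (auto simp: d_def algebra_simps)
        then show ?thesis using D(5) by (simp add: iet_def ppi_def)
      next
        case F': False
        then have "lb = w - 1" using lbz True by (simp add: lb_def)
        then have "rot sg (z - d) = w - 1" using shift[of d] d w1 True by (simp add: d_def)
        then show ?thesis using D(3) by (simp add: iet_def ppi_def)
      qed
    next
      case False
      obtain k :: int where k: "?R = z + sg * (w - 1) + of_int k" using rot_up(3)[of z] False by auto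
      have "lb = w" using lbz False by (auto simp: lb_def)
      then have "rot sg (z - d) = w + 1"
          using False zd k w1 by (intro rot_up_eq[where k = "k + 1"]) (auto simp: d_def algebra_simps)
      then show ?thesis using D(4) by (simp add: iet_def ppi_def)
    qed
    then show False using D(9) zd by blast
  qed
  then have el: "lb < ?R - e" using e by simp
  then have r: "rot sg (z - e) = ?R - e" using shift[OF e] lbz(1) by simp
  have "ppi (?R - e) = ppi ?R - e" using el e(1) RD w1 unfolding ppi_def lb_def by (auto split: if_splits)
  then show "iet sg (z - e) = iet sg z - e" by (simp add: iet_def r)
qed

text \<open>Otherwise the left neighbour of \<open>iet sg z\<close> would be the image of an
  interior point of the gap of \<open>z\<close>, which would then belong to
  \<open>F\<close>.\<close>

lemma gap_le_iet:
  assumes g: "good sg F" and z: "z \<in> F"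
  shows "gap F z \<le> gap F (iet sg z)"
proof -
  note D = goodD[OF g]
  define y where "y = iet sg z"
  have y: "y \<in> F" "0 < y" using D(2) D(8)[OF z] by (auto simp: y_def Dom_def)
  note PR = prv_props[OF D(1) y(2)]
  have "prv F y \<le> y - gap F z"
  proof (rule ccontr)
    assume "\<not> prv F y \<le> y - gap F z"
    define e where "e = y - prv F y"
    have e: "0 < e" "e < gap F z" using PR(2) \<open>\<not> prv F y \<le> y - gap F z\<close> by (auto simp: e_def)
    note S = gap_shift[OF g z less_imp_le[OF e(1)] e(2)]
    have i: "iet sg (z - e) = prv F y" using S(1) by (simp add: e_def y_def)
    then have "prv F y > 0" using iet_Dom[OF S(2), of sg] by (simp add: Dom_def)
    then have "prv F y \<in> F" using PR(4) by auto
    then show False using D(9)[OF S(2)] i S(4)[OF e(1)] by simp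
  qed
  then show ?thesis by (simp add: gap_def y_def)
qed

text \<open>Summed over \<open>F\<close>, the inequality of \<open>gap_le_iet\<close> is an equality
  because \<open>iet\<close> permutes \<open>F\<close>; so it is an equality term by term.\<close>

lemma gap_iet:
  assumes g: "good sg F" and z: "z \<in> F"
  shows "gap F (iet sg z) = gap F z"
proof -
  note D = goodD[OF g]
  have "(\<Sum>z\<in>F. gap F (iet sg z)) = (\<Sum>z\<in>F. gap F z)" by (rule sum.reindex_bij_betw[OF D(7)])
  then show ?thesis using sum_mono_inv[of "gap F" F "\<lambda>z. gap F (iet sg z)"] gap_le_iet[OF g] z D(1) by metis
qed

lemma gap_iet_pow: "good sg F \<Longrightarrow> z \<in> F \<Longrightarrow> itr sg n z \<in> F \<and> gap F (itr sg n z) = gap F z"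
  by (induction n) (auto simp: gap_iet goodD(8))

lemma gap_shift_pow:
  assumes "good sg F" "z \<in> F" "0 \<le> e" "e < gap F z"
  shows "itr sg n (z - e) = itr sg n z - e"
    "itr sg n (z - e) \<le> w \<longleftrightarrow> itr sg n z \<le> w"
    "e > 0 \<Longrightarrow> itr sg n (z - e) \<notin> F"
proof -
  have 1: "itr sg n (z - e) = itr sg n z - e" for n
  proof (induction n)
    case (Suc n)
    then show ?case using gap_shift(1)[OF assms(1), of "itr sg n z" e] gap_iet_pow[OF assms(1,2), of n] assms(3,4) by simp
  qed simp
  show "itr sg n (z - e) = itr sg n z - e" by (rule 1)
  show "itr sg n (z - e) \<le> w \<longleftrightarrow> itr sg n z \<le> w" "e > 0 \<Longrightarrow> itr sg n (z - e) \<notin> F"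
    unfolding 1
    using gap_shift(3,4)[OF assms(1), of "itr sg n z" e] gap_iet_pow[OF assms(1,2), of n] assms(3,4) by auto
qed

text \<open>Flow time up to the \<open>n\<close>-th return to a base. With velocity
  \<open>(sg, 1)\<close> time is measured by height, so each passage costs the height of its
  cylinder.\<close>

definition tm :: "real \<Rightarrow> nat \<Rightarrow> real \<Rightarrow> real" where
  "tm sg n x = (\<Sum>i<n. roof (itr sg i x))"

text \<open>At height 0 the point lies on an edge, where \<open>low\<close> and \<open>up\<close>
  have no meaning; \<open>base\<close> takes over there and gives the cone point for the three
  singular base points.\<close>

definition pos :: "real \<Rightarrow> real \<Rightarrow> real \<Rightarrow> (real^2) set" where
  "pos sg x h = (if h = 0 then base x else if x \<le> w then low (x + sg * h) h else up (x - 1 + sg * h) (1 + h))"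

definition flow :: "real \<Rightarrow> real \<Rightarrow> real \<Rightarrow> (real^2) set" where
  "flow sg x t = (let n = (LEAST n. t < tm sg (Suc n) x) in pos sg (itr sg n x) (t - tm sg n x))"

lemma tm_0 [simp]: "tm sg 0 x = 0" and tm_Suc: "tm sg (Suc n) x = tm sg n x + roof (itr sg n x)"
  by (simp_all add: tm_def)

lemma tm_less: "tm sg n x < tm sg (Suc n) x" using roof_pos by (simp add: tm_Suc)

lemma tm_strict: "n < m \<Longrightarrow> tm sg n x < tm sg m x"
  by (rule lift_Suc_mono_less[of "\<lambda>n. tm sg n x", OF tm_less])

lemma tm_mono: "n \<le> m \<Longrightarrow> tm sg n x \<le> tm sg m x" using tm_strict by (metis le_less)

lemma tm_lower: "of_nat n * min 1 (w - 1) \<le> tm sg n x"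
proof (induction n)
  case (Suc n)
  moreover have "min 1 (w - 1) \<le> roof (itr sg n x)" by (simp add: roof_def)
  ultimately show ?case by (simp add: tm_Suc algebra_simps)
qed simp

lemma tm_add: "tm sg (m + n) x = tm sg m x + tm sg n (itr sg m x)"
proof (induction n)
  case (Suc n)
  have "itr sg (m + n) x = itr sg n (itr sg m x)" by (metis add.commute comp_apply funpow_add)
  then show ?case using Suc by (simp add: tm_Suc)
qed simp

lemma tm_piece:
  assumes "t \<ge> 0" shows "\<exists>n. tm sg n x \<le> t \<and> t < tm sg (Suc n) x"
proof -
  have m: "min 1 (w - 1) > 0" using w1 by simp
  obtain N where "t < of_nat N * min 1 (w - 1)" using reals_Archimedean3[OF m] by blast
  then have "t < tm sg N x" using tm_lower[of N sg x] by linarith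
  then have ex: "\<exists>N. t < tm sg N x" by blast
  define N where "N = (LEAST N. t < tm sg N x)"
  have N: "t < tm sg N x" unfolding N_def using ex by (rule LeastI_ex)
  then obtain n where n: "N = Suc n" using assms by (cases N) auto
  have "\<not> t < tm sg n x" using not_less_Least[of n "\<lambda>N. t < tm sg N x"] n unfolding N_def[symmetric] by simp
  then show ?thesis using N n by (intro exI[of _ n]) simp
qed

lemma flow_eq:
  assumes "tm sg n x \<le> t" "t < tm sg (Suc n) x"
  shows "flow sg x t = pos sg (itr sg n x) (t - tm sg n x)"
proof -
  have "(LEAST n. t < tm sg (Suc n) x) = n"
  proof (rule Least_equality)
    show "t < tm sg (Suc n) x" by fact
    fix m assume "t < tm sg (Suc m) x"
    then show "n \<le> m" using assms(1) tm_mono[of "Suc m" n sg x] by (cases "n \<le> m") auto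
  qed
  then show ?thesis by (simp add: flow_def Let_def)
qed

lemma flow_shift:
  assumes "t \<ge> 0" shows "flow sg x (tm sg m x + t) = flow sg (itr sg m x) t"
proof -
  obtain n where n: "tm sg n (itr sg m x) \<le> t" "t < tm sg (Suc n) (itr sg m x)" using tm_piece[OF assms] by blast
  have "itr sg (m + n) x = itr sg n (itr sg m x)" by (metis add.commute comp_apply funpow_add)
  moreover have "flow sg x (tm sg m x + t) = pos sg (itr sg (m + n) x) (tm sg m x + t - tm sg (m + n) x)"
    using n tm_add[of sg m n x] tm_add[of sg m "Suc n" x] by (intro flow_eq) auto
  ultimately show ?thesis using flow_eq[OF n] by (simp add: tm_add)
qed

text \<open>Coordinates adapted to the flow, \<open>k\<close> across it and \<open>s\<close> along
  it; \<open>ev_unshear\<close> goes back.\<close>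

lemma ev_sheared:
  assumes "eventually Q (nhds (0::real^2))"
  shows "\<exists>d>0. \<forall>k s. \<bar>k\<bar> < d \<longrightarrow> \<bar>s\<bar> < d \<longrightarrow> Q (pt (k + sg * s) s)"
proof -
  obtain e where e: "e > 0" "\<And>u. norm u < e \<Longrightarrow> Q u"
    using assms unfolding eventually_nhds_metric by (auto simp: dist_norm)
  define d where "d = e / (2 + \<bar>sg\<bar>)"
  have d: "d > 0" "d * (2 + \<bar>sg\<bar>) = e" using e(1) by (auto simp: d_def add_pos_nonneg)
  have "Q (pt (k + sg * s) s)" if "\<bar>k\<bar> < d" "\<bar>s\<bar> < d" for k s
  proof (rule e(2))
    have "\<bar>sg * s\<bar> \<le> \<bar>sg\<bar> * d" using that(2) by (simp add: abs_mult mult_left_mono)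
    moreover have "norm (pt (k + sg * s) s) \<le> \<bar>k\<bar> + \<bar>sg * s\<bar> + \<bar>s\<bar>"
      using norm_pt_le[of "k + sg * s" s] abs_triangle_ineq[of k "sg * s"] by linarith
    moreover have "d + \<bar>sg\<bar> * d + d = e" using d(2) by (simp add: algebra_simps)
    ultimately show "norm (pt (k + sg * s) s) < e" using that by linarith
  qed
  then show ?thesis using d(1) by blast
qed

lemma pos_Sp: "0 < h \<Longrightarrow> h < roof x \<Longrightarrow> pos sg x h \<in> Sp"
  using low_Sp up_Sp by (auto simp: pos_def roof_def split: if_splits)

lemma pos_base_Sp: "x \<in> Dom \<Longrightarrow> x \<notin> sing \<Longrightarrow> pos sg x 0 \<in> Sp"
  using base_Sp[of x] by (auto simp: pos_def Dom_def sing_def)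

lemma low_per: "0 < y \<Longrightarrow> y < 1 \<Longrightarrow> x = x' + w * of_int k \<Longrightarrow> low x y = low x' y"
  using low_eq[of y y x x'] by auto

lemma up_per:
  assumes y: "1 < y" "y < w" and x: "x = x' + of_int k" shows "up x y = up x' y"
proof -
  obtain x0 j where x0: "w - 1 \<le> x0" "x0 < w" "x' = x0 + of_int j" using up_ex_rep by blast
  then show ?thesis using up_rep[OF y x0(1) _ x0(3)] up_rep[OF y x0(1), of x "j + k"] x by simp
qed

text \<open>Points just below the top of a cylinder, written in the coordinate of the top.\<close>
lemma bel_pos:
  assumes x: "x \<in> Dom" and h: "- roof x < h" "h < 0" and Y: "Y \<le> w \<longleftrightarrow> rot sg x \<le> w" "Y = rot sg x + k + sg * h"
  shows "bel Y h = (if x \<le> w then low (x + k + sg * (roof x + h)) (roof x + h)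
     else up (x + k - 1 + sg * (roof x + h)) (1 + (roof x + h)))"
proof (cases "x \<le> w")
  case True
  have x0: "0 < x" using x by (simp add: Dom_def)
  obtain j :: int where j: "rot sg x = x + sg + w * of_int j" using rot_low(3)[OF x0 True] by blast
  have "Y \<le> w" using Y rot_low(2)[OF x0 True] by simp
  then have "bel Y h = low Y (1 + h)" by (simp add: bel_def)
  also have "\<dots> = low (x + k + sg * (1 + h)) (1 + h)"
    by (rule low_per[where k = j]) (use h True j Y(2) in \<open>auto simp: roof_def algebra_simps\<close>)
  finally show ?thesis using True by (simp add: roof_def)
next
  case False
  then have x0: "w < x" by simp
  obtain j :: int where j: "rot sg x = x + sg * (w - 1) + of_int j" using rot_up(3)[OF x0] by blast
  have "\<not> Y \<le> w" using Y rot_up(1)[OF x0, of sg] by simp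
  then have "bel Y h = up (Y - 1) (w + h)" by (simp add: bel_def)
  also have "\<dots> = up (x + k - 1 + sg * (w - 1 + h)) (w + h)"
    by (rule up_per[where k = j]) (use h False j Y(2) in \<open>auto simp: roof_def algebra_simps\<close>)
  finally show ?thesis using False by (simp add: roof_def algebra_simps)
qed

lemma ev_keep_side: "y \<noteq> w \<Longrightarrow> \<forall>\<^sub>F u in nhds (0::real^2). y + u $ 1 \<le> w \<longleftrightarrow> y \<le> w"
proof -
  assume "y \<noteq> w"
  then have "\<bar>w - y\<bar> > 0" by simp
  from ev_lt[OF this] show ?thesis
    by eventually_elim (use \<open>y \<noteq> w\<close> in \<open>auto simp: abs_if split: if_splits\<close>)
qed

lemma iet_nonsing:
  assumes "iet sg x \<notin> sing" "x \<in> Dom"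
  shows "0 < rot sg x" "rot sg x < w + 1" "rot sg x \<noteq> w - 1" "rot sg x \<noteq> w"
proof -
  have "rot sg x \<in> Dom" using rot_Dom(1)[OF assms(2)] .
  moreover have "rot sg x \<noteq> w + 1" "rot sg x \<noteq> w - 1" "rot sg x \<noteq> w"
    using assms(1) w1 by (auto simp: iet_def ppi_def sing_def)
  ultimately show "0 < rot sg x" "rot sg x < w + 1" "rot sg x \<noteq> w - 1" "rot sg x \<noteq> w"
    by (auto simp: Dom_def)
qed

text \<open>Offsets in \<open>K\<close> are those whose orbits run parallel to the orbit of
  \<open>x\<close>; their flow lines are then parallel too, with \<open>cross\<close> joining the
  two sides of an edge. An arbitrary \<open>K\<close> admits one-sided neighbourhoods, as needed at
  the right end of a gap.\<close>

lemma flow_box: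
  assumes x: "x \<in> Dom" and t: "t > 0"
    and par: "\<And>k m. k \<in> K \<Longrightarrow> itr sg m (x + k) = itr sg m x + k \<and>
        (itr sg m x + k \<le> w \<longleftrightarrow> itr sg m x \<le> w)"
    and sg: "\<And>n. n > 0 \<Longrightarrow> tm sg n x = t \<Longrightarrow> itr sg n x \<notin> sing"
  shows "flow sg x t \<in> Sp \<and> (\<exists>d>0. \<forall>k\<in>K. \<forall>s. \<bar>k\<bar> < d \<longrightarrow> \<bar>s\<bar> < d \<longrightarrow>
     flow sg (x + k) (t + s) = ex (flow sg x t) (pt (k + sg * s) s))"
proof -
  have rf: "roof (itr sg m (x + k)) = roof (itr sg m x)" if "k \<in> K" for k m
    using par[OF that, of m] by (simp add: roof_def)
  have tmk: "tm sg m (x + k) = tm sg m x" if "k \<in> K" for k m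
    unfolding tm_def by (rule sum.cong) (use rf[OF that] in simp_all)
  obtain n where n: "tm sg n x \<le> t" "t < tm sg (Suc n) x" using tm_piece[of t] t by auto
  define xn where "xn = itr sg n x"
  have xnD: "xn \<in> Dom" unfolding xn_def by (rule iet_pow_Dom[OF x])
  define h where "h = t - tm sg n x"
  have h: "0 \<le> h" "h < roof xn" using n by (auto simp: h_def tm_Suc xn_def)
  have fl: "flow sg x t = pos sg xn h" using flow_eq[OF n] by (simp add: xn_def h_def)
  have flk: "flow sg (x + k) (t + s) = pos sg (xn + k) (h + s)"
    if "k \<in> K" "0 \<le> h + s" "h + s < roof xn" for k s
  proof -
    have "flow sg (x + k) (t + s) = pos sg (itr sg n (x + k)) (t + s - tm sg n (x + k))"
      by (rule flow_eq) (use that tmk[OF that(1)] rf[OF that(1), of n] in \<open>auto simp: h_def tm_Suc xn_def\<close>)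
    then show ?thesis using par[OF that(1), of n] tmk[OF that(1)] by (simp add: h_def xn_def algebra_simps)
  qed
  show ?thesis
  proof (cases "h = 0")
    case False
    then have h0: "0 < h" using h by simp
    have S: "flow sg x t \<in> Sp" unfolding fl by (rule pos_Sp[OF h0 h(2)])
    define C where "C = min h (roof xn - h)"
    have C: "C > 0" using h0 h by (simp add: C_def)
    show ?thesis
    proof (cases "xn \<le> w")
      case True
      have ev: "\<forall>\<^sub>F u in nhds 0. ex (flow sg x t) u = low (xn + sg * h + u $ 1) (h + u $ 2)"
        using ex_low[of h "xn + sg * h"] h0 h True False by (simp add: fl pos_def roof_def)
      obtain d where d: "d > 0" "\<And>k s. \<bar>k\<bar> < d \<Longrightarrow> \<bar>s\<bar> < d \<Longrightarrow>
          ex (flow sg x t) (pt (k + sg * s) s) = low (xn + sg * h + (k + sg * s)) (h + s) \<and> \<bar>k + sg * s\<bar> < C \<and> \<bar>s\<bar> < C"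
        using ev_sheared[OF eventually_conj[OF ev ev_lt[OF C]], of sg] unfolding pt_nth
        by (elim exE conjE) (rule that, assumption, iprover)
      have "flow sg (x + k) (t + s) = ex (flow sg x t) (pt (k + sg * s) s)" if k: "k \<in> K" "\<bar>k\<bar> < d" "\<bar>s\<bar> < d" for k s
      proof -
        have b: "0 < h + s" "h + s < roof xn" using d(2)[OF k(2,3)] by (auto simp: C_def)
        have "xn + k \<le> w" using par[OF k(1), of n] True by (simp add: xn_def)
        then show ?thesis using flk[OF k(1), of s] b d(2)[OF k(2,3)] by (simp add: pos_def algebra_simps)
      qed
      then show ?thesis using S d(1) by blast
    next
      case F: False
      have ev: "\<forall>\<^sub>F u in nhds 0. ex (flow sg x t) u = up (xn - 1 + sg * h + u $ 1) (1 + h + u $ 2)"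
        using ex_up[of "1 + h" "xn - 1 + sg * h"] h0 h F False by (simp add: fl pos_def roof_def)
      obtain d where d: "d > 0" "\<And>k s. \<bar>k\<bar> < d \<Longrightarrow> \<bar>s\<bar> < d \<Longrightarrow>
          ex (flow sg x t) (pt (k + sg * s) s) = up (xn - 1 + sg * h + (k + sg * s)) (1 + h + s) \<and> \<bar>k + sg * s\<bar> < C \<and> \<bar>s\<bar> < C"
        using ev_sheared[OF eventually_conj[OF ev ev_lt[OF C]], of sg] unfolding pt_nth
        by (elim exE conjE) (rule that, assumption, iprover)
      have "flow sg (x + k) (t + s) = ex (flow sg x t) (pt (k + sg * s) s)" if k: "k \<in> K" "\<bar>k\<bar> < d" "\<bar>s\<bar> < d" for k s
      proof -
        have b: "0 < h + s" "h + s < roof xn" using d(2)[OF k(2,3)] by (auto simp: C_def)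
        have "\<not> xn + k \<le> w" using par[OF k(1), of n] F by (simp add: xn_def)
        then show ?thesis using flk[OF k(1), of s] b d(2)[OF k(2,3)] by (simp add: pos_def algebra_simps)
      qed
      then show ?thesis using S d(1) by blast
    qed
  next
    case True
    \<comment> \<open>On an edge \<open>t\<close> is a return time. For negative \<open>s\<close>
      the position has to be read off the preceding passage, based at \<open>xm\<close>.\<close>
    have n0: "n > 0" using True t by (cases n) (auto simp: h_def)
    then obtain m where m: "n = Suc m" by (cases n) auto
    define xm where "xm = itr sg m x"
    have xmD: "xm \<in> Dom" unfolding xm_def by (rule iet_pow_Dom[OF x])
    have xn': "xn = iet sg xm" by (simp add: xn_def xm_def m)
    have ns: "xn \<notin> sing" using sg[OF n0] True by (simp add: h_def xn_def)
    note R = iet_nonsing[OF ns[unfolded xn'] xmD]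
    have S: "flow sg x t \<in> Sp" unfolding fl True by (rule pos_base_Sp[OF xnD ns])
    have fb: "flow sg x t = base xn" using fl True by (simp add: pos_def)
    define C where "C = min (roof xn) (roof xm)"
    have C: "C > 0" using roof_pos by (simp add: C_def)
    have xnw: "xn \<noteq> w" using ns by (simp add: sing_def)
    have ev: "\<forall>\<^sub>F u in nhds 0. ex (base xn) u =
      (if u $ 2 > 0 then abv (xn + u $ 1) (u $ 2) else if u $ 2 < 0 then bel (rot sg xm + u $ 1) (u $ 2) else base (xn + u $ 1))"
      by (rule cross[OF R]) (simp add: xn' iet_def)
    obtain d where d: "d > 0" "\<And>k s. \<bar>k\<bar> < d \<Longrightarrow> \<bar>s\<bar> < d \<Longrightarrow>
      (ex (base xn) (pt (k + sg * s) s) =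
      (if s > 0 then abv (xn + (k + sg * s)) s else if s < 0 then bel (rot sg xm + (k + sg * s)) s else base (xn + (k + sg * s))) \<and>
       \<bar>k + sg * s\<bar> < C \<and> \<bar>s\<bar> < C) \<and> (xn + (k + sg * s) \<le> w \<longleftrightarrow> xn \<le> w) \<and> (rot sg xm + (k + sg * s) \<le> w \<longleftrightarrow> rot sg xm \<le> w)"
      using ev_sheared[OF eventually_conj[OF eventually_conj[OF ev ev_lt[OF C]] eventually_conj[OF ev_keep_side[OF xnw] ev_keep_side[OF R(4)]]], of sg] unfolding pt_nth
        by (elim exE conjE) (rule that, assumption, iprover)
    have "flow sg (x + k) (t + s) = ex (flow sg x t) (pt (k + sg * s) s)" if k: "k \<in> K" "\<bar>k\<bar> < d" "\<bar>s\<bar> < d" for k s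
    proof -
      note E = d(2)[OF k(2,3)]
      have kn: "xn + k \<le> w \<longleftrightarrow> xn \<le> w" "xm + k \<le> w \<longleftrightarrow> xm \<le> w"
        using par[OF k(1), of n] par[OF k(1), of m] by (auto simp: xn_def xm_def)
      consider "s > 0" | "s = 0" | "s < 0" by linarith
      then show ?thesis
      proof cases
        case 1
        then have "flow sg (x + k) (t + s) = pos sg (xn + k) s" using flk[OF k(1), of s] E True by (simp add: C_def)
        also have "\<dots> = abv (xn + (k + sg * s)) s" using 1 kn(1) E by (simp add: pos_def abv_def algebra_simps)
        finally show ?thesis using E 1 fb by simp
      next
        case 2
        then have "flow sg (x + k) (t + s) = pos sg (xn + k) 0" using flk[OF k(1), of s] True h(2) by simp
        then show ?thesis using E 2 fb by (simp add: pos_def)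
      next
        case 3
        have ts: "tm sg n x = tm sg m x + roof xm" by (simp add: m tm_Suc xm_def)
        have tt: "t = tm sg n x" using True by (simp add: h_def)
        have "flow sg (x + k) (t + s) = pos sg (itr sg m (x + k)) (t + s - tm sg m (x + k))"
          by (rule flow_eq) (use 3 E ts tt tmk[OF k(1)] rf[OF k(1), of m] in \<open>auto simp: C_def m tm_Suc xm_def\<close>)
        also have "\<dots> = pos sg (xm + k) (roof xm + s)"
          using par[OF k(1), of m] tmk[OF k(1), of m] ts tt by (simp add: xm_def)
        also have "\<dots> = bel (rot sg xm + (k + sg * s)) s"
          using bel_pos[OF xmD, of s "rot sg xm + (k + sg * s)" sg k] 3 E kn(2) roof_pos[of xm]
          by (auto simp: pos_def C_def algebra_simps)
        finally show ?thesis using E 3 fb by simp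
      qed
    qed
    then show ?thesis using S d(1) by blast
  qed
qed

lemma base_sing: "x \<in> sing \<Longrightarrow> base x = cone"
proof -
  assume "x \<in> sing"
  then consider "x = w - 1" | "x = w" | "x = w + 1" by (auto simp: sing_def)
  moreover have "pt (w - 1) 0 \<in> P" "corner (pt (w - 1) 0)" "pt w 0 \<in> P" "corner (pt w 0)" "pt w 1 \<in> P" "corner (pt w 1)"
    using w1 by (simp_all add: mem_P corner_def)
  ultimately show "base x = cone" using w1 by cases (simp_all add: base_def cls_cone del: set_eq_iff)
qed

lemma base_inj:
  assumes "0 < x" "x < w + 1" "x \<noteq> w - 1" "x \<noteq> w" "0 < y" "y < w + 1" "y \<noteq> w - 1" "y \<noteq> w"
    and e: "base x = base y" shows "x = y"
proof -
  have k: "(if x \<le> w then pt x 0 else pt (x - 1) 1) \<in> P \<and> kap (if x \<le> w then pt x 0 else pt (x - 1) 1) = (if x \<le> w then pt x 0 else pt (x - 1) 1)"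
    if "0 < x" "x < w + 1" "x \<noteq> w - 1" "x \<noteq> w" for x
  proof -
    have "\<not> corner (if x \<le> w then pt x 0 else pt (x - 1) 1)" using that w1 by (simp add: corner_def)
    then show ?thesis using that w1 by (auto simp: kap_noncorner mem_P)
  qed
  have b: "base x = cls (if x \<le> w then pt x 0 else pt (x - 1) 1)" for x by (simp add: base_def)
  have "(if x \<le> w then pt x 0 else pt (x - 1) 1) = (if y \<le> w then pt y 0 else pt (y - 1) 1)"
    (is "?a = ?b")
  proof -
    have "cls ?a = cls ?b" using e unfolding b .
    then have "kap ?a = kap ?b" using cls_eq[OF conjunct1[OF k[OF assms(1-4)]] conjunct1[OF k[OF assms(5-8)]]] by blast
    then show ?thesis unfolding conjunct2[OF k[OF assms(1-4)]] conjunct2[OF k[OF assms(5-8)]] .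
  qed
  then show ?thesis by (simp split: if_splits)
qed

lemma pos_pos: "0 < h \<Longrightarrow> pos sg x h = (if x \<le> w then low (x + sg * h) h else up (x - 1 + sg * h) (1 + h))"
  by (simp add: pos_def)

lemma pos_level:
  assumes "x \<in> Dom" "pos sg x 0 \<in> Sp" shows "0 < x" "x < w + 1" "x \<noteq> w - 1" "x \<noteq> w"
proof -
  have "x \<notin> sing" using assms(2) base_sing cone_notin by (auto simp: pos_def)
  then show "0 < x" "x < w + 1" "x \<noteq> w - 1" "x \<noteq> w" using assms(1) by (auto simp: Dom_def sing_def)
qed

lemma pos_not_level:
  assumes "0 < h" "h < roof x" "level q" shows "q \<noteq> pos sg x h"
  using level_not_low[OF assms(3)] level_not_up[OF assms(3)] assms(1,2)
  by (auto simp: pos_pos roof_def split: if_splits)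

text \<open>The point determines the cylinder, the height and the horizontal coordinate modulo the
  circumference, and \<open>Dom\<close> contains one base point for each residue.\<close>

lemma pos_inj:
  assumes x: "x \<in> Dom" "0 \<le> h" "h < roof x" and x': "x' \<in> Dom" "0 \<le> h'" "h' < roof x'"
    and S: "pos sg x h \<in> Sp" and e: "pos sg x h = pos sg x' h'"
  shows "x = x' \<and> h = h'"
proof -
  have S': "pos sg x' h' \<in> Sp" using S e by simp
  consider "h = 0" "h' = 0" | "h = 0" "0 < h'" | "0 < h" "h' = 0" | "0 < h" "0 < h'" using x x' by linarith
  then show ?thesis
  proof cases
    case 1
    note L = pos_level[OF x(1) S[unfolded 1]] and L' = pos_level[OF x'(1) S'[unfolded 1]]
    have "base x = base x'" using e 1 by (simp add: pos_def)
    then show ?thesis using base_inj[OF L L'] 1 by simp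
  next
    case 2
    have "level (pos sg x h)" using level_base[OF pos_level[OF x(1) S[unfolded 2(1)]]] 2 by (simp add: pos_def)
    then show ?thesis using pos_not_level[OF 2(2) x'(3)] e by blast
  next
    case 3
    have "level (pos sg x' h')" using level_base[OF pos_level[OF x'(1) S'[unfolded 3(2)]]] 3 by (simp add: pos_def)
    then show ?thesis using pos_not_level[OF 3(1) x(3)] e[symmetric] by blast
  next
    case 4
    show ?thesis
    proof (cases "x \<le> w"; cases "x' \<le> w")
      assume c: "x \<le> w" "x' \<le> w"
      have "h = h' \<and> (\<exists>k. x + sg * h = x' + sg * h' + w * of_int k)"
        by (rule low_eq[THEN iffD1]) (use e 4 c x(3) x'(3) in \<open>simp_all add: pos_pos roof_def\<close>)
      then obtain k where k0: "h = h'" "x + sg * h = x' + sg * h' + w * of_int k" by (elim conjE exE)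
      then have k: "h = h'" "x = x' + w * of_int k" by simp_all
      then show ?thesis using c x(1) x'(1) wrapL_eq[of w x x 0] wrapL_eq[of w x' x k] w1 unfolding Dom_def by simp
    next
      assume c: "\<not> x \<le> w" "\<not> x' \<le> w"
      have u: "up (x - 1 + sg * h) (1 + h) = up (x' - 1 + sg * h') (1 + h')" using e 4 c by (simp add: pos_pos)
      have "h = h'" "\<exists>k. x - 1 + sg * h = x' - 1 + sg * h' + of_int k"
        using up_eq[OF _ _ _ _ u] 4 c x(3) x'(3) by (simp_all add: roof_def)
      then obtain k where k0: "h = h'" "x - 1 + sg * h = x' - 1 + sg * h' + of_int k" by (elim exE)
      then have k: "h = h'" "x - w = x' - w + 1 * of_int k" by simp_all
      then show ?thesis using c x(1) x'(1) wrapL_eq[of 1 "x - w" "x - w" 0] wrapL_eq[of 1 "x' - w" "x - w" k] unfolding Dom_def by simp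
    next
      assume c: "x \<le> w" "\<not> x' \<le> w"
      then show ?thesis using e 4 low_not_up[of h "1 + h'"] x(3) x'(3) by (simp add: pos_pos roof_def)
    next
      assume c: "\<not> x \<le> w" "x' \<le> w"
      then show ?thesis using e[symmetric] 4 low_not_up[of h' "1 + h"] x(3) x'(3) by (simp add: pos_pos roof_def)
    qed
  qed
qed

lemma Sp_pos:
  assumes q: "q \<in> Sp"
  shows "\<exists>x h. x \<in> Dom \<and> 0 \<le> h \<and> h < roof x \<and> q = pos sg x h" using q
proof (cases rule: Sp_class)
  case (low x y)
  define X where "X = wrapL w (x - sg * y)"
  have w0: "w > 0" using w1 by simp
  have X: "0 < X" "X \<le> w" unfolding X_def using wrapL_range[OF w0] by blast+
  obtain k :: int where k: "X = x - sg * y + w * of_int k" unfolding X_def using wrapL_ex by blast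
  have "low x y = low (X + sg * y) y" by (rule low_per[OF low(1,2), where k = "- k"]) (simp add: k)
  then have "q = pos sg X y" using low X by (simp add: pos_pos)
  moreover have "X \<in> Dom" using X by (simp add: Dom_def)
  ultimately show ?thesis using X low by (intro exI[of _ X] exI[of _ y]) (simp add: roof_def)
next
  case (up x y)
  define X where "X = w + wrapL 1 (x + 1 - sg * (y - 1) - w)"
  have X: "w < X" "X \<le> w + 1" unfolding X_def using wrapL_range[of 1 "x + 1 - sg * (y - 1) - w"] by simp_all
  obtain k :: int where k: "wrapL 1 (x + 1 - sg * (y - 1) - w) = x + 1 - sg * (y - 1) - w + 1 * of_int k" using wrapL_ex by blast
  have "up x y = up (X - 1 + sg * (y - 1)) y" by (rule up_per[OF up(1,2), where k = "- k"]) (simp add: X_def k)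
  then have "q = pos sg X (y - 1)" using up X by (simp add: pos_pos)
  moreover have "X \<in> Dom" using X w1 by (simp add: Dom_def)
  ultimately show ?thesis using X up by (intro exI[of _ X] exI[of _ "y - 1"]) (simp add: roof_def)
next
  case level
  then obtain Y where Y: "0 < Y" "Y < w + 1" "Y \<noteq> w - 1" "Y \<noteq> w" "q = base (ppi Y)" unfolding level_def by blast
  have "q = pos sg (ppi Y) 0" using Y(5) by (simp add: pos_def)
  moreover have "ppi Y \<in> Dom" using ppi_range[OF Y(1-4)] by (simp add: Dom_def)
  ultimately show ?thesis using roof_pos by (intro exI[of _ "ppi Y"] exI[of _ 0]) simp
qed

lemma flow_pos: "0 \<le> h \<Longrightarrow> h < roof x \<Longrightarrow> flow sg x h = pos sg x h"
  using flow_eq[of sg 0 x h] by (simp add: tm_Suc)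

lemma flow_Sp:
  assumes "x \<in> Dom" "s \<ge> 0" "\<And>n. s = tm sg n x \<Longrightarrow> itr sg n x \<notin> sing"
  shows "flow sg x s \<in> Sp"
proof -
  obtain n where n: "tm sg n x \<le> s" "s < tm sg (Suc n) x" using tm_piece[OF assms(2)] by blast
  have "pos sg (itr sg n x) (s - tm sg n x) \<in> Sp"
  proof (cases "s = tm sg n x")
    case True
    then show ?thesis using pos_base_Sp[OF iet_pow_Dom[OF assms(1)] assms(3)[OF True]] by simp
  next
    case False
    then show ?thesis using n by (intro pos_Sp) (auto simp: tm_Suc)
  qed
  then show ?thesis using flow_eq[OF n] by simp
qed

lemma flow_nonsing:
  assumes "flow sg x (tm sg n x) \<in> Sp" shows "itr sg n x \<notin> sing"
proof
  assume s: "itr sg n x \<in> sing"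
  have "flow sg x (tm sg n x) = pos sg (itr sg n x) 0" using flow_eq[of sg n x "tm sg n x"] tm_less by simp
  then show False using assms base_sing[OF s] cone_notin by (simp add: pos_def)
qed

text \<open>Flow lines that meet have a common base point and height there, so they agree from then
  on. This makes \<open>twist\<close> independent of the flow coordinates chosen for a
  point.\<close>

lemma flow_cong:
  assumes x: "x \<in> Dom" "s \<ge> 0" and y: "y \<in> Dom" "r \<ge> 0" and S: "flow sg x s \<in> Sp" and e: "flow sg x s = flow sg y r"
  shows "\<exists>n m. itr sg n x = itr sg m y \<and> (\<forall>u\<ge>0. flow sg x (s + u) = flow sg y (r + u))"
proof -
  obtain n where n: "tm sg n x \<le> s" "s < tm sg (Suc n) x" using tm_piece[OF x(2)] by blast
  obtain m where m: "tm sg m y \<le> r" "r < tm sg (Suc m) y" using tm_piece[OF y(2)] by blast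
  note fn = flow_eq[OF n] and fm = flow_eq[OF m]
  have E: "itr sg n x = itr sg m y \<and> s - tm sg n x = r - tm sg m y"
    by (rule pos_inj[where sg = sg]) (use fn fm n m e S x y iet_pow_Dom in \<open>auto simp: tm_Suc\<close>)
  have "flow sg x (s + u) = flow sg y (r + u)" if "u \<ge> 0" for u
  proof -
    have "flow sg x (s + u) = flow sg (itr sg n x) (s - tm sg n x + u)"
      using flow_shift[of "s - tm sg n x + u" sg x n] n that by simp
    also have "\<dots> = flow sg y (r + u)" using flow_shift[of "r - tm sg m y + u" sg y m] m that E by simp
    finally show ?thesis .
  qed
  then show ?thesis using E by blast
qed

lemma gap_cover:
  assumes g: "good sg F" and x: "x \<in> Dom"
  shows "\<exists>z e. z \<in> F \<and> 0 \<le> e \<and> e < gap F z \<and> x = z - e"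
proof -
  note D = goodD[OF g]
  define z where "z = Min {y \<in> F. x \<le> y}"
  have fin: "finite {y \<in> F. x \<le> y}" "{y \<in> F. x \<le> y} \<noteq> {}" using D(1,5) x by (auto simp: Dom_def)
  have z: "z \<in> F" "x \<le> z" using Min_in[OF fin] by (auto simp: z_def)
  have x0: "0 < x" using x by (simp add: Dom_def)
  then have z0: "z > 0" using z by simp
  note PR = prv_props[OF D(1) z0]
  have "prv F z < x"
  proof (rule ccontr)
    assume a: "\<not> prv F z < x"
    then have "prv F z \<in> {y \<in> F. x \<le> y}" using PR(4) x0 by auto
    then have "z \<le> prv F z" unfolding z_def by (rule Min_le[OF fin(1)])
    then show False using PR(2) by simp
  qed
  then show ?thesis using z by (intro exI[of _ z] exI[of _ "z - x"]) (simp add: gap_def)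
qed

lemma gap_unique:
  assumes g: "good sg F" and z: "z \<in> F" "0 \<le> e" "e < gap F z" and z': "z' \<in> F" "0 \<le> e'" "e' < gap F z'" and E: "z - e = z' - e'"
  shows "z = z' \<and> e = e'"
proof -
  note D = goodD[OF g]
  have p: "z > 0" "z' > 0" using D(2) z z' by (auto simp: Dom_def)
  have "z \<le> z'" using prv_props(3)[OF D(1) p(1) z'(1)] z z' E by (auto simp: gap_def)
  moreover have "z' \<le> z" using prv_props(3)[OF D(1) p(2) z(1)] z z' E by (auto simp: gap_def)
  ultimately show ?thesis using E by simp
qed

lemma prv_surj:
  assumes g: "good sg F" and y: "y = 0 \<or> y \<in> F" "y < w + 1"
  shows "\<exists>z\<in>F. prv F z = y"
proof -
  note D = goodD[OF g]
  have y0: "0 \<le> y" using y D(2) by (auto simp: Dom_def)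
  have fin: "finite {f \<in> F. y < f}" "{f \<in> F. y < f} \<noteq> {}" using D(1,5) y by auto
  define z where "z = Min {f \<in> F. y < f}"
  have z: "z \<in> F" "y < z" using Min_in[OF fin] by (auto simp: z_def)
  have "f \<le> y" if "f \<in> F" "f < z" for f
  proof (rule ccontr)
    assume "\<not> f \<le> y"
    then have "z \<le> f" unfolding z_def using that by (intro Min_le[OF fin(1)]) auto
    then show False using that by simp
  qed
  then have "prv F z = y" unfolding prv_def using D(1) y(1) z(2) y0 by (intro Max_eqI) auto
  then show ?thesis using z by blast
qed

text \<open>The flow line of the right end \<open>z\<close> of one gap is also the left boundary of
  another, that of \<open>z2\<close>. This describes its right-hand side, which
  \<open>gap_box\<close> cannot reach since \<open>z + k\<close> is outside the gap of
  \<open>z\<close>.\<close>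

lemma right_box:
  assumes g: "good sg F" and z: "z \<in> F" and s: "s \<ge> 0" and S: "flow sg z s \<in> Sp"
  shows "\<exists>z2\<in>F. \<exists>r>0. \<exists>d>0. \<forall>k \<sigma>. 0 < k \<longrightarrow> k < d \<longrightarrow> \<bar>\<sigma>\<bar> < d \<longrightarrow>
     k < gap F z2 \<and> flow sg (prv F z2 + k) (r + \<sigma>) = ex (flow sg z s) (pt (k + sg * \<sigma>) \<sigma>)"
proof -
  note D = goodD[OF g]
  obtain n where n: "tm sg n z \<le> s" "s < tm sg (Suc n) z" using tm_piece[OF s] by blast
  define xn where "xn = itr sg n z"
  have xnF: "xn \<in> F" unfolding xn_def using gap_iet_pow[OF g z] by blast
  then have xnD: "xn \<in> Dom" using D(2) by blast
  define h where "h = s - tm sg n z"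
  have h: "0 \<le> h" "h < roof xn" using n by (auto simp: h_def tm_Suc xn_def)
  have fl: "flow sg z s = pos sg xn h" using flow_eq[OF n] by (simp add: xn_def h_def)
  \<comment> \<open>A right end rewritten as a left end modulo the circumference of its floor:
    \<open>w\<close> is read as \<open>0\<close> and \<open>w + 1\<close> as
    \<open>w\<close>.\<close>
  define Y where "Y b = (if b = w then 0 else if b = w + 1 then w else b)" for b
  have Yb: "0 \<le> Y b \<and> Y b < w + 1 \<and> (Y b = 0 \<or> Y b \<in> F) \<and> (b \<le> w \<longrightarrow> Y b < w) \<and> (b > w \<longrightarrow> Y b \<ge> w)" if "b \<in> F" for b
    using that D(2,4) w1 by (auto simp: Y_def Dom_def)
  show ?thesis
  proof (cases "h = 0")
    case False
    then have h0: "0 < h" using h by simp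
    define C where "C = min h (roof xn - h)"
    have C: "C > 0" using h0 h by (simp add: C_def)
    obtain z2 where z2: "z2 \<in> F" "prv F z2 = Y xn" using prv_surj[OF g] Yb[OF xnF] by blast
    have gp: "gap F z2 > 0" using gap_pos[OF D(1)] D(2) z2 by (auto simp: Dom_def)
    show ?thesis
    proof (cases "xn \<le> w")
      case True
      have ev: "\<forall>\<^sub>F u in nhds 0. ex (flow sg z s) u = low (xn + sg * h + u $ 1) (h + u $ 2)"
        using ex_low[of h "xn + sg * h"] h0 h True False by (simp add: fl pos_def roof_def)
      obtain d where d: "d > 0" "\<And>k s'. \<bar>k\<bar> < d \<Longrightarrow> \<bar>s'\<bar> < d \<Longrightarrow>
          ex (flow sg z s) (pt (k + sg * s') s') = low (xn + sg * h + (k + sg * s')) (h + s') \<and> \<bar>k + sg * s'\<bar> < C \<and> \<bar>s'\<bar> < C"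
        using ev_sheared[OF eventually_conj[OF ev ev_lt[OF C]], of sg] unfolding pt_nth
        by (elim exE conjE) (rule that, assumption, iprover)
      define d' where "d' = min d (min (gap F z2) (w - Y xn))"
      have d': "d' > 0" using d(1) gp Yb[OF xnF] True by (simp add: d'_def)
      have "k < gap F z2 \<and> flow sg (prv F z2 + k) (h + \<sigma>) = ex (flow sg z s) (pt (k + sg * \<sigma>) \<sigma>)"
        if k: "0 < k" "k < d'" "\<bar>\<sigma>\<bar> < d'" for k \<sigma>
      proof -
        have kd: "\<bar>k\<bar> < d" "\<bar>\<sigma>\<bar> < d" "k < gap F z2" "Y xn + k \<le> w" using k by (auto simp: d'_def)
        note E = d(2)[OF kd(1,2)]
        have b: "0 < h + \<sigma>" "h + \<sigma> < roof xn" using E by (auto simp: C_def)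
        then have "flow sg (Y xn + k) (h + \<sigma>) = low (Y xn + k + sg * (h + \<sigma>)) (h + \<sigma>)"
          using kd(4) True by (simp add: flow_pos roof_def pos_pos)
        also have "\<dots> = low (xn + sg * h + (k + sg * \<sigma>)) (h + \<sigma>)"
          by (rule low_per[where k = "if xn = w then -1 else 0"]) (use b True in \<open>auto simp: roof_def Y_def algebra_simps\<close>)
        finally show ?thesis using E kd z2 by simp
      qed
      then show ?thesis using z2(1) h0 d' by blast
    next
      case F: False
      have ev: "\<forall>\<^sub>F u in nhds 0. ex (flow sg z s) u = up (xn - 1 + sg * h + u $ 1) (1 + h + u $ 2)"
        using ex_up[of "1 + h" "xn - 1 + sg * h"] h0 h F False by (simp add: fl pos_def roof_def)
      obtain d where d: "d > 0" "\<And>k s'. \<bar>k\<bar> < d \<Longrightarrow> \<bar>s'\<bar> < d \<Longrightarrow>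
          ex (flow sg z s) (pt (k + sg * s') s') = up (xn - 1 + sg * h + (k + sg * s')) (1 + h + s') \<and> \<bar>k + sg * s'\<bar> < C \<and> \<bar>s'\<bar> < C"
        using ev_sheared[OF eventually_conj[OF ev ev_lt[OF C]], of sg] unfolding pt_nth
        by (elim exE conjE) (rule that, assumption, iprover)
      define d' where "d' = min d (gap F z2)"
      have d': "d' > 0" using d(1) gp by (simp add: d'_def)
      have "k < gap F z2 \<and> flow sg (prv F z2 + k) (h + \<sigma>) = ex (flow sg z s) (pt (k + sg * \<sigma>) \<sigma>)"
        if k: "0 < k" "k < d'" "\<bar>\<sigma>\<bar> < d'" for k \<sigma>
      proof -
        have kd: "\<bar>k\<bar> < d" "\<bar>\<sigma>\<bar> < d" "k < gap F z2" using k by (auto simp: d'_def)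
        have kw: "\<not> Y xn + k \<le> w" using k Yb[OF xnF] F by auto
        note E = d(2)[OF kd(1,2)]
        have b: "0 < h + \<sigma>" "h + \<sigma> < roof xn" using E by (auto simp: C_def)
        then have "flow sg (Y xn + k) (h + \<sigma>) = up (Y xn + k - 1 + sg * (h + \<sigma>)) (1 + (h + \<sigma>))"
          using kw F by (simp add: flow_pos roof_def pos_pos)
        also have "\<dots> = up (xn - 1 + sg * h + (k + sg * \<sigma>)) (1 + (h + \<sigma>))"
          by (rule up_per[where k = "if xn = w + 1 then -1 else 0"]) (use b F in \<open>auto simp: roof_def Y_def algebra_simps\<close>)
        finally show ?thesis using E kd z2 by (simp add: add.assoc)
      qed
      then show ?thesis using z2(1) h0 d' by blast
    qed
  next
    case True
    \<comment> \<open>On an edge the points just below are needed as well, so the flow is started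
      one passage earlier, at \<open>b\<close>.\<close>
    have "xn \<in> iet sg ` F" using xnF D(6) by simp
    then obtain b where b: "b \<in> F" "xn = iet sg b" by blast
    have bD: "b \<in> Dom" using b D(2) by blast
    have fb: "flow sg z s = base xn" using fl True by (simp add: pos_def)
    have ns: "xn \<notin> sing" using S fb base_sing cone_notin by auto
    note R = iet_nonsing[OF ns[unfolded b(2)] bD]
    define y where "y = Y b"
    note Yb = Yb[OF b(1), folded y_def]
    obtain z2 where z2: "z2 \<in> F" "prv F z2 = y" using prv_surj[OF g] Yb by blast
    have gp: "gap F z2 > 0" using gap_pos[OF D(1)] D(2) z2 by (auto simp: Dom_def)
    define C where "C = min (roof xn) (roof b)"
    have C: "C > 0" using roof_pos by (simp add: C_def)
    have xnw: "xn \<noteq> w" using ns by (simp add: sing_def)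
    have ev: "\<forall>\<^sub>F u in nhds 0. ex (base xn) u =
      (if u $ 2 > 0 then abv (xn + u $ 1) (u $ 2) else if u $ 2 < 0 then bel (rot sg b + u $ 1) (u $ 2) else base (xn + u $ 1))"
      by (rule cross[OF R]) (simp add: b iet_def)
    obtain d where d: "d > 0" "\<And>k s. \<bar>k\<bar> < d \<Longrightarrow> \<bar>s\<bar> < d \<Longrightarrow>
      (ex (base xn) (pt (k + sg * s) s) =
      (if s > 0 then abv (xn + (k + sg * s)) s else if s < 0 then bel (rot sg b + (k + sg * s)) s else base (xn + (k + sg * s))) \<and>
       \<bar>k + sg * s\<bar> < C \<and> \<bar>s\<bar> < C) \<and> (xn + (k + sg * s) \<le> w \<longleftrightarrow> xn \<le> w) \<and> (rot sg b + (k + sg * s) \<le> w \<longleftrightarrow> rot sg b \<le> w)"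
      using ev_sheared[OF eventually_conj[OF eventually_conj[OF ev ev_lt[OF C]] eventually_conj[OF ev_keep_side[OF xnw] ev_keep_side[OF R(4)]]], of sg]
      unfolding pt_nth by (elim exE conjE) (rule that, assumption, iprover)
    define d' where "d' = Min {d, gap F z2, w + 1 - y, if b \<le> w then w - y else 1, \<bar>rot sg b - w\<bar>, \<bar>rot sg b - (w - 1)\<bar>, w + 1 - rot sg b, \<bar>xn - w\<bar>}"
    have p: "0 < w + 1 - y" "0 < (if b \<le> w then w - y else 1)" "0 < \<bar>rot sg b - w\<bar>" "0 < \<bar>rot sg b - (w - 1)\<bar>"
      "0 < w + 1 - rot sg b" "0 < \<bar>xn - w\<bar>" using Yb R xnw by simp_all
    have d': "d' > 0" unfolding d'_def by (subst Min_gr_iff) (use d(1) gp p in simp_all)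
    have dl: "d' \<le> d" "d' \<le> gap F z2" "d' \<le> w + 1 - y" "b \<le> w \<Longrightarrow> d' \<le> w - y" "d' \<le> \<bar>rot sg b - w\<bar>"
      "d' \<le> \<bar>rot sg b - (w - 1)\<bar>" "d' \<le> w + 1 - rot sg b" "d' \<le> \<bar>xn - w\<bar>"
      unfolding d'_def by (rule Min_le; simp)+
    have "k < gap F z2 \<and> flow sg (prv F z2 + k) (roof b + \<sigma>) = ex (flow sg z s) (pt (k + sg * \<sigma>) \<sigma>)"
      if k: "0 < k" "k < d'" "\<bar>\<sigma>\<bar> < d'" for k \<sigma>
    proof -
      have kd: "\<bar>k\<bar> < d" "\<bar>\<sigma>\<bar> < d" "k < gap F z2" using k dl by auto
      note E = d(2)[OF kd(1,2)]
      have yk: "y + k \<in> Dom" "y + k \<le> w \<longleftrightarrow> b \<le> w" using k dl(3,4) Yb by (auto simp: Dom_def)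
      have xk: "xn + k \<le> w \<longleftrightarrow> xn \<le> w" using k dl(8) by (auto simp: abs_if split: if_splits)
      have rk: "rot sg (y + k) = rot sg b + k"
      proof (cases "b \<le> w")
        case T: True
        obtain j :: int where j: "rot sg b = b + sg + w * of_int j" using rot_low(3) T bD unfolding Dom_def by (metis greaterThanAtMost_iff)
        have "rot sg b \<le> w" using rot_Dom(2)[OF bD] T by blast
        then show ?thesis using T yk k R dl(5) j
          by (intro rot_low_eq[where k = "if b = w then j + 1 else j"]) (auto simp: y_def Y_def algebra_simps)
      next
        case F: False
        obtain j :: int where j: "rot sg b = b + sg * (w - 1) + of_int j" using rot_up(3)[of b] F by auto
        have "\<not> rot sg b \<le> w" using rot_Dom(2)[OF bD] F by blast
        then show ?thesis using F yk k R dl(7) j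
          by (intro rot_up_eq[where k = "if b = w + 1 then j + 1 else j"]) (auto simp: y_def Y_def algebra_simps)
      qed
      have ik: "iet sg (y + k) = xn + k"
        unfolding b(2) iet_def rk ppi_def using k dl(5,6) by (auto simp: abs_if split: if_splits)
      have ry: "roof (y + k) = roof b" "roof (xn + k) = roof xn" using yk xk by (simp_all add: roof_def)
      consider "\<sigma> \<ge> 0" | "\<sigma> < 0" by linarith
      then have "flow sg (y + k) (roof b + \<sigma>) = ex (flow sg z s) (pt (k + sg * \<sigma>) \<sigma>)"
      proof cases
        case 1
        have "flow sg (y + k) (roof b + \<sigma>) = flow sg (iet sg (y + k)) \<sigma>"
          using flow_shift[OF 1, of sg "y + k" 1] ry by (simp add: tm_Suc)
        also have "\<dots> = pos sg (xn + k) \<sigma>" unfolding ik by (rule flow_pos) (use 1 E ry in \<open>auto simp: C_def\<close>)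
        finally show ?thesis using E 1 fb xk by (auto simp: pos_def abv_def algebra_simps)
      next
        case 2
        have "flow sg (y + k) (roof b + \<sigma>) = pos sg (y + k) (roof b + \<sigma>)"
          by (rule flow_pos) (use 2 E ry in \<open>auto simp: C_def\<close>)
        also have "\<dots> = bel (rot sg b + (k + sg * \<sigma>)) \<sigma>"
        proof (subst bel_pos[OF yk(1), where k = 0])
          show "- roof (y + k) < \<sigma>" "\<sigma> < 0" using 2 E ry by (simp_all add: C_def abs_less_iff)
          show "rot sg b + (k + sg * \<sigma>) \<le> w \<longleftrightarrow> rot sg (y + k) \<le> w"
            using E rot_Dom(2)[OF yk(1), of sg] rot_Dom(2)[OF bD, of sg] yk(2) by simp
          show "rot sg b + (k + sg * \<sigma>) = rot sg (y + k) + 0 + sg * \<sigma>" using rk by simp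
          have "roof (y + k) + \<sigma> > 0" using 2 E ry by (simp add: C_def abs_less_iff)
          then show "pos sg (y + k) (roof b + \<sigma>) = (if y + k \<le> w then low (y + k + 0 + sg * (roof (y + k) + \<sigma>)) (roof (y + k) + \<sigma>)
            else up (y + k + 0 - 1 + sg * (roof (y + k) + \<sigma>)) (1 + (roof (y + k) + \<sigma>)))"
            using ry(1) by (simp add: pos_pos)
        qed
        finally show ?thesis using E 2 fb by simp
      qed
      then show ?thesis using kd z2 by simp
    qed
    then show ?thesis using z2(1) roof_pos d' by blast
  qed
qed

text \<open>Shears along the flow by \<open>T z e\<close>, a function of the cylinder and of the distance \<open>e\<close> to its
  right boundary.\<close>
definition twist :: "real \<Rightarrow> real set \<Rightarrow> (real \<Rightarrow> real \<Rightarrow> real) \<Rightarrow> (real^2) set \<Rightarrow> (real^2) set" where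
  "twist sg F T q = (SOME q'. \<exists>z\<in>F. \<exists>e s. 0 \<le> e \<and> e < gap F z \<and> 0 \<le> s \<and>
     q = flow sg (z - e) s \<and> q' = flow sg (z - e) (s + T z e))"

lemma gap_orbit_unique:
  assumes g: "good sg F" and z: "z \<in> F" "0 \<le> e" "e < gap F z" and z': "z' \<in> F" "0 \<le> e'" "e' < gap F z'"
    and E: "itr sg n (z - e) = itr sg m (z' - e')"
  shows "itr sg n z = itr sg m z' \<and> e = e' \<and> gap F z = gap F z'"
proof -
  have i: "itr sg n z \<in> F \<and> gap F (itr sg n z) = gap F z" "itr sg m z' \<in> F \<and> gap F (itr sg m z') = gap F z'"
    using gap_iet_pow[OF g] z z' by blast+
  have "itr sg n z - e = itr sg m z' - e'"
    using E gap_shift_pow(1)[OF g z, of n] gap_shift_pow(1)[OF g z', of m] by simp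
  then show ?thesis using gap_unique[OF g, of "itr sg n z" e "itr sg m z'" e'] i z z' by auto
qed

text \<open>The choice in \<open>twist\<close> is harmless: two flow coordinates of one point have
  the same distance \<open>e\<close> and gaps of equal width, and \<open>T\<close> depends on
  nothing else.\<close>

lemma twist_eq:
  assumes g: "good sg F" and z: "z \<in> F" "0 \<le> e" "e < gap F z" and s: "0 \<le> s" and S: "flow sg (z - e) s \<in> Sp"
    and T: "\<And>z e. z \<in> F \<Longrightarrow> 0 \<le> e \<Longrightarrow> e < gap F z \<Longrightarrow> T z e \<ge> 0"
      "\<And>z e z'. z \<in> F \<Longrightarrow> z' \<in> F \<Longrightarrow> gap F z = gap F z' \<Longrightarrow> T z e = T z' e"
  shows "twist sg F T (flow sg (z - e) s) = flow sg (z - e) (s + T z e)" unfolding twist_def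
proof (rule some_equality)
  show "\<exists>z'\<in>F. \<exists>e' s'. 0 \<le> e' \<and> e' < gap F z' \<and> 0 \<le> s' \<and> flow sg (z - e) s = flow sg (z' - e') s' \<and>
      flow sg (z - e) (s + T z e) = flow sg (z' - e') (s' + T z' e')" using z s by blast
  fix q' assume "\<exists>z'\<in>F. \<exists>e' s'. 0 \<le> e' \<and> e' < gap F z' \<and> 0 \<le> s' \<and> flow sg (z - e) s = flow sg (z' - e') s' \<and>
      q' = flow sg (z' - e') (s' + T z' e')"
  then obtain z' e' s' where z': "z' \<in> F" "0 \<le> e'" "e' < gap F z'" and s': "0 \<le> s'"
    and E: "flow sg (z - e) s = flow sg (z' - e') s'" and q': "q' = flow sg (z' - e') (s' + T z' e')"
    by (elim bexE exE conjE)
  have d: "z - e \<in> Dom" "z' - e' \<in> Dom" using gap_shift(2)[OF g z] gap_shift(2)[OF g z'] by blast+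
  obtain n m where nm: "itr sg n (z - e) = itr sg m (z' - e')"
    and fl: "\<forall>u\<ge>0. flow sg (z - e) (s + u) = flow sg (z' - e') (s' + u)"
    using flow_cong[OF d(1) s d(2) s' S E] by (elim exE conjE)
  have G: "e = e'" "gap F z = gap F z'" using gap_orbit_unique[OF g z z' nm] by blast+
  have "T z e = T z' e'" using T(2)[OF z(1) z'(1) G(2)] G(1) by simp
  then show "q' = flow sg (z - e) (s + T z e)" using fl T(1)[OF z] q' by metis
qed

lemma tm_shift:
  assumes g: "good sg F" and z: "z \<in> F" "0 \<le> e" "e < gap F z"
  shows "tm sg n (z - e) = tm sg n z"
  unfolding tm_def by (rule sum.cong) (use gap_shift_pow(2)[OF g z] in \<open>simp_all add: roof_def\<close>)

lemma flow_periodic: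
  assumes g: "good sg F" and z: "z \<in> F" "0 \<le> e" "e < gap F z" and s: "s \<ge> 0"
    and n: "itr sg n z = z"
  shows "flow sg (z - e) (s + tm sg n z) = flow sg (z - e) s"
  using flow_shift[OF s, of sg "z - e" n] tm_shift[OF g z, of n] gap_shift_pow(1)[OF g z, of n] n
  by (simp add: add.commute)

text \<open>Orbits of interior points of a gap never enter \<open>F\<close>, which contains the
  singular base points.\<close>

lemma flow_Sp_gap:
  assumes g: "good sg F" and z: "z \<in> F" "0 < e" "e < gap F z" and s: "s \<ge> 0"
  shows "flow sg (z - e) s \<in> Sp"
proof (rule flow_Sp[OF _ s])
  show "z - e \<in> Dom" using gap_shift(2)[OF g z(1) _ z(3)] z(2) by simp
  fix n
  have "sing \<subseteq> F" using g by (simp add: good_def)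
  then show "itr sg n (z - e) \<notin> sing" using gap_shift_pow(3)[OF g z(1) _ z(3) z(2), of n] z(2) by auto
qed

lemma gap_box:
  assumes g: "good sg F" and z: "z \<in> F" "0 \<le> e" "e < gap F z" and s: "s > 0" and S: "flow sg (z - e) s \<in> Sp"
  shows "\<exists>d>0. \<forall>k \<sigma>. 0 \<le> e - k \<and> e - k < gap F z \<longrightarrow> \<bar>k\<bar> < d \<longrightarrow> \<bar>\<sigma>\<bar> < d \<longrightarrow>
    flow sg (z - (e - k)) (s + \<sigma>) = ex (flow sg (z - e) s) (pt (k + sg * \<sigma>) \<sigma>)"
proof -
  define K where "K = {k. 0 \<le> e - k \<and> e - k < gap F z}"
  have "flow sg (z - e) s \<in> Sp \<and> (\<exists>d>0. \<forall>k\<in>K. \<forall>\<sigma>. \<bar>k\<bar> < d \<longrightarrow> \<bar>\<sigma>\<bar> < d \<longrightarrow>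
     flow sg (z - e + k) (s + \<sigma>) = ex (flow sg (z - e) s) (pt (k + sg * \<sigma>) \<sigma>))"
  proof (rule flow_box[OF _ s])
    show "z - e \<in> Dom" using gap_shift(2)[OF g z] .
    show "itr sg n (z - e) \<notin> sing" if "n > 0" "tm sg n (z - e) = s" for n
      using flow_nonsing[of sg "z - e" n] S that by simp
    show "itr sg m (z - e + k) = itr sg m (z - e) + k \<and> (itr sg m (z - e) + k \<le> w \<longleftrightarrow> itr sg m (z - e) \<le> w)"
      if "k \<in> K" for k m
    proof -
      have k: "0 \<le> e - k" "e - k < gap F z" using that by (auto simp: K_def)
      have zk: "z - e + k = z - (e - k)" by simp
      have eq: "itr sg m (z - (e - k)) = itr sg m (z - e) + k"
        using gap_shift_pow(1)[OF g z, of m] gap_shift_pow(1)[OF g z(1) k, of m] by simp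
      show ?thesis unfolding zk eq[symmetric] using gap_shift_pow(2)[OF g z, of m] gap_shift_pow(2)[OF g z(1) k, of m] by simp
    qed
  qed
  then obtain d where d: "d > 0" "\<forall>k\<in>K. \<forall>\<sigma>. \<bar>k\<bar> < d \<longrightarrow> \<bar>\<sigma>\<bar> < d \<longrightarrow>
     flow sg (z - e + k) (s + \<sigma>) = ex (flow sg (z - e) s) (pt (k + sg * \<sigma>) \<sigma>)" by (elim exE conjE)
  have "flow sg (z - (e - k)) (s + \<sigma>) = ex (flow sg (z - e) s) (pt (k + sg * \<sigma>) \<sigma>)"
    if "0 \<le> e - k \<and> e - k < gap F z" "\<bar>k\<bar> < d" "\<bar>\<sigma>\<bar> < d" for k \<sigma>
  proof -
    have "z - (e - k) = z - e + k" by simp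
    show ?thesis unfolding \<open>z - (e - k) = z - e + k\<close> using d(2) that by (simp add: K_def)
  qed
  then show ?thesis using d(1) by blast
qed

text \<open>The parabolic matrix fixing the direction \<open>(sg, 1)\<close>, namely
  \<open>h + t * (sg * h2 - h1) * (sg, 1)\<close>. A point at horizontal distance \<open>e\<close>
  to the left of a fixed line moves by \<open>t * e\<close> along it.\<close>

definition shear :: "real \<Rightarrow> real \<Rightarrow> real^2^2" where
  "shear sg t = vector [vector [1 - t * sg, t * sg\<^sup>2], vector [- t, 1 + t * sg]]"

lemma shear_nth [simp]: "shear sg t $ 1 $ 1 = 1 - t * sg" "shear sg t $ 1 $ 2 = t * sg\<^sup>2"
  "shear sg t $ 2 $ 1 = - t" "shear sg t $ 2 $ 2 = 1 + t * sg" by (simp_all add: shear_def vector_2)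

lemma shear_mult: "shear sg t *v h = pt (h $ 1 + t * (sg * h $ 2 - h $ 1) * sg) (h $ 2 + t * (sg * h $ 2 - h $ 1))"
  by (simp add: pt_eq_iff matrix_vector_mult_def sum_2 algebra_simps power2_eq_square)

lemma det_shear: "det (shear sg t) = 1" by (simp add: det_2 algebra_simps power2_eq_square)

lemma ev_unshear:
  assumes d: "d > 0" and Q: "\<And>k s. \<bar>k\<bar> < d \<Longrightarrow> \<bar>s\<bar> < d \<Longrightarrow> Q (pt (k + sg * s) s)"
  shows "eventually Q (nhds (0::real^2))"
proof -
  define c where "c = d / (1 + \<bar>sg\<bar>)"
  have c: "c > 0" "c * (1 + \<bar>sg\<bar>) = d" using d by (auto simp: c_def add_pos_nonneg)
  from ev_lt[OF c(1)] show ?thesis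
  proof eventually_elim
    fix h :: "real^2" assume h: "\<bar>h $ 1\<bar> < c \<and> \<bar>h $ 2\<bar> < c"
    have "\<bar>sg * h $ 2\<bar> \<le> \<bar>sg\<bar> * c" using h by (simp add: abs_mult mult_left_mono)
    then have "\<bar>h $ 1 - sg * h $ 2\<bar> < c + \<bar>sg\<bar> * c" using h abs_triangle_ineq4[of "h $ 1" "sg * h $ 2"] by linarith
    then have 1: "\<bar>h $ 1 - sg * h $ 2\<bar> < d" using c(2) by (simp add: algebra_simps)
    have "0 \<le> c * \<bar>sg\<bar>" using c(1) by simp
    then have "c \<le> d" using c(2) by (simp add: algebra_simps)
    then have "Q (pt (h $ 1 - sg * h $ 2 + sg * h $ 2) (h $ 2))" using Q[OF 1, of "h $ 2"] h by simp
    then show "Q h" by simp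
  qed
qed

text \<open>Points at distance \<open>e\<close> from the right end of their gap are pushed by
  \<open>t * e\<close> along the flow. The push is trivial at \<open>e = 0\<close> and, by the
  hypothesis on the periods, a whole number of turns as \<open>e\<close> approaches the gap, so
  adjacent cylinders fit together.\<close>

lemma multitwist:
  assumes g: "good sg F" and t: "t > 0"
    and per: "\<And>z. z \<in> F \<Longrightarrow> \<exists>n. itr sg n z = z \<and> tm sg n z = t * gap F z"
  shows "shear sg t \<in> L_veech_group w w"
proof -
  note D = goodD[OF g]
  define \<phi> where "\<phi> = twist sg F (\<lambda>z e. t * e)"
  \<comment> \<open>Completes the push of \<open>\<phi>\<close> to \<open>t * gap F z\<close>, a
    period of the flow line; hence the inverse map.\<close>
  define \<psi> where "\<psi> = twist sg F (\<lambda>z e. t * (gap F z - e))"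
  have ph: "\<phi> (flow sg (z - e) s) = flow sg (z - e) (s + t * e)"
    if "z \<in> F" "0 \<le> e" "e < gap F z" "0 \<le> s" "flow sg (z - e) s \<in> Sp" for z e s
    unfolding \<phi>_def by (rule twist_eq[OF g that]) (use t in simp_all)
  have ps: "\<psi> (flow sg (z - e) s) = flow sg (z - e) (s + t * (gap F z - e))"
    if "z \<in> F" "0 \<le> e" "e < gap F z" "0 \<le> s" "flow sg (z - e) s \<in> Sp" for z e s
    unfolding \<psi>_def by (rule twist_eq[OF g that]) (use t in simp_all)
  have gp: "gap F z > 0" if "z \<in> F" for z using that gap_pos[OF D(1)] D(2) by (auto simp: Dom_def)
  have fp: "flow sg (z - e) (s + t * gap F z) = flow sg (z - e) s" if z: "z \<in> F" "0 \<le> e" "e < gap F z" "s \<ge> 0" for z e s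
  proof -
    obtain n where "itr sg n z = z" "tm sg n z = t * gap F z" using per[OF z(1)] by blast
    then show ?thesis using flow_periodic[OF g z] by metis
  qed
  \<comment> \<open>Adding a full period makes the flow time positive, as the flow boxes
    require.\<close>
  have cov: "\<exists>z e s. z \<in> F \<and> 0 \<le> e \<and> e < gap F z \<and> s > 0 \<and> q = flow sg (z - e) s" if q: "q \<in> Sp" for q
  proof -
    obtain x h where x: "x \<in> Dom" "0 \<le> h" "h < roof x" "q = pos sg x h" using Sp_pos[OF q, of sg] by blast
    obtain z e where z: "z \<in> F" "0 \<le> e" "e < gap F z" "x = z - e" using gap_cover[OF g x(1)] by blast
    have "q = flow sg (z - e) (h + t * gap F z)" using fp[OF z(1-3) x(2)] flow_pos[OF x(2,3), of sg] x(4) z(4) by simp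
    moreover have "h + t * gap F z > 0" using x(2) t gp[OF z(1)] by (simp add: add_nonneg_pos)
    ultimately show ?thesis using z by blast
  qed
  have inSp: "flow sg (z - e) (s + u) \<in> Sp"
    if "z \<in> F" "0 \<le> e" "e < gap F z" "0 \<le> s" "flow sg (z - e) s \<in> Sp" "u = t * e \<or> u = t * (gap F z - e)" for z e s u
  proof (cases "e = 0")
    case True
    then show ?thesis using that fp[OF that(1-4)] by auto
  next
    case False
    have "u \<ge> 0" using that t by auto
    then show ?thesis using flow_Sp_gap[OF g that(1) _ that(3)] that(2,4) False by simp
  qed
  have bij: "bij_betw \<phi> Sp Sp"
  proof (rule bij_betw_byWitness[where f' = \<psi>])
    have phi_all: "\<phi> q \<in> Sp \<and> \<psi> (\<phi> q) = q" if q: "q \<in> Sp" for q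
    proof -
      obtain z e s where z: "z \<in> F" "0 \<le> e" "e < gap F z" and s: "s > 0" "q = flow sg (z - e) s" using cov[OF q] by blast
      have S: "flow sg (z - e) s \<in> Sp" and s0: "0 \<le> s" "0 \<le> s + t * e" using s q t z by auto
      have S2: "flow sg (z - e) (s + t * e) \<in> Sp" by (rule inSp[OF z s0(1) S]) simp
      have "\<psi> (\<phi> q) = flow sg (z - e) (s + t * e + t * (gap F z - e))"
        using ph[OF z s0(1) S] ps[OF z s0(2) S2] s(2) by simp
      also have "\<dots> = flow sg (z - e) (s + t * gap F z)" by (simp add: algebra_simps)
      finally show ?thesis using fp[OF z s0(1)] ph[OF z s0(1) S] S2 s(2) by simp
    qed
    have psi_all: "\<psi> q \<in> Sp \<and> \<phi> (\<psi> q) = q" if q: "q \<in> Sp" for q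
    proof -
      obtain z e s where z: "z \<in> F" "0 \<le> e" "e < gap F z" and s: "s > 0" "q = flow sg (z - e) s" using cov[OF q] by blast
      have S: "flow sg (z - e) s \<in> Sp" and s0: "0 \<le> s" "0 \<le> s + t * (gap F z - e)" using s q t z by auto
      have S2: "flow sg (z - e) (s + t * (gap F z - e)) \<in> Sp" by (rule inSp[OF z s0(1) S]) simp
      have "\<phi> (\<psi> q) = flow sg (z - e) (s + t * (gap F z - e) + t * e)"
        using ps[OF z s0(1) S] ph[OF z s0(2) S2] s(2) by simp
      also have "\<dots> = flow sg (z - e) (s + t * gap F z)" by (simp add: algebra_simps)
      finally show ?thesis using fp[OF z s0(1)] ps[OF z s0(1) S] S2 s(2) by simp
    qed
    show "\<forall>q\<in>Sp. \<psi> (\<phi> q) = q" "\<forall>q\<in>Sp. \<phi> (\<psi> q) = q" using phi_all psi_all by blast+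
    show "\<phi> ` Sp \<subseteq> Sp" "\<psi> ` Sp \<subseteq> Sp" using phi_all psi_all by blast+
  qed
  have loc: "\<forall>\<^sub>F h in nhds 0. \<phi> (ex q h) = ex (\<phi> q) (shear sg t *v h)" if q: "q \<in> Sp" for q
  proof -
    obtain z e s where z: "z \<in> F" "0 \<le> e" "e < gap F z" and s: "s > 0" "q = flow sg (z - e) s" using cov[OF q] by blast
    have S: "flow sg (z - e) s \<in> Sp" and s0: "0 \<le> s" "0 < s + t * e" using s q t z by (auto simp: add_pos_nonneg)
    have S2: "flow sg (z - e) (s + t * e) \<in> Sp" by (rule inSp[OF z s0(1) S]) simp
    have pq: "\<phi> q = flow sg (z - e) (s + t * e)" using ph[OF z s0(1) S] s(2) by simp
    have sh: "shear sg t *v pt (k + sg * \<sigma>) \<sigma> = pt (k + sg * (\<sigma> - t * k)) (\<sigma> - t * k)" for k \<sigma>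
      by (simp add: shear_mult algebra_simps)
    obtain d1 where d1: "d1 > 0" "\<forall>k \<sigma>. 0 \<le> e - k \<and> e - k < gap F z \<longrightarrow> \<bar>k\<bar> < d1 \<longrightarrow> \<bar>\<sigma>\<bar> < d1 \<longrightarrow>
      flow sg (z - (e - k)) (s + \<sigma>) = ex q (pt (k + sg * \<sigma>) \<sigma>)"
      using gap_box[OF g z s(1) S] unfolding s(2) by (elim exE conjE)
    obtain d2 where d2: "d2 > 0" "\<forall>k \<sigma>. 0 \<le> e - k \<and> e - k < gap F z \<longrightarrow> \<bar>k\<bar> < d2 \<longrightarrow> \<bar>\<sigma>\<bar> < d2 \<longrightarrow>
      flow sg (z - (e - k)) (s + t * e + \<sigma>) = ex (\<phi> q) (pt (k + sg * \<sigma>) \<sigma>)"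
      using gap_box[OF g z s0(2) S2] unfolding pq by (elim exE conjE)
    obtain d3 where d3: "d3 > 0" "\<forall>k \<sigma>. \<bar>k\<bar> < d3 \<longrightarrow> \<bar>\<sigma>\<bar> < d3 \<longrightarrow> ex q (pt (k + sg * \<sigma>) \<sigma>) \<in> Sp"
      using ev_sheared[OF ev_ex_Sp[OF q], of sg] by (elim exE conjE)
    \<comment> \<open>Shrinks a radius so that both \<open>\<sigma>\<close> and the sheared
      \<open>\<sigma> - t * k\<close> stay below it.\<close>
    define L where "L m = m / (1 + t)" for m
    have L: "L m > 0 \<and> L m \<le> m" if "m > 0" for m using that t by (simp add: L_def divide_le_eq)
    have small: "\<bar>\<sigma> - t * k\<bar> < m" if "\<bar>k\<bar> < L m" "\<bar>\<sigma>\<bar> < L m" for k \<sigma> m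
    proof -
      have "\<bar>t * k\<bar> \<le> t * L m" using that t by (simp add: abs_mult)
      then have "\<bar>\<sigma> - t * k\<bar> < L m + t * L m" using that abs_triangle_ineq4[of \<sigma> "t * k"] by linarith
      also have "\<dots> = L m * (1 + t)" by (simp add: algebra_simps)
      also have "\<dots> = m" using t by (simp add: L_def)
      finally show ?thesis .
    qed
    have left: "\<phi> (ex q (pt (k + sg * \<sigma>) \<sigma>)) = ex (\<phi> q) (shear sg t *v pt (k + sg * \<sigma>) \<sigma>)"
      if k: "0 \<le> e - k" "e - k < gap F z" "\<bar>k\<bar> < d1" "\<bar>k\<bar> < L d2" "\<bar>k\<bar> < d3"
        "\<bar>\<sigma>\<bar> < d1" "\<bar>\<sigma>\<bar> < L d2" "\<bar>\<sigma>\<bar> < d3" "\<bar>\<sigma>\<bar> < s" for k \<sigma>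
    proof -
      have E: "ex q (pt (k + sg * \<sigma>) \<sigma>) = flow sg (z - (e - k)) (s + \<sigma>)" using d1(2) k by simp
      have "ex q (pt (k + sg * \<sigma>) \<sigma>) \<in> Sp" using d3(2) k by blast
      then have "\<phi> (ex q (pt (k + sg * \<sigma>) \<sigma>)) = flow sg (z - (e - k)) (s + \<sigma> + t * (e - k))"
        unfolding E by (intro ph[OF z(1) k(1,2)]) (use k in auto)
      also have "\<dots> = flow sg (z - (e - k)) (s + t * e + (\<sigma> - t * k))" by (simp add: algebra_simps)
      also have "\<dots> = ex (\<phi> q) (pt (k + sg * (\<sigma> - t * k)) (\<sigma> - t * k))"
        using d2(2) k small[OF k(4,7)] L[OF d2(1)] by simp
      finally show ?thesis by (simp add: sh)
    qed
    show ?thesis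
    proof (cases "e = 0")
      case False
      define d where "d = Min {d1, L d2, d3, s, e, gap F z - e}"
      have d: "d > 0" unfolding d_def using d1(1) L[OF d2(1)] d3(1) s(1) z False by (subst Min_gr_iff) simp_all
      have dl: "d \<le> d1" "d \<le> L d2" "d \<le> d3" "d \<le> s" "d \<le> e" "d \<le> gap F z - e"
        unfolding d_def by (rule Min_le; simp)+
      show ?thesis by (rule ev_unshear[OF d, of _ sg], rule left) (use dl in \<open>simp_all add: abs_less_iff\<close>)
    next
      case True
      \<comment> \<open>The point lies on the boundary between two cylinders and is fixed. Its left
        side is handled by \<open>left\<close>; on its right, in the gap of \<open>z2\<close>, the
        distance \<open>gap F z2 - k\<close> gives a push by \<open>- t * k\<close> modulo the
        period.\<close>
      have qz: "flow sg z s = q" using s(2) True by simp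
      have pqq: "\<phi> q = q" using pq True s(2) by simp
      obtain z2 r d4 where z2: "z2 \<in> F" and r: "r > 0" and d4: "d4 > 0" "\<forall>k \<sigma>. 0 < k \<longrightarrow> k < d4 \<longrightarrow> \<bar>\<sigma>\<bar> < d4 \<longrightarrow>
       k < gap F z2 \<and> flow sg (prv F z2 + k) (r + \<sigma>) = ex q (pt (k + sg * \<sigma>) \<sigma>)"
        using right_box[OF g z(1) s0(1), unfolded qz, OF q] by (elim bexE exE conjE)
      define d where "d = Min {d1, L d2, d3, s, gap F z, L d4, L r}"
      have d: "d > 0" unfolding d_def using d1(1) L[OF d2(1)] d3(1) s(1) z L[OF d4(1)] L[OF r] True by (subst Min_gr_iff) simp_all
      have dl: "d \<le> d1" "d \<le> L d2" "d \<le> d3" "d \<le> s" "d \<le> gap F z" "d \<le> L d4" "d \<le> L r"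
        unfolding d_def by (rule Min_le; simp)+
      show ?thesis
      proof (rule ev_unshear[OF d, of _ sg])
        fix k \<sigma> assume k: "\<bar>k\<bar> < d" "\<bar>\<sigma>\<bar> < d"
        show "\<phi> (ex q (pt (k + sg * \<sigma>) \<sigma>)) = ex (\<phi> q) (shear sg t *v pt (k + sg * \<sigma>) \<sigma>)"
        proof (cases "k \<le> 0")
          case T: True
          then show ?thesis by (intro left) (use dl k True in \<open>simp_all add: abs_less_iff\<close>)
        next
          case F: False
          have k4: "0 < k" "k < d4" "\<bar>\<sigma>\<bar> < d4" "\<bar>\<sigma> - t * k\<bar> < d4" "\<bar>\<sigma> - t * k\<bar> < r" "\<bar>\<sigma>\<bar> < r" "\<bar>k\<bar> < d3" "\<bar>\<sigma>\<bar> < d3"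
            using F k dl L[OF d4(1)] L[OF r] small[of k d4 \<sigma>] small[of k r \<sigma>] by auto
          have E: "k < gap F z2" "flow sg (prv F z2 + k) (r + \<sigma>) = ex q (pt (k + sg * \<sigma>) \<sigma>)"
            "flow sg (prv F z2 + k) (r + (\<sigma> - t * k)) = ex q (pt (k + sg * (\<sigma> - t * k)) (\<sigma> - t * k))"
            using d4(2) k4 by blast+
          have y: "prv F z2 + k = z2 - (gap F z2 - k)" by (simp add: gap_def)
          have e2: "0 \<le> gap F z2 - k" "gap F z2 - k < gap F z2" using E k4 by auto
          have "ex q (pt (k + sg * \<sigma>) \<sigma>) \<in> Sp" using d3(2) k4 by blast
          then have "\<phi> (ex q (pt (k + sg * \<sigma>) \<sigma>)) = flow sg (z2 - (gap F z2 - k)) (r + \<sigma> + t * (gap F z2 - k))"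
            unfolding E(2)[symmetric] y by (intro ph[OF z2 e2]) (use k4 in auto)
          also have "\<dots> = flow sg (z2 - (gap F z2 - k)) (r + (\<sigma> - t * k) + t * gap F z2)" by (simp add: algebra_simps)
          also have "\<dots> = flow sg (z2 - (gap F z2 - k)) (r + (\<sigma> - t * k))"
            by (rule fp[OF z2 e2]) (use k4 in auto)
          also have "\<dots> = ex q (pt (k + sg * (\<sigma> - t * k)) (\<sigma> - t * k))" using E(3) y by simp
          finally show ?thesis by (simp add: sh pqq)
        qed
      qed
    qed
  qed
  show ?thesis unfolding veech_iff loc_aff_def using det_shear bij loc by blast
qed

section \<open>Two explicit multitwists\<close>

lemma prv_eqI:
  assumes "finite F" "p = 0 \<or> p \<in> F" "0 \<le> p" "p < z" "\<And>y. y \<in> F \<Longrightarrow> y < z \<Longrightarrow> y \<le> p"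
  shows "prv F z = p" unfolding prv_def using assms by (intro Max_eqI) auto

lemma iet_pow_mult:
  assumes "itr sg n z = z"
  shows "itr sg (k * n) z = z \<and> tm sg (k * n) z = of_nat k * tm sg n z"
proof (induction k)
  case (Suc k)
  have "itr sg (n + k * n) z = z" using Suc assms by (simp add: funpow_add)
  then show ?case using Suc tm_add[of sg n "k * n" z] assms by (simp add: algebra_simps)
qed simp

text \<open>The period condition of \<open>multitwist\<close> at one base point. It is constant
  along orbits by \<open>closes_pow\<close>, so one point per orbit has to be checked.\<close>

definition closes :: "real \<Rightarrow> real set \<Rightarrow> real \<Rightarrow> real \<Rightarrow> bool" where
  "closes sg F t z \<longleftrightarrow> (\<exists>n. itr sg n z = z \<and> tm sg n z = t * gap F z)"

lemma closesI:
  assumes "itr sg n z = z" "t * gap F z = of_nat k * tm sg n z" shows "closes sg F t z"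
  unfolding closes_def using iet_pow_mult[OF assms(1), of k] assms(2) by (intro exI[of _ "k * n"]) simp

lemma closes_pow:
  assumes g: "good sg F" and z: "z \<in> F" "closes sg F t z" shows "closes sg F t (itr sg m z)"
proof -
  obtain n where n: "itr sg n z = z" "tm sg n z = t * gap F z" using z(2) unfolding closes_def by blast
  have "itr sg n (itr sg m z) = itr sg m (itr sg n z)" by (metis add.commute comp_apply funpow_add)
  moreover have "tm sg n (itr sg m z) = tm sg n z"
    using tm_add[of sg m n z] tm_add[of sg n m z] n(1) by (simp add: add.commute)
  ultimately show ?thesis unfolding closes_def using n gap_iet_pow[OF g z(1), of m] by (intro exI[of _ n]) simp
qed

lemma iet_lowI:
  assumes "x \<le> w" "0 < y" "y \<le> w" "y = x + sg + w * of_int k" shows "iet sg x = ppi y"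
  using rot_low_eq[OF assms] by (simp add: iet_def)

lemma iet_upI:
  assumes "w < x" "w < y" "y \<le> w + 1" "y = x + sg * (w - 1) + of_int k" shows "iet sg x = ppi y"
  using rot_up_eq[OF assms] by (simp add: iet_def)

text \<open>Vertically there is a cylinder of width \<open>w - 1\<close> and height 1 and one of
  width 1 and height \<open>w\<close>. The twist by \<open>w\<close> turns \<open>N\<close> times
  around the first and once around the second.\<close>

lemma shear_vertical:
  assumes N: "w * (w - 1) = of_nat N"
  shows "shear 0 w \<in> L_veech_group w w"
proof (rule multitwist)
  have i1: "iet 0 (w - 1) = w - 1" using w1 by (subst iet_lowI[of _ "w - 1" _ 0]) (auto simp: ppi_def)
  have i2: "iet 0 w = w + 1" using w1 by (subst iet_lowI[of _ w _ 0]) (auto simp: ppi_def)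
  have i3: "iet 0 (w + 1) = w" using w1 by (subst iet_upI[of _ "w + 1" _ 0]) (auto simp: ppi_def)
  show g: "good 0 sing" unfolding good_def using i1 i2 i3 w1 by (simp add: sing_def Dom_def)
  have fin: "finite sing" by (simp add: sing_def)
  have g1: "gap sing (w - 1) = w - 1" using prv_eqI[OF fin, of 0 "w - 1"] w1 by (auto simp: gap_def sing_def)
  have g2: "gap sing w = 1" using prv_eqI[OF fin, of "w - 1" w] w1 by (auto simp: gap_def sing_def)
  have c1: "closes 0 sing w (w - 1)"
    by (rule closesI[where n = 1 and k = N]) (use i1 N w1 in \<open>simp_all add: g1 tm_Suc roof_def\<close>)
  have c2: "closes 0 sing w w"
    by (rule closesI[where n = 2 and k = 1]) (use i2 i3 w1 in \<open>simp_all add: g2 tm_def roof_def numeral_2_eq_2\<close>)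
  have c3: "closes 0 sing w (w + 1)" using closes_pow[OF g _ c2, of 1] i2 by (simp add: sing_def)
  show "\<exists>n. (iet 0 ^^ n) z = z \<and> tm 0 n z = w * gap sing z" if "z \<in> sing" for z
    using that c1 c2 c3 unfolding closes_def sing_def by blast
qed (use w1 in simp)

definition reach :: "real \<Rightarrow> real \<Rightarrow> real \<Rightarrow> real \<Rightarrow> bool" where
  "reach sg x y \<tau> \<longleftrightarrow> (\<exists>n. itr sg n x = y \<and> tm sg n x = \<tau>)"

lemma reach_trans: "reach sg x y \<tau> \<Longrightarrow> reach sg y z \<sigma> \<Longrightarrow> reach sg x z (\<tau> + \<sigma>)"
proof -
  assume "reach sg x y \<tau>" "reach sg y z \<sigma>"
  then obtain n m where "itr sg n x = y" "tm sg n x = \<tau>" "itr sg m y = z" "tm sg m y = \<sigma>"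
    unfolding reach_def by blast
  moreover have "itr sg (n + m) x = itr sg m (itr sg n x)" by (metis add.commute comp_apply funpow_add)
  ultimately show ?thesis unfolding reach_def using tm_add[of sg n m x] by (intro exI[of _ "n + m"]) simp
qed

lemma reach_step: "iet sg x = y \<Longrightarrow> reach sg x y (roof x)"
  unfolding reach_def by (intro exI[of _ 1]) (simp add: tm_Suc)

lemma reach_closes: "reach sg z z \<tau> \<Longrightarrow> t * gap F z = of_nat k * \<tau> \<Longrightarrow> closes sg F t z"
  unfolding reach_def using closesI by blast

lemma closes_reach: "good sg F \<Longrightarrow> z \<in> F \<Longrightarrow> closes sg F t z \<Longrightarrow> reach sg z y \<tau> \<Longrightarrow> closes sg F t y"
  unfolding reach_def using closes_pow by blast

text \<open>With slope \<open>w / 2\<close> the points \<open>i / w\<close> form one long periodic orbit if \<open>N\<close> is odd and two if \<open>N\<close>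
  is even.\<close>
lemma shear_two:
  assumes w2: "w > 2" and N: "w * (w - 1) = of_nat N" and h: "h = (if even N then 2 else 1)"
  shows "shear (2 / w) ((w + 1) * w\<^sup>2 / h) \<in> L_veech_group w w"
proof (rule multitwist)
  \<comment> \<open>The grid of step \<open>1 / w\<close>: the return map advances by two steps, and
    \<open>N\<close> steps make up \<open>w - 1\<close>.\<close>
  define c where "c = 1 / w"
  have w0: "w > 0" using w1 by simp
  have c: "c > 0" "2 * c < 1" "w * c = 1" "2 / w = 2 * c" using w2 by (auto simp: c_def)
  have Nw: "of_nat N * c = w - 1" using N w0 by (simp add: c_def field_simps)
  have "2 * (w - 1) < of_nat N" unfolding N[symmetric] using w2 by (intro mult_strict_right_mono) simp_all
  moreover have "2 * 1 < 2 * (w - 1)" using w2 by simp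
  ultimately have "of_nat N > (2::real)" by simp
  then have N3: "N \<ge> 3" by simp
  define E where "E = (\<lambda>i. of_nat i * c) ` {1..N}"
  \<comment> \<open>The points where the grid orbits leave \<open>{0<..w - 1}\<close>, and the orbit
    of \<open>w + 1\<close>. For even \<open>N\<close> the orbit of \<open>c\<close> meets no
    singular base point and merely halves a cylinder, so \<open>F\<close> is then larger than the
    set of separatrices.\<close>
  define T where "T = {w - 2 * c, w - c, w, w + c, w + 2 * c, w + 1}"
  define F where "F = E \<union> T"
  define sg where "sg = 2 * c"
  have ic: "of_nat i * c \<le> w - 1 \<longleftrightarrow> i \<le> N" for i unfolding Nw[symmetric] using c(1) by simp
  have step: "iet sg (of_nat i * c) = of_nat (i + 2) * c" if "1 \<le> i" "i + 2 \<le> N" for i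
  proof (subst iet_lowI[of _ "of_nat (i + 2) * c" _ 0])
    have l: "of_nat (i + 2) * c \<le> w - 1" "of_nat i * c \<le> w - 1" using ic[of "i + 2"] ic[of i] that by simp_all
    show "of_nat i * c \<le> w" "of_nat (i + 2) * c \<le> w" "0 < of_nat (i + 2) * c" using l c(1) by simp_all
    show "of_nat (i + 2) * c = of_nat i * c + sg + w * of_int 0" by (simp add: sg_def algebra_simps)
    show "ppi (of_nat (i + 2) * c) = of_nat (i + 2) * c" using l by (simp add: ppi_def)
  qed
  have NN: "(of_nat (N - Suc 0) :: real) = of_nat N - 1" using N3 by (simp add: of_nat_diff)
  have cN0: "0 < c + c * real N" using c(1) by (simp add: add_pos_nonneg)
  have sb: "iet sg (of_nat (N - 1) * c) = w + c"
    using c Nw cN0 by (subst iet_lowI[of _ "w - 1 + c" _ 0]) (auto simp: ppi_def sg_def NN algebra_simps)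
  have sc: "iet sg (of_nat N * c) = w + 2 * c"
    unfolding Nw using c w1 by (subst iet_lowI[of _ "w - 1 + 2 * c" _ 0]) (auto simp: ppi_def sg_def algebra_simps)
  have sd: "iet sg (w - 2 * c) = w + 1"
    using c w1 by (subst iet_lowI[of _ w _ 0]) (auto simp: ppi_def sg_def algebra_simps)
  have se: "iet sg (w - c) = c"
    using c w2 by (subst iet_lowI[of _ c _ "-1"]) (auto simp: ppi_def sg_def algebra_simps)
  have sf: "iet sg w = 2 * c"
    using c w2 by (subst iet_lowI[of _ "2 * c" _ "-1"]) (auto simp: ppi_def sg_def algebra_simps)
  have sw: "sg * (w - 1) = 2 - 2 * c" using c by (simp add: sg_def algebra_simps)
  have sg': "iet sg (w + c) = w - c" using c w2 by (subst iet_upI[of _ "w + 1 - c" _ "-1"]) (auto simp: ppi_def sw)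
  have sh: "iet sg (w + 2 * c) = w" using c w2 by (subst iet_upI[of _ "w + 1" _ "-1"]) (auto simp: ppi_def sw)
  have si: "iet sg (w + 1) = w - 2 * c"
    using c w2 by (subst iet_upI[of _ "w + 1 - 2 * c" _ "-2"]) (auto simp: ppi_def sw)
  have E_I: "of_nat i * c \<in> F" if "1 \<le> i" "i \<le> N" for i using that by (auto simp: F_def E_def)
  have cF: "c \<in> F" "2 * c \<in> F" using E_I[of 1] E_I[of 2] N3 by simp_all
  have Fin: "finite F" by (simp add: F_def E_def T_def)
  have F_le: "x \<le> w - 1 \<or> x \<in> T" if "x \<in> F" for x
  proof (cases "x \<in> E")
    case True
    then obtain i where "i \<le> N" "x = of_nat i * c" by (auto simp: E_def)
    then show ?thesis using ic[of i] by simp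
  next
    case False
    then show ?thesis using that by (simp add: F_def)
  qed
  have F_ge: "x \<ge> c" if "x \<in> F" for x
  proof -
    have "of_nat i * c \<ge> c" if "1 \<le> i" for i :: nat using that c(1) mult_right_mono[of 1 "real i" c] by simp
    then have "x \<ge> c" if "x \<in> E" using that by (auto simp: E_def)
    moreover have "y \<ge> c" if "y \<in> T" for y using that c w2 unfolding T_def by (elim insertE) simp_all
    ultimately show ?thesis using that unfolding F_def Un_iff by blast
  qed
  show g: "good (2 / w) F" unfolding c(4) sg_def[symmetric] good_def
  proof (intro conjI)
    show "finite F" by (rule Fin)
    show "F \<subseteq> Dom"
    proof
      fix x assume x: "x \<in> F"
      have "y \<le> w + 1" if "y \<in> T" for y using that c unfolding T_def by (elim insertE) simp_all
      then have "x \<le> w + 1" using F_le[OF x] by (elim disjE) (simp, blast)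
      then show "x \<in> Dom" using F_ge[OF x] c by (simp add: Dom_def)
    qed
    show "sing \<subseteq> F" using E_I[of N] N3 unfolding Nw by (auto simp: sing_def F_def T_def)
    show "iet sg ` F \<subseteq> F"
    proof
      fix y assume "y \<in> iet sg ` F"
      then obtain x where x: "x \<in> F" "y = iet sg x" by blast
      show "y \<in> F"
      proof (cases "x \<in> E")
        case True
        then obtain i where i: "1 \<le> i" "i \<le> N" "x = of_nat i * c" by (auto simp: E_def)
        consider "i + 2 \<le> N" | "i = N - 1" | "i = N" using i by linarith
        then show ?thesis
        proof cases
          case 1
          then show ?thesis using step[OF i(1) 1] E_I[of "i + 2"] x i by simp
        qed (use x i sb sc in \<open>simp_all add: F_def T_def\<close>)
      next
        case False
        then have "x \<in> T" using x by (simp add: F_def)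
        then show ?thesis using x(2) sd se sf sg' sh si cF unfolding T_def by (elim insertE) (simp_all add: F_def T_def)
      qed
    qed
  qed
  note g' = g[unfolded c(4) sg_def[symmetric]]
  define t where "t = (w + 1) * w\<^sup>2 / h"
  have h0: "h > 0" using h by simp
  have t0: "t > 0" using w1 h0 by (simp add: t_def)
  then show "(w + 1) * w\<^sup>2 / h > 0" by (simp add: t_def)
  have w2': "w\<^sup>2 = of_nat N + w" using N by (simp add: power2_eq_square algebra_simps)
  have chain: "reach sg (of_nat i * c) (of_nat (i + 2 * j) * c) (of_nat j)" if "1 \<le> i" "i + 2 * j \<le> N" for i j
    using that(2)
  proof (induction j)
    case 0
    show ?case unfolding reach_def by (intro exI[of _ 0]) simp
  next
    case (Suc j)
    have "roof (of_nat (i + 2 * j) * c) = 1" using ic[of "i + 2 * j"] Suc.prems w1 by (simp add: roof_def)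
    then have "reach sg (of_nat (i + 2 * j) * c) (of_nat (i + 2 * Suc j) * c) 1"
      using reach_step[OF step[of "i + 2 * j"]] that(1) Suc.prems by (simp add: add.assoc)
    then show ?case using reach_trans[OF Suc.IH] Suc.prems by (simp add: add.commute)
  qed
  have rl: "roof (of_nat (N - Suc 0) * c) = 1" "roof (of_nat N * c) = 1" using ic[of "N - 1"] ic[of N] w1 by (simp_all add: roof_def)
  have ru: "roof (w - c) = 1" "roof w = 1" "roof (w + c) = w - 1" "roof (w + 2 * c) = w - 1" "roof (w + 1) = w - 1" "roof (w - 2 * c) = 1"
    using c by (simp_all add: roof_def)
  have tail1: "reach sg (of_nat (N - 1) * c) c (w + 1)"
    using reach_trans[OF reach_step[OF sb] reach_trans[OF reach_step[OF sg'] reach_step[OF se]]] unfolding One_nat_def rl ru by (simp add: add.commute)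
  have tail2: "reach sg (of_nat N * c) (2 * c) (w + 1)"
    using reach_trans[OF reach_step[OF sc] reach_trans[OF reach_step[OF sh] reach_step[OF sf]]] unfolding rl ru by (simp add: add.commute)
  have "prv F c = 0"
  proof (rule prv_eqI[OF Fin])
    show "y \<le> 0" if "y \<in> F" "y < c" for y using F_ge[OF that(1)] that(2) by simp
  qed (use c in simp_all)
  then have gc: "gap F c = c" by (simp add: gap_def)
  have "prv F (2 * c) = c"
  proof (rule prv_eqI[OF Fin])
    fix y assume y: "y \<in> F" "y < 2 * c"
    have "w - 1 \<ge> 2 * c" using ic[of 2] N3 by simp
    have Tge: "y' \<ge> w - 1" if "y' \<in> T" for y' using that c unfolding T_def by (elim insertE) simp_all
    have "y \<in> E"
    proof (rule ccontr)
      assume "y \<notin> E"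
      then have "y \<in> T" using y(1) by (simp add: F_def)
      then show False using Tge[of y] y(2) \<open>w - 1 \<ge> 2 * c\<close> by linarith
    qed
    then obtain i where i: "1 \<le> i" "y = of_nat i * c" by (auto simp: E_def)
    then have "of_nat i < (2::real)" using y(2) c(1) by simp
    then have "i = 1" using i by simp
    then show "y \<le> c" using i by simp
  qed (use cF c in auto)
  then have g2c: "gap F (2 * c) = c" by (simp add: gap_def)
  have "prv F (w + 1) = w + 2 * c"
  proof (rule prv_eqI[OF Fin])
    fix y assume y: "y \<in> F" "y < w + 1"
    have Tle: "y' \<le> w + 2 * c \<or> y' = w + 1" if "y' \<in> T" for y' using that c unfolding T_def by (elim insertE) simp_all
    show "y \<le> w + 2 * c"
    proof (cases "y \<in> T")
      case True
      then show ?thesis using Tle[of y] y(2) by linarith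
    next
      case False
      then show ?thesis using F_le[OF y(1)] c(1) by linarith
    qed
  qed (use c w1 in \<open>simp_all add: F_def T_def\<close>)
  then have gw: "gap F (w + 1) = 1 - 2 * c" by (simp add: gap_def)
  have cw: "closes sg F t (w + 1)"
  proof (rule reach_closes)
    show "reach sg (w + 1) (w + 1) w" using reach_trans[OF reach_step[OF si] reach_step[OF sd]] by (simp add: ru)
    \<comment> \<open>By \<open>(w + 1) * (w - 2) = N - 2\<close> the twist turns
      \<open>(N - 2) / h\<close> times around this cylinder of width \<open>1 - 2 / w\<close> and
      period \<open>w\<close>.\<close>
    have "(w + 1) * w\<^sup>2 * (1 - 2 * c) = (w + 1) * w * (w - 2 * (w * c))" by (simp add: power2_eq_square algebra_simps)
    also have "\<dots> = w * (w\<^sup>2 - w - 2)" using c by (simp add: power2_eq_square algebra_simps)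
    also have "\<dots> = w * (of_nat N - 2)" using w2' by simp
    finally have e: "(w + 1) * w\<^sup>2 * (1 - 2 * c) = w * (of_nat N - 2)" .
    have "t * gap F (w + 1) = (of_nat N - 2) / h * w" unfolding gw t_def times_divide_eq_left e by simp
    also have "(of_nat N - 2) / h = of_nat ((N - 2) div (if even N then 2 else 1))"
      using N3 h by (auto simp: of_nat_diff real_of_nat_div)
    finally show "t * gap F (w + 1) = of_nat ((N - 2) div (if even N then 2 else 1)) * w" .
  qed
  \<comment> \<open>The push across a width \<open>c\<close>. It matches the grid orbits: each of
    the \<open>N\<close> grid points costs time 1 and each of the two excursions through the upper
    cylinder adds \<open>w\<close>; for even \<open>N\<close> this total is shared equally by two
    orbits, whence \<open>h = 2\<close>.\<close>
  have tc: "t * c = (of_nat N + 2 * w) / h"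
  proof -
    have "(w + 1) * w\<^sup>2 * c = (w + 1) * w * (w * c)" by (simp add: power2_eq_square)
    also have "\<dots> = of_nat N + 2 * w" using w2' c(3) by (simp add: power2_eq_square algebra_simps)
    finally show ?thesis by (simp add: t_def)
  qed
  have c1: "closes sg F t c \<and> closes sg F t (2 * c)"
  proof (cases "even N")
    case True
    then obtain m where m: "N = 2 * m" by blast
    have m1: "m \<ge> 2" using N3 m by simp
    have r1: "reach sg c (of_nat (N - 1) * c) (of_nat (m - 1))" using chain[of 1 "m - 1"] m m1 by (simp add: algebra_simps)
    have r2: "reach sg (2 * c) (of_nat N * c) (of_nat (m - 1))" using chain[of 2 "m - 1"] m m1 by (simp add: algebra_simps)
    have tt: "t * c = of_nat (m - 1) + (w + 1)" unfolding tc using m m1 h by (simp add: of_nat_diff)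
    show ?thesis using reach_closes[OF reach_trans[OF r1 tail1], where F = F and t = t and k = 1]
        reach_closes[OF reach_trans[OF r2 tail2], where F = F and t = t and k = 1] tt gc g2c by simp
  next
    case False
    then obtain m where m: "N = 2 * m + 1" using oddE by blast
    have m1: "m \<ge> 1" using N3 m by simp
    have r1: "reach sg c (of_nat N * c) (of_nat m)" using chain[of 1 m] m by (simp add: algebra_simps)
    have r2: "reach sg (2 * c) (of_nat (N - 1) * c) (of_nat (m - 1))" using chain[of 2 "m - 1"] m m1 by (simp add: algebra_simps)
    have r3: "reach sg c (2 * c) (of_nat m + (w + 1))" using reach_trans[OF r1 tail2] .
    have r4: "reach sg c c (of_nat m + (w + 1) + (of_nat (m - 1) + (w + 1)))" using reach_trans[OF r3 reach_trans[OF r2 tail1]] .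
    have tt: "t * c = of_nat m + (w + 1) + (of_nat (m - 1) + (w + 1))" unfolding tc using m m1 h by (simp add: of_nat_diff)
    have "closes sg F t c" using reach_closes[OF r4, where F = F and t = t and k = 1] tt gc by simp
    then show ?thesis using closes_reach[OF g' cF(1) _ r3] by blast
  qed
  note cr = closes_reach[OF g']
  have cE: "closes sg F t (of_nat i * c)" if i: "1 \<le> i" "i \<le> N" for i
  proof (cases "even i")
    case True
    then obtain j' where j': "i = 2 * j'" by blast
    define j where "j = j' - 1"
    have j: "i = 2 + 2 * j" using j' i(1) by (simp add: j_def)
    show ?thesis using cr[OF cF(2) conjunct2[OF c1]] chain[of 2 j] i j by simp
  next
    case False
    then obtain j where "i = 2 * j + 1" using oddE by blast
    then have j: "i = 1 + 2 * j" by simp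
    show ?thesis using cr[OF cF(1) conjunct1[OF c1]] chain[of 1 j] i j by simp
  qed
  have cN: "closes sg F t (w + c)" "closes sg F t (w + 2 * c)"
    using cr[OF E_I cE reach_step[OF sb]] cr[OF E_I cE reach_step[OF sc]] N3 by simp_all
  have "closes sg F t z" if z: "z \<in> F" for z
  proof (cases "z \<in> E")
    case True
    then show ?thesis using cE by (auto simp: E_def)
  next
    case False
    have "closes sg F t (w - c)" "closes sg F t w" "closes sg F t (w - 2 * c)"
      using cr[OF _ cN(1) reach_step[OF sg']] cr[OF _ cN(2) reach_step[OF sh]] cr[OF _ cw reach_step[OF si]] by (simp_all add: F_def T_def)
    moreover have "z \<in> T" using False z by (simp add: F_def)
    ultimately show ?thesis using cN cw unfolding T_def by (elim insertE) simp_all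
  qed
  then show "\<exists>n. (iet (2 / w) ^^ n) z = z \<and> tm (2 / w) n z = (w + 1) * w\<^sup>2 / h * gap F z" if "z \<in> F" for z
    using that unfolding closes_def t_def sg_def c(4) by blast
qed

end

section \<open>Parabolic elements are multitwists\<close>

lemma funpow_finite_id:
  assumes fin: "finite X" and f: "f ` X \<subseteq> X" "inj_on f X"
  shows "\<exists>m>0. \<forall>x\<in>X. (f ^^ m) x = x"
proof -
  have im: "(f ^^ n) x \<in> X" if "x \<in> X" for n x using that f(1) by (induction n) auto
  have inj: "inj_on (f ^^ n) X" for n
  proof (induction n)
    case (Suc n)
    have "(f ^^ n) ` X \<subseteq> X" using im by blast
    then show ?case using comp_inj_on[OF Suc inj_on_subset[OF f(2)]] by (simp add: comp_def)
  qed simp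
  define R where "R n = restrict (f ^^ n) X" for n
  have "range R \<subseteq> X \<rightarrow>\<^sub>E X" using im by (auto simp: R_def)
  then have "finite (range R)" using finite_PiE[OF fin, of "\<lambda>_. X"] fin finite_subset by blast
  then have "\<not> inj R" using finite_imageD infinite_UNIV_nat by blast
  then obtain a b where "a \<noteq> b" "R a = R b" unfolding inj_on_def by blast
  then obtain i j where ij: "i < j" "R i = R j" by (metis linorder_neqE_nat)
  have "(f ^^ (j - i)) x = x" if x: "x \<in> X" for x
  proof -
    have "(f ^^ i) x = (f ^^ j) x" using ij(2) x unfolding R_def by (metis restrict_apply')
    also have "\<dots> = (f ^^ (i + (j - i))) x" using ij by simp
    also have "\<dots> = (f ^^ i) ((f ^^ (j - i)) x)" by (simp only: funpow_add comp_apply)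
    finally show ?thesis using inj_onD[OF inj[of i]] x im by metis
  qed
  then show ?thesis using ij by (intro exI[of _ "j - i"]) simp
qed

context lsurf begin

lemma rot_surj:
  assumes Y: "Y \<in> Dom" shows "\<exists>b\<in>Dom. rot sg b = Y"
proof (cases "Y \<le> w")
  case True
  have Y0: "0 < Y" using Y by (simp add: Dom_def)
  note R = rot_low[OF Y0 True, of "- sg"]
  obtain k :: int where k: "rot (- sg) Y = Y + - sg + w * of_int k" using R(3) by blast
  have "rot sg (rot (- sg) Y) = Y"
    by (rule rot_low_eq[where k = "- k"]) (use R Y0 True k in \<open>simp_all add: algebra_simps\<close>)
  then show ?thesis using R(1,2) by (intro bexI[of _ "rot (- sg) Y"]) (auto simp: Dom_def)
next
  case False
  then have Y0: "w < Y" by simp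
  note R = rot_up[OF Y0, of "- sg"]
  obtain k :: int where k: "rot (- sg) Y = Y + - sg * (w - 1) + of_int k" using R(3) by blast
  have "rot sg (rot (- sg) Y) = Y"
    by (rule rot_up_eq[where k = "- k"]) (use R Y0 Y k in \<open>simp_all add: algebra_simps Dom_def\<close>)
  then show ?thesis using R(1,2) w1 by (intro bexI[of _ "rot (- sg) Y"]) (auto simp: Dom_def)
qed

section \<open>Separatrices under an affine map with parabolic derivative\<close>

lemma iet_surj:
  assumes y: "y \<in> Dom" "y \<notin> sing" shows "\<exists>b\<in>Dom. iet sg b = y"
proof -
  obtain Y where Y: "0 < Y" "Y < w + 1" "y = ppi Y" using ppi_surj[of y] y by (auto simp: Dom_def sing_def)
  then have "Y \<in> Dom" by (simp add: Dom_def)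
  then obtain b where "b \<in> Dom" "rot sg b = Y" using rot_surj by blast
  then show ?thesis using Y(3) unfolding iet_def by blast
qed

lemma flow_straight:
  assumes x: "x \<in> Dom" and I: "\<And>s. s \<in> I \<Longrightarrow> s > 0" and ns: "\<And>n. n > 0 \<Longrightarrow> tm sg n x \<in> I \<Longrightarrow> itr sg n x \<notin> sing"
  shows "straight I (flow sg x) (pt sg 1)" unfolding straight_def
proof (intro ballI conjI)
  fix s assume s: "s \<in> I"
  have B: "flow sg x s \<in> Sp \<and> (\<exists>d>0. \<forall>k\<in>{0}. \<forall>\<sigma>. \<bar>k\<bar> < d \<longrightarrow> \<bar>\<sigma>\<bar> < d \<longrightarrow>
     flow sg (x + k) (s + \<sigma>) = ex (flow sg x s) (pt (k + sg * \<sigma>) \<sigma>))"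
    by (rule flow_box[OF x I[OF s]]) (use ns s in auto)
  then show "flow sg x s \<in> Sp" by blast
  obtain d where d: "d > 0" "\<forall>k\<in>{0}. \<forall>\<sigma>. \<bar>k\<bar> < d \<longrightarrow> \<bar>\<sigma>\<bar> < d \<longrightarrow>
     flow sg (x + k) (s + \<sigma>) = ex (flow sg x s) (pt (k + sg * \<sigma>) \<sigma>)" using conjunct2[OF B] by (elim exE conjE)
  have "flow sg x (s + \<sigma>) = ex (flow sg x s) (\<sigma> *\<^sub>R pt sg 1)" if "\<bar>\<sigma>\<bar> < d" for \<sigma>
  proof -
    have "\<sigma> *\<^sub>R pt sg 1 = pt (0 + sg * \<sigma>) \<sigma>" by (simp add: pt_eq_iff)
    then show ?thesis using d that by simp
  qed
  then show "\<forall>\<^sub>F \<sigma> in nhds 0. s + \<sigma> \<in> I \<longrightarrow> flow sg x (s + \<sigma>) = ex (flow sg x s) (\<sigma> *\<^sub>R pt sg 1)"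
    unfolding ev_nhds0_real using d(1) by blast
qed

text \<open>Going back by less than the height of both cylinders crosses at most one edge, and the
  only obstruction is that the point crossed is the cone point. Counterpart of
  \<open>no_straight_back\<close>.\<close>

lemma straight_back:
  assumes x: "x \<in> Dom" and h: "0 \<le> h" "h < roof x" and l: "0 < l" "l < roof x" "l < min 1 (w - 1)" and c: "x \<notin> sing \<or> l < h"
  shows "\<exists>p. straight {- l..0} p (pt sg 1) \<and> p 0 = pos sg x h"
proof -
  have shift: "straight {- l..0} (\<lambda>\<tau>. flow sg y (r + \<tau>)) (pt sg 1)" if "straight {r - l..r} (flow sg y) (pt sg 1)" for y r
    unfolding straight_def
  proof (intro ballI conjI)
    fix \<tau> assume \<tau>: "\<tau> \<in> {- l..0}"
    then have r: "r + \<tau> \<in> {r - l..r}" by simp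
    show "flow sg y (r + \<tau>) \<in> Sp" using straightD(1)[OF that r] .
    from straightD(2)[OF that r] show "\<forall>\<^sub>F s in nhds 0. \<tau> + s \<in> {- l..0} \<longrightarrow> flow sg y (r + (\<tau> + s)) = ex (flow sg y (r + \<tau>)) (s *\<^sub>R pt sg 1)"
      by eventually_elim (simp add: add.assoc)
  qed
  show ?thesis
  proof (cases "l < h")
    case True
    have "straight {h - l..h} (flow sg x) (pt sg 1)"
    proof (rule flow_straight[OF x])
      show "s > 0" if "s \<in> {h - l..h}" for s using that True by simp
      fix n :: nat assume "n > 0" "tm sg n x \<in> {h - l..h}"
      moreover have "tm sg 1 x \<le> tm sg n x" using \<open>n > 0\<close> by (intro tm_mono) simp
      ultimately show "itr sg n x \<notin> sing" using h by (simp add: tm_Suc)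
    qed
    then show ?thesis using shift flow_pos[OF h, of sg] by (intro exI[of _ "\<lambda>\<tau>. flow sg x (h + \<tau>)"]) simp
  next
    case False
    then have ns: "x \<notin> sing" using c by simp
    obtain b where b: "b \<in> Dom" "iet sg b = x" using iet_surj[OF x ns] by blast
    have rb: "l < roof b" using l(3) by (simp add: roof_def)
    have "straight {roof b + h - l..roof b + h} (flow sg b) (pt sg 1)"
    proof (rule flow_straight[OF b(1)])
      show "s > 0" if "s \<in> {roof b + h - l..roof b + h}" for s using that rb h by simp
      fix n :: nat assume n: "n > 0" "tm sg n b \<in> {roof b + h - l..roof b + h}"
      have "n = 1"
      proof (rule ccontr)
        assume "n \<noteq> 1"
        then have "tm sg 2 b \<le> tm sg n b" using n(1) by (intro tm_mono) simp
        moreover have "tm sg 2 b = roof b + roof x" using b by (simp add: tm_def numeral_2_eq_2)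
        ultimately show False using n(2) h by simp
      qed
      then show "itr sg n b \<notin> sing" using b ns by simp
    qed
    moreover have "flow sg b (roof b + h) = pos sg x h"
      using flow_shift[OF h(1), of sg b 1] flow_pos[OF h, of sg] b by (simp add: tm_Suc)
    ultimately show ?thesis using shift[of "roof b + h" b] by (intro exI[of _ "\<lambda>\<tau>. flow sg b (roof b + h + \<tau>)"]) simp
  qed
qed

lemma straight_pos:
  assumes x: "x \<in> Dom" shows "straight {0<..<roof x} (pos sg x) (pt sg 1)"
proof (rule straight_cong)
  show "straight {0<..<roof x} (flow sg x) (pt sg 1)"
  proof (rule flow_straight[OF x])
    fix n :: nat assume n: "n > 0" "tm sg n x \<in> {0<..<roof x}"
    have "tm sg 1 x \<le> tm sg n x" using n by (intro tm_mono) simp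
    then show "itr sg n x \<notin> sing" using n by (simp add: tm_Suc)
  qed simp
  show "flow sg x \<tau> = pos sg x \<tau>" if "\<tau> \<in> {0<..<roof x}" for \<tau> using that by (intro flow_pos) auto
qed

text \<open>This singles out the separatrices in a way that is invariant under affine maps.\<close>
lemma no_straight_back:
  assumes x: "x \<in> sing" and h: "0 < h" "h < roof x"
  shows "\<not> (\<exists>p. straight {- h..0} p (pt sg 1) \<and> p 0 = pos sg x h)"
proof
  assume "\<exists>p. straight {- h..0} p (pt sg 1) \<and> p 0 = pos sg x h"
  then obtain p where p: "straight {- h..0} p (pt sg 1)" "p 0 = pos sg x h" by blast
  have xD: "x \<in> Dom" using x w1 by (auto simp: sing_def Dom_def)
  have pp: "p \<tau> = pos sg x (h + \<tau>)" if "- h < \<tau>" "\<tau> \<le> 0" for \<tau>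
  proof (rule straight_unique[where I = "{- h<..0}" and u = "pt sg 1" and ?t0.0 = 0 and p = p and p' = "\<lambda>\<tau>. pos sg x (h + \<tau>)"])
    show "straight {- h<..0} p (pt sg 1)" by (rule straight_subset[OF p(1)]) auto
    show "straight {- h<..0} (\<lambda>\<tau>. pos sg x (h + \<tau>)) (pt sg 1)" unfolding straight_def
    proof (intro ballI conjI)
      fix \<tau> assume \<tau>: "\<tau> \<in> {- h<..0}"
      then have r: "h + \<tau> \<in> {0<..<roof x}" using h by simp
      note st = straight_pos[OF xD, of sg]
      show "pos sg x (h + \<tau>) \<in> Sp" using straightD(1)[OF st r] .
      from straightD(2)[OF st r] show "\<forall>\<^sub>F s in nhds 0. \<tau> + s \<in> {- h<..0} \<longrightarrow> pos sg x (h + (\<tau> + s)) = ex (pos sg x (h + \<tau>)) (s *\<^sub>R pt sg 1)"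
        by eventually_elim (use h in \<open>simp add: add.assoc\<close>)
    qed
  qed (use p(2) h that in auto)
  \<comment> \<open>The supposed path would reach \<open>q\<close> at time \<open>- h\<close>.
    Forward from \<open>q\<close> it is again a flow line, based at some \<open>y\<close>; comparing
    flow coordinates shortly afterwards identifies \<open>y\<close> with the singular
    \<open>x\<close> and \<open>q\<close> with the cone point.\<close>
  define q where "q = p (- h)"
  have q: "q \<in> Sp" unfolding q_def using straightD(1)[OF p(1), of "- h"] h by simp
  obtain d where d: "d > 0" "\<forall>s. \<bar>s\<bar> < d \<longrightarrow> - h + s \<in> {- h..0} \<longrightarrow> p (- h + s) = ex q (s *\<^sub>R pt sg 1)"
    using straightD(2)[OF p(1), of "- h"] h unfolding ev_nhds0_real q_def by auto
  obtain y r where y: "y \<in> Dom" "0 \<le> r" "r < roof y" "q = pos sg y r" using Sp_pos[OF q, of sg] by blast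
  have "\<exists>c>0. \<forall>s. 0 < s \<and> s < c \<longrightarrow> ex q (s *\<^sub>R pt sg 1) = pos sg y (r + s)"
  proof (cases "r = 0")
    case False
    then have r: "r \<in> {0<..<roof y}" using y by simp
    obtain c where c: "c > 0" "\<forall>s. \<bar>s\<bar> < c \<longrightarrow> r + s \<in> {0<..<roof y} \<longrightarrow> pos sg y (r + s) = ex q (s *\<^sub>R pt sg 1)"
      using straightD(2)[OF straight_pos[OF y(1), of sg] r] unfolding ev_nhds0_real y(4) by (elim exE conjE)
    then show ?thesis using y(3) r by (intro exI[of _ "min c (roof y - r)"]) auto
  next
    case True
    have ns: "y \<notin> sing" using pos_level[OF y(1), of sg] q y(4) True by (auto simp: sing_def)
    obtain b where b: "b \<in> Dom" "iet sg b = y" using iet_surj[OF y(1) ns] by blast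
    have st: "straight {0<..<roof b + roof y} (flow sg b) (pt sg 1)"
    proof (rule flow_straight[OF b(1)])
      fix n :: nat assume n: "n > 0" "tm sg n b \<in> {0<..<roof b + roof y}"
      have "n = 1"
      proof (rule ccontr)
        assume "n \<noteq> 1"
        then have "tm sg 2 b \<le> tm sg n b" using n(1) by (intro tm_mono) simp
        moreover have "tm sg 2 b = roof b + roof y" using b by (simp add: tm_def numeral_2_eq_2)
        ultimately show False using n(2) by simp
      qed
      then show "itr sg n b \<notin> sing" using b ns by simp
    qed simp
    have fb: "flow sg b (roof b + s) = pos sg y s" if "0 \<le> s" "s < roof y" for s
      using flow_shift[OF that(1), of sg b 1] flow_pos[OF that, of sg] b by (simp add: tm_Suc)
    have r: "roof b \<in> {0<..<roof b + roof y}" using roof_pos by simp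
    have qb: "flow sg b (roof b) = q" using fb[of 0] roof_pos[of y] y(4) True by simp
    obtain c where c: "c > 0" "\<forall>s. \<bar>s\<bar> < c \<longrightarrow> roof b + s \<in> {0<..<roof b + roof y} \<longrightarrow> flow sg b (roof b + s) = ex q (s *\<^sub>R pt sg 1)"
      using straightD(2)[OF st r] unfolding ev_nhds0_real qb by (elim exE conjE)
    have "ex q (s *\<^sub>R pt sg 1) = pos sg y (r + s)" if "0 < s \<and> s < min c (roof y)" for s
      using c(2)[rule_format, of s] fb[of s] that True roof_pos[of b] by simp
    then show ?thesis using c(1) roof_pos[of y] by (intro exI[of _ "min c (roof y)"]) simp
  qed
  then obtain c where c: "c > 0" "\<forall>s. 0 < s \<and> s < c \<longrightarrow> ex q (s *\<^sub>R pt sg 1) = pos sg y (r + s)" by (elim exE conjE)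
  define M where "M = Min {c, d, h, roof y - r}"
  have M0: "0 < M" unfolding M_def using c(1) d(1) h y by (simp add: Min_gr_iff)
  have Ml: "M \<le> c" "M \<le> d" "M \<le> h" "M \<le> roof y - r" unfolding M_def by (rule Min_le; simp)+
  define s where "s = M / 2"
  have s: "0 < s" using M0 by (simp add: s_def)
  have sl: "s < c" "s < d" "s < h" "r + s < roof y" using Ml M0 unfolding s_def by linarith+
  have "pos sg x s = p (- h + s)" using pp[of "- h + s"] s sl by simp
  also have "\<dots> = pos sg y (r + s)" using d(2)[rule_format, of s] c(2)[rule_format, of s] s sl by simp
  finally have e: "pos sg x s = pos sg y (r + s)" .
  have "x = y \<and> s = r + s" by (rule pos_inj[where sg = sg]) (use xD y s sl h e pos_Sp[of s x sg] in simp_all)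
  then have "y \<in> sing" "q = pos sg y 0" using x y(4) by auto
  then show False using pos_level[OF y(1), of sg] q by (auto simp: sing_def)
qed

text \<open>A marking height below both roofs: the three points at this height above the singular
  base points stand for the outgoing separatrices.\<close>

definition hh :: real where "hh = min 1 (w - 1) / 2"

lemma hh: "0 < hh" "hh < roof x" "hh < min 1 (w - 1)" using w1 by (auto simp: hh_def roof_def)

text \<open>Straight paths in a direction fixed by \<open>A\<close> can be carried over by the map
  and back by its inverse, so their existence through a point is an invariant.\<close>

lemma loc_aff_straight_iff:
  assumes A: "loc_aff A \<phi>" and v: "A *v v = v" and q: "q \<in> Sp" and B: "A ** B = mat 1"
  shows "(\<exists>p. straight I p v \<and> p t0 = \<phi> q) \<longleftrightarrow> (\<exists>p. straight I p v \<and> p t0 = q)"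
proof
  assume "\<exists>p. straight I p v \<and> p t0 = q"
  then obtain p where p: "straight I p v" "p t0 = q" by blast
  then show "\<exists>p. straight I p v \<and> p t0 = \<phi> q" using straight_aff[OF A p(1)] v by (intro exI[of _ "\<lambda>\<tau>. \<phi> (p \<tau>)"]) simp
next
  assume "\<exists>p. straight I p v \<and> p t0 = \<phi> q"
  then obtain p where p: "straight I p v" "p t0 = \<phi> q" by blast
  have "B ** A = mat 1" using B matrix_left_right_inverse by blast
  then have "B *v v = v" by (metis v matrix_vector_mul_assoc matrix_vector_mul_lid)
  moreover have "inv_into Sp \<phi> (\<phi> q) = q" using loc_affD(1)[OF A] q by (meson bij_betw_imp_inj_on inv_into_f_f)
  ultimately show "\<exists>p. straight I p v \<and> p t0 = q" using straight_aff[OF loc_aff_inv[OF A B] p(1)] p(2)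
    by (intro exI[of _ "\<lambda>\<tau>. inv_into Sp \<phi> (p \<tau>)"]) simp
qed

lemma shear_mul: "shear sg a ** shear sg b = shear sg (a + b)"
  by (simp add: vec_eq_iff forall_2 matrix_matrix_mult_def sum_2 algebra_simps power2_eq_square)

lemma shear_0: "shear sg 0 = mat 1" by (simp add: vec_eq_iff forall_2 mat_def)

lemma shear_v: "shear sg a *v pt sg 1 = pt sg 1" by (simp add: shear_mult pt_eq_iff)

lemma loc_aff_pow: "loc_aff (shear sg t) \<phi> \<Longrightarrow> loc_aff (shear sg (of_nat m * t)) (\<phi> ^^ m)"
proof (induction m)
  case (Suc m)
  have "loc_aff (shear sg (t + of_nat m * t)) (\<phi> \<circ> (\<phi> ^^ m))"
    using loc_aff_comp[OF Suc.IH[OF Suc.prems] Suc.prems] unfolding shear_mul .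
  then show ?case unfolding funpow.simps by (simp only: of_nat_Suc distrib_right mult_1)
qed (simp add: shear_0 loc_aff_id)

text \<open>How far one can go straight back is invariant, so a marked point goes to a point above a
  singular base at height at most \<open>hh\<close>; a smaller height is excluded because the
  original point could go back that far. A power of the resulting permutation of marked points is
  trivial.\<close>

lemma sep_fixed:
  assumes A: "loc_aff (shear sg t) \<phi>"
  shows "\<exists>m>0. \<forall>x\<in>sing. (\<phi> ^^ m) (pos sg x hh) = pos sg x hh"
proof -
  define X where "X = (\<lambda>x. pos sg x hh) ` sing"
  have fin: "finite X" by (simp add: X_def sing_def)
  have sD: "x \<in> Dom" if "x \<in> sing" for x using that w1 by (auto simp: sing_def Dom_def)
  have XS: "pos sg x hh \<in> Sp" for x by (rule pos_Sp[OF hh(1,2)])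
  have inv: "shear sg t ** shear sg (- t) = mat 1" by (simp add: shear_mul shear_0)
  have iff: "(\<exists>p. straight I p (pt sg 1) \<and> p 0 = \<phi> (pos sg x hh)) \<longleftrightarrow> (\<exists>p. straight I p (pt sg 1) \<and> p 0 = pos sg x hh)" for I x
    by (rule loc_aff_straight_iff[OF A shear_v XS inv])
  have im: "\<phi> (pos sg x hh) \<in> X" if x: "x \<in> sing" for x
  proof -
    obtain y h where y: "y \<in> Dom" "0 \<le> h" "h < roof y" "\<phi> (pos sg x hh) = pos sg y h"
      using Sp_pos[OF loc_affD(2)[OF A XS[of x]], of sg] by (elim exE conjE)
    have nb: "\<not> (\<exists>p. straight {- hh..0} p (pt sg 1) \<and> p 0 = pos sg y h)"
      unfolding y(4)[symmetric] iff by (rule no_straight_back[OF x hh(1,2)])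
    have "\<not> (y \<notin> sing \<or> hh < h)"
    proof
      assume c: "y \<notin> sing \<or> hh < h"
      show False by (rule notE[OF nb]) (rule straight_back[OF y(1-3) hh(1,2,3) c])
    qed
    then have yh: "y \<in> sing" "h \<le> hh" by simp_all
    have h0: "h \<noteq> 0" using pos_level[OF y(1), of sg] loc_affD(2)[OF A XS, of x] y(4) yh(1) by (auto simp: sing_def)
    have "h = hh"
    proof (rule ccontr)
      assume "h \<noteq> hh"
      then have hl: "0 < h" "h < hh" using yh(2) y(2) h0 by simp_all
      have hm: "h < min 1 (w - 1)" "h < roof x" using hl hh(3) hh(2)[of x] by linarith+
      have "\<not> (\<exists>p. straight {- h..0} p (pt sg 1) \<and> p 0 = pos sg x hh)"
        unfolding iff[symmetric] y(4) by (rule no_straight_back[OF yh(1) hl(1) y(3)])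
      then show False by (rule notE) (rule straight_back[OF sD[OF x] less_imp_le[OF hh(1)] hh(2) hl(1) hm(2,1) disjI2[OF hl(2)]])
    qed
    then show ?thesis using yh y by (simp add: X_def)
  qed
  have fX: "\<phi> ` X \<subseteq> X" using im by (auto simp: X_def)
  have "inj_on \<phi> X"
    by (rule inj_on_subset[OF bij_betw_imp_inj_on[OF loc_affD(1)[OF A]]]) (use XS in \<open>auto simp: X_def\<close>)
  from funpow_finite_id[OF fin fX this] obtain m where "m > 0" "\<forall>x\<in>X. (\<phi> ^^ m) x = x" by (elim exE conjE)
  then show ?thesis unfolding X_def by (intro exI[of _ m]) simp
qed

definition fixpos :: "real \<Rightarrow> ((real^2) set \<Rightarrow> (real^2) set) \<Rightarrow> real \<Rightarrow> bool" where
  "fixpos sg \<phi> z \<longleftrightarrow> (\<forall>h. 0 < h \<and> h < roof z \<longrightarrow> \<phi> (pos sg z h) = pos sg z h)"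

lemma fixpos_sing:
  assumes A: "loc_aff (shear sg t) \<phi>" and x: "x \<in> Dom" "\<phi> (pos sg x hh) = pos sg x hh"
  shows "fixpos sg \<phi> x" unfolding fixpos_def
proof (intro allI impI)
  fix h assume h: "0 < h \<and> h < roof x"
  have s: "straight {0<..<roof x} (\<lambda>\<tau>. \<phi> (pos sg x \<tau>)) (pt sg 1)"
    using straight_aff[OF A straight_pos[OF x(1), of sg]] unfolding shear_v .
  show "\<phi> (pos sg x h) = pos sg x h"
    by (rule straight_unique[OF s straight_pos[OF x(1), of sg], where ?t0.0 = hh and t = h]) (use x hh h in simp_all)
qed

lemma fixpos_iet:
  assumes A: "loc_aff (shear sg t) \<phi>" and z: "z \<in> Dom" "fixpos sg \<phi> z" and ns: "iet sg z \<notin> sing"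
  shows "fixpos sg \<phi> (iet sg z)" unfolding fixpos_def
proof (intro allI impI)
  let ?y = "iet sg z" let ?I = "{0<..<roof z + roof (iet sg z)}"
  fix h assume h: "0 < h \<and> h < roof ?y"
  have st: "straight ?I (flow sg z) (pt sg 1)"
  proof (rule flow_straight[OF z(1)])
    fix n :: nat assume n: "n > 0" "tm sg n z \<in> ?I"
    have "n = 1"
    proof (rule ccontr)
      assume "n \<noteq> 1"
      then have "tm sg 2 z \<le> tm sg n z" using n(1) by (intro tm_mono) simp
      moreover have "tm sg 2 z = roof z + roof ?y" by (simp add: tm_def numeral_2_eq_2)
      ultimately show False using n(2) by simp
    qed
    then show "itr sg n z \<notin> sing" using ns by simp
  qed simp
  have s: "straight ?I (\<lambda>\<tau>. \<phi> (flow sg z \<tau>)) (pt sg 1)" using straight_aff[OF A st] unfolding shear_v .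
  have f1: "flow sg z hh = pos sg z hh" by (rule flow_pos) (use hh(1,2) in \<open>simp_all add: less_imp_le\<close>)
  have f2: "flow sg z (roof z + h) = pos sg ?y h"
    using flow_shift[of h sg z 1] flow_pos[of h ?y sg] h by (simp add: tm_Suc)
  have "\<phi> (flow sg z (roof z + h)) = flow sg z (roof z + h)"
  proof (rule straight_unique[OF s st, where ?t0.0 = hh and t = "roof z + h"])
    show "hh \<in> ?I" "roof z + h \<in> ?I" using h hh(1) hh(2)[of z] roof_pos[of z] roof_pos[of ?y] by simp_all
    show "\<phi> (flow sg z hh) = flow sg z hh" using z(2)[unfolded fixpos_def] hh(1) hh(2)[of z] unfolding f1 by simp
  qed simp
  then show "\<phi> (pos sg ?y h) = pos sg ?y h" unfolding f2 .
qed

text \<open>The base points met by the forward separatrices. \<open>iet\<close> has a value at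
  singular points too, so the list goes on after a separatrix has returned to the cone point; this
  makes the set invariant.\<close>

definition orbs :: "real \<Rightarrow> real set" where "orbs sg = {itr sg n x | n x. x \<in> sing}"

lemma orbsI: "x \<in> sing \<Longrightarrow> itr sg n x \<in> orbs sg" by (auto simp: orbs_def)

lemma sing_Dom: "x \<in> sing \<Longrightarrow> x \<in> Dom" using w1 by (auto simp: sing_def Dom_def)

lemma orbs_Dom: "z \<in> orbs sg \<Longrightarrow> z \<in> Dom" using iet_pow_Dom[OF sing_Dom] by (auto simp: orbs_def)

text \<open>Being fixed is carried along a separatrix by uniqueness of straight paths; at a singular
  base point it starts afresh from the assumption.\<close>

lemma orbs_fixpos:
  assumes A: "loc_aff (shear sg t) \<phi>" and fx: "\<forall>x\<in>sing. \<phi> (pos sg x hh) = pos sg x hh" and z: "z \<in> orbs sg"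
  shows "fixpos sg \<phi> z"
proof -
  have "fixpos sg \<phi> (itr sg n x)" if x: "x \<in> sing" for n x
  proof (induction n)
    case 0
    then show ?case using fixpos_sing[OF A sing_Dom[OF x]] fx x by simp
  next
    case (Suc n)
    show ?case
    proof (cases "itr sg (Suc n) x \<in> sing")
      case True
      then show ?thesis using fixpos_sing[OF A sing_Dom[OF True]] fx by simp
    next
      case False
      then show ?thesis using fixpos_iet[OF A iet_pow_Dom[OF sing_Dom[OF x]] Suc] by simp
    qed
  qed
  then show ?thesis using z by (auto simp: orbs_def)
qed

lemma Sp_hausdorff:
  assumes "q \<in> Sp" "r \<in> Sp" "q \<noteq> r"
  shows "\<exists>U V. U \<inter> V = {} \<and> (\<forall>\<^sub>F h in nhds 0. ex q h \<in> U) \<and> (\<forall>\<^sub>F h in nhds 0. ex r h \<in> V)"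
proof -
  have "q \<in> topspace S" "r \<in> topspace S" using assms Sp_subset by blast+
  then obtain U V where UV: "openin S U" "openin S V" "q \<in> U" "r \<in> V" "disjnt U V"
    using Hausdorff_S assms(3) unfolding Hausdorff_space_def by (elim allE impE) blast+
  have "openin S (U \<inter> Sp)" "openin S (V \<inter> Sp)" using UV openin_Sp by blast+
  then have ev: "\<forall>\<^sub>F h in nhds 0. ex q h \<in> U \<inter> Sp" "\<forall>\<^sub>F h in nhds 0. ex r h \<in> V \<inter> Sp"
    using open_Sp_iff[of "U \<inter> Sp"] open_Sp_iff[of "V \<inter> Sp"] UV assms by blast+
  have "(U \<inter> Sp) \<inter> (V \<inter> Sp) = {}" using UV(5) unfolding disjnt_def by blast
  then show ?thesis using ev by (intro exI[of _ "U \<inter> Sp"] exI[of _ "V \<inter> Sp"] conjI)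
qed

text \<open>Points of an infinite separatrix would accumulate at a point near which the affine map is not
  the identity on a horizontal line.\<close>
lemma fixed_accumulation:
  assumes A: "loc_aff (shear sg t) \<phi>" and t: "t \<noteq> 0" and q: "q \<in> Sp"
    and acc: "\<And>e. e > 0 \<Longrightarrow> \<exists>d. d \<noteq> 0 \<and> \<bar>d\<bar> < e \<and> \<phi> (ex q (pt d 0)) = ex q (pt d 0)"
  shows False
proof -
  note ev = loc_affD(3)[OF A q]
  have acc': "\<exists>d. d \<noteq> 0 \<and> \<phi> (ex q (pt d 0)) = ex q (pt d 0) \<and> Q (pt d 0)" if "eventually Q (nhds 0)" for Q
  proof -
    obtain e where e: "e > 0" "\<And>u. norm u < e \<Longrightarrow> Q u"
      using \<open>eventually Q (nhds 0)\<close> unfolding eventually_nhds_metric by (auto simp: dist_norm)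
    from acc[OF e(1)] obtain d where d: "d \<noteq> 0" "\<bar>d\<bar> < e" "\<phi> (ex q (pt d 0)) = ex q (pt d 0)" by (elim exE conjE)
    have "norm (pt d 0) < e" using norm_pt_axis(2)[of d] d by simp
    then show ?thesis using d e(2) by (intro exI[of _ d]) simp
  qed
  have "\<phi> q = q"
  proof (rule ccontr)
    assume ne: "\<phi> q \<noteq> q"
    obtain U V where UV: "U \<inter> V = {}" "\<forall>\<^sub>F h in nhds 0. ex (\<phi> q) h \<in> U" "\<forall>\<^sub>F h in nhds 0. ex q h \<in> V"
      using Sp_hausdorff[OF loc_affD(2)[OF A q] q ne] by (elim exE conjE)
    from acc'[OF eventually_conj[OF ev eventually_conj[OF ev_matrix[OF UV(2), of "shear sg t"] UV(3)]]]
    obtain d where "\<phi> (ex q (pt d 0)) = ex q (pt d 0)" "\<phi> (ex q (pt d 0)) \<in> U" "ex q (pt d 0) \<in> V" by (elim exE conjE) simp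
    then show False using UV(1) by auto
  qed
  obtain e where e: "nice q e" using Sp_nice[OF q] by blast
  note sm = ev_norm_less[OF nice_pos[OF e]]
  from acc'[OF eventually_conj[OF ev eventually_conj[OF sm ev_matrix[OF sm, of "shear sg t"]]]]
  obtain d where d: "d \<noteq> 0" "ex q (pt d 0) = ex q (shear sg t *v pt d 0)" "norm (pt d 0) < e" "norm (shear sg t *v pt d 0) < e"
    unfolding \<open>\<phi> q = q\<close> by (elim exE conjE) simp
  have "pt d 0 = shear sg t *v pt d 0" by (rule ex_inj[OF e d(3,4,2)])
  then show False using d(1) t by (simp add: shear_mult)
qed

text \<open>The points at height \<open>hh\<close> over \<open>orbs sg\<close> are all fixed.
  Infinitely many of them would accumulate horizontally in the punctured surface, against
  \<open>fixed_accumulation\<close>. The floors are treated separately because \<open>pos\<close>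
  uses different coordinates on them.\<close>

lemma orbs_finite:
  assumes A: "loc_aff (shear sg t) \<phi>" and t: "t \<noteq> 0" and fx: "\<forall>x\<in>sing. \<phi> (pos sg x hh) = pos sg x hh"
  shows "finite (orbs sg)"
proof -
  have fin: "finite E" if E: "E \<subseteq> orbs sg" and q: "\<And>l. q l \<in> Sp"
    and loc: "\<And>l. \<forall>\<^sub>F u in nhds 0. \<forall>d. u = pt d 0 \<longrightarrow> l + d \<in> E \<longrightarrow> ex (q l) u = pos sg (l + d) hh" for E q
  proof (rule ccontr)
    assume inf: "infinite E"
    have "E \<subseteq> {0..w + 1}"
    proof
      fix x assume "x \<in> E"
      then have "x \<in> Dom" using E orbs_Dom[of x sg] by blast
      then show "x \<in> {0..w + 1}" by (simp add: Dom_def)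
    qed
    then obtain l where l: "l islimpt E"
      using compact_Icc[of 0 "w + 1"] inf unfolding compact_eq_Bolzano_Weierstrass by metis
    show False
    proof (rule fixed_accumulation[OF A t q[of l]])
      fix e :: real assume e: "e > 0"
      obtain r where r: "r > 0" "\<And>u. norm u < r \<Longrightarrow> \<forall>d. u = pt d 0 \<longrightarrow> l + d \<in> E \<longrightarrow> ex (q l) u = pos sg (l + d) hh"
        using loc[of l] unfolding eventually_nhds_metric dist_norm diff_zero by (elim exE conjE) blast
      have er: "0 < min e r" using e r(1) by simp
      from l[unfolded islimpt_approachable, rule_format, OF er]
      obtain x where x: "x \<in> E" "x \<noteq> l" "dist x l < min e r" by (elim bexE conjE)
      define d where "d = x - l"
      have d: "d \<noteq> 0" "\<bar>d\<bar> < e" "\<bar>d\<bar> < r" "l + d = x" using x by (auto simp: d_def dist_real_def)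
      have E2: "ex (q l) (pt d 0) = pos sg x hh" using r(2)[of "pt d 0"] d x(1) norm_pt_axis(2)[of d] by simp
      have "x \<in> orbs sg" using E x(1) by blast
      note this = orbs_fixpos[OF A fx this]
      then have "\<phi> (pos sg x hh) = pos sg x hh" using hh(1) hh(2)[of x] unfolding fixpos_def by simp
      then show "\<exists>d. d \<noteq> 0 \<and> \<bar>d\<bar> < e \<and> \<phi> (ex (q l) (pt d 0)) = ex (q l) (pt d 0)" using d(1,2) E2 by (intro exI[of _ d]) simp
    qed
  qed
  have h1: "0 < hh" "hh < 1" "1 < 1 + hh" "1 + hh < w" using hh(1,3) by simp_all
  have "finite {z \<in> orbs sg. z \<le> w}"
  proof (rule fin[where q = "\<lambda>l. low (l + sg * hh) hh"])
    show "low (l + sg * hh) hh \<in> Sp" for l using low_Sp h1 by blast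
    show "\<forall>\<^sub>F u in nhds 0. \<forall>d. u = pt d 0 \<longrightarrow> l + d \<in> {z \<in> orbs sg. z \<le> w} \<longrightarrow> ex (low (l + sg * hh) hh) u = pos sg (l + d) hh" for l
      using ex_low[OF h1(1,2), of "l + sg * hh"] 
    proof eventually_elim
      case (elim u)
      show ?case
      proof (intro allI impI)
        fix d assume u: "u = pt d 0" and d: "l + d \<in> {z \<in> orbs sg. z \<le> w}"
        show "ex (low (l + sg * hh) hh) u = pos sg (l + d) hh" using elim d h1 unfolding u by (simp add: pos_pos algebra_simps)
      qed
    qed
  qed simp
  moreover have "finite {z \<in> orbs sg. \<not> z \<le> w}"
  proof (rule fin[where q = "\<lambda>l. up (l - 1 + sg * hh) (1 + hh)"])
    show "up (l - 1 + sg * hh) (1 + hh) \<in> Sp" for l using up_Sp h1 by blast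
    show "\<forall>\<^sub>F u in nhds 0. \<forall>d. u = pt d 0 \<longrightarrow> l + d \<in> {z \<in> orbs sg. \<not> z \<le> w} \<longrightarrow> ex (up (l - 1 + sg * hh) (1 + hh)) u = pos sg (l + d) hh" for l
      using ex_up[OF h1(3,4), of "l - 1 + sg * hh"] 
    proof eventually_elim
      case (elim u)
      show ?case
      proof (intro allI impI)
        fix d assume u: "u = pt d 0" and d: "l + d \<in> {z \<in> orbs sg. \<not> z \<le> w}"
        show "ex (up (l - 1 + sg * hh) (1 + hh)) u = pos sg (l + d) hh" using elim d h1 unfolding u by (simp add: pos_pos algebra_simps)
      qed
    qed
  qed simp
  moreover have "orbs sg = {z \<in> orbs sg. z \<le> w} \<union> {z \<in> orbs sg. \<not> z \<le> w}" by blast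
  ultimately show ?thesis by (metis finite_UnI)
qed

lemma orbs_good: "finite (orbs sg) \<Longrightarrow> good sg (orbs sg)" unfolding good_def
proof (intro conjI)
  show "orbs sg \<subseteq> Dom" using orbs_Dom by blast
  show "sing \<subseteq> orbs sg" using orbsI[of _ 0] by auto
  show "iet sg ` orbs sg \<subseteq> orbs sg"
  proof
    fix y assume "y \<in> iet sg ` orbs sg"
    then obtain n x where "x \<in> sing" "y = itr sg (Suc n) x" by (auto simp: orbs_def)
    then show "y \<in> orbs sg" using orbsI by blast
  qed
qed

text \<open>If both \<open>hh\<close> and \<open>hh / 2\<close> failed, two return times would
  differ by \<open>hh / 2\<close>, less than the height of any cylinder. It keeps the image of the
  left end of a cross section off the edges.\<close>

lemma generic_height:
  shows "\<exists>h. 0 < h \<and> h \<le> hh \<and> (\<forall>n. h + c \<noteq> tm sg n z)"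
proof (rule ccontr)
  assume a: "\<not> ?thesis"
  define m where "m = min 1 (w - 1)"
  have m: "m > 0" "m \<le> roof y" for y using w1 by (auto simp: m_def roof_def)
  have "\<exists>n. hh + c = tm sg n z" "\<exists>n. hh / 2 + c = tm sg n z" using a hh(1) by auto
  then obtain i j where ij: "hh + c = tm sg i z" "hh / 2 + c = tm sg j z" by blast
  then have "tm sg j z < tm sg i z" using hh(1) by simp
  then have "j < i" using tm_mono[of i j sg z] by (cases "j < i") auto
  then have "tm sg (Suc j) z \<le> tm sg i z" by (intro tm_mono) simp
  then show False using ij hh(1,3) m(2)[of "itr sg j z"] unfolding tm_Suc m_def by simp
qed

text \<open>The left end of the gap of \<open>z\<close>, at height \<open>h\<close>.\<close>
definition lend :: "real \<Rightarrow> real set \<Rightarrow> real \<Rightarrow> real \<Rightarrow> (real^2) set" where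
  "lend sg F z h = (if z \<le> w then low (prv F z + sg * h) h else up (prv F z - 1 + sg * h) (1 + h))"

lemma lend_Sp: "0 < h \<Longrightarrow> h < roof z \<Longrightarrow> lend sg F z h \<in> Sp"
  using low_Sp up_Sp by (auto simp: lend_def roof_def split: if_splits)

lemma lend_ex:
  assumes g: "good sg F" and z: "z \<in> F" and h: "0 < h" "h < roof z"
  shows "\<exists>d>0. \<forall>\<delta> s. 0 < \<delta> \<longrightarrow> \<delta> < d \<longrightarrow> \<bar>s\<bar> < d \<longrightarrow>
     pos sg (z - (gap F z - \<delta>)) (h + s) = ex (lend sg F z h) (pt (\<delta> + sg * s) s)"
proof -
  have gp: "gap F z > 0" using gap_pos goodD(1,2)[OF g] z by (auto simp: Dom_def)
  define c where "c = min h (roof z - h)"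
  have c: "c > 0" using h by (simp add: c_def)
  have ev: "\<forall>\<^sub>F u in nhds 0. ex (lend sg F z h) u = (if z \<le> w then low (prv F z + sg * h + u $ 1) (h + u $ 2)
     else up (prv F z - 1 + sg * h + u $ 1) (1 + h + u $ 2))"
  proof (cases "z \<le> w")
    case True
    then show ?thesis using ex_low[of h "prv F z + sg * h"] h by (simp add: lend_def roof_def)
  next
    case False
    then show ?thesis using ex_up[of "1 + h" "prv F z - 1 + sg * h"] h by (simp add: lend_def roof_def)
  qed
  obtain d where d: "d > 0" "\<And>k s. \<bar>k\<bar> < d \<Longrightarrow> \<bar>s\<bar> < d \<Longrightarrow>
     ex (lend sg F z h) (pt (k + sg * s) s) = (if z \<le> w then low (prv F z + sg * h + (k + sg * s)) (h + s)
     else up (prv F z - 1 + sg * h + (k + sg * s)) (1 + h + s)) \<and> \<bar>k + sg * s\<bar> < c \<and> \<bar>s\<bar> < c"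
    using ev_sheared[OF eventually_conj[OF ev ev_lt[OF c]], of sg] unfolding pt_nth
    by (elim exE conjE) (rule that, assumption, iprover)
  have "pos sg (z - (gap F z - \<delta>)) (h + s) = ex (lend sg F z h) (pt (\<delta> + sg * s) s)"
    if k: "0 < \<delta>" "\<delta> < min d (gap F z)" "\<bar>s\<bar> < min d (gap F z)" for \<delta> s
  proof -
    have E: "ex (lend sg F z h) (pt (\<delta> + sg * s) s) = (if z \<le> w then low (prv F z + sg * h + (\<delta> + sg * s)) (h + s)
     else up (prv F z - 1 + sg * h + (\<delta> + sg * s)) (1 + h + s))" "\<bar>s\<bar> < c"
      using d(2)[of \<delta> s] k by simp_all
    have b: "0 < h + s" using E(2) by (simp add: c_def abs_less_iff)
    have zd: "z - (gap F z - \<delta>) = prv F z + \<delta>" by (simp add: gap_def)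
    have sd: "prv F z + \<delta> \<le> w \<longleftrightarrow> z \<le> w" using gap_shift(3)[OF g z, of "gap F z - \<delta>"] k unfolding zd by simp
    show ?thesis unfolding E(1) zd using sd b by (simp add: pos_pos algebra_simps)
  qed
  then show ?thesis using d(1) gp by (intro exI[of _ "min d (gap F z)"]) simp
qed

text \<open>The point determines the height and \<open>prv F z\<close>, and then
  \<open>z = prv F z + gap F z\<close>.\<close>

lemma lend_inj:
  assumes g: "good sg F" and z: "z \<in> F" "0 < h" "h < roof z" and z': "z' \<in> F" "0 < h'" "h' < roof z'"
    and gp: "gap F z = gap F z'" and e: "lend sg F z h = lend sg F z' h'"
  shows "z = z' \<and> h = h'"
proof -
  note D = goodD[OF g]
  have p: "z > 0" "z' > 0" "z \<le> w + 1" "z' \<le> w + 1" using D(2) z(1) z'(1) by (auto simp: Dom_def)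
  note PR = prv_props[OF D(1) p(1)] and PR' = prv_props[OF D(1) p(2)]
  have zz: "z = prv F z + gap F z" "z' = prv F z' + gap F z'" by (simp_all add: gap_def)
  have w0: "w > 0" using w1 by simp
  show ?thesis
  proof (cases "z \<le> w"; cases "z' \<le> w")
    assume c: "z \<le> w" "z' \<le> w"
    have "h = h' \<and> (\<exists>k. prv F z + sg * h = prv F z' + sg * h' + w * of_int k)"
      by (rule low_eq[THEN iffD1]) (use e z z' c in \<open>simp_all add: lend_def roof_def\<close>)
    then obtain k where k0: "h = h'" "prv F z + sg * h = prv F z' + sg * h' + w * of_int k" by (elim conjE exE)
    then have k: "h = h'" "prv F z = prv F z' + w * of_int k" by simp_all
    have r: "0 \<le> prv F z" "prv F z < w" "0 \<le> prv F z'" "prv F z' < w" using PR(1,2) PR'(1,2) c by simp_all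
    have "prv F z = prv F z'" using wrap_eq[OF r(3,4) k(2)] wrap_eq[OF r(1,2), of "prv F z" 0] by simp
    then have "z = z'" using zz gp by linarith
    then show ?thesis using k by blast
  next
    assume c: "\<not> z \<le> w" "\<not> z' \<le> w"
    have u: "up (prv F z - 1 + sg * h) (1 + h) = up (prv F z' - 1 + sg * h') (1 + h')" using e c by (simp add: lend_def)
    have "h = h'" "\<exists>k. prv F z - 1 + sg * h = prv F z' - 1 + sg * h' + of_int k"
      using up_eq[OF _ _ _ _ u] z z' c by (simp_all add: roof_def)
    then obtain k where k0: "h = h'" "prv F z - 1 + sg * h = prv F z' - 1 + sg * h' + of_int k" by (elim exE)
    then have k: "h = h'" "prv F z = prv F z' + of_int k" by simp_all
    have r: "w \<le> prv F z" "prv F z < w + 1" "w \<le> prv F z'" "prv F z' < w + 1"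
      using PR(2) PR'(2) PR(5)[OF D(4)] PR'(5)[OF D(4)] c p by simp_all
    have "of_int k < (1::real)" "of_int k > (-1::real)" using k r by linarith+
    then have "k = 0" by linarith
    then have "z = z'" using k(2) zz gp by simp
    then show ?thesis using k by blast
  next
    assume c: "z \<le> w" "\<not> z' \<le> w"
    then show ?thesis using e low_not_up[of h "1 + h'"] z z' by (simp add: lend_def roof_def)
  next
    assume c: "\<not> z \<le> w" "z' \<le> w"
    then show ?thesis using e[symmetric] low_not_up[of h' "1 + h"] z z' by (simp add: lend_def roof_def)
  qed
qed

text \<open>The left end of a gap is the right end of the preceding one, cyclically in each floor
  (\<open>w\<close> for \<open>0\<close>, \<open>w + 1\<close> for \<open>w\<close>), and the flow
  segments above right ends are fixed.\<close>

lemma lend_fixed: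
  assumes g: "good sg F" and z: "z \<in> F" and h: "0 < h" "h < roof z" and fx: "\<And>z. z \<in> F \<Longrightarrow> fixpos sg \<phi> z"
  shows "\<phi> (lend sg F z h) = lend sg F z h"
proof -
  note D = goodD[OF g]
  have p: "z > 0" "z \<le> w + 1" using D(2) z by (auto simp: Dom_def)
  note PR = prv_props[OF D(1) p(1)]
  have "\<exists>y\<in>F. h < roof y \<and> lend sg F z h = pos sg y h"
  proof (cases "z \<le> w")
    case True
    show ?thesis
    proof (cases "prv F z = 0")
      case T: True
      have "lend sg F z h = low (w + sg * h) h" unfolding lend_def using True T
        by (simp, intro low_per[where k = "-1"]) (use h True in \<open>simp_all add: roof_def\<close>)
      then show ?thesis using h True D(4) by (intro bexI[of _ w]) (simp_all add: pos_pos roof_def)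
    next
      case F: False
      then show ?thesis using PR(2,4) h True by (intro bexI[of _ "prv F z"]) (simp_all add: pos_pos roof_def lend_def)
    qed
  next
    case False
    then have pw: "prv F z \<ge> w" using PR(5)[OF D(4)] by simp
    show ?thesis
    proof (cases "prv F z = w")
      case T: True
      have "lend sg F z h = up (w + sg * h) (1 + h)" unfolding lend_def using False T
        by (simp, intro up_per[where k = "-1"]) (use h False in \<open>simp_all add: roof_def\<close>)
      then show ?thesis using h False D(5) by (intro bexI[of _ "w + 1"]) (simp_all add: pos_pos roof_def)
    next
      case F: False
      then show ?thesis using pw PR(4) w1 h False by (intro bexI[of _ "prv F z"]) (auto simp add: pos_pos roof_def lend_def)
    qed
  qed
  then obtain y where y: "y \<in> F" "h < roof y" "lend sg F z h = pos sg y h" by (elim bexE conjE)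
  then show ?thesis using fx[OF y(1)] h(1) unfolding fixpos_def by simp
qed

text \<open>The image of the cross section of a cylinder is straight and starts at a fixed point, hence is
  sheared along the flow; as its other end is fixed too, the shear is a multiple of the period.\<close>
lemma twist_closes:
  assumes A: "loc_aff (shear sg t) \<phi>" and t: "t > 0" and g: "good sg F"
    and fx: "\<And>z. z \<in> F \<Longrightarrow> fixpos sg \<phi> z" and z: "z \<in> F"
  shows "\<exists>n. itr sg n z = z \<and> tm sg n z = t * gap F z"
proof -
  note D = goodD[OF g]
  have zD: "z \<in> Dom" using z D(2) by blast
  define gp where "gp = gap F z"
  have gp: "gp > 0" unfolding gp_def using gap_pos[OF D(1)] zD by (auto simp: Dom_def)
  obtain h where h: "0 < h" "h \<le> hh" and hn: "\<forall>n. h + t * gp \<noteq> tm sg n z" using generic_height by blast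
  have hr: "h < roof y" for y using h(2) hh(2)[of y] by simp
  have tg: "t * gp > 0" using t gp by simp
  then have "0 \<le> h + t * gp" using h by simp
  from tm_piece[OF this, of sg z] obtain n where "tm sg n z \<le> h + t * gp" "h + t * gp < tm sg (Suc n) z" by (elim exE conjE)
  then have "tm sg n z < h + t * gp" using hn[rule_format, of n] by (simp add: less_le)
  with \<open>h + t * gp < tm sg (Suc n) z\<close> have n: "tm sg n z < h + t * gp" "h + t * gp < tm sg (Suc n) z" by blast+
  define xn where "xn = itr sg n z"
  have xn: "xn \<in> F" "gap F xn = gp" unfolding xn_def gp_def using gap_iet_pow[OF g z] by blast+
  \<comment> \<open>Height above its base of the point reached from height \<open>h\<close> after
    the push \<open>t * gp\<close>, the limit of the pushes at the left end.\<close>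
  define h2 where "h2 = h + t * gp - tm sg n z"
  have h2: "0 < h2" "h2 < roof xn" using n by (simp_all add: h2_def tm_Suc xn_def)
  let ?I = "{0..<gp}" let ?u = "pt (-1 + t * sg) t"
  have Iz: "z - e \<in> Dom" "z - e \<le> w \<longleftrightarrow> z \<le> w" if "e \<in> ?I" for e
    using gap_shift(2,3)[OF g z, of e] that by (simp_all add: gp_def)
  have pos0: "straight ?I (\<lambda>e. pos sg (z - e) h) (pt (-1) 0)"
  proof (cases "z \<le> w")
    case True
    have "straight ?I (\<lambda>e. low (z + sg * h + (-1) * e) (h + 0 * e)) (pt (-1) 0)"
      by (rule low_straight) (use h(1) hr[of z] True in \<open>simp add: roof_def\<close>)
    then show ?thesis by (rule straight_cong) (use Iz True h(1) in \<open>simp add: pos_pos algebra_simps\<close>)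
  next
    case False
    have "straight ?I (\<lambda>e. up (z - 1 + sg * h + (-1) * e) (1 + h + 0 * e)) (pt (-1) 0)"
      by (rule up_straight) (use h(1) hr[of z] False in \<open>simp add: roof_def\<close>)
    then show ?thesis by (rule straight_cong) (use Iz False h(1) in \<open>simp add: pos_pos algebra_simps\<close>)
  qed
  have "shear sg t *v pt (-1) 0 = ?u" by (simp add: shear_mult pt_eq_iff)
  then have st1: "straight ?I (\<lambda>e. \<phi> (pos sg (z - e) h)) ?u" using straight_aff[OF A pos0] by simp
  have fh: "flow sg z h = pos sg z h" by (rule flow_pos) (use h(1) hr in \<open>simp_all add: less_imp_le\<close>)
  have st2: "straight ?I (\<lambda>e. flow sg (z - e) (h + t * e)) ?u" unfolding straight_def
  proof (intro ballI conjI)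
    fix e assume e: "e \<in> ?I"
    then have e': "0 \<le> e" "e < gap F z" by (simp_all add: gp_def)
    have te: "h + t * e > 0" using h(1) t e by (simp add: add_pos_nonneg)
    show S: "flow sg (z - e) (h + t * e) \<in> Sp"
    proof (cases "e = 0")
      case True
      then show ?thesis using fh pos_Sp[OF h(1) hr] by simp
    next
      case False
      then show ?thesis using flow_Sp_gap[OF g z _ e'(2) less_imp_le[OF te]] e' by simp
    qed
    obtain d where d: "d > 0" "\<forall>k \<sigma>. 0 \<le> e - k \<and> e - k < gap F z \<longrightarrow> \<bar>k\<bar> < d \<longrightarrow> \<bar>\<sigma>\<bar> < d \<longrightarrow>
      flow sg (z - (e - k)) (h + t * e + \<sigma>) = ex (flow sg (z - e) (h + t * e)) (pt (k + sg * \<sigma>) \<sigma>)"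
      using gap_box[OF g z e' te S] by (elim exE conjE)
    define d' where "d' = d / (1 + t)"
    have d': "d' > 0" "d' \<le> d" "d' * t < d" using d(1) t by (simp_all add: d'_def field_simps)
    have "flow sg (z - (e + s)) (h + t * (e + s)) = ex (flow sg (z - e) (h + t * e)) (s *\<^sub>R ?u)"
      if s: "\<bar>s\<bar> < d'" "e + s \<in> ?I" for s
    proof -
      have "\<bar>t * s\<bar> = t * \<bar>s\<bar>" using t by (simp add: abs_mult)
      also have "\<dots> \<le> t * d'" using s(1) t by simp
      finally have ts: "\<bar>t * s\<bar> < d" using d'(3) by (simp add: mult.commute)
      have "flow sg (z - (e - (- s))) (h + t * e + t * s) = ex (flow sg (z - e) (h + t * e)) (pt (- s + sg * (t * s)) (t * s))"
        using d(2)[rule_format, of "- s" "t * s"] s d'(2) ts by (simp add: gp_def)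
      moreover have "s *\<^sub>R ?u = pt (- s + sg * (t * s)) (t * s)" by (simp add: pt_eq_iff algebra_simps)
      ultimately show ?thesis by (simp add: algebra_simps)
    qed
    then show "\<forall>\<^sub>F s in nhds 0. e + s \<in> ?I \<longrightarrow> flow sg (z - (e + s)) (h + t * (e + s)) = ex (flow sg (z - e) (h + t * e)) (s *\<^sub>R ?u)"
      unfolding ev_nhds0_real using d'(1) by blast
  qed
  have eq: "\<phi> (pos sg (z - e) h) = flow sg (z - e) (h + t * e)" if e: "e \<in> ?I" for e
  proof (rule straight_unique[OF st1 st2, where ?t0.0 = 0 and t = e])
    show "\<phi> (pos sg (z - 0) h) = flow sg (z - 0) (h + t * 0)"
      using fx[OF z] h(1) hr fh unfolding fixpos_def by simp
  qed (use gp e in simp_all)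
  define L where "L = lend sg F z h"
  define L2 where "L2 = lend sg F xn h2"
  have LS: "L \<in> Sp" "L2 \<in> Sp" unfolding L_def L2_def using lend_Sp h(1) hr h2 by blast+
  have L_fix: "\<phi> L = L" unfolding L_def by (rule lend_fixed[OF g z h(1) hr fx])
  obtain d1 where d1: "d1 > 0" "\<forall>\<delta> s. 0 < \<delta> \<longrightarrow> \<delta> < d1 \<longrightarrow> \<bar>s\<bar> < d1 \<longrightarrow>
     pos sg (z - (gp - \<delta>)) (h + s) = ex L (pt (\<delta> + sg * s) s)"
    using lend_ex[OF g z h(1) hr] unfolding L_def gp_def by (elim exE conjE)
  obtain d2 where d2: "d2 > 0" "\<forall>\<delta> s. 0 < \<delta> \<longrightarrow> \<delta> < d2 \<longrightarrow> \<bar>s\<bar> < d2 \<longrightarrow>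
     pos sg (xn - (gp - \<delta>)) (h2 + s) = ex L2 (pt (\<delta> + sg * s) s)"
    using lend_ex[OF g xn(1) h2] unfolding L2_def xn(2) by (elim exE conjE)
  have ev3: "\<forall>\<^sub>F s in nhds 0. \<phi> (ex L (s *\<^sub>R pt 1 0)) = ex L (shear sg t *v (s *\<^sub>R pt 1 0))"
    using ev_scaleR[OF loc_affD(3)[OF A LS(1)], of "pt 1 0"] unfolding L_fix .
  let ?b = "shear sg t *v pt 1 0"
  have sb: "shear sg t *v (s *\<^sub>R pt 1 0) = s *\<^sub>R ?b" for s by (simp add: shear_mult pt_eq_iff algebra_simps)
  \<comment> \<open>Just to the right of the left end the image is computed twice: by the affine
    formula around the fixed point \<open>L\<close>, and by the flow formula as a displacement of
    \<open>L2\<close>. Distinct points would remain separated under equal small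
    displacements.\<close>
  have LL: "L = L2"
  proof (rule ccontr)
    assume "L \<noteq> L2"
    from Sp_separate[OF LS this, of ?b] have ev4: "\<forall>\<^sub>F s in nhds 0. ex L (s *\<^sub>R ?b) \<noteq> ex L2 (s *\<^sub>R ?b)" .
    from eventually_conj[OF ev3 ev4] obtain d where d: "d > 0"
      "\<forall>s. \<bar>s\<bar> < d \<longrightarrow> \<phi> (ex L (s *\<^sub>R pt 1 0)) = ex L (s *\<^sub>R ?b) \<and> ex L (s *\<^sub>R ?b) \<noteq> ex L2 (s *\<^sub>R ?b)"
      unfolding ev_nhds0_real sb by (elim exE conjE)
    define M where "M = Min {d, d1, d2 / (1 + t), gp, h2 / (1 + t), (h + t * gp - tm sg n z) / (1 + t)}"
    have M0: "M > 0" unfolding M_def by (subst Min_gr_iff) (use d(1) d1(1) d2(1) gp h2 t n in simp_all)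
    have Ml: "M \<le> d" "M \<le> d1" "M \<le> d2 / (1 + t)" "M \<le> gp" "M \<le> h2 / (1 + t)" unfolding M_def by (rule Min_le; simp)+
    define s where "s = M / 2"
    have s0: "0 < s" using M0 by (simp add: s_def)
    have sl: "s < d" "s < d1" "s < d2 / (1 + t)" "s < gp" "s < h2 / (1 + t)" using Ml M0 unfolding s_def by linarith+
    have s2: "s + t * s < d2" "s + t * s < h2" using sl(3,5) t by (simp_all add: field_simps)
    have ts: "t * s > 0" using t s0 by simp
    have sI: "gp - s \<in> ?I" using s0 sl by simp
    have E1: "pos sg (z - (gp - s)) h = ex L (s *\<^sub>R pt 1 0)"
    proof -
      have "s *\<^sub>R pt 1 0 = pt (s + sg * 0) 0" by (simp add: pt_eq_iff)
      then show ?thesis using d1(2)[rule_format, of s 0] s0 sl d1(1) by simp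
    qed
    have hs: "h + t * (gp - s) = tm sg n z + (h2 - t * s)" by (simp add: h2_def algebra_simps)
    have s': "0 \<le> gp - s" "gp - s < gap F z" using s0 sl by (simp_all add: gp_def)
    note tms = tm_shift[OF g z s']
    have E2: "flow sg (z - (gp - s)) (h + t * (gp - s)) = ex L2 (s *\<^sub>R ?b)"
    proof -
      have ix: "itr sg n (z - (gp - s)) = xn - (gp - s)" unfolding xn_def by (rule gap_shift_pow(1)[OF g z s'])
      have "flow sg (z - (gp - s)) (h + t * (gp - s)) = pos sg (itr sg n (z - (gp - s))) (h + t * (gp - s) - tm sg n (z - (gp - s)))"
      proof (rule flow_eq)
        show "tm sg n (z - (gp - s)) \<le> h + t * (gp - s)" unfolding tms hs using s2 s0 by simp
        show "h + t * (gp - s) < tm sg (Suc n) (z - (gp - s))" unfolding tms hs using n ts by (simp add: h2_def)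
      qed
      also have "\<dots> = pos sg (xn - (gp - s)) (h2 + (- t * s))" unfolding ix tms hs by simp
      also have "\<dots> = ex L2 (pt (s + sg * (- t * s)) (- t * s))"
        using d2(2)[rule_format, of s "- t * s"] s0 s2 ts by simp
      also have "pt (s + sg * (- t * s)) (- t * s) = s *\<^sub>R ?b" by (simp add: shear_mult pt_eq_iff algebra_simps)
      finally show ?thesis .
    qed
    have "ex L (s *\<^sub>R ?b) = ex L2 (s *\<^sub>R ?b)" using d(2)[rule_format, of s] s0 sl(1) eq[OF sI] E1 E2 by simp
    then show False using d(2)[rule_format, of s] s0 sl(1) by simp
  qed
  have "z = xn \<and> h = h2"
    by (rule lend_inj[OF g z h(1) hr xn(1) h2 _ LL[unfolded L_def L2_def]]) (simp add: xn gp_def)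
  then show ?thesis unfolding h2_def xn_def gp_def by (intro exI[of _ n]) simp
qed

text \<open>A power of the affine map fixes the separatrices. They are then finite in number of base
  points, bound cylinders, and on each cylinder that power is a whole number of turns.\<close>

lemma cusp_closes:
  assumes A: "shear sg t \<in> L_veech_group w w" and t: "t > 0"
  shows "\<exists>m>0. good sg (orbs sg) \<and> (\<forall>z\<in>orbs sg. \<exists>n. itr sg n z = z \<and> tm sg n z = of_nat m * t * gap (orbs sg) z)"
proof -
  obtain \<phi> where \<phi>: "loc_aff (shear sg t) \<phi>" using A veech_iff by blast
  obtain m where m: "m > 0" "\<forall>x\<in>sing. (\<phi> ^^ m) (pos sg x hh) = pos sg x hh" using sep_fixed[OF \<phi>] by blast
  note \<phi>m = loc_aff_pow[OF \<phi>, of m]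
  have tm: "of_nat m * t > 0" using m(1) t by simp
  have g: "good sg (orbs sg)" by (rule orbs_good[OF orbs_finite[OF \<phi>m less_imp_neq[OF tm, symmetric] m(2)]])
  show ?thesis
  proof (rule exI[of _ m], intro conjI ballI)
    fix z assume z: "z \<in> orbs sg"
    show "\<exists>n. itr sg n z = z \<and> tm sg n z = of_nat m * t * gap (orbs sg) z"
      by (rule twist_closes[OF \<phi>m tm g orbs_fixpos[OF \<phi>m m(2)] z])
  qed (use m(1) g in simp_all)
qed

text \<open>The gaps tile \<open>{0<..x}\<close>; induction on the number of points up to
  \<open>x\<close>.\<close>

lemma sum_gap:
  assumes F: "finite F" "\<And>z. z \<in> F \<Longrightarrow> z > 0" and x: "x = 0 \<or> x \<in> F"
  shows "(\<Sum>z\<in>{z \<in> F. z \<le> x}. gap F z) = x" using x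
proof (induction "card {z \<in> F. z \<le> x}" arbitrary: x rule: less_induct)
  case less
  show ?case
  proof (cases "x \<in> F")
    case False
    then have "x = 0" using less.prems by simp
    then have e: "{z \<in> F. z \<le> x} = {}" using F(2) by force
    show ?thesis unfolding e using \<open>x = 0\<close> by simp
  next
    case True
    note PR = prv_props[OF F(1) F(2)[OF True]]
    have s: "{z \<in> F. z \<le> x} = insert x {z \<in> F. z \<le> prv F x}"
    proof (intro equalityI subsetI)
      fix z assume "z \<in> {z \<in> F. z \<le> x}"
      then show "z \<in> insert x {z \<in> F. z \<le> prv F x}" using PR(5)[of z] by (cases "z = x") auto
    next
      fix z assume "z \<in> insert x {z \<in> F. z \<le> prv F x}"
      then show "z \<in> {z \<in> F. z \<le> x}" using PR(2) True by auto
    qed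
    have xn: "x \<notin> {z \<in> F. z \<le> prv F x}" using PR(2) by simp
    have fin: "finite {z \<in> F. z \<le> prv F x}" using F(1) by simp
    have "card {z \<in> F. z \<le> prv F x} < card {z \<in> F. z \<le> x}" unfolding s using xn fin by simp
    from less.hyps[OF this PR(4)] show ?thesis unfolding s using xn fin by (simp add: gap_def)
  qed
qed

section \<open>Numerical data of the cylinders\<close>

definition orb :: "real \<Rightarrow> real \<Rightarrow> real set" where "orb sg z = range (\<lambda>n. itr sg n z)"

lemma orb_period:
  assumes g: "good sg F" and z: "z \<in> F"
  shows "\<exists>p>0. itr sg p z = z \<and> orb sg z = (\<lambda>n. itr sg n z) ` {..<p} \<and> inj_on (\<lambda>n. itr sg n z) {..<p} \<and>
     (\<forall>n. itr sg n z = z \<longrightarrow> p dvd n)"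
proof -
  note D = goodD[OF g]
  have inF: "inj_on (iet sg) F" using D(7) by (rule bij_betw_imp_inj_on)
  have im: "iet sg ` F \<subseteq> F" using D(6) by simp
  have "\<exists>m>0. itr sg m z = z" using funpow_finite_id[OF D(1) im inF] z by blast
  define p where "p = (LEAST m. m > 0 \<and> itr sg m z = z)"
  have p: "p > 0 \<and> itr sg p z = z" unfolding p_def by (rule LeastI_ex) fact
  have least: "\<not> (m > 0 \<and> itr sg m z = z)" if "m < p" for m using not_less_Least that unfolding p_def .
  have modp: "itr sg (n mod p) z = itr sg n z" for n using p by (intro funpow_mod_eq) simp
  have injn: "inj_on (iet sg ^^ n) F" for n
  proof (induction n)
    case (Suc n)
    have "itr sg n ` F \<subseteq> F" using gap_iet_pow[OF g] by blast
    then show ?case using comp_inj_on[OF Suc inj_on_subset[OF inF]] by (simp add: comp_def)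
  qed simp
  have dist: "itr sg i z \<noteq> itr sg j z" if "i < j" "j < p" for i j
  proof
    assume "itr sg i z = itr sg j z"
    also have "j = i + (j - i)" using that by simp
    also have "(iet sg ^^ (i + (j - i))) z = itr sg i (itr sg (j - i) z)" by (simp only: funpow_add comp_apply)
    finally have "z = itr sg (j - i) z" using inj_onD[OF injn[of i]] z gap_iet_pow[OF g z] by blast
    then have "j - i > 0 \<and> itr sg (j - i) z = z" using that by simp
    moreover have "j - i < p" using that by simp
    ultimately show False using least by blast
  qed
  have "inj_on (\<lambda>n. itr sg n z) {..<p}" by (rule linorder_inj_onI) (use dist in auto)
  moreover have "orb sg z = (\<lambda>n. itr sg n z) ` {..<p}"
  proof (intro equalityI subsetI)
    fix y assume "y \<in> orb sg z"
    then obtain n where "y = itr sg n z" by (auto simp: orb_def)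
    then have "y = itr sg (n mod p) z" using modp by simp
    then show "y \<in> (\<lambda>n. itr sg n z) ` {..<p}" using p by auto
  qed (auto simp: orb_def)
  moreover have "p dvd n" if "itr sg n z = z" for n
  proof -
    have "itr sg (n mod p) z = z" using modp that by simp
    then show ?thesis using least[of "n mod p"] p by (auto simp: mod_eq_0_iff_dvd)
  qed
  ultimately show ?thesis using p by blast
qed

lemma orb_eq:
  assumes g: "good sg F" and z: "z \<in> F" and y: "y \<in> orb sg z" shows "orb sg y = orb sg z"
proof -
  obtain p where p: "p > 0" "itr sg p z = z" using orb_period[OF g z] by blast
  obtain i where i: "y = itr sg i z" using y by (auto simp: orb_def)
  have sub: "itr sg n y = itr sg (n + i) z" for n by (simp add: i funpow_add)
  have "itr sg n z \<in> orb sg y" for n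
  proof -
    have "itr sg (n + p * i) z = itr sg n (itr sg (i * p) z)" by (simp add: funpow_add mult.commute)
    also have "itr sg (i * p) z = z" using iet_pow_mult[OF p(2)] by blast
    finally have "itr sg n z = (iet sg ^^ (n + (p - 1) * i)) y"
      unfolding sub using p(1) by (cases p) (simp_all add: algebra_simps)
    then show ?thesis by (auto simp: orb_def)
  qed
  then show ?thesis using sub by (auto simp: orb_def)
qed

text \<open>A passage moves horizontally by \<open>sg\<close> times the height of the cylinder;
  reduction modulo its circumference and the translation \<open>ppi\<close> contribute elements of
  \<open>ZW\<close>.\<close>

lemma iet_displacement:
  assumes "x \<in> Dom" shows "\<exists>c\<in>ZW. iet sg x = x + sg * roof x + c"
proof -
  have "\<exists>c\<in>ZW. rot sg x = x + sg * roof x + c"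
  proof (cases "x \<le> w")
    case True
    have x0: "0 < x" using assms by (simp add: Dom_def)
    obtain k :: int where "rot sg x = x + sg + w * of_int k" using rot_low(3)[OF x0 True] by blast
    then show ?thesis using True by (intro bexI[of _ "w * of_int k"]) (simp_all add: roof_def)
  next
    case False
    then have x0: "w < x" by simp
    obtain k :: int where "rot sg x = x + sg * (w - 1) + of_int k" using rot_up(3)[OF x0] by blast
    then show ?thesis using False by (intro bexI[of _ "of_int k"]) (simp_all add: roof_def)
  qed
  then obtain c where c: "c \<in> ZW" "rot sg x = x + sg * roof x + c" by blast
  have "iet sg x = x + sg * roof x + c \<or> iet sg x = x + sg * roof x + (c + 1) \<or> iet sg x = x + sg * roof x + (c - 1)"
    using c by (simp add: iet_def ppi_def)
  then show ?thesis using c(1) ZW_add ZW_diff ZW_1 by blast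
qed

lemma iet_pow_displacement:
  assumes x: "x \<in> Dom" shows "\<exists>c\<in>ZW. itr sg n x = x + sg * tm sg n x + c"
proof (induction n)
  case (Suc n)
  then obtain c where c: "c \<in> ZW" "itr sg n x = x + sg * tm sg n x + c" by blast
  obtain c' where c': "c' \<in> ZW" "iet sg (itr sg n x) = itr sg n x + sg * roof (itr sg n x) + c'"
    using iet_displacement[OF iet_pow_Dom[OF x]] by blast
  then have "itr sg (Suc n) x = x + sg * tm sg (Suc n) x + (c + c')" using c by (simp add: tm_Suc algebra_simps)
  then show ?case using c(1) c'(1) by (intro bexI[of _ "c + c'"]) simp_all
qed (intro bexI[of _ 0]; simp)

lemma tm_ZW: "tm sg n x \<in> ZW" by (induction n) (simp_all add: tm_Suc roof_def)

lemma orbs_ZW: "z \<in> orbs sg \<Longrightarrow> \<exists>a\<in>ZW. \<exists>b\<in>ZW. z = a + sg * b"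
proof -
  assume "z \<in> orbs sg"
  then obtain n x where z: "z = itr sg n x" "x \<in> sing" by (auto simp: orbs_def)
  have x: "x \<in> ZW" using z(2) by (auto simp: sing_def)
  obtain c where c: "c \<in> ZW" "itr sg n x = x + sg * tm sg n x + c" using iet_pow_displacement[OF sing_Dom[OF z(2)]] by blast
  have "x + c \<in> ZW" "z = (x + c) + sg * tm sg n x" using x c z by simp_all
  then show ?thesis using tm_ZW by blast
qed

text \<open>The cylinders in a parabolic direction: \<open>g C\<close> is the width of the cylinder \<open>C\<close>, and its core
  curve crosses the lower and upper horizontal cylinder \<open>a C\<close> and \<open>b C\<close> times.\<close>
lemma cusp_cylinders:
  assumes A: "shear sg t \<in> L_veech_group w w" and t: "t > 0"
  shows "\<exists>m I (a :: real set \<Rightarrow> nat) (b :: real set \<Rightarrow> nat) (k :: real set \<Rightarrow> nat) g (c :: real set \<Rightarrow> int).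
    m > 0 \<and> finite I \<and>
    (\<forall>C\<in>I. g C > 0 \<and> k C > 0 \<and> of_nat m * t * g C = of_nat (k C) * (of_nat (a C) + of_nat (b C) * (w - 1)) \<and>
      sg * (of_nat (a C) + of_nat (b C) * (w - 1)) \<in> ZW \<and> (\<exists>x\<in>ZW. \<exists>y\<in>ZW. g C = x + sg * y)) \<and>
    (\<Sum>C\<in>I. of_nat (a C) * g C) = w \<and> (\<Sum>C\<in>I. of_nat (b C) * g C) = 1 \<and> (\<Sum>C\<in>I. of_int (c C) * g C) = sg"
proof -
  obtain m where m: "m > 0" and gd: "good sg (orbs sg)"
    and per: "\<forall>z\<in>orbs sg. \<exists>n. itr sg n z = z \<and> tm sg n z = of_nat m * t * gap (orbs sg) z"
    using cusp_closes[OF A t] by (elim exE conjE)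
  define F where "F = orbs sg"
  note gd = gd[folded F_def] and per = per[folded F_def]
  note D = goodD[OF gd]
  have pos: "z > 0" if "z \<in> F" for z using that D(2) by (auto simp: Dom_def)
  \<comment> \<open>Cylinders are the cycles of \<open>iet\<close> on \<open>orbs sg\<close>. All
    points of a cycle have equal gaps, so \<open>g\<close> may use any of them.\<close>
  define I where "I = orb sg ` F"
  define g where "g C = gap F (SOME y. y \<in> C)" for C
  have orbF: "y \<in> F \<and> gap F y = gap F z" if "z \<in> F" "y \<in> orb sg z" for y z
    using that gap_iet_pow[OF gd] by (auto simp: orb_def)
  have self: "z \<in> orb sg z" for z unfolding orb_def using rangeI[of "\<lambda>n. itr sg n z" 0] by simp
  have gz: "g (orb sg z) = gap F z" if z: "z \<in> F" for z
  proof -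
    have "(SOME y. y \<in> orb sg z) \<in> orb sg z" using self[of z] by (rule someI)
    then show ?thesis using orbF[OF z] by (simp add: g_def)
  qed
  have fibre: "{y \<in> F. orb sg y = C} = C" if C: "C \<in> I" for C
  proof -
    obtain z where z: "z \<in> F" "C = orb sg z" using C by (auto simp: I_def)
    show ?thesis
    proof (intro equalityI subsetI)
      fix y assume "y \<in> {y \<in> F. orb sg y = C}"
      then show "y \<in> C" using self[of y] by auto
    next
      fix y assume "y \<in> C"
      then show "y \<in> {y \<in> F. orb sg y = C}" using orb_eq[OF gd z(1), of y] orbF[OF z(1), of y] z(2) by simp
    qed
  qed
  have finI: "finite I" using D(1) by (simp add: I_def)
  have CF: "y \<in> F \<and> g C = gap F y" if C: "C \<in> I" "y \<in> C" for C y
  proof -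
    have "y \<in> F" "orb sg y = C" using fibre[OF C(1)] C(2) by blast+
    then show ?thesis using gz by blast
  qed
  have group: "(\<Sum>z\<in>F. f z * gap F z) = (\<Sum>C\<in>I. (\<Sum>z\<in>C. f z) * g C)" for f :: "real \<Rightarrow> real"
  proof -
    have "(\<Sum>z\<in>F. f z * gap F z) = (\<Sum>C\<in>I. \<Sum>z\<in>{z \<in> F. orb sg z = C}. f z * gap F z)"
      by (rule sum.group[symmetric]) (use D(1) in \<open>auto simp: I_def\<close>)
    also have "\<dots> = (\<Sum>C\<in>I. (\<Sum>z\<in>C. f z) * g C)"
    proof (rule sum.cong[OF refl])
      fix C assume C: "C \<in> I"
      have "(\<Sum>z\<in>C. f z * gap F z) = (\<Sum>z\<in>C. f z * g C)" by (rule sum.cong[OF refl]) (use CF[OF C] in simp)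
      then show "(\<Sum>z\<in>{z \<in> F. orb sg z = C}. f z * gap F z) = (\<Sum>z\<in>C. f z) * g C"
        unfolding fibre[OF C] by (simp add: sum_distrib_right)
    qed
    finally show ?thesis .
  qed
  have finC: "finite C" if "C \<in> I" for C using finite_subset[OF _ D(1), of C] CF[OF that] by blast
  define a where "a C = card {y \<in> C. y \<le> w}" for C :: "real set"
  define b where "b C = card {y \<in> C. \<not> y \<le> w}" for C :: "real set"
  have ca: "(\<Sum>z\<in>C. of_bool (z \<le> w)) = (of_nat (a C) :: real)" "(\<Sum>z\<in>C. of_bool (\<not> z \<le> w)) = (of_nat (b C) :: real)"
    if "C \<in> I" for C
    using finC[OF that] by (simp_all add: a_def b_def of_bool_def sum.If_cases Int_def conj_commute)
  have sum_le: "(\<Sum>z\<in>F. of_bool (z \<le> x) * gap F z) = x" if "x = 0 \<or> x \<in> F" for x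
  proof -
    have "(\<Sum>z\<in>F. of_bool (z \<le> x) * gap F z) = (\<Sum>z\<in>{z \<in> F. z \<le> x}. gap F z)"
      using D(1) by (intro sum.mono_neutral_cong_right) auto
    then show ?thesis using sum_gap[OF D(1) pos that] by simp
  qed
  have sa: "(\<Sum>C\<in>I. of_nat (a C) * g C) = w"
  proof -
    have "(\<Sum>C\<in>I. of_nat (a C) * g C) = (\<Sum>C\<in>I. (\<Sum>z\<in>C. of_bool (z \<le> w)) * g C)"
      by (rule sum.cong[OF refl]) (use ca in simp)
    then show ?thesis using group[of "\<lambda>z. of_bool (z \<le> w)"] sum_le[of w] D(4) by simp
  qed
  have all: "(\<Sum>z\<in>F. gap F z) = w + 1"
  proof -
    have "{z \<in> F. z \<le> w + 1} = F" using D(2) by (auto simp: Dom_def)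
    then show ?thesis using sum_gap[OF D(1) pos, of "w + 1"] D(5) by simp
  qed
  have sb: "(\<Sum>C\<in>I. of_nat (b C) * g C) = 1"
  proof -
    have "(\<Sum>C\<in>I. of_nat (b C) * g C) = (\<Sum>C\<in>I. (\<Sum>z\<in>C. of_bool (\<not> z \<le> w)) * g C)"
      by (rule sum.cong[OF refl]) (use ca in simp)
    also have "\<dots> = (\<Sum>z\<in>F. of_bool (\<not> z \<le> w) * gap F z)" by (rule group[symmetric])
    also have "\<dots> = (\<Sum>z\<in>F. gap F z - of_bool (z \<le> w) * gap F z)" by (rule sum.cong[OF refl]) simp
    also have "\<dots> = 1" using all sum_le[of w] D(4) by (simp add: sum_subtractf)
    finally show ?thesis .
  qed
  \<comment> \<open>\<open>p\<close> is the length of the cycle, so \<open>tm sg p z\<close> is the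
    height of one turn, and \<open>q\<close> counts the turns of the twist. Since the core curve
    closes up, \<open>sg\<close> times that height lies in \<open>ZW\<close>.\<close>
  have ex_k: "\<exists>k>0. of_nat m * t * g C = of_nat k * (of_nat (a C) + of_nat (b C) * (w - 1)) \<and>
      sg * (of_nat (a C) + of_nat (b C) * (w - 1)) \<in> ZW" if C: "C \<in> I" for C
  proof -
    obtain z where z: "z \<in> F" "C = orb sg z" using C by (auto simp: I_def)
    obtain p where p: "p > 0" "itr sg p z = z" "C = (\<lambda>n. itr sg n z) ` {..<p}" "inj_on (\<lambda>n. itr sg n z) {..<p}"
      "\<forall>n. itr sg n z = z \<longrightarrow> p dvd n" using orb_period[OF gd z(1)] unfolding z(2) by (elim exE conjE)
    obtain n where n: "itr sg n z = z" "tm sg n z = of_nat m * t * gap F z" using per z(1) by blast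
    obtain q where q: "n = p * q" using p(5) n(1) by blast
    have tq: "tm sg n z = of_nat q * tm sg p z" using iet_pow_mult[OF p(2), of q] q by (simp add: mult.commute)
    have "tm sg p z = (\<Sum>y\<in>C. roof y)" unfolding tm_def p(3) by (simp add: sum.reindex[OF p(4)])
    also have "\<dots> = (\<Sum>y\<in>C. of_bool (y \<le> w) + of_bool (\<not> y \<le> w) * (w - 1))"
      by (rule sum.cong[OF refl]) (simp add: roof_def)
    also have "\<dots> = of_nat (a C) + of_nat (b C) * (w - 1)"
      unfolding sum.distrib sum_distrib_right[symmetric] ca[OF C] ..
    finally have mu: "tm sg p z = of_nat (a C) + of_nat (b C) * (w - 1)" .
    have gz': "g C = gap F z" using gz[OF z(1)] z(2) by simp
    have "of_nat m * t * gap F z > 0" using m t gap_pos[OF D(1) pos[OF z(1)]] by simp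
    then have "tm sg n z > 0" unfolding n(2) .
    then have q0: "q > 0" using tq by (cases q) simp_all
    obtain c where c: "c \<in> ZW" "itr sg p z = z + sg * tm sg p z + c"
      using iet_pow_displacement[where x = z and sg = sg and n = p] z(1) D(2) by blast
    have "sg * tm sg p z = - c" using c(2) p(2) by simp
    then show ?thesis using q0 n(2) tq c(1) unfolding mu gz' by (intro exI[of _ q]) simp
  qed
  then obtain k where k: "\<forall>C\<in>I. k C > 0 \<and> of_nat m * t * g C = of_nat (k C) * (of_nat (a C) + of_nat (b C) * (w - 1)) \<and>
      sg * (of_nat (a C) + of_nat (b C) * (w - 1)) \<in> ZW" by metis
  have gC: "g C > 0 \<and> (\<exists>x\<in>ZW. \<exists>y\<in>ZW. g C = x + sg * y)" if C: "C \<in> I" for C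
  proof -
    obtain z where z: "z \<in> F" "C = orb sg z" using C by (auto simp: I_def)
    have gz': "g C = z - prv F z" using gz[OF z(1)] z(2) by (simp add: gap_def)
    obtain x y where xy: "x \<in> ZW" "y \<in> ZW" "z = x + sg * y" using orbs_ZW[of z sg] z(1) unfolding F_def by blast
    have "\<exists>x\<in>ZW. \<exists>y\<in>ZW. prv F z = x + sg * y"
    proof (cases "prv F z = 0")
      case True
      then show ?thesis by (intro bexI[of _ 0]) simp_all
    next
      case False
      then show ?thesis using prv_props(4)[OF D(1) pos[OF z(1)]] orbs_ZW unfolding F_def by blast
    qed
    then obtain x' y' where xy': "x' \<in> ZW" "y' \<in> ZW" "prv F z = x' + sg * y'" by blast
    have "g C = (x - x') + sg * (y - y')" using gz' xy xy' by (simp add: algebra_simps)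
    moreover have "x - x' \<in> ZW" "y - y' \<in> ZW" using xy xy' by simp_all
    ultimately show ?thesis using gz[OF z(1)] z(2) gap_pos[OF D(1) pos[OF z(1)]] by auto
  qed
  \<comment> \<open>The integer span of the widths. It contains \<open>F\<close>, hence
    \<open>w\<close> and \<open>1\<close>, and the return point of \<open>w\<close>, which differs
    from \<open>sg\<close> by integer multiples of \<open>w\<close> and \<open>1\<close>; so it
    contains \<open>sg\<close>.\<close>
  define L where "L x \<longleftrightarrow> (\<exists>f :: real \<Rightarrow> int. x = (\<Sum>z\<in>F. of_int (f z) * gap F z))" for x
  have LF: "L x" if "x \<in> F" for x
    unfolding L_def using sum_le[of x] that by (intro exI[of _ "\<lambda>z. of_bool (z \<le> x)"]) simp
  have Ld: "L (x - y)" if "L x" "L y" for x y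
  proof -
    obtain f f' :: "real \<Rightarrow> int" where "x = (\<Sum>z\<in>F. of_int (f z) * gap F z)" "y = (\<Sum>z\<in>F. of_int (f' z) * gap F z)"
      using \<open>L x\<close> \<open>L y\<close> unfolding L_def by blast
    then have "x - y = (\<Sum>z\<in>F. of_int (f z - f' z) * gap F z)" by (simp add: sum_subtractf algebra_simps)
    then show ?thesis unfolding L_def by (intro exI[of _ "\<lambda>z. f z - f' z"])
  qed
  have Lm: "L (x * of_int j)" if "L x" for x j
  proof -
    obtain f :: "real \<Rightarrow> int" where "x = (\<Sum>z\<in>F. of_int (f z) * gap F z)" using \<open>L x\<close> unfolding L_def by blast
    then have "x * of_int j = (\<Sum>z\<in>F. of_int (f z * j) * gap F z)" by (simp add: sum_distrib_left mult_ac)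
    then show ?thesis unfolding L_def by (intro exI[of _ "\<lambda>z. f z * j"])
  qed
  have Lw: "L w" "L 1" using LF[OF D(4)] Ld[OF LF[OF D(5)] LF[OF D(4)]] by simp_all
  have L0: "L 0" using Ld[OF Lw(1) Lw(1)] by simp
  have "L sg"
  proof -
    have w0: "0 < w" using w1 by simp
    obtain j :: int where j: "rot sg w = w + sg + w * of_int j" using rot_low(3)[OF w0 order_refl] by blast
    have Li: "L (iet sg w)" using LF[OF D(8)[OF D(4)]] .
    have "L (rot sg w)"
    proof -
      have L1: "L (iet sg w - 1)" using Ld[OF Li Lw(2)] .
      have L2: "L (iet sg w + 1)" using Ld[OF Li Ld[OF L0 Lw(2)]] by simp
      have "rot sg w = iet sg w \<or> rot sg w = iet sg w - 1 \<or> rot sg w = iet sg w + 1" by (simp add: iet_def ppi_def)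
      then show ?thesis using Li L1 L2 by (elim disjE) simp_all
    qed
    then have "L (rot sg w - w - w * of_int j)" using Ld[OF Ld[OF _ Lw(1)] Lm[OF Lw(1)]] by blast
    then show ?thesis using j by simp
  qed
  then obtain f :: "real \<Rightarrow> int" where f: "sg = (\<Sum>z\<in>F. of_int (f z) * gap F z)" unfolding L_def by blast
  have sc: "(\<Sum>C\<in>I. of_int (\<Sum>z\<in>C. f z) * g C) = sg" using group[of "\<lambda>z. of_int (f z)"] f by simp
  show ?thesis
    by (rule exI[of _ m], rule exI[of _ I], rule exI[of _ a], rule exI[of _ b], rule exI[of _ k], rule exI[of _ g],
        rule exI[of _ "\<lambda>C. \<Sum>z\<in>C. f z"]) (use m finI k gC sa sb sc in blast)
qed

section \<open>Discreteness of the Veech group\<close>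

lemma veech_mult: "A \<in> L_veech_group w w \<Longrightarrow> B \<in> L_veech_group w w \<Longrightarrow> A ** B \<in> L_veech_group w w"
  using subgroup.m_closed[OF veech_subgroup] by (simp add: SL2R_def)

lemma veech_inverse: "A \<in> L_veech_group w w \<Longrightarrow> A ** B = mat 1 \<Longrightarrow> B \<in> L_veech_group w w"
proof -
  assume A: "A \<in> L_veech_group w w" and AB: "A ** B = mat 1"
  obtain \<phi> where \<phi>: "loc_aff A \<phi>" and d: "det A = 1" using A veech_iff by blast
  have "det A * det B = 1" using AB det_mul[of A B] by simp
  then show ?thesis using d loc_aff_inv[OF \<phi> AB] veech_iff by auto
qed

text \<open>Small off-diagonal entries vanish by \<open>veech_c_bound\<close> and its mirror image.
  For a diagonal element near 1, conjugation by the vertical twist turns the difference of the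
  eigenvalues into an off-diagonal entry, which vanishes as well.\<close>

lemma veech_discrete:
  assumes N: "w * (w - 1) = of_nat N"
  shows "discrete (L_veech_group w w)"
proof -
  define \<delta> where "\<delta> = min 1 (w - 1)"
  have \<delta>: "0 < \<delta>" "\<delta> \<le> 1" using w1 by (simp_all add: \<delta>_def)
  let ?\<Gamma> = "L_veech_group w w"
  have c0: "Z $ 2 $ 1 = 0" if "Z \<in> ?\<Gamma>" "\<bar>Z $ 2 $ 1\<bar> < \<delta>" for Z
    using veech_c_bound[of Z] that unfolding \<delta>_def by force
  have b0: "Z $ 1 $ 2 = 0" if "Z \<in> ?\<Gamma>" "\<bar>Z $ 1 $ 2\<bar> < \<delta>" for Z
    using c0[OF veech_swap[OF that(1)]] that(2) by simp
  \<comment> \<open>The factor \<open>8 * w\<close> makes \<open>w * (2 * \<eta>)\<close> a quarter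
    of \<open>\<delta>\<close> and keeps the diagonal within \<open>1 / 2\<close> of 1, which
    excludes the eigenvalue \<open>-1\<close>.\<close>
  define \<eta> where "\<eta> = \<delta> / (8 * w)"
  have \<eta>: "0 < \<eta>" "\<eta> * (8 * w) = \<delta>" "\<eta> < \<delta>" "\<eta> < 1 / 2"
    using \<delta> w1 by (auto simp: \<eta>_def field_simps)
  have one: "Z = mat 1" if Z: "Z \<in> ?\<Gamma>" and near: "\<And>i j. \<bar>Z $ i $ j - mat 1 $ i $ j\<bar> < \<eta>" for Z
  proof -
    have n: "\<bar>Z $ 1 $ 1 - 1\<bar> < \<eta>" "\<bar>Z $ 2 $ 2 - 1\<bar> < \<eta>" "\<bar>Z $ 1 $ 2\<bar> < \<eta>" "\<bar>Z $ 2 $ 1\<bar> < \<eta>"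
      using near[of 1 1] near[of 2 2] near[of 1 2] near[of 2 1] by (simp_all add: mat_def)
    have z: "Z $ 2 $ 1 = 0" "Z $ 1 $ 2 = 0" using c0[OF Z] b0[OF Z] n \<eta>(3) by simp_all
    have det: "Z $ 1 $ 1 * Z $ 2 $ 2 = 1" using Z z veech_iff[of Z] by (simp add: det_2)
    define V where "V = shear 0 w"
    define V' where "V' = shear 0 (- w)"
    have V: "V \<in> ?\<Gamma>" unfolding V_def by (rule shear_vertical[OF N])
    have "V ** V' = mat 1" unfolding V_def V'_def by (simp add: shear_mul shear_0)
    then have V': "V' \<in> ?\<Gamma>" using veech_inverse[OF V] by blast
    have Y: "V ** Z ** V' \<in> ?\<Gamma>" by (intro veech_mult V V' Z)
    have e: "(V ** Z ** V') $ 2 $ 1 = w * (Z $ 2 $ 2 - Z $ 1 $ 1)"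
      by (simp add: V_def V'_def matrix_matrix_mult_def sum_2 z algebra_simps)
    have "\<bar>Z $ 2 $ 2 - Z $ 1 $ 1\<bar> < 2 * \<eta>" using n by linarith
    then have "w * \<bar>Z $ 2 $ 2 - Z $ 1 $ 1\<bar> < w * (2 * \<eta>)" using w1 by simp
    moreover have "4 * (w * (2 * \<eta>)) = \<delta>" using \<eta>(2) by (simp add: mult_ac)
    ultimately have "w * \<bar>Z $ 2 $ 2 - Z $ 1 $ 1\<bar> < \<delta>" using \<delta> by linarith
    then have "\<bar>(V ** Z ** V') $ 2 $ 1\<bar> < \<delta>" unfolding e abs_mult using w1 by simp
    from c0[OF Y this] have "Z $ 2 $ 2 = Z $ 1 $ 1" unfolding e using w1 by simp
    then have "(Z $ 1 $ 1 - 1) * (Z $ 1 $ 1 + 1) = 0" using det by (simp add: algebra_simps)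
    then have "Z $ 1 $ 1 = 1" using n(1) \<eta>(4) by auto
    then show ?thesis using z \<open>Z $ 2 $ 2 = Z $ 1 $ 1\<close> by (simp add: vec_eq_iff forall_2 mat_def)
  qed
  show ?thesis unfolding discrete_altdef
  proof
    fix X assume X: "X \<in> ?\<Gamma>"
    obtain B where B: "X ** B = mat 1" using X veech_iff invertible_ex by blast
    have BG: "B \<in> ?\<Gamma>" using veech_inverse[OF X B] .
    \<comment> \<open>Bounds the entries of the inverse \<open>B\<close> of \<open>X\<close>, so
      that \<open>Y\<close> close to \<open>X\<close> gives \<open>Y ** B\<close> within
      \<open>\<eta>\<close> of the identity.\<close>
    define K where "K = 1 + 2 * (\<bar>B $ 1 $ 1\<bar> + \<bar>B $ 1 $ 2\<bar> + \<bar>B $ 2 $ 1\<bar> + \<bar>B $ 2 $ 2\<bar>)"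
    have K: "K > 0" by (simp add: K_def add_pos_nonneg)
    have "Y = X" if Y: "Y \<in> ?\<Gamma>" "dist Y X < \<eta> / K" for Y
    proof -
      have d: "\<bar>(Y - X) $ i $ j\<bar> < \<eta> / K" for i j
      proof -
        have "\<bar>(Y - X) $ i $ j\<bar> \<le> norm ((Y - X) $ i)" using component_le_norm_cart[of "(Y - X) $ i" j] by simp
        also have "\<dots> \<le> norm (Y - X)" by (rule Finite_Cartesian_Product.norm_nth_le)
        finally show ?thesis using Y(2) by (simp add: dist_norm)
      qed
      have "Y ** B = mat 1"
      proof (rule one[OF veech_mult[OF Y(1) BG]])
        fix i j :: 2
        have "(Y ** B) $ i $ j - mat 1 $ i $ j = ((Y - X) ** B) $ i $ j"
          unfolding B[symmetric] by (simp add: matrix_matrix_mult_def sum_2 algebra_simps)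
        also have "\<dots> = (Y - X) $ i $ 1 * B $ 1 $ j + (Y - X) $ i $ 2 * B $ 2 $ j"
          by (simp add: matrix_matrix_mult_def sum_2)
        also have "\<bar>\<dots>\<bar> \<le> \<eta> / K * \<bar>B $ 1 $ j\<bar> + \<eta> / K * \<bar>B $ 2 $ j\<bar>"
          by (rule order_trans[OF abs_triangle_ineq]) (unfold abs_mult, intro add_mono mult_right_mono less_imp_le[OF d], simp_all)
        also have "\<dots> = \<eta> / K * (\<bar>B $ 1 $ j\<bar> + \<bar>B $ 2 $ j\<bar>)" by (simp add: algebra_simps)
        also have "\<dots> < \<eta> / K * K"
        proof (rule mult_strict_left_mono)
          show "\<bar>B $ 1 $ j\<bar> + \<bar>B $ 2 $ j\<bar> < K" using exhaust_2[of j] by (auto simp: K_def)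
        qed (use \<eta> K in simp)
        finally show "\<bar>(Y ** B) $ i $ j - mat 1 $ i $ j\<bar> < \<eta>" using K by simp
      qed
      then have "X = (Y ** B) ** X" by simp
      also have "\<dots> = Y ** (B ** X)" by (simp only: matrix_mul_assoc)
      also have "B ** X = mat 1" using B matrix_left_right_inverse by blast
      finally show ?thesis by simp
    qed
    then show "\<forall>\<^sub>F Y in at X. Y \<notin> ?\<Gamma>"
      unfolding eventually_at using \<eta>(1) K by (intro exI[of _ "\<eta> / K"]) auto
  qed
qed

end

section \<open>The quadratic order\<close>

locale quad =
  fixes D :: int
  assumes D_pos: "D > 0" and D_nsq: "\<not> (\<exists>k::int. D = k\<^sup>2)" and D4: "D mod 4 = 1"
begin

definition rt :: real where "rt = sqrt (of_int D)"
abbreviation om :: real where "om \<equiv> quad_w D"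
abbreviation Or :: "real set" where "Or \<equiv> quad_order D"
abbreviation Kf :: "real set" where "Kf \<equiv> quad_field D"
text \<open>Minus the norm of \<open>om\<close>, and the constant in
  \<open>om * om = NN + om\<close>. It is odd exactly when \<open>D mod 8 = 5\<close>.\<close>

definition NN :: int where "NN = (D - 1) div 4"

lemma D_NN: "D = 4 * NN + 1" unfolding NN_def using D4 by presburger

lemma rt_sq: "rt * rt = of_int D" using D_pos by (simp add: rt_def)
lemma rt_pos: "rt > 0" using D_pos by (simp add: rt_def)
lemma om_rt: "om = (1 + rt) / 2" by (simp add: quad_w_def rt_def)
lemma om_sq: "om * om = of_int NN + om" using quad_w_square[of D] D_pos D4 by (simp add: NN_def)

lemma rt_irrational: "rt \<notin> \<rat>"
proof
  assume "rt \<in> \<rat>"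
  then obtain m n :: nat where mn: "n \<noteq> 0" "\<bar>rt\<bar> = of_nat m / of_nat n" "coprime m n" by (rule Rats_abs_nat_div_natE)
  then have "rt * of_nat n = of_nat m" using rt_pos by simp
  then have "(rt * rt) * (of_nat n * of_nat n) = of_nat m * of_nat m" by (metis mult.assoc mult.commute)
  then have "real_of_int (D * int (n * n)) = real_of_int (int (m * m))" using rt_sq by simp
  then have e: "D * int (n * n) = int (m * m)" by (simp only: of_int_eq_iff)
  then have "int (n * n) dvd int (m * m)" by (metis dvd_triv_right)
  then have "n * n dvd m * m" by (simp only: int_dvd_int_iff)
  moreover have "coprime (m * m) (n * n)" using mn(3) by simp
  ultimately have "n * n = 1" by (metis coprime_common_divisor_nat dvd_refl)
  then have "D = (int m)\<^sup>2" using e by (simp add: power2_eq_square)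
  then show False using D_nsq by blast
qed

lemma rt_coord: "p \<in> \<rat> \<Longrightarrow> q \<in> \<rat> \<Longrightarrow> p' \<in> \<rat> \<Longrightarrow> q' \<in> \<rat> \<Longrightarrow> p + q * rt = p' + q' * rt \<Longrightarrow> p = p' \<and> q = q'"
proof (rule ccontr)
  assume r: "p \<in> \<rat>" "q \<in> \<rat>" "p' \<in> \<rat>" "q' \<in> \<rat>" and e: "p + q * rt = p' + q' * rt" and n: "\<not> (p = p' \<and> q = q')"
  then have "q \<noteq> q'" by auto
  then have "rt = (p' - p) / (q - q')" using e by (simp add: field_simps)
  then show False using r rt_irrational by (metis Rats_diff Rats_divide)
qed

lemma Kf_iff: "x \<in> Kf \<longleftrightarrow> (\<exists>p\<in>\<rat>. \<exists>q\<in>\<rat>. x = p + q * rt)"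
  unfolding quad_field_def rt_def by blast

text \<open>Galois conjugation; \<open>rt_coord\<close> makes it well defined on
  \<open>Kf\<close>.\<close>

definition cj :: "real \<Rightarrow> real" where
  "cj x = (SOME y. \<exists>p\<in>\<rat>. \<exists>q\<in>\<rat>. x = p + q * rt \<and> y = p - q * rt)"

lemma cj_eq: assumes "p \<in> \<rat>" "q \<in> \<rat>" shows "cj (p + q * rt) = p - q * rt" unfolding cj_def
proof (rule some_equality)
  show "\<exists>p'\<in>\<rat>. \<exists>q'\<in>\<rat>. p + q * rt = p' + q' * rt \<and> p - q * rt = p' - q' * rt" using assms by blast
  fix y assume "\<exists>p'\<in>\<rat>. \<exists>q'\<in>\<rat>. p + q * rt = p' + q' * rt \<and> y = p' - q' * rt"
  then obtain p' q' where "p' \<in> \<rat>" "q' \<in> \<rat>" "p + q * rt = p' + q' * rt" "y = p' - q' * rt" by blast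
  then show "y = p - q * rt" using rt_coord[OF assms] by blast
qed

lemma Kf_rat: "p \<in> \<rat> \<Longrightarrow> p \<in> Kf" and cj_rat: "p \<in> \<rat> \<Longrightarrow> cj p = p"
proof -
  assume p: "p \<in> \<rat>"
  show "p \<in> Kf" unfolding Kf_iff using p by (intro bexI[of _ p] bexI[of _ 0]) simp_all
  show "cj p = p" using cj_eq[OF p Rats_0] by simp
qed

lemma Kf_rt: "rt \<in> Kf" and cj_rt: "cj rt = - rt"
proof -
  show "rt \<in> Kf" unfolding Kf_iff by (intro bexI[of _ 0] bexI[of _ 1]) simp_all
  show "cj rt = - rt" using cj_eq[OF Rats_0 Rats_1] by simp
qed

lemma Kf_add [simp]: "x \<in> Kf \<Longrightarrow> y \<in> Kf \<Longrightarrow> x + y \<in> Kf"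
  and cj_add: "x \<in> Kf \<Longrightarrow> y \<in> Kf \<Longrightarrow> cj (x + y) = cj x + cj y"
proof -
  assume "x \<in> Kf" "y \<in> Kf"
  then obtain p q p' q' where r: "p \<in> \<rat>" "q \<in> \<rat>" "p' \<in> \<rat>" "q' \<in> \<rat>" and xy: "x = p + q * rt" "y = p' + q' * rt"
    unfolding Kf_iff by blast
  have e: "x + y = (p + p') + (q + q') * rt" by (simp add: xy algebra_simps)
  show "x + y \<in> Kf" unfolding e Kf_iff using r by (intro bexI[of _ "p + p'"] bexI[of _ "q + q'"]) simp_all
  have "cj (x + y) = (p + p') - (q + q') * rt" unfolding e using r by (intro cj_eq) simp_all
  then show "cj (x + y) = cj x + cj y" using r by (simp add: xy cj_eq algebra_simps)
qed

lemma Kf_mult [simp]: "x \<in> Kf \<Longrightarrow> y \<in> Kf \<Longrightarrow> x * y \<in> Kf"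
  and cj_mult: "x \<in> Kf \<Longrightarrow> y \<in> Kf \<Longrightarrow> cj (x * y) = cj x * cj y"
proof -
  assume "x \<in> Kf" "y \<in> Kf"
  then obtain p q p' q' where r: "p \<in> \<rat>" "q \<in> \<rat>" "p' \<in> \<rat>" "q' \<in> \<rat>" and xy: "x = p + q * rt" "y = p' + q' * rt"
    unfolding Kf_iff by blast
  have q: "q * q' * of_int D = q * q' * (rt * rt)" by (simp add: rt_sq)
  have e: "x * y = (p * p' + q * q' * of_int D) + (p * q' + q * p') * rt" unfolding q xy by (simp add: algebra_simps)
  have R: "p * p' + q * q' * of_int D \<in> \<rat>" "p * q' + q * p' \<in> \<rat>" using r by simp_all
  show "x * y \<in> Kf" unfolding e Kf_iff using R by blast
  have "cj (x * y) = (p * p' + q * q' * of_int D) - (p * q' + q * p') * rt" unfolding e by (rule cj_eq[OF R])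
  then show "cj (x * y) = cj x * cj y" unfolding q using r by (simp add: xy cj_eq algebra_simps)
qed

lemma Kf_int [simp]: "of_int k \<in> Kf" and cj_int [simp]: "cj (of_int k) = of_int k"
  by (simp_all add: Kf_rat cj_rat)

lemma Kf_nat [simp]: "of_nat k \<in> Kf" and cj_nat [simp]: "cj (of_nat k) = of_nat k"
  using Kf_int[of "int k"] cj_int[of "int k"] by simp_all

lemma Kf_01 [simp]: "0 \<in> Kf" "1 \<in> Kf" and cj_01 [simp]: "cj 0 = 0" "cj 1 = 1"
  using Kf_int[of 0] Kf_int[of 1] cj_int[of 0] cj_int[of 1] by simp_all

lemma Kf_minus [simp]: "x \<in> Kf \<Longrightarrow> - x \<in> Kf" and cj_minus: "x \<in> Kf \<Longrightarrow> cj (- x) = - cj x"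
  using Kf_mult[OF Kf_int[of "-1"], of x] cj_mult[OF Kf_int[of "-1"], of x] cj_int[of "-1"] by simp_all

lemma Kf_diff [simp]: "x \<in> Kf \<Longrightarrow> y \<in> Kf \<Longrightarrow> x - y \<in> Kf" and cj_diff: "x \<in> Kf \<Longrightarrow> y \<in> Kf \<Longrightarrow> cj (x - y) = cj x - cj y"
  using Kf_add[of x "- y"] cj_add[of x "- y"] by (simp_all add: cj_minus)

lemma Kf_cj [simp]: "x \<in> Kf \<Longrightarrow> cj x \<in> Kf" and cj_cj: "x \<in> Kf \<Longrightarrow> cj (cj x) = x"
proof -
  assume "x \<in> Kf"
  then obtain p q where r: "p \<in> \<rat>" "q \<in> \<rat>" "x = p + q * rt" unfolding Kf_iff by blast
  have c: "cj x = p + (- q) * rt" using cj_eq[OF r(1,2)] r(3) by simp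
  have mq: "- q \<in> \<rat>" using r by simp
  show "cj x \<in> Kf" unfolding c Kf_iff using r(1) mq by blast
  show "cj (cj x) = x" unfolding c using cj_eq[OF r(1) mq] r(3) by simp
qed

lemma cj_0_iff: "x \<in> Kf \<Longrightarrow> cj x = 0 \<longleftrightarrow> x = 0" using cj_cj[of x] by fastforce

lemma Kf_inverse [simp]: "x \<in> Kf \<Longrightarrow> inverse x \<in> Kf"
proof -
  assume x: "x \<in> Kf"
  then obtain p q where r: "p \<in> \<rat>" "q \<in> \<rat>" "x = p + q * rt" unfolding Kf_iff by blast
  show ?thesis
  proof (cases "x = 0")
    case False
    define n where "n = x * cj x"
    have "n \<noteq> 0" using False cj_0_iff[OF x] by (simp add: n_def)
    have qq: "q * q * of_int D = q * q * (rt * rt)" by (simp add: rt_sq)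
    have "n = p * p - q * q * of_int D" unfolding qq n_def using r by (simp add: cj_eq algebra_simps)
    then have "n \<in> \<rat>" using r by simp
    then have "inverse n \<in> Kf" by (simp add: Kf_rat)
    moreover have "inverse x = cj x * inverse n" using False \<open>n \<noteq> 0\<close> unfolding n_def by (simp add: field_simps)
    ultimately show ?thesis using x by simp
  qed simp
qed

lemma Kf_divide [simp]: "x \<in> Kf \<Longrightarrow> y \<in> Kf \<Longrightarrow> x / y \<in> Kf"
  unfolding divide_inverse by simp

lemma Kf_om [simp]: "om \<in> Kf" and cj_om: "cj om = 1 - om"
proof -
  have r: "(1/2 :: real) \<in> \<rat>" by simp
  have e: "om = 1/2 + 1/2 * rt" by (simp add: om_rt)
  show "om \<in> Kf" unfolding e Kf_iff using r by blast
  show "cj om = 1 - om" unfolding e using cj_eq[OF r r] by simp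
qed

lemma Or_I: "of_int m + of_int n * om \<in> Or" unfolding quad_order_def by blast

lemma Or_int [simp]: "of_int m \<in> Or" using Or_I[of m 0] by simp
lemma Or_nat [simp]: "of_nat m \<in> Or" using Or_int[of "int m"] by simp
lemma Or_om [simp]: "om \<in> Or" using Or_I[of 0 1] by simp
lemma Or_01 [simp]: "0 \<in> Or" "1 \<in> Or" using Or_int[of 0] Or_int[of 1] by simp_all

lemma Or_add [simp]: "x \<in> Or \<Longrightarrow> y \<in> Or \<Longrightarrow> x + y \<in> Or"
proof -
  assume "x \<in> Or" "y \<in> Or"
  then obtain m n m' n' where "x = of_int m + of_int n * om" "y = of_int m' + of_int n' * om" unfolding quad_order_def by blast
  then have "x + y = of_int (m + m') + of_int (n + n') * om" by (simp add: algebra_simps)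
  then show "x + y \<in> Or" using Or_I by presburger
qed

lemma Or_mult [simp]: "x \<in> Or \<Longrightarrow> y \<in> Or \<Longrightarrow> x * y \<in> Or"
proof -
  assume "x \<in> Or" "y \<in> Or"
  then obtain m n m' n' where xy: "x = of_int m + of_int n * om" "y = of_int m' + of_int n' * om" unfolding quad_order_def by blast
  have "x * y = of_int m * of_int m' + (of_int m * of_int n' + of_int n * of_int m') * om + of_int n * of_int n' * (om * om)"
    by (simp add: xy algebra_simps)
  also have "\<dots> = of_int (m * m' + n * n' * NN) + of_int (m * n' + n * m' + n * n') * om"
    unfolding om_sq by (simp add: algebra_simps)
  finally show ?thesis using Or_I by presburger
qed

lemma Or_minus [simp]: "x \<in> Or \<Longrightarrow> - x \<in> Or" using Or_mult[OF Or_int[of "-1"], of x] by simp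
lemma Or_diff [simp]: "x \<in> Or \<Longrightarrow> y \<in> Or \<Longrightarrow> x - y \<in> Or" using Or_add[of x "- y"] by simp
lemma Or_sum: "(\<And>i. i \<in> I \<Longrightarrow> f i \<in> Or) \<Longrightarrow> sum f I \<in> Or"
  by (induction I rule: infinite_finite_induct) simp_all

lemma Or_rt [simp]: "rt \<in> Or"
proof -
  have "rt = of_int (-1) + of_int 2 * om" by (simp add: om_rt field_simps)
  then show ?thesis using Or_I by presburger
qed

lemma Or_Kf: "x \<in> Or \<Longrightarrow> x \<in> Kf" and Or_cj [simp]: "x \<in> Or \<Longrightarrow> cj x \<in> Or"
proof -
  assume "x \<in> Or"
  then obtain m n where x: "x = of_int m + of_int n * om" unfolding quad_order_def by blast
  show "x \<in> Kf" unfolding x by simp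
  have "cj x = of_int (m + n) + of_int (- n) * om" unfolding x by (simp add: cj_add cj_mult cj_om algebra_simps)
  then show "cj x \<in> Or" using Or_I by presburger
qed

lemma Or_rat: assumes "x \<in> Or" "x \<in> \<rat>" shows "x \<in> \<int>"
proof -
  obtain m n where x: "x = of_int m + of_int n * om" using assms(1) unfolding quad_order_def by blast
  have e: "(of_int m + of_int n / 2) + (of_int n / 2) * rt = x + 0 * rt" unfolding x om_rt by (simp add: field_simps)
  have "of_int n / 2 = (0::real)" using rt_coord[OF _ _ assms(2) Rats_0 e] by simp
  then show ?thesis using x by simp
qed

lemma Kf_denom: assumes "x \<in> Kf" shows "\<exists>d::int. d \<noteq> 0 \<and> of_int d * x \<in> Or"
proof -
  have rd: "\<exists>a b :: int. b \<noteq> 0 \<and> p = of_int a / of_int b" if "p \<in> \<rat>" for p :: real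
    using that by (metis Rats_cases' less_irrefl)
  obtain p q where pq: "p \<in> \<rat>" "q \<in> \<rat>" "x = p + q * rt" using assms unfolding Kf_iff by blast
  obtain a b a' b' :: int where r: "b \<noteq> 0" "p = of_int a / of_int b" "b' \<noteq> 0" "q = of_int a' / of_int b'"
    using rd[OF pq(1)] rd[OF pq(2)] by blast
  have "of_int (b * b') * x = of_int (a * b') + of_int (a' * b) * rt" unfolding pq(3) r(2,4) using r(1,3) by (simp add: field_simps)
  then have "of_int (b * b') * x \<in> Or" by (simp only: Or_add Or_mult Or_int Or_rt)
  then show ?thesis using r(1,3) by (intro exI[of _ "b * b'"]) simp
qed

text \<open>Almost integral elements; they form the maximal order.\<close>
definition alm :: "real \<Rightarrow> bool" where
  "alm x \<longleftrightarrow> x \<in> Kf \<and> (\<exists>M::int. M \<noteq> 0 \<and> (\<forall>j::nat. of_int M * x ^ j \<in> Or))"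

lemma Or_power [simp]: "x \<in> Or \<Longrightarrow> x ^ (j::nat) \<in> Or" by (induction j) simp_all

lemma alm_Or: "x \<in> Or \<Longrightarrow> alm x"
  unfolding alm_def by (intro conjI exI[of _ 1]) (simp_all add: Or_Kf)

lemma alm_Kf: "alm x \<Longrightarrow> x \<in> Kf" by (simp add: alm_def)

lemma alm_mult: assumes "alm x" "alm y" shows "alm (x * y)"
proof -
  obtain M M' :: int where M: "M \<noteq> 0" "\<And>j. of_int M * x ^ j \<in> Or" "M' \<noteq> 0" "\<And>j. of_int M' * y ^ j \<in> Or"
    using assms unfolding alm_def by blast
  have "of_int (M * M') * (x * y) ^ j = (of_int M * x ^ j) * (of_int M' * y ^ j)" for j by (simp add: power_mult_distrib)
  then have "of_int (M * M') * (x * y) ^ j \<in> Or" for j using M Or_mult by presburger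
  then show ?thesis unfolding alm_def using M assms alm_Kf by (intro conjI exI[of _ "M * M'"]) simp_all
qed

lemma alm_add: assumes "alm x" "alm y" shows "alm (x + y)"
proof -
  obtain M M' :: int where M: "M \<noteq> 0" "\<And>j. of_int M * x ^ j \<in> Or" "M' \<noteq> 0" "\<And>j. of_int M' * y ^ j \<in> Or"
    using assms unfolding alm_def by blast
  have "of_int (M * M') * (x + y) ^ j \<in> Or" for j
  proof -
    have "of_int (M * M') * (x + y) ^ j = (\<Sum>k\<le>j. of_nat (j choose k) * ((of_int M * x ^ k) * (of_int M' * y ^ (j - k))))"
      by (simp add: binomial_ring sum_distrib_left mult_ac)
    also have "\<dots> \<in> Or" by (intro Or_sum Or_mult M Or_nat)
    finally show ?thesis .
  qed
  then show ?thesis unfolding alm_def using M assms alm_Kf by (intro conjI exI[of _ "M * M'"]) simp_all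
qed

lemma alm_int [simp]: "alm (of_int k)" "alm (of_nat n)" "alm om" by (simp_all add: alm_Or)
lemma alm_minus: "alm x \<Longrightarrow> alm (- x)" using alm_mult[OF alm_int(1)[of "-1"], of x] by simp
lemma alm_diff: "alm x \<Longrightarrow> alm y \<Longrightarrow> alm (x - y)" using alm_add[of x "- y"] alm_minus by simp

text \<open>Even powers of \<open>x\<close> are controlled by those of \<open>x * x\<close>; odd
  powers cost one further denominator of \<open>x\<close>.\<close>

lemma alm_square: assumes x: "x \<in> Kf" "alm (x * x)" shows "alm x"
proof -
  obtain M :: int where M: "M \<noteq> 0" "\<And>j. of_int M * (x * x) ^ j \<in> Or" using x(2) unfolding alm_def by blast
  obtain d :: int where d: "d \<noteq> 0" "of_int d * x \<in> Or" using Kf_denom[OF x(1)] by blast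
  have "of_int (M * d) * x ^ j \<in> Or" for j
  proof (cases "even j")
    case True
    then obtain i where i: "j = 2 * i" by blast
    have "of_int (M * d) * x ^ j = of_int d * (of_int M * (x * x) ^ i)"
      unfolding i power_mult power2_eq_square by simp
    then show ?thesis by (simp only: Or_mult Or_int M(2))
  next
    case False
    then obtain i where i: "j = 2 * i + 1" using oddE by blast
    have "of_int (M * d) * x ^ j = (of_int d * x) * (of_int M * (x * x) ^ i)"
      unfolding i power_add power_mult power2_eq_square by simp
    then show ?thesis by (simp only: Or_mult d(2) M(2))
  qed
  then show ?thesis unfolding alm_def using M d x by (intro conjI exI[of _ "M * d"]) simp_all
qed

lemma alm_cj: assumes "alm x" shows "alm (cj x)"
proof -
  obtain M :: int where M: "M \<noteq> 0" "\<And>j. of_int M * x ^ j \<in> Or" using assms unfolding alm_def by blast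
  have x: "x \<in> Kf" using assms alm_Kf by blast
  have p: "x ^ j \<in> Kf \<and> cj (x ^ j) = cj x ^ j" for j by (induction j) (simp_all add: x cj_mult)
  have "of_int M * cj x ^ j \<in> Or" for j using Or_cj[OF M(2)[of j]] p[of j] by (simp add: cj_mult)
  then show ?thesis unfolding alm_def using M x by (intro conjI exI[of _ M]) simp_all
qed

text \<open>In lowest terms all powers of the denominator \<open>b\<close> divide the fixed nonzero
  integer \<open>M\<close>, which forces \<open>b = 1\<close>.\<close>

lemma alm_rat: assumes "alm x" "x \<in> \<rat>" shows "x \<in> \<int>"
proof -
  obtain M :: int where M: "M \<noteq> 0" "\<And>j. of_int M * x ^ j \<in> Or" using assms unfolding alm_def by blast
  obtain a b :: int where ab: "b > 0" "coprime a b" "x = of_int a / of_int b" using assms(2) by (rule Rats_cases')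
  have "b ^ j dvd M" for j
  proof -
    have "x ^ j \<in> \<rat>" using assms(2) by (induction j) simp_all
    then have "of_int M * x ^ j \<in> \<rat>" by simp
    then have "of_int M * x ^ j \<in> \<int>" using Or_rat[OF M(2)] by blast
    then obtain c :: int where c: "of_int M * x ^ j = of_int c" by (metis Ints_cases)
    have "real_of_int (M * a ^ j) = of_int (c * b ^ j)" using c ab by (simp add: power_divide field_simps)
    then have "M * a ^ j = c * b ^ j" by (simp only: of_int_eq_iff)
    then have "b ^ j dvd M * a ^ j" by simp
    moreover have "coprime (b ^ j) (a ^ j)" using ab(2) by (simp add: coprime_commute)
    ultimately show ?thesis using coprime_dvd_mult_left_iff by blast
  qed
  then have le: "b ^ j \<le> \<bar>M\<bar>" for j using M(1) ab(1) by (metis abs_of_pos dvd_abs_iff dvd_imp_le_int zero_less_power abs_zero abs_eq_0)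
  have "b = 1"
  proof (rule ccontr)
    assume "b \<noteq> 1"
    then have "2 \<le> b" using ab(1) by simp
    then have "2 ^ nat \<bar>M\<bar> \<le> b ^ nat \<bar>M\<bar>" by (intro power_mono) simp_all
    moreover have "int (nat \<bar>M\<bar>) < 2 ^ nat \<bar>M\<bar>" using of_nat_less_two_power[of "nat \<bar>M\<bar>", where ?'a = int] by simp
    ultimately show False using le[of "nat \<bar>M\<bar>"] by simp
  qed
  then show ?thesis using ab(3) by simp
qed

lemma trace_rat: "x \<in> Kf \<Longrightarrow> x + cj x \<in> \<rat>" and norm_rat: "x \<in> Kf \<Longrightarrow> x * cj x \<in> \<rat>"
proof -
  assume "x \<in> Kf"
  then obtain p q where r: "p \<in> \<rat>" "q \<in> \<rat>" "x = p + q * rt" unfolding Kf_iff by blast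
  have "x + cj x = p + p" unfolding r(3) cj_eq[OF r(1,2)] by simp
  then show "x + cj x \<in> \<rat>" using r(1) by simp
  have qq: "q * q * of_int D = q * q * (rt * rt)" by (simp add: rt_sq)
  have "x * cj x = p * p - q * q * of_int D" unfolding qq r(3) cj_eq[OF r(1,2)] by (simp add: algebra_simps)
  then show "x * cj x \<in> \<rat>" using r by simp
qed

lemma alm_trace: "alm x \<Longrightarrow> x + cj x \<in> \<int>"
  using alm_rat[OF alm_add[OF _ alm_cj]] trace_rat alm_Kf by blast

lemma alm_norm: "alm x \<Longrightarrow> x * cj x \<in> \<int>"
  using alm_rat[OF alm_mult[OF _ alm_cj]] norm_rat alm_Kf by blast

text \<open>Trace duality: the traces of \<open>x * rt\<close> and of
  \<open>x * rt * (om - 1)\<close> are integers, and they turn out to be the coordinates of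
  \<open>D * x\<close> with respect to \<open>om\<close> and 1.\<close>

lemma alm_D: assumes x: "alm x" shows "of_int D * x \<in> Or"
proof -
  have K: "x \<in> Kf" using alm_Kf[OF x] .
  obtain p q where r: "p \<in> \<rat>" "q \<in> \<rat>" "x = p + q * rt" using K unfolding Kf_iff by blast
  have c: "cj x = p - q * rt" using cj_eq[OF r(1,2)] r(3) by simp
  obtain a :: int where a: "x * rt + cj (x * rt) = of_int a"
    using alm_trace[OF alm_mult[OF x alm_Or[OF Or_rt]]] by (metis Ints_cases)
  obtain b :: int where b: "x * (rt * (om - 1)) + cj (x * (rt * (om - 1))) = of_int b"
    using alm_trace[OF alm_mult[OF x alm_Or[of "rt * (om - 1)"]]] by (metis Ints_cases Or_01(2) Or_diff Or_mult Or_om Or_rt)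
  have "of_int a = x * rt + cj x * cj rt" using a cj_mult[OF K Kf_rt] by simp
  also have "\<dots> = (p + q * rt) * rt + (p - q * rt) * (- rt)" unfolding cj_rt c by (simp only: r(3))
  finally have A: "of_int a = 2 * q * (rt * rt)" by (simp add: algebra_simps)
  have cb: "cj (rt * (om - 1)) = rt * om" using Kf_rt by (simp add: cj_mult cj_diff cj_rt cj_om algebra_simps)
  have "of_int b = x * (rt * (om - 1)) + cj x * cj (rt * (om - 1))" using b cj_mult[OF K, of "rt * (om - 1)"] Kf_rt by simp
  also have "\<dots> = (p + q * rt) * (rt * (om - 1)) + (p - q * rt) * (rt * om)" unfolding cb c by (simp only: r(3))
  also have "\<dots> = p * (rt * rt) - q * (rt * rt)" unfolding om_rt by (simp add: field_simps)
  finally have B: "of_int b = p * (rt * rt) - q * (rt * rt)" .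
  have "of_int D * x = (rt * rt) * p + (rt * rt) * q * rt" unfolding rt_sq[symmetric] r(3) by (simp add: algebra_simps)
  also have "\<dots> = of_int b + of_int a * om" unfolding A B om_rt by (simp add: field_simps)
  finally show ?thesis using Or_I by presburger
qed

text \<open>Bezout for \<open>c\<close> and \<open>D\<close>, using \<open>alm_D\<close>: once a
  denominator prime to \<open>D\<close> is known, an almost integral element lies in the order
  itself.\<close>

lemma alm_coprime: assumes x: "alm x" and c: "of_int c * x \<in> Or" "coprime c D" shows "x \<in> Or"
proof -
  obtain u v where uv: "u * c + v * D = 1" using c(2) by (metis bezout_int coprime_imp_gcd_eq_1)
  have "x = of_int (u * c + v * D) * x" using uv by simp
  also have "\<dots> = of_int u * (of_int c * x) + of_int v * (of_int D * x)" by (simp add: algebra_simps)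
  finally show ?thesis using c(1) alm_D[OF x] by (metis Or_add Or_int Or_mult)
qed

lemma alm_coprime2: assumes x: "x \<in> Kf" "alm (of_int a * x)" "alm (of_int b * x)" "coprime a b" shows "alm x"
proof -
  obtain u v where uv: "u * a + v * b = 1" using x(4) by (metis bezout_int coprime_imp_gcd_eq_1)
  have "x = of_int (u * a + v * b) * x" using uv by simp
  also have "\<dots> = of_int u * (of_int a * x) + of_int v * (of_int b * x)" by (simp add: algebra_simps)
  finally show ?thesis using x(2,3) by (metis alm_add alm_int(1) alm_mult)
qed

end

sublocale quad \<subseteq> lsurf om
proof
  have "D \<noteq> 1" using D_nsq by (metis power_one)
  then have "1 < sqrt (of_int D)" using D_pos by simp
  then show "om > 1" by (simp add: quad_w_def)
qed

section \<open>Arithmetic of a cusp over the quadratic field\<close>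

context quad begin

lemma ZW_Or: "ZW = Or" by (simp add: ZW_def quad_order_def)

lemma om_norm: "om * (om - 1) = of_int NN" using om_sq by (simp add: algebra_simps)

lemma NN_pos: "NN > 0"
proof -
  have "real_of_int NN > 0" unfolding om_norm[symmetric] using w1 by simp
  then show ?thesis by simp
qed

lemma Or_parts_unique: "of_int m + of_int n * om = of_int m' + of_int n' * om \<Longrightarrow> m = m' \<and> n = n'"
proof -
  assume e: "of_int m + of_int n * om = of_int m' + of_int n' * om"
  have "(of_int m + of_int n / 2) + (of_int n / 2) * rt = (of_int m' + of_int n' / 2) + (of_int n' / 2) * rt"
    using e unfolding om_rt by (simp add: field_simps)
  from rt_coord[OF _ _ _ _ this] show ?thesis by simp
qed

text \<open>By Bezout \<open>om ^ 3 / j\<close> is itself almost integral. Its norm makes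
  \<open>j\<close> divide a power of \<open>NN\<close>, and its trace makes \<open>j\<close> divide
  \<open>1 + 3 * NN\<close>, which is prime to \<open>NN\<close>.\<close>

lemma alm_om_cube:
  assumes c: "coprime p j" "j > 0" and a: "alm (of_int p * om ^ 3 / of_int j)"
  shows "j = 1"
proof -
  define y where "y = om ^ 3 / of_int j"
  have yK: "y \<in> Kf" unfolding y_def by (simp add: power3_eq_cube)
  have "alm (of_int p * y)" using a by (simp add: y_def)
  moreover have "of_int j * y = om ^ 3" using c(2) by (simp add: y_def)
  then have "alm (of_int j * y)" by (simp add: alm_Or)
  ultimately have y: "alm y" using alm_coprime2[OF yK _ _ c(1)] by blast
  have jy: "of_int j * y = om ^ 3" using c(2) by (simp add: y_def)
  have "cj (of_int j * y) = of_int j * cj y" using yK by (simp add: cj_mult)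
  moreover have "cj (om ^ 3) = (1 - om) ^ 3" by (simp add: power3_eq_cube cj_mult cj_om)
  ultimately have jc: "of_int j * cj y = (1 - om) ^ 3" using jy by simp
  obtain t :: int where t: "y + cj y = of_int t" using alm_trace[OF y] by (metis Ints_cases)
  obtain n :: int where n: "y * cj y = of_int n" using alm_norm[OF y] by (metis Ints_cases)
  have "om ^ 3 + (1 - om) ^ 3 = 1 + 3 * (om * (om - 1))" by (simp add: power3_eq_cube algebra_simps)
  then have "of_int j * (y + cj y) = 1 + 3 * of_int NN" using jy jc om_norm by (simp add: distrib_left)
  then have "real_of_int (j * t) = of_int (1 + 3 * NN)" unfolding t by simp
  then have T: "j * t = 1 + 3 * NN" by (simp only: of_int_eq_iff)
  have "om ^ 3 * (1 - om) ^ 3 = - ((om * (om - 1)) ^ 3)" by (simp add: power3_eq_cube algebra_simps)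
  then have "(of_int j * y) * (of_int j * cj y) = - (of_int NN ^ 3)" unfolding jy jc om_norm by simp
  then have "real_of_int (j * j * n) = of_int (- (NN ^ 3))" unfolding of_int_mult n[symmetric] by (simp add: mult_ac)
  then have "j * j * n = - (NN ^ 3)" by (simp only: of_int_eq_iff)
  then have "j dvd NN ^ 3" by (metis dvd_minus_iff dvd_mult2 dvd_triv_left)
  moreover have "coprime j NN"
  proof (rule coprimeI)
    fix d assume "d dvd j" "d dvd NN"
    then have "d dvd j * t" "d dvd 3 * NN" by simp_all
    then have "d dvd j * t - 3 * NN" by (rule dvd_diff)
    then show "is_unit d" using T by simp
  qed
  then have "coprime j (NN ^ 3)" by simp
  ultimately have "is_unit j" by (metis coprime_absorb_left)
  then show "j = 1" using c(2) by simp
qed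

text \<open>With core holonomies \<open>mu C\<close> and widths \<open>g C\<close>, the products \<open>z C = mu C * g C\<close> lie in the order,
  have negative norm and sum \<open>\<surd>D\<close>; hence there are two cylinders, and the norms of their \<open>z C\<close> agree
  and are at most that of \<open>om\<close>.\<close>
lemma cusp_arithmetic:
  assumes K: "v1 \<in> Kf" "v2 \<in> Kf" "v2 \<noteq> 0"
    and w: "alm (om * b1)" "alm (om * b2)" and bK: "b1 \<in> Kf" "b2 \<in> Kf" and det: "v1 * b2 - v2 * b1 = 1"
    and wv: "alm (om * v1)" "alm (om * v2)"
    and h: "h > 0" "alm (of_int h * v1)" "alm (of_int h * v2)"
    and M0: "M0 > 0" and cusp: "shear (v1 / v2) (of_nat M0 * (om * v2\<^sup>2)) \<in> L_veech_group om om"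
  shows "\<exists>r::int. 1 \<le> r \<and> r \<le> h \<and> of_int r * (om * v1 * v1) \<in> Or \<and> of_int r * (om * v1 * v2) \<in> Or \<and> of_int r * (om * v2 * v2) \<in> Or"
proof -
  define sg where "sg = v1 / v2"
  have sgK: "sg \<in> Kf" and v1: "v1 = sg * v2" using K by (simp_all add: sg_def)
  have om0: "om > 0" using w1 by simp
  have tpos: "of_nat M0 * (om * v2\<^sup>2) > 0" using M0 om0 K(3) by simp
  obtain m I and a b k :: "real set \<Rightarrow> nat" and g :: "real set \<Rightarrow> real" and c :: "real set \<Rightarrow> int" where m: "m > 0" and fin: "finite I"
    and C0: "\<forall>C\<in>I. g C > 0 \<and> k C > 0 \<and> of_nat m * (of_nat M0 * (om * v2\<^sup>2)) * g C = of_nat (k C) * (of_nat (a C) + of_nat (b C) * (om - 1)) \<and>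
      sg * (of_nat (a C) + of_nat (b C) * (om - 1)) \<in> ZW \<and> (\<exists>x\<in>ZW. \<exists>y\<in>ZW. g C = x + sg * y)"
    and sa: "(\<Sum>C\<in>I. of_nat (a C) * g C) = om" and sb: "(\<Sum>C\<in>I. of_nat (b C) * g C) = 1" and sc: "(\<Sum>C\<in>I. of_int (c C) * g C) = sg"
    using cusp_cylinders[OF cusp[folded sg_def] tpos] by (elim exE conjE)
  define M where "M = int (m * M0)"
  have Mp: "M > 0" using m M0 by (simp add: M_def)
  define mu where "mu C = of_nat (a C) + of_nat (b C) * (om - 1)" for C
  have C: "g C > 0" "k C > 0" "of_int M * (om * v2\<^sup>2) * g C = of_nat (k C) * mu C" "sg * mu C \<in> Or" "mu C \<in> Or"
    "\<exists>x\<in>Or. \<exists>y\<in>Or. g C = x + sg * y" if "C \<in> I" for C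
    using C0[rule_format, OF that] unfolding ZW_Or by (simp_all add: M_def mu_def mult_ac)
  have gK: "g C \<in> Kf" if C': "C \<in> I" for C
  proof -
    obtain x y where "x \<in> Or" "y \<in> Or" "g C = x + sg * y" using C(6)[OF C'] by blast
    then show ?thesis using sgK Or_Kf by simp
  qed
  \<comment> \<open>The area of the cylinder; hence the sum, \<open>2 * om - 1\<close>, is the area
    of the surface.\<close>
  define z where "z C = mu C * g C" for C
  have zO: "z C \<in> Or" if C': "C \<in> I" for C
  proof -
    obtain x y where xy: "x \<in> Or" "y \<in> Or" "g C = x + sg * y" using C(6)[OF C'] by blast
    have "z C = mu C * x + (sg * mu C) * y" unfolding z_def xy(3) by (simp add: algebra_simps)
    then show ?thesis using xy C(4,5)[OF C'] by simp
  qed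
  have muK: "mu C \<in> Kf" for C by (simp add: mu_def)
  have ck: "of_int M * (om * v2\<^sup>2) * (g C * g C) = of_nat (k C) * z C" if "C \<in> I" for C
    using C(3)[OF that] by (simp add: z_def mult_ac)
  have ck': "of_int M * ((1 - om) * (cj v2)\<^sup>2) * (cj (g C) * cj (g C)) = of_nat (k C) * cj (z C)" if C': "C \<in> I" for C
  proof -
    have "cj (of_int M * (om * v2\<^sup>2) * (g C * g C)) = cj (of_nat (k C) * z C)" using ck[OF C'] by simp
    then show ?thesis using K gK[OF C'] Or_Kf[OF zO[OF C']] by (simp add: cj_mult cj_om power2_eq_square)
  qed
  have zpos: "z C > 0" if C': "C \<in> I" for C
  proof -
    have "of_int M * (om * v2\<^sup>2) * (g C * g C) > 0" using Mp om0 K(3) C(1)[OF C'] by simp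
    then show ?thesis unfolding ck[OF C'] using C(2)[OF C'] by (simp add: zero_less_mult_iff)
  qed
  \<comment> \<open>\<open>cj om = 1 - om\<close> is negative while the other factors are positive
    or squares: this is where the form \<open>om * v2\<^sup>2\<close> of the twist constant
    enters.\<close>
  have zneg: "cj (z C) < 0" if C': "C \<in> I" for C
  proof -
    have "cj v2 \<noteq> 0" "cj (g C) \<noteq> 0" using cj_0_iff K gK[OF C'] C(1)[OF C'] by auto
    then have "of_int M * (cj v2)\<^sup>2 * (cj (g C) * cj (g C)) > 0" using Mp by (simp add: power2_eq_square[symmetric])
    then have "(1 - om) * (of_int M * (cj v2)\<^sup>2 * (cj (g C) * cj (g C))) < 0" using w1 by (intro mult_neg_pos) simp_all
    then have "of_nat (k C) * cj (z C) < 0" unfolding ck'[OF C', symmetric] by (simp add: mult_ac)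
    then show ?thesis using C(2)[OF C'] by (simp add: mult_less_0_iff)
  qed
  have "\<forall>C\<in>I. \<exists>e n. z C = of_int e + of_int n * om" using zO unfolding quad_order_def by blast
  then obtain e n where en: "\<And>C. C \<in> I \<Longrightarrow> z C = of_int (e C) + of_int (n C) * om" by metis
  have cz: "cj (z C) = of_int (e C) + of_int (n C) * (1 - om)" if "C \<in> I" for C
    unfolding en[OF that] by (simp add: cj_add cj_mult cj_om)
  have n1: "n C \<ge> 1" if C': "C \<in> I" for C
  proof -
    have "z C - cj (z C) = of_int (n C) * (2 * om - 1)" unfolding cz[OF C'] by (simp add: en[OF C'] algebra_simps)
    also have "2 * om - 1 = rt" by (simp add: om_rt field_simps)
    finally have "of_int (n C) * rt = z C - cj (z C)" ..
    then have "of_int (n C) * rt > 0" using zpos[OF C'] zneg[OF C'] by simp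
    then have "n C > 0" using rt_pos by (simp add: zero_less_mult_iff)
    then show ?thesis by simp
  qed
  have sz: "(\<Sum>C\<in>I. z C) = 2 * om - 1"
  proof -
    have "(\<Sum>C\<in>I. z C) = (\<Sum>C\<in>I. of_nat (a C) * g C) + (om - 1) * (\<Sum>C\<in>I. of_nat (b C) * g C)"
      by (simp add: z_def mu_def sum_distrib_left sum.distrib[symmetric] algebra_simps sum_subtractf)
    then show ?thesis unfolding sa sb by simp
  qed
  have "of_int (\<Sum>C\<in>I. e C) + of_int (\<Sum>C\<in>I. n C) * om = of_int (-1) + of_int 2 * om"
  proof -
    have "of_int (\<Sum>C\<in>I. e C) + of_int (\<Sum>C\<in>I. n C) * om = (\<Sum>C\<in>I. z C)"
      using en by (simp add: sum.distrib sum_distrib_right)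
    then show ?thesis using sz by simp
  qed
  from Or_parts_unique[OF this] have en2: "(\<Sum>C\<in>I. e C) = -1" "(\<Sum>C\<in>I. n C) = 2" by blast+
  have "int (card I) \<le> 2" using sum_mono[of I "\<lambda>_. 1" n] n1 en2(2) by simp
  moreover have "card I \<noteq> 0" using en2(2) fin by auto
  \<comment> \<open>A single cylinder would make \<open>om\<close> a quotient of two crossing
    numbers.\<close>
  moreover have "card I \<noteq> 1"
  proof
    assume "card I = 1"
    then obtain C where I: "I = {C}" by (metis card_1_singletonE)
    have ab: "of_nat (b C) * g C = 1" "of_nat (a C) * g C = om" using sa sb I by simp_all
    have b0: "of_nat (b C) \<noteq> (0::real)"
    proof
      assume "of_nat (b C) = (0::real)"
      then show False using ab(1) by simp
    qed
    have "om * of_nat (b C) = of_nat (a C) * (of_nat (b C) * g C)" unfolding ab(2)[symmetric] by simp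
    then have "om * of_nat (b C) = of_nat (a C)" unfolding ab(1) by simp
    with b0 have "om = of_nat (a C) / of_nat (b C)" by (simp add: field_simps)
    then have "om \<in> \<rat>" by simp
    moreover have "rt = 2 * om - 1" by (simp add: om_rt field_simps)
    ultimately have "rt \<in> \<rat>" by simp
    then show False using rt_irrational by blast
  qed
  ultimately have "card I = 2" by linarith
  then obtain C1 C2 where I: "I = {C1, C2}" "C1 \<noteq> C2" by (metis card_2_iff)
  have i: "C1 \<in> I" "C2 \<in> I" using I by auto
  have n12: "n C1 = 1" "n C2 = 1" using en2(2) n1[OF i(1)] n1[OF i(2)] I by simp_all
  have e12: "e C2 = - 1 - e C1" using en2(1) I by simp
  \<comment> \<open>\<open>- n0\<close> is the common norm: \<open>e C2 = - 1 - e C1\<close> makes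
    one area minus the conjugate of the other.\<close>
  define n0 where "n0 = NN - e C1 * (e C1 + 1)"
  have nz: "z C * cj (z C) = - of_int n0" if C': "C \<in> I" for C
  proof -
    have nC: "n C = 1" and eC: "e C * (e C + 1) = e C1 * (e C1 + 1)"
    proof -
      have "e C2 * (e C2 + 1) = e C1 * (e C1 + 1)" unfolding e12 by (simp add: algebra_simps)
      moreover have "C = C1 \<or> C = C2" using C' I by blast
      ultimately show "n C = 1" "e C * (e C + 1) = e C1 * (e C1 + 1)" using n12 by (elim disjE; simp)+
    qed
    have zz: "cj (z C) = of_int (e C) + (1 - om)" "z C = of_int (e C) + om" using cz[OF C'] en[OF C'] nC by simp_all
    have "z C * cj (z C) = of_int (e C * (e C + 1)) - om * (om - 1)"
    proof -
      have "z C * cj (z C) = z C * (of_int (e C) + (1 - om))" unfolding zz(1) ..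
      also have "\<dots> = (of_int (e C) + om) * (of_int (e C) + (1 - om))" unfolding zz(2) ..
      finally show ?thesis by (simp add: algebra_simps)
    qed
    then show ?thesis unfolding om_norm eC n0_def by simp
  qed
  have n0: "n0 > 0" "n0 \<le> NN"
  proof -
    have "z C1 * cj (z C1) < 0" using zpos[OF i(1)] zneg[OF i(1)] by (rule mult_pos_neg)
    then show "n0 > 0" using nz[OF i(1)] by simp
    have "e C1 * (e C1 + 1) \<ge> 0" by (cases "e C1 \<ge> 0") (simp_all add: mult_nonpos_nonpos)
    then show "n0 \<le> NN" by (simp add: n0_def)
  qed
  define y where "y C = (v2 * g C) * cj (v2 * g C)" for C
  have hy: "\<exists>u::int. of_int h * y C = of_int u \<and> u \<noteq> 0" if C': "C \<in> I" for C
  proof -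
    obtain p q where pq: "p \<in> Or" "q \<in> Or" "g C = p + sg * q" using C(6)[OF C'] by blast
    define x where "x = v2 * g C"
    have xK: "x \<in> Kf" using K gK[OF C'] by (simp add: x_def)
    have x: "x = v2 * p + v1 * q" unfolding x_def pq(3) v1 by (simp add: algebra_simps)
    have "of_int h * x = (of_int h * v2) * p + (of_int h * v1) * q" "om * x = (om * v2) * p + (om * v1) * q"
      unfolding x by (simp_all add: algebra_simps)
    then have ax: "alm (of_int h * x)" "alm (om * x)" using h wv pq alm_Or alm_add alm_mult by presburger+
    \<comment> \<open>The trace of this product is \<open>h\<close> times the norm of
      \<open>x\<close>, because \<open>om + cj om = 1\<close>. Pairing \<open>h * x\<close> with
      \<open>om * x\<close> costs only \<open>h\<close>, where \<open>h * x\<close> alone would cost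
      \<open>h\<^sup>2\<close>.\<close>
    have "alm ((of_int h * x) * cj (om * x))" using alm_mult[OF ax(1) alm_cj[OF ax(2)]] .
    from alm_trace[OF this] have "(of_int h * x) * cj (om * x) + cj ((of_int h * x) * cj (om * x)) \<in> \<int>" .
    moreover have "(of_int h * x) * cj (om * x) + cj ((of_int h * x) * cj (om * x)) = of_int h * y C"
      using xK by (simp add: cj_mult cj_cj cj_om cj_diff y_def x_def[symmetric] algebra_simps)
    ultimately obtain u :: int where u: "of_int h * y C = of_int u" by (metis Ints_cases)
    have "x \<noteq> 0" using K C(1)[OF C'] by (simp add: x_def)
    then have "y C \<noteq> 0" using cj_0_iff[OF xK] by (simp add: y_def x_def[symmetric])
    then show ?thesis using u h(1) by (intro exI[of _ u]) auto
  qed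
  \<comment> \<open>The norm of the relation \<open>ck\<close>.\<close>
  have yk: "(of_int M * y C)\<^sup>2 * of_int NN = (of_nat (k C))\<^sup>2 * of_int n0" if C': "C \<in> I" for C
  proof -
    have "(of_nat (k C) * z C) * (of_nat (k C) * cj (z C)) = (of_int M * (om * v2\<^sup>2) * (g C * g C)) * (of_int M * ((1 - om) * (cj v2)\<^sup>2) * (cj (g C) * cj (g C)))"
      unfolding ck[OF C'] ck'[OF C'] ..
    also have "\<dots> = - ((of_int M * y C)\<^sup>2 * (om * (om - 1)))"
      using K gK[OF C'] by (simp add: y_def cj_mult power2_eq_square algebra_simps)
    finally have "(of_nat (k C))\<^sup>2 * (z C * cj (z C)) = - ((of_int M * y C)\<^sup>2 * of_int NN)"
      unfolding om_norm by (simp add: power2_eq_square mult_ac)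
    then show ?thesis unfolding nz[OF C'] by simp
  qed
  obtain u1 where u1: "of_int h * y C1 = of_int u1" "u1 \<noteq> 0" using hy[OF i(1)] by blast
  obtain u2 where u2: "of_int h * y C2 = of_int u2" "u2 \<noteq> 0" using hy[OF i(2)] by blast
  have uk: "(M * u)\<^sup>2 * NN = (h * int (k C))\<^sup>2 * n0" if C': "C \<in> I" and u: "of_int h * y C = of_int u" for C u
  proof -
    have "real_of_int ((M * u)\<^sup>2 * NN) = (of_int h)\<^sup>2 * ((of_int M * y C)\<^sup>2 * of_int NN)"
      unfolding of_int_mult of_int_power u[symmetric] by (simp add: power_mult_distrib mult_ac)
    also have "\<dots> = real_of_int ((h * int (k C))\<^sup>2 * n0)" unfolding yk[OF C'] by (simp add: power_mult_distrib)
    finally show ?thesis by (simp only: of_int_eq_iff)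
  qed
  define k1 where "k1 = int (k C1)"
  define k2 where "k2 = int (k C2)"
  have kp: "k1 > 0" "k2 > 0" using C(2) i by (simp_all add: k1_def k2_def)
  note uk1 = uk[OF i(1) u1(1), folded k1_def] and uk2 = uk[OF i(2) u2(1), folded k2_def]
  \<comment> \<open>Put \<open>k1 : k2 = a1 : a2\<close> in lowest terms. By \<open>yk\<close> the
    integers \<open>u1\<close>, \<open>u2\<close> are in the same ratio up to sign, so
    \<open>a1\<close> divides \<open>u1\<close>; with \<open>n0 \<le> NN\<close> this yields
    \<open>M \<le> h * G\<close>.\<close>
  define G where "G = gcd k1 k2"
  have G: "G > 0" using kp by (simp add: G_def)
  obtain a1 a2 where al: "k1 = G * a1" "k2 = G * a2" unfolding G_def by (metis dvdE gcd_dvd1 gcd_dvd2)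
  have alp: "a1 > 0" "a2 > 0" using kp al G by (simp_all add: zero_less_mult_iff)
  have cop: "coprime a1 a2"
  proof -
    have "gcd (G * a1) (G * a2) = G" by (simp only: al[symmetric] G_def[symmetric])
    then have "G * gcd a1 a2 = G" using G by (simp add: gcd_mult_left)
    then have "gcd a1 a2 = 1" using G by simp
    then show ?thesis by (simp add: coprime_iff_gcd_eq_1)
  qed
  have ratio: "\<bar>u1\<bar> * a2 = \<bar>u2\<bar> * a1"
  proof -
    have "((M * u1)\<^sup>2 * NN) * ((h * k2)\<^sup>2 * n0) = ((M * u2)\<^sup>2 * NN) * ((h * k1)\<^sup>2 * n0)" unfolding uk1 uk2 by (simp add: mult_ac)
    then have "(M\<^sup>2 * NN * h\<^sup>2 * n0 * G\<^sup>2) * (u1 * a2)\<^sup>2 = (M\<^sup>2 * NN * h\<^sup>2 * n0 * G\<^sup>2) * (u2 * a1)\<^sup>2"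
      unfolding al by (simp add: power_mult_distrib mult_ac)
    moreover have "M\<^sup>2 * NN * h\<^sup>2 * n0 * G\<^sup>2 \<noteq> 0" using Mp NN_pos h(1) n0 G by simp
    ultimately have "(u1 * a2)\<^sup>2 = (u2 * a1)\<^sup>2" by simp
    then have "\<bar>u1 * a2\<bar> = \<bar>u2 * a1\<bar>" by (simp add: power2_eq_iff abs_eq_iff)
    then show ?thesis using alp by (simp add: abs_mult)
  qed
  have "a1 dvd \<bar>u1\<bar> * a2" unfolding ratio by simp
  then have "a1 dvd \<bar>u1\<bar>" using cop coprime_dvd_mult_left_iff by blast
  then have a1u: "a1 \<le> \<bar>u1\<bar>" using u1(2) by (simp add: zdvd_imp_le)
  have "M * a1 \<le> h * k1"
  proof -
    have "(M * a1)\<^sup>2 * NN \<le> (M * u1)\<^sup>2 * NN"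
    proof (rule mult_right_mono)
      have "\<bar>M * a1\<bar> \<le> \<bar>M * u1\<bar>" using a1u Mp alp by (simp add: abs_mult)
      then show "(M * a1)\<^sup>2 \<le> (M * u1)\<^sup>2" by (rule abs_le_square_iff[THEN iffD1])
    qed (use NN_pos in simp)
    also have "\<dots> = (h * k1)\<^sup>2 * n0" by (rule uk1)
    also have "\<dots> \<le> (h * k1)\<^sup>2 * NN" using n0 by (simp add: mult_left_mono)
    finally have "(M * a1)\<^sup>2 \<le> (h * k1)\<^sup>2" using NN_pos by simp
    then show ?thesis by (rule power2_le_imp_le) (use h(1) kp in simp)
  qed
  then have "M * a1 \<le> (h * G) * a1" unfolding al by (simp add: mult_ac)
  then have MhG: "M \<le> h * G" using alp by simp
  define dd where "dd = gcd M G"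
  define p where "p = M div dd"
  define j where "j = G div dd"
  have pj: "M = dd * p" "G = dd * j" by (simp_all add: p_def j_def dd_def)
  have gg: "dd > 0" using Mp by (simp add: dd_def)
  have pp: "p > 0" "j > 0" using Mp G pj gg by (metis zero_less_mult_pos)+
  have cpj: "coprime p j" unfolding p_def j_def dd_def using Mp by (intro div_gcd_coprime) simp
  have alg: "of_int p * (om * v2\<^sup>2) * g C = of_int j * (of_int (k C div G) * mu C)" if C': "C \<in> I" for C
  proof -
    have kC: "int (k C) = G * (int (k C) div G)" using C' I al by (auto simp: k1_def k2_def)
    have "of_int (dd) * (of_int p * (om * v2\<^sup>2) * g C) = of_int (dd * p) * (om * v2\<^sup>2) * g C" by simp
    also have "\<dots> = of_int (int (k C)) * mu C" using C(3)[OF C'] pj(1) by simp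
    also have "\<dots> = of_int (dd * j * (int (k C) div G)) * mu C" using kC pj(2) by metis
    also have "\<dots> = of_int (dd) * (of_int j * (of_int (int (k C) div G) * mu C))" by simp
    finally show ?thesis using gg by simp
  qed
  \<comment> \<open>Used for the combinations of widths equal to 1 and to \<open>sg\<close>, which
    together produce the three entries of \<open>p * om\<close> times the symmetric square of
    \<open>(v1, v2)\<close>.\<close>
  have EE: "\<exists>x\<in>Or. of_int p * (om * v2\<^sup>2) * (\<Sum>C\<in>I. of_int (f C) * g C) = of_int j * x \<and>
      of_int p * (om * v2\<^sup>2) * sg * (\<Sum>C\<in>I. of_int (f C) * g C) = of_int j * (sg * x) \<and> sg * x \<in> Or" for f :: "real set \<Rightarrow> int"
  proof -
    define x where "x = (\<Sum>C\<in>I. of_int (f C * (int (k C) div G)) * mu C)"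
    have xO: "x \<in> Or" unfolding x_def by (rule Or_sum) (use C(5) in simp)
    have sx: "sg * x = (\<Sum>C\<in>I. of_int (f C * (int (k C) div G)) * (sg * mu C))" unfolding x_def by (simp add: sum_distrib_left mult_ac)
    have sxO: "sg * x \<in> Or" unfolding sx by (rule Or_sum) (use C(4) in simp)
    have 1: "of_int p * (om * v2\<^sup>2) * (\<Sum>C\<in>I. of_int (f C) * g C) = of_int j * x"
      unfolding x_def sum_distrib_left
    proof (rule sum.cong[OF refl])
      fix C assume C': "C \<in> I"
      have "of_int p * (om * v2\<^sup>2) * (of_int (f C) * g C) = of_int (f C) * (of_int p * (om * v2\<^sup>2) * g C)" by simp
      also have "\<dots> = of_int j * (of_int (f C * (int (k C) div G)) * mu C)" unfolding alg[OF C'] by simp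
      finally show "of_int p * (om * v2\<^sup>2) * (of_int (f C) * g C) = of_int j * (of_int (f C * (int (k C) div G)) * mu C)" .
    qed
    have "of_int p * (om * v2\<^sup>2) * sg * (\<Sum>C\<in>I. of_int (f C) * g C) = sg * (of_int p * (om * v2\<^sup>2) * (\<Sum>C\<in>I. of_int (f C) * g C))" by simp
    also have "\<dots> = of_int j * (sg * x)" unfolding 1 by simp
    finally show ?thesis using xO sxO 1 by blast
  qed
  obtain x22 where x22: "x22 \<in> Or" "of_int p * (om * v2\<^sup>2) = of_int j * x22" "of_int p * (om * v2\<^sup>2) * sg = of_int j * (sg * x22)" "sg * x22 \<in> Or"
    using EE[of "\<lambda>C. int (b C)"] sb by auto
  obtain x12 where x12: "of_int p * (om * v2\<^sup>2) * sg * sg = of_int j * (sg * x12)" "sg * x12 \<in> Or"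
    using EE[of c] unfolding sc by blast
  have Eq: "of_int p * (om * v2 * v2) = of_int j * x22" "of_int p * (om * v1 * v2) = of_int j * (sg * x22)" "of_int p * (om * v1 * v1) = of_int j * (sg * x12)"
    using x22 x12 unfolding v1 by (simp_all add: power2_eq_square mult_ac)
  \<comment> \<open>The determinant identity recovers \<open>om ^ 3\<close> from these entries with
    coefficients built from the almost integral \<open>om * b1\<close> and \<open>om * b2\<close>;
    thus \<open>p * om ^ 3 / j\<close> is almost integral and \<open>j = 1\<close>.\<close>
  have "om ^ 3 = om * ((v1 * b2 - v2 * b1) * om)\<^sup>2" unfolding det by (simp add: power3_eq_cube power2_eq_square)
  then have "of_int p * om ^ 3 = of_int p * (om * ((v1 * b2 - v2 * b1) * om)\<^sup>2)" by (rule arg_cong)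
  also have "\<dots> = (of_int p * (om * v1 * v1)) * ((om * b2) * (om * b2)) - (of_int p * (om * v1 * v2)) * (of_int 2 * ((om * b1) * (om * b2)))
      + (of_int p * (om * v2 * v2)) * ((om * b1) * (om * b1))" by (simp add: power2_eq_square algebra_simps)
  also have "\<dots> = of_int j * ((sg * x12) * ((om * b2) * (om * b2)) - (sg * x22) * (of_int 2 * ((om * b1) * (om * b2))) + x22 * ((om * b1) * (om * b1)))"
    unfolding Eq by (simp add: algebra_simps)
  finally have "of_int p * om ^ 3 / of_int j = (sg * x12) * ((om * b2) * (om * b2)) - (sg * x22) * (of_int 2 * ((om * b1) * (om * b2))) + x22 * ((om * b1) * (om * b1))"
    using pp by simp
  moreover have "alm ((sg * x12) * ((om * b2) * (om * b2)) - (sg * x22) * (of_int 2 * ((om * b1) * (om * b2))) + x22 * ((om * b1) * (om * b1)))"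
    by (intro alm_add alm_diff alm_mult alm_Or x12 x22 w Or_int)
  ultimately have "j = 1" using alm_om_cube[OF cpj pp(2)] by simp
  then have Eq1: "of_int p * (om * v2 * v2) \<in> Or" "of_int p * (om * v1 * v2) \<in> Or" "of_int p * (om * v1 * v1) \<in> Or"
    unfolding Eq using x22 x12 by simp_all
  have "p \<le> h"
  proof -
    have "dd * p \<le> h * dd" using MhG pj \<open>j = 1\<close> by simp
    then show ?thesis using gg by (simp add: mult.commute)
  qed
  then show ?thesis using Eq1 pp by (intro exI[of _ p]) simp
qed

end

section \<open>Finite extensions of the Veech group\<close>

definition adj :: "real^2^2 \<Rightarrow> real^2^2" where
  "adj X = vector [vector [X $ 2 $ 2, - X $ 1 $ 2], vector [- X $ 2 $ 1, X $ 1 $ 1]]"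

lemma adj_nth [simp]: "adj X $ 1 $ 1 = X $ 2 $ 2" "adj X $ 1 $ 2 = - X $ 1 $ 2"
  "adj X $ 2 $ 1 = - X $ 2 $ 1" "adj X $ 2 $ 2 = X $ 1 $ 1" by (simp_all add: adj_def vector_2)

lemma mat2_eq_iff: "X = Y \<longleftrightarrow> X $ 1 $ 1 = Y $ 1 $ 1 \<and> X $ 1 $ 2 = Y $ 1 $ 2 \<and> X $ 2 $ 1 = Y $ 2 $ 1 \<and> X $ 2 $ 2 = (Y :: real^2^2) $ 2 $ 2"
  by (simp only: vec_eq_iff forall_2 conj_assoc)

lemma mult_nth: "(X ** Y) $ i $ j = X $ i $ 1 * Y $ 1 $ j + X $ i $ 2 * (Y :: real^2^2) $ 2 $ j"
  by (simp add: matrix_matrix_mult_def sum_2)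

lemma mult_adj: "det X = 1 \<Longrightarrow> X ** adj X = mat 1" "det X = 1 \<Longrightarrow> adj X ** X = mat 1"
  by (auto simp: mat2_eq_iff mult_nth mat_def det_2 algebra_simps)

lemma adj_unique: assumes "det X = 1" "X ** Y = mat 1" shows "Y = adj X"
proof -
  have "Y = (adj X ** X) ** Y" using mult_adj(2)[OF assms(1)] by simp
  also have "\<dots> = adj X ** (X ** Y)" by (simp only: matrix_mul_assoc)
  finally show ?thesis using assms(2) by simp
qed

lemma swapm_mult: "swapm (X ** Y) = swapm X ** swapm Y" by (simp add: mat2_eq_iff mult_nth add.commute)

lemma swapm_swapm [simp]: "swapm (swapm X) = X" by (simp add: mat2_eq_iff)

lemma trace2: "trace X = X $ 1 $ 1 + X $ 2 $ 2" for X :: "real^2^2" by (simp add: trace_def sum_2)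

context quad begin

abbreviation Gam :: "(real^2^2) set" where "Gam \<equiv> L_veech_group om om"

text \<open>Finite extensions in terms of matrices: \<open>adj\<close> is the inverse in determinant
  1, and \<open>R\<close> contains representatives of the cosets \<open>Gam r\<close>. This form
  passes to the mirror image in \<open>over_swap\<close>.\<close>

definition over :: "(real^2^2) set \<Rightarrow> bool" where
  "over H \<longleftrightarrow> Gam \<subseteq> H \<and> (\<forall>X\<in>H. \<forall>Y\<in>H. X ** Y \<in> H) \<and> (\<forall>X\<in>H. det X = 1 \<and> adj X \<in> H) \<and>
     (\<exists>R. finite R \<and> (\<forall>X\<in>H. \<exists>Y\<in>Gam. \<exists>r\<in>R. X = Y ** r))"

lemma overD:
  assumes "over H"
  shows "\<And>X. X \<in> Gam \<Longrightarrow> X \<in> H" "\<And>X Y. X \<in> H \<Longrightarrow> Y \<in> H \<Longrightarrow> X ** Y \<in> H" "\<And>X. X \<in> H \<Longrightarrow> det X = 1" "\<And>X. X \<in> H \<Longrightarrow> adj X \<in> H"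
    "\<exists>R. finite R \<and> (\<forall>X\<in>H. \<exists>Y\<in>Gam. \<exists>r\<in>R. X = Y ** r)"
  using assms unfolding over_def by blast+

lemma Gam_adj: "X \<in> Gam \<Longrightarrow> adj X \<in> Gam" using veech_inverse mult_adj(1) veech_iff by blast

lemma over_finite_index:
  assumes H: "fuchsian H" and f: "finite_index_in Gam H"
  shows "over H"
proof -
  have sub: "subgroup H SL2R" using H by (simp add: fuchsian_def)
  interpret group SL2R by (rule group_SL2R)
  have GH: "Gam \<subseteq> H" and fin: "finite (rcosets\<^bsub>SL2R\<lparr>carrier := H\<rparr>\<^esub> Gam)" using f by (auto simp: finite_index_in_def)
  have mult: "X ** Y \<in> H" if "X \<in> H" "Y \<in> H" for X Y using subgroup.m_closed[OF sub that] by (simp add: SL2R_def)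
  have det: "det X = 1" if "X \<in> H" for X using subgroup.mem_carrier[OF sub that] by (simp add: SL2R_def SL2_def)
  have adjH: "adj X \<in> H" if X: "X \<in> H" for X
  proof -
    have i: "inv\<^bsub>SL2R\<^esub> X \<in> H" using subgroup.m_inv_closed[OF sub X] .
    have "X \<otimes>\<^bsub>SL2R\<^esub> inv\<^bsub>SL2R\<^esub> X = \<one>\<^bsub>SL2R\<^esub>" using r_inv[OF subgroup.mem_carrier[OF sub X]] .
    then have "X ** inv\<^bsub>SL2R\<^esub> X = mat 1" by (simp add: SL2R_def)
    from adj_unique[OF det[OF X] this] show ?thesis using i by simp
  qed
  define cs :: "real^2^2 \<Rightarrow> _" where "cs r = {Y ** r | Y. Y \<in> Gam}" for r
  have rc: "rcosets\<^bsub>SL2R\<lparr>carrier := H\<rparr>\<^esub> Gam = cs ` H"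
    by (auto simp: RCOSETS_def r_coset_def SL2R_def cs_def)
  obtain R where R: "R \<subseteq> H" "finite R" "cs ` H = cs ` R" using fin unfolding rc by (metis finite_subset_image subset_refl)
  have "\<exists>Y\<in>Gam. \<exists>r\<in>R. X = Y ** r" if X: "X \<in> H" for X
  proof -
    obtain r where r: "r \<in> R" "cs X = cs r" using R(3) X by blast
    have "mat 1 \<in> Gam" using subgroup.one_closed[OF veech_subgroup] by (simp add: SL2R_def)
    then have "mat 1 ** X \<in> cs X" unfolding cs_def by blast
    then have "X \<in> cs r" using r by simp
    then show ?thesis using r(1) unfolding cs_def by blast
  qed
  then show ?thesis unfolding over_def using GH mult det adjH R(2) by blast
qed

lemma over_swap: assumes H: "over H" shows "over (swapm ` H)" unfolding over_def
proof (intro conjI)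
  note O = overD[OF H]
  show "Gam \<subseteq> swapm ` H"
  proof
    fix X assume "X \<in> Gam"
    then have "swapm X \<in> H" using O(1) veech_swap by blast
    then show "X \<in> swapm ` H" by (metis imageI swapm_swapm)
  qed
  show "\<forall>X\<in>swapm ` H. \<forall>Y\<in>swapm ` H. X ** Y \<in> swapm ` H" using O(2) by (auto simp: swapm_mult[symmetric])
  have "adj (swapm X) = swapm (adj X)" for X by (simp add: mat2_eq_iff)
  then show "\<forall>X\<in>swapm ` H. det X = 1 \<and> adj X \<in> swapm ` H" using O(3,4) by auto
  obtain R where R: "finite R" "\<forall>X\<in>H. \<exists>Y\<in>Gam. \<exists>r\<in>R. X = Y ** r" using O(5) by blast
  have "\<exists>Y\<in>Gam. \<exists>r\<in>swapm ` R. X = Y ** r" if X: "X \<in> swapm ` H" for X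
  proof -
    obtain Z where Z: "Z \<in> H" "X = swapm Z" using X by blast
    obtain Y r where Yr: "Y \<in> Gam" "r \<in> R" "Z = Y ** r" using R(2) Z(1) by blast
    have "X = swapm Y ** swapm r" unfolding Z(2) Yr(3) by (rule swapm_mult)
    then show ?thesis using veech_swap[OF Yr(1)] Yr(2) by blast
  qed
  then show "\<exists>R. finite R \<and> (\<forall>X\<in>swapm ` H. \<exists>Y\<in>Gam. \<exists>r\<in>R. X = Y ** r)" using R(1) by (intro exI[of _ "swapm ` R"]) simp
qed

lemma Kf_numeral [simp]: "numeral k \<in> Kf" using Kf_int[of "numeral k"] by simp

definition inK :: "real^2^2 \<Rightarrow> bool" where "inK X \<longleftrightarrow> (\<forall>i j. X $ i $ j \<in> Kf)"

lemma inK_iff: "inK X \<longleftrightarrow> X $ 1 $ 1 \<in> Kf \<and> X $ 1 $ 2 \<in> Kf \<and> X $ 2 $ 1 \<in> Kf \<and> X $ 2 $ 2 \<in> Kf"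
  by (auto simp: inK_def forall_2)

lemma inK_mult: "inK X \<Longrightarrow> inK Y \<Longrightarrow> inK (X ** Y)" and inK_adj: "inK X \<Longrightarrow> inK (adj X)"
  and inK_swap: "inK X \<Longrightarrow> inK (swapm X)" unfolding inK_iff by (simp_all add: mult_nth)

lemma Gam_Or: "X \<in> Gam \<Longrightarrow> X $ i $ j \<in> Or" using veech_entries ZW_Or by blast

lemma Gam_inK: "X \<in> Gam \<Longrightarrow> inK X" unfolding inK_def using Gam_Or Or_Kf by blast

text \<open>Given one element \<open>?Z\<close> of a coset with entries in \<open>Kf\<close>, the
  others are integral matrices from \<open>Gam\<close> times \<open>?Z\<close>; so one denominator
  serves the whole coset, and there are finitely many cosets.\<close>

lemma over_denominator:
  assumes H: "over H"
  shows "\<exists>M::int. M \<noteq> 0 \<and> (\<forall>X\<in>H. inK X \<longrightarrow> (\<forall>i j. of_int M * X $ i $ j \<in> Or))"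
proof -
  obtain R where R: "finite R" "\<forall>X\<in>H. \<exists>Y\<in>Gam. \<exists>r\<in>R. X = Y ** r" using overD(5)[OF H] by blast
  have "\<exists>d::int. d \<noteq> 0 \<and> (\<forall>Y\<in>Gam. inK (Y ** r) \<longrightarrow> (\<forall>i j. of_int d * (Y ** r) $ i $ j \<in> Or))" for r
  proof (cases "\<exists>Y\<in>Gam. inK (Y ** r)")
    case True
    then obtain Y0 where Y0: "Y0 \<in> Gam" "inK (Y0 ** r)" by blast
    let ?Z = "Y0 ** r"
    obtain d11 where d11: "d11 \<noteq> 0" "of_int d11 * ?Z $ 1 $ 1 \<in> Or" using Kf_denom Y0(2) unfolding inK_iff by blast
    obtain d12 where d12: "d12 \<noteq> 0" "of_int d12 * ?Z $ 1 $ 2 \<in> Or" using Kf_denom Y0(2) unfolding inK_iff by blast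
    obtain d21 where d21: "d21 \<noteq> 0" "of_int d21 * ?Z $ 2 $ 1 \<in> Or" using Kf_denom Y0(2) unfolding inK_iff by blast
    obtain d22 where d22: "d22 \<noteq> 0" "of_int d22 * ?Z $ 2 $ 2 \<in> Or" using Kf_denom Y0(2) unfolding inK_iff by blast
    define d where "d = d11 * d12 * d21 * d22"
    have dd: "of_int d * ?Z $ 1 $ 1 = of_int (d12 * d21 * d22) * (of_int d11 * ?Z $ 1 $ 1)"
      "of_int d * ?Z $ 1 $ 2 = of_int (d11 * d21 * d22) * (of_int d12 * ?Z $ 1 $ 2)"
      "of_int d * ?Z $ 2 $ 1 = of_int (d11 * d12 * d22) * (of_int d21 * ?Z $ 2 $ 1)"
      "of_int d * ?Z $ 2 $ 2 = of_int (d11 * d12 * d21) * (of_int d22 * ?Z $ 2 $ 2)" by (simp_all add: d_def)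
    have "\<forall>i j. of_int d * ?Z $ i $ j \<in> Or"
      unfolding forall_2 dd by (intro conjI Or_mult Or_int d11 d12 d21 d22)
    then have dZ: "of_int d * ?Z $ i $ j \<in> Or" for i j by blast
    have "of_int d * (Y ** r) $ i $ j \<in> Or" if Y: "Y \<in> Gam" for Y i j
    proof -
      have "adj Y0 ** ?Z = (adj Y0 ** Y0) ** r" by (simp only: matrix_mul_assoc)
      then have "r = adj Y0 ** ?Z" using mult_adj(2) veech_iff Y0(1) by simp
      then have e: "Y ** r = (Y ** adj Y0) ** ?Z" by (metis matrix_mul_assoc)
      have YG: "Y ** adj Y0 \<in> Gam" using veech_mult[OF Y Gam_adj[OF Y0(1)]] .
      have "of_int d * (Y ** r) $ i $ j = (Y ** adj Y0) $ i $ 1 * (of_int d * ?Z $ 1 $ j) + (Y ** adj Y0) $ i $ 2 * (of_int d * ?Z $ 2 $ j)"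
        unfolding e mult_nth[of "Y ** adj Y0" ?Z] by (simp only: distrib_left mult_ac)
      then show ?thesis using dZ Gam_Or[OF YG] by (simp only: Or_add Or_mult)
    qed
    moreover have "d \<noteq> 0" using d11 d12 d21 d22 by (simp add: d_def)
    ultimately show ?thesis by blast
  next
    case False
    then show ?thesis by (intro exI[of _ 1]) simp
  qed
  then obtain d :: "real^2^2 \<Rightarrow> int" where d: "\<And>r. d r \<noteq> 0" "\<And>r Y i j. Y \<in> Gam \<Longrightarrow> inK (Y ** r) \<Longrightarrow> of_int (d r) * (Y ** r) $ i $ j \<in> Or"
    by metis
  define M where "M = (\<Prod>r\<in>R. d r)"
  have M0: "M \<noteq> 0" unfolding M_def using R(1) d(1) by simp
  have "of_int M * X $ i $ j \<in> Or" if X: "X \<in> H" "inK X" for X i j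
  proof -
    obtain Y r where Yr: "Y \<in> Gam" "r \<in> R" "X = Y ** r" using R(2) X(1) by blast
    have "M = d r * (\<Prod>r\<in>R - {r}. d r)" unfolding M_def using R(1) Yr(2) by (rule prod.remove)
    then have "of_int M * X $ i $ j = of_int (\<Prod>r\<in>R - {r}. d r) * (of_int (d r) * (Y ** r) $ i $ j)" using Yr(3) by simp
    then show ?thesis using d(2)[OF Yr(1)] X(2) Yr(3) by (simp only: Or_mult Or_int)
  qed
  then show ?thesis using M0 by blast
qed

text \<open>The rule \<open>tr X * tr Y = tr (X Y) + tr (X\<^sup>-\<^sup>1 Y)\<close> writes powers of a trace as sums of traces, which
  have bounded denominators.\<close>
lemma trace_alm:
  assumes H: "over H" and X: "X \<in> H" "inK X" shows "alm (trace X)"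
proof -
  note O = overD[OF H]
  obtain M :: int where M: "M \<noteq> 0" "\<And>X i j. X \<in> H \<Longrightarrow> inK X \<Longrightarrow> of_int M * X $ i $ j \<in> Or" using over_denominator[OF H] by blast
  have tr: "trace X * trace Y = trace (X ** Y) + trace (adj X ** Y)" for Y
    by (simp add: trace2 mult_nth algebra_simps)
  have "of_int M * (trace X ^ j * trace Y) \<in> Or" if "Y \<in> H" "inK Y" for j Y using that
  proof (induction j arbitrary: Y)
    case 0
    have "of_int M * trace Y = of_int M * Y $ 1 $ 1 + of_int M * Y $ 2 $ 2" by (simp add: trace2 distrib_left)
    then show ?case using M(2)[OF 0] by simp
  next
    case (Suc j)
    have "of_int M * (trace X ^ Suc j * trace Y) = of_int M * (trace X ^ j * (trace X * trace Y))" by (simp add: mult_ac)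
    also have "\<dots> = of_int M * (trace X ^ j * trace (X ** Y)) + of_int M * (trace X ^ j * trace (adj X ** Y))"
      unfolding tr by (simp only: distrib_left)
    finally show ?case using Suc.IH[OF O(2)[OF X(1) Suc.prems(1)] inK_mult[OF X(2) Suc.prems(2)]]
        Suc.IH[OF O(2)[OF O(4)[OF X(1)] Suc.prems(1)] inK_mult[OF inK_adj[OF X(2)] Suc.prems(2)]] by simp
  qed
  moreover have "mat 1 \<in> H" "inK (mat 1)"
    using O(1) subgroup.one_closed[OF veech_subgroup] by (simp_all add: SL2R_def inK_iff mat_def)
  moreover have "trace (mat 1 :: real^2^2) = 2" by (simp add: trace2 mat_def)
  ultimately have t: "of_int M * (trace X ^ j * 2) \<in> Or" for j by metis
  have "of_int (M * 2) * trace X ^ j \<in> Or" for j using t[of j] by (simp add: mult_ac)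
  then show ?thesis unfolding alm_def using M(1) X(2) by (intro conjI exI[of _ "M * 2"]) (simp_all add: trace2 inK_iff)
qed

text \<open>The constant \<open>h\<close> of \<open>shear_two\<close>. It survives as the multiplier
  in the final integrality statement, where for even \<open>NN\<close> the prime ideal above 2
  absorbs it.\<close>

definition hh2 :: int where "hh2 = (if even NN then 2 else 1)"

lemma om_nat: "om * (om - 1) = of_nat (nat NN)" using om_norm NN_pos by simp

text \<open>\<open>NN = 2\<close> would mean \<open>D = 9\<close>, a square, and
  \<open>NN \<ge> 3\<close> forces \<open>om > 2\<close>.\<close>

lemma om_gt_2: assumes "NN \<noteq> 1" shows "om > 2"
proof (rule ccontr)
  assume "\<not> om > 2"
  then have "om * (om - 1) \<le> 2 * 1" using w1 by (intro mult_mono) simp_all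
  then have "real_of_int NN \<le> of_int 2" unfolding om_norm by simp
  then have "NN \<le> 2" by (simp only: of_int_le_iff)
  then have "NN = 2" using NN_pos assms by simp
  then have "D = 3\<^sup>2" using D_NN by simp
  then show False using D_nsq by blast
qed

section \<open>Integrality of parabolic elements of a finite extension\<close>

lemma V_Gam: "shear 0 om \<in> Gam" by (rule shear_vertical[OF om_nat])

text \<open>Traces of \<open>A\<close> times elements of \<open>Gam\<close> are linear in the
  entries of \<open>A\<close>. The vertical twist and its mirror image isolate \<open>om * b\<close>
  and \<open>om * c\<close>; since \<open>u * u = - (b * c)\<close>, the diagonal follows by
  \<open>alm_square\<close>. The twists of slope \<open>2 / om\<close> and of its mirror image then
  replace the factor \<open>om\<close> by \<open>hh2\<close>.\<close>

lemma parabolic_alm: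
  assumes H: "over H" and A: "A \<in> H" "inK A" and tr: "A $ 1 $ 1 + A $ 2 $ 2 = of_int (2 * s)" and s: "s * s = 1"
    and u: "u = (A $ 1 $ 1 - A $ 2 $ 2) / 2"
  shows "alm (om * u)" "alm (om * A $ 1 $ 2)" "alm (om * A $ 2 $ 1)"
    "alm (of_int hh2 * u)" "alm (of_int hh2 * A $ 1 $ 2)" "alm (of_int hh2 * A $ 2 $ 1)"
proof -
  note O = overD[OF H]
  define b where "b = A $ 1 $ 2"
  define c where "c = A $ 2 $ 1"
  have K: "u \<in> Kf" "b \<in> Kf" "c \<in> Kf" using A(2) unfolding inK_iff u b_def c_def by simp_all
  have ad: "A $ 1 $ 1 = of_int s + u" "A $ 2 $ 2 = of_int s - u" using tr by (simp_all add: u field_simps)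
  have ss: "real_of_int s * of_int s = 1" using s by (metis of_int_1 of_int_mult)
  have "A $ 1 $ 1 * A $ 2 $ 2 - b * c = 1" using O(3)[OF A(1)] by (simp add: det_2 b_def c_def)
  then have uu: "u * u = - (b * c)" unfolding ad using ss by (simp add: algebra_simps)
  have trG: "alm (trace (A ** X))" if "X \<in> Gam" for X
    using trace_alm[OF H O(2)[OF A(1) O(1)[OF that]] inK_mult[OF A(2) Gam_inK[OF that]]] .
  have 1: "alm (om * b)"
  proof -
    have "om * b = of_int (2 * s) - trace (A ** shear 0 om)" using tr by (simp add: trace2 mult_nth b_def algebra_simps)
    then show ?thesis using trG[OF V_Gam] alm_diff alm_int(1) by metis
  qed
  have 2: "alm (om * c)"
  proof -
    have "om * c = of_int (2 * s) - trace (A ** swapm (shear 0 om))" using tr by (simp add: trace2 mult_nth c_def algebra_simps)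
    then show ?thesis using trG[OF veech_swap[OF V_Gam]] alm_diff alm_int(1) by metis
  qed
  have sq: "alm (x * u)" if "x \<in> Kf" "alm (x * b)" "alm (x * c)" for x
  proof (rule alm_square)
    have "(x * u) * (x * u) = x * x * (u * u)" by (simp only: mult_ac)
    also have "\<dots> = - ((x * b) * (x * c))" unfolding uu by (simp add: mult_ac)
    finally show "alm ((x * u) * (x * u))" using alm_minus[OF alm_mult[OF that(2,3)]] by simp
  qed (use that K in simp)
  have 3: "alm (om * u)" using sq[OF Kf_om 1 2] .
  \<comment> \<open>\<open>NN\<close> is a multiple of \<open>om\<close> in the order, so almost
    integrality of \<open>om * x\<close> passes to an integer multiple of \<open>x\<close>.\<close>
  have Nalm: "alm (of_int NN * x)" if "alm (om * x)" for x
  proof -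
    have e: "of_int NN * x = (om - 1) * (om * x)" unfolding om_norm[symmetric] by (simp only: mult_ac)
    show ?thesis unfolding e by (rule alm_mult[OF alm_Or that]) simp
  qed
  have hbc: "alm (of_int hh2 * b) \<and> alm (of_int hh2 * c)"
  proof (cases "NN = 1")
    \<comment> \<open>Here \<open>D = 5\<close> and \<open>om < 2\<close>, so
      \<open>shear_two\<close> does not apply; but \<open>om\<close> is a unit and the integer
      multiple is \<open>x\<close> itself.\<close>
    case True
    then have "hh2 = 1" by (simp add: hh2_def)
    then show ?thesis using Nalm[OF 1] Nalm[OF 2] True by simp
  next
    case False
    define h where "h = real_of_int hh2"
    have h0: "h > 0" by (simp add: h_def hh2_def)
    define T where "T = (om + 1) * om\<^sup>2 / h"
    have "even (nat NN) \<longleftrightarrow> even NN" using NN_pos by (simp add: even_nat_iff)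
    then have hq: "h = (if even (nat NN) then 2 else 1)" by (simp add: h_def hh2_def)
    have Q: "shear (2 / om) T \<in> Gam" unfolding T_def by (rule shear_two[OF om_gt_2[OF False] om_nat hq])
    have o0: "om \<noteq> 0" using w1 by simp
    define k where "k = (om + 1) / h"
    have T1: "T = k * (om * om)" "T * (2 / om) = 2 * (k * om)" "T * (2 / om)\<^sup>2 = 4 * k"
      using o0 by (simp_all add: T_def k_def power2_eq_square)
    have tr1: "trace (A ** shear q T) - of_int (2 * s) = (T * q\<^sup>2) * c - 2 * (T * q) * u - T * b" for q
      unfolding trace2 mult_nth shear_nth ad b_def c_def by (simp add: algebra_simps)
    have tr2: "trace (A ** swapm (shear q T)) - of_int (2 * s) = (T * q\<^sup>2) * b + 2 * (T * q) * u - T * c" for q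
      unfolding trace2 mult_nth swapm_nth shear_nth ad b_def c_def by (simp add: algebra_simps)
    \<comment> \<open>As \<open>T * (2 / om)\<^sup>2 = 4 * k\<close>, the trace contains
      \<open>c\<close> with a coefficient free of denominators in \<open>om\<close>, while
      \<open>u\<close> and \<open>b\<close> come with a factor \<open>om\<close> and are already
      controlled.\<close>
    define e1 where "e1 = k * (4 * c - 4 * (om * u) - om * (om * b))"
    define e2 where "e2 = k * (4 * b + 4 * (om * u) - om * (om * c))"
    have e1eq: "e1 = trace (A ** shear (2 / om) T) - of_int (2 * s)"
      unfolding tr1 T1(2,3) e1_def by (simp add: T1(1) algebra_simps)
    have e1: "alm e1" unfolding e1eq by (rule alm_diff[OF trG[OF Q] alm_int(1)])
    have e2eq: "e2 = trace (A ** swapm (shear (2 / om) T)) - of_int (2 * s)"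
      unfolding tr2 T1(2,3) e2_def by (simp add: T1(1) algebra_simps)
    have e2: "alm e2" unfolding e2eq by (rule alm_diff[OF trG[OF veech_swap[OF Q]] alm_int(1)])
    have al: "alm (om * (om * b))" "alm (om * (om * c))" "alm (om + 1)" using 1 2 alm_mult alm_int(3) alm_Or by simp_all
    show ?thesis
    proof (cases "even NN")
      case True
      then have h2: "h = 2" "hh2 = 2" by (simp_all add: h_def hh2_def)
      obtain m where m: "NN = 2 * m" using True by blast
      \<comment> \<open>\<open>om * (om + 1) = 2 * om + NN\<close>, so for even \<open>NN\<close>
        division by \<open>h = 2\<close> stays in the order.\<close>
      have oo: "(om + 1) * om / 2 = om + of_int m" using om_sq m by (simp add: field_simps)
      have ao: "alm (om + of_int m)" by (simp add: alm_Or)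
      have "of_int 2 * c = e1 + (om + 1) * (of_int 2 * (om * u)) + (om + of_int m) * (om * b) - of_int 2 * (om * c)"
        unfolding oo[symmetric] e1_def k_def h2 by (simp add: field_simps)
      moreover have "of_int 2 * b = e2 - (om + 1) * (of_int 2 * (om * u)) + (om + of_int m) * (om * c) - of_int 2 * (om * b)"
        unfolding oo[symmetric] e2_def k_def h2 by (simp add: field_simps)
      moreover have "alm (e1 + (om + 1) * (of_int 2 * (om * u)) + (om + of_int m) * (om * b) - of_int 2 * (om * c))"
        "alm (e2 - (om + 1) * (of_int 2 * (om * u)) + (om + of_int m) * (om * c) - of_int 2 * (om * b))"
        by (intro alm_add alm_diff alm_mult e1 e2 al ao 1 2 3 alm_int)+
      ultimately show ?thesis unfolding h2 by simp
    next
      case F: False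
      then have h2: "h = 1" "hh2 = 1" by (simp_all add: h_def hh2_def)
      have "of_int 4 * c = e1 + (om + 1) * (of_int 4 * (om * u)) + (om + 1) * (om * (om * b)) - of_int 4 * (om * c)"
        unfolding e1_def k_def h2 by (simp add: algebra_simps)
      moreover have "of_int 4 * b = e2 - (om + 1) * (of_int 4 * (om * u)) + (om + 1) * (om * (om * c)) - of_int 4 * (om * b)"
        unfolding e2_def k_def h2 by (simp add: algebra_simps)
      moreover have "alm (e1 + (om + 1) * (of_int 4 * (om * u)) + (om + 1) * (om * (om * b)) - of_int 4 * (om * c))"
        "alm (e2 - (om + 1) * (of_int 4 * (om * u)) + (om + 1) * (om * (om * c)) - of_int 4 * (om * b))"
        by (intro alm_add alm_diff alm_mult e1 e2 al 1 2 3 alm_int)+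
      ultimately have 4: "alm (of_int 4 * c)" "alm (of_int 4 * b)" by simp_all
      note Nb = Nalm[OF 1] Nalm[OF 2]
      \<comment> \<open>Both the multiples by 4 and those by \<open>NN\<close> are almost integral;
        for odd \<open>NN\<close> Bezout removes the multiplier.\<close>
      have "coprime (2 ^ 2) NN" using F by (simp only: coprime_power_left_iff) simp
      then have c4: "coprime 4 NN" by simp
      show ?thesis unfolding h2 using alm_coprime2[OF K(2) 4(2) Nb(1) c4] alm_coprime2[OF K(3) 4(1) Nb(2) c4] by simp
    qed
  qed
  then have 4: "alm (of_int hh2 * u)" using sq[OF Kf_int] by blast
  show "alm (om * u)" "alm (om * A $ 1 $ 2)" "alm (om * A $ 2 $ 1)"
    "alm (of_int hh2 * u)" "alm (of_int hh2 * A $ 1 $ 2)" "alm (of_int hh2 * A $ 2 $ 1)"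
    using 1 2 3 4 hbc by (simp_all add: b_def c_def)
qed

text \<open>Pigeonhole on the finitely many cosets: two powers of the shear in the same coset differ
  by an element of \<open>Gam\<close>.\<close>

lemma over_shear_power:
  assumes H: "over H" and X: "shear sg t \<in> H"
  shows "\<exists>m>0. shear sg (of_nat m * t) \<in> Gam"
proof -
  note O = overD[OF H]
  have pw: "shear sg (of_nat i * t) \<in> H" for i
  proof (induction i)
    case 0
    have "mat 1 \<in> H" using O(1) subgroup.one_closed[OF veech_subgroup] by (simp add: SL2R_def)
    then show ?case by (simp add: shear_0)
  next
    case (Suc i)
    have "shear sg (of_nat (Suc i) * t) = shear sg t ** shear sg (of_nat i * t)" by (simp add: shear_mul algebra_simps)
    then show ?case using O(2)[OF X Suc] by simp
  qed
  obtain R where R: "finite R" "\<forall>X\<in>H. \<exists>Y\<in>Gam. \<exists>r\<in>R. X = Y ** r" using O(5) by blast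
  have "\<forall>i. \<exists>Y r. Y \<in> Gam \<and> r \<in> R \<and> shear sg (of_nat i * t) = Y ** r" using R(2) pw by blast
  then obtain Y r where Yr: "\<And>i. Y i \<in> Gam" "\<And>i. r i \<in> R" "\<And>i. shear sg (of_nat i * t) = Y i ** r i" by metis
  have "range r \<subseteq> R" using Yr(2) by blast
  then have "\<not> inj r" using R(1) finite_subset finite_imageD infinite_UNIV_nat by metis
  then obtain a b where "a \<noteq> b" "r a = r b" unfolding inj_on_def by blast
  then obtain i j where ij: "i < j" "r i = r j" by (metis linorder_neqE_nat)
  have "adj (Y i) ** shear sg (of_nat i * t) = (adj (Y i) ** Y i) ** r i" unfolding Yr(3) by (simp only: matrix_mul_assoc)
  then have ri: "r i = adj (Y i) ** shear sg (of_nat i * t)" using mult_adj(2) veech_iff Yr(1) by simp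
  have "shear sg (of_nat j * t) = (Y j ** adj (Y i)) ** shear sg (of_nat i * t)"
    unfolding Yr(3)[of j] ij(2)[symmetric] ri by (simp only: matrix_mul_assoc)
  then have "shear sg (of_nat j * t) ** shear sg (- (of_nat i * t)) = (Y j ** adj (Y i)) ** (shear sg (of_nat i * t) ** shear sg (- (of_nat i * t)))"
    by (simp only: matrix_mul_assoc)
  then have "shear sg (of_nat j * t + - (of_nat i * t)) = Y j ** adj (Y i)" by (simp add: shear_mul shear_0)
  moreover have "real j * t + - (of_nat i * t) = of_nat (j - i) * t" using ij(1) by (simp add: of_nat_diff algebra_simps)
  ultimately have "shear sg (of_nat (j - i) * t) \<in> Gam" using veech_mult[OF Yr(1) Gam_adj[OF Yr(1)]] by simp
  then show ?thesis using ij(1) by (intro exI[of _ "j - i"]) simp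
qed

text \<open>Conjugating the horizontal parabolic \<open>U\<close> by \<open>A\<close> gives the
  shear along the first column of \<open>A\<close> with constant \<open>om * v2\<^sup>2\<close>,
  where \<open>v2\<close> is the lower entry. \<open>cusp_arithmetic\<close> bounds the denominator
  by \<open>hh2\<close>, so it is 1 or 2 and 2 clears it.\<close>

lemma cusp_integrality:
  assumes H: "over H" and A: "A \<in> H" "inK A" and c: "A $ 2 $ 1 \<noteq> 0"
    and a: "alm (om * A $ 1 $ 1)" "alm (om * A $ 1 $ 2)" "alm (om * A $ 2 $ 1)" "alm (om * A $ 2 $ 2)"
    and h: "alm (of_int hh2 * A $ 1 $ 1)" "alm (of_int hh2 * A $ 2 $ 1)"
  shows "of_int 2 * (om * A $ 1 $ 1 * A $ 1 $ 1) \<in> Or \<and> of_int 2 * (om * A $ 1 $ 1 * A $ 2 $ 1) \<in> Or"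
proof -
  note O = overD[OF H]
  define U where "U = adj (swapm (shear 0 om))"
  have UG: "U \<in> Gam" unfolding U_def by (rule Gam_adj[OF veech_swap[OF V_Gam]])
  have det: "A $ 1 $ 1 * A $ 2 $ 2 - A $ 2 $ 1 * A $ 1 $ 2 = 1" using O(3)[OF A(1)] by (simp add: det_2 mult.commute)
  have f: "om * (A $ 2 $ 1)\<^sup>2 * (A $ 1 $ 1 / A $ 2 $ 1) = om * A $ 1 $ 1 * A $ 2 $ 1"
    "om * (A $ 2 $ 1)\<^sup>2 * (A $ 1 $ 1 / A $ 2 $ 1)\<^sup>2 = om * A $ 1 $ 1 * A $ 1 $ 1"
    using c by (simp_all add: power2_eq_square)
  have "(A ** U) ** adj A = shear (A $ 1 $ 1 / A $ 2 $ 1) (om * (A $ 2 $ 1)\<^sup>2)"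
    unfolding mat2_eq_iff mult_nth shear_nth f U_def adj_nth swapm_nth
    using det by (simp add: power2_eq_square algebra_simps)
  moreover have "(A ** U) ** adj A \<in> H" by (rule O(2)[OF O(2)[OF A(1) O(1)[OF UG]] O(4)[OF A(1)]])
  ultimately have "shear (A $ 1 $ 1 / A $ 2 $ 1) (om * (A $ 2 $ 1)\<^sup>2) \<in> H" by (simp only:)
  from over_shear_power[OF H this] obtain m where m: "m > 0"
    "shear (A $ 1 $ 1 / A $ 2 $ 1) (of_nat m * (om * (A $ 2 $ 1)\<^sup>2)) \<in> Gam" by blast
  have hp: "hh2 > 0" by (simp add: hh2_def)
  have AK: "A $ 1 $ 1 \<in> Kf" "A $ 2 $ 1 \<in> Kf" "A $ 1 $ 2 \<in> Kf" "A $ 2 $ 2 \<in> Kf" using A(2) by (simp_all add: inK_iff)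
  obtain r where r: "1 \<le> r" "r \<le> hh2" "of_int r * (om * A $ 1 $ 1 * A $ 1 $ 1) \<in> Or" "of_int r * (om * A $ 1 $ 1 * A $ 2 $ 1) \<in> Or"
    using cusp_arithmetic[OF AK(1,2) c a(2,4) AK(3,4) det a(1,3) hp h m] by (elim exE conjE)
  have "r = 1 \<or> r = 2" using r(1,2) by (auto simp: hh2_def split: if_splits)
  then show ?thesis
  proof
    assume "r = 1"
    then have "om * A $ 1 $ 1 * A $ 1 $ 1 \<in> Or" "om * A $ 1 $ 1 * A $ 2 $ 1 \<in> Or" using r by simp_all
    then show ?thesis using Or_mult[OF Or_int[of 2]] by blast
  qed (use r in simp)
qed

text \<open>\<open>cusp_integrality\<close> for \<open>A\<close> and for its inverse controls the
  squares of both diagonal entries and their products with the lower left entry, all times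
  \<open>2 * om\<close>. As the trace is \<open>2 * s\<close>, combining them yields
  \<open>8 * om * u\<close> and 8 times \<open>om * A $ 2 $ 1\<close>. Finally 8 and
  \<open>NN\<close> are prime to \<open>D\<close>.\<close>

lemma parabolic_column:
  assumes H: "over H" and A: "A \<in> H" "inK A" and tr: "A $ 1 $ 1 + A $ 2 $ 2 = of_int (2 * s)" and s: "s * s = 1"
    and u: "u = (A $ 1 $ 1 - A $ 2 $ 2) / 2"
  shows "om * u \<in> Or \<and> om * A $ 2 $ 1 \<in> Or \<and> of_int hh2 * u \<in> Or \<and> of_int hh2 * A $ 2 $ 1 \<in> Or"
proof -
  note O = overD[OF H]
  note al = parabolic_alm[OF H A tr s u]
  have ad: "A $ 1 $ 1 = of_int s + u" "A $ 2 $ 2 = of_int s - u" using tr by (simp_all add: u field_simps)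
  have ss: "real_of_int s * of_int s = 1" using s by (metis of_int_1 of_int_mult)
  have main: "om * u \<in> Or \<and> om * A $ 2 $ 1 \<in> Or"
  proof (cases "A $ 2 $ 1 = 0")
    \<comment> \<open>A triangular matrix with trace \<open>2 * s\<close> and determinant 1 has
      equal diagonal entries, so \<open>u = 0\<close>.\<close>
    case True
    have "A $ 1 $ 1 * A $ 2 $ 2 = 1" using O(3)[OF A(1)] True by (simp add: det_2)
    then have "u * u = 0" unfolding ad using ss by (simp add: algebra_simps)
    then show ?thesis using True by simp
  next
    case False
    have oa: "alm (om * A $ 1 $ 1)" "alm (om * A $ 2 $ 2)" "alm (of_int hh2 * A $ 1 $ 1)" "alm (of_int hh2 * A $ 2 $ 2)"
      unfolding ad distrib_left right_diff_distrib by (intro alm_add alm_diff alm_mult al alm_int)+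
    have 1: "of_int 2 * (om * A $ 1 $ 1 * A $ 1 $ 1) \<in> Or" "of_int 2 * (om * A $ 1 $ 1 * A $ 2 $ 1) \<in> Or"
      using cusp_integrality[OF H A False oa(1) al(2,3) oa(2,3) al(6)] by blast+
    have 2: "of_int 2 * (om * A $ 2 $ 2 * A $ 2 $ 2) \<in> Or" "of_int 2 * (om * A $ 2 $ 2 * - A $ 2 $ 1) \<in> Or"
      using cusp_integrality[OF H O(4)[OF A(1)] inK_adj[OF A(2)]] False oa al alm_minus by simp_all
    have "of_int 8 * (om * u) = of_int s * (of_int 2 * (om * A $ 1 $ 1 * A $ 1 $ 1) - of_int 2 * (om * A $ 2 $ 2 * A $ 2 $ 2))"
    proof -
      have "of_int s * (of_int 2 * (om * A $ 1 $ 1 * A $ 1 $ 1) - of_int 2 * (om * A $ 2 $ 2 * A $ 2 $ 2)) = 8 * (of_int s * of_int s) * (om * u)"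
        unfolding ad by (simp add: algebra_simps)
      then show ?thesis unfolding ss by simp
    qed
    also have "\<dots> \<in> Or" by (rule Or_mult[OF Or_int Or_diff[OF 1(1) 2(1)]])
    finally have u8: "of_int 8 * (om * u) \<in> Or" .
    have "of_int 8 * (om * A $ 2 $ 1) = of_int (2 * s) * (of_int 2 * (om * A $ 1 $ 1 * A $ 2 $ 1) - of_int 2 * (om * A $ 2 $ 2 * - A $ 2 $ 1))"
    proof -
      have "of_int (2 * s) * (of_int 2 * (om * A $ 1 $ 1 * A $ 2 $ 1) - of_int 2 * (om * A $ 2 $ 2 * - A $ 2 $ 1)) = 8 * (of_int s * of_int s) * (om * A $ 2 $ 1)"
        unfolding ad by (simp add: algebra_simps)
      then show ?thesis unfolding ss by simp
    qed
    also have "\<dots> \<in> Or" by (rule Or_mult[OF Or_int Or_diff[OF 1(2) 2(2)]])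
    finally have c8: "of_int 8 * (om * A $ 2 $ 1) \<in> Or" .
    have "odd D" using D4 by presburger
    then have "coprime (2 ^ 3) D" by (simp only: coprime_power_left_iff) simp
    then have "coprime 8 D" by simp
    then show ?thesis using alm_coprime[OF al(1) u8] alm_coprime[OF al(3) c8] by blast
  qed
  have cND: "coprime NN D"
  proof (rule coprimeI)
    fix d assume "d dvd NN" "d dvd D"
    then have "d dvd D - 4 * NN" by (simp add: dvd_diff)
    moreover have "D - 4 * NN = 1" using D_NN by linarith
    ultimately show "is_unit d" by simp
  qed
  have fin: "of_int hh2 * x \<in> Or" if x: "alm (of_int hh2 * x)" "om * x \<in> Or" for x
  proof (rule alm_coprime[OF x(1) _ cND])
    have e: "of_int NN * (of_int hh2 * x) = of_int hh2 * ((om - 1) * (om * x))" unfolding om_norm[symmetric] by (simp add: mult_ac)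
    show "of_int NN * (of_int hh2 * x) \<in> Or" unfolding e by (rule Or_mult[OF Or_int Or_mult[OF Or_diff[OF Or_om Or_01(2)] x(2)]])
  qed
  show ?thesis using main fin al(4,6) by blast
qed

text \<open>\<open>parabolic_column\<close> for \<open>A\<close> and for its mirror image, which
  supplies the upper right entry.\<close>

lemma parabolic_integral:
  assumes H: "fuchsian H" "finite_index_in Gam H" and A: "A \<in> H" "parabolic A" "A \<in> SL2 Kf"
  shows "\<exists>s. A $ 1 $ 1 = of_int s + (A $ 1 $ 1 - A $ 2 $ 2) / 2 \<and> A $ 2 $ 2 = of_int s - (A $ 1 $ 1 - A $ 2 $ 2) / 2 \<and>
    (\<forall>x \<in> {(A $ 1 $ 1 - A $ 2 $ 2) / 2, A $ 1 $ 2, A $ 2 $ 1}. om * x \<in> Or \<and> of_int hh2 * x \<in> Or)"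
proof -
  have ov: "over H" by (rule over_finite_index[OF H])
  have K: "inK A" using A(3) by (simp add: SL2_def inK_def)
  have "\<bar>A $ 1 $ 1 + A $ 2 $ 2\<bar> = 2" using A(2) by (simp add: parabolic_def trace2)
  then obtain s :: int where s: "s * s = 1" and tr: "A $ 1 $ 1 + A $ 2 $ 2 = of_int (2 * s)"
    by (cases "A $ 1 $ 1 + A $ 2 $ 2 \<ge> 0") (force intro: that[of 1] that[of "-1"])+
  note 1 = parabolic_column[OF ov A(1) K tr s refl]
  have tr': "swapm A $ 1 $ 1 + swapm A $ 2 $ 2 = of_int (2 * s)" using tr by simp
  have 2: "om * A $ 1 $ 2 \<in> Or \<and> of_int hh2 * A $ 1 $ 2 \<in> Or"
    using parabolic_column[OF over_swap[OF ov] imageI[OF A(1)] inK_swap[OF K] tr' s refl] by simp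
  have 3: "om * x \<in> Or \<and> of_int hh2 * x \<in> Or" if "x \<in> {(A $ 1 $ 1 - A $ 2 $ 2) / 2, A $ 1 $ 2, A $ 2 $ 1}" for x
    using that
  proof (elim insertE emptyE)
    assume x: "x = (A $ 1 $ 1 - A $ 2 $ 2) / 2"
    show ?thesis unfolding x using 1 by blast
  next
    assume x: "x = A $ 1 $ 2"
    show ?thesis unfolding x by (rule 2)
  next
    assume x: "x = A $ 2 $ 1"
    show ?thesis unfolding x using 1 by blast
  qed
  have "A $ 1 $ 1 = of_int s + (A $ 1 $ 1 - A $ 2 $ 2) / 2" "A $ 2 $ 2 = of_int s - (A $ 1 $ 1 - A $ 2 $ 2) / 2"
    using tr by (simp_all add: field_simps)
  then show ?thesis using 3 by blast
qed

lemma Gam_fuchsian: "fuchsian Gam" and Gam_SL2: "Gam \<subseteq> SL2 Or"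
  using veech_subgroup veech_discrete[OF om_nat] Gam_Or veech_iff by (auto simp: fuchsian_def SL2_def)

lemma maximal_odd:
  assumes "odd NN" shows "pseudo_parabolic_maximal D Gam" unfolding pseudo_parabolic_maximal_def
proof (intro conjI Gam_fuchsian Gam_SL2 notI)
  assume "\<exists>H. fuchsian H \<and> finite_index_in Gam H \<and> (\<exists>A\<in>H. parabolic A \<and> A \<in> SL2 Kf - SL2 Or)"
  then obtain H A where H: "fuchsian H" "finite_index_in Gam H" and A: "A \<in> H" "parabolic A" "A \<in> SL2 Kf" "A \<notin> SL2 Or" by blast
  obtain s where s: "A $ 1 $ 1 = of_int s + (A $ 1 $ 1 - A $ 2 $ 2) / 2" "A $ 2 $ 2 = of_int s - (A $ 1 $ 1 - A $ 2 $ 2) / 2"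
    and x: "\<forall>x \<in> {(A $ 1 $ 1 - A $ 2 $ 2) / 2, A $ 1 $ 2, A $ 2 $ 1}. om * x \<in> Or \<and> of_int hh2 * x \<in> Or"
    using parabolic_integral[OF H A(1-3)] by blast
  have "hh2 = 1" using assms by (simp add: hh2_def)
  then have y: "(A $ 1 $ 1 - A $ 2 $ 2) / 2 \<in> Or" "A $ 1 $ 2 \<in> Or" "A $ 2 $ 1 \<in> Or" using x by simp_all
  have "A $ 1 $ 1 \<in> Or" by (subst s(1)) (intro Or_add Or_int y)
  moreover have "A $ 2 $ 2 \<in> Or" by (subst s(2)) (intro Or_diff Or_int y)
  ultimately have "A \<in> SL2 Or" using y A(3) by (simp add: SL2_def forall_2)
  then show False using A(4) by blast
qed

text \<open>For even \<open>NN\<close> this is the ideal generated by 2 and \<open>om\<close>, in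
  coordinates; \<open>common_prime_divisor_iff\<close> identifies it as the prime of the
  statement.\<close>

definition pp2 :: "real set" where "pp2 = {of_int m + of_int n * om | m n. even m}"

lemma maximal_even:
  assumes "even NN" shows "ideal_pseudo_parabolic_maximal D pp2 Gam" unfolding ideal_pseudo_parabolic_maximal_def
proof (intro conjI Gam_fuchsian Gam_SL2 notI)
  assume "\<exists>H. fuchsian H \<and> finite_index_in Gam H \<and>
    (\<exists>A\<in>H. parabolic A \<and> A \<in> SL2 Kf - (SL2 Kf \<inter> Mat2 (inv_ideal D pp2)))"
  then obtain H A where H: "fuchsian H" "finite_index_in Gam H" and A: "A \<in> H" "parabolic A" "A \<in> SL2 Kf" "A \<notin> Mat2 (inv_ideal D pp2)" by blast
  obtain s where s: "A $ 1 $ 1 = of_int s + (A $ 1 $ 1 - A $ 2 $ 2) / 2" "A $ 2 $ 2 = of_int s - (A $ 1 $ 1 - A $ 2 $ 2) / 2"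
    and x: "\<forall>x \<in> {(A $ 1 $ 1 - A $ 2 $ 2) / 2, A $ 1 $ 2, A $ 2 $ 1}. om * x \<in> Or \<and> of_int hh2 * x \<in> Or"
    using parabolic_integral[OF H A(1-3)] by blast
  have h2: "hh2 = 2" using assms by (simp add: hh2_def)
  have AK: "A $ i $ j \<in> Kf" for i j using A(3) by (simp add: SL2_def)
  \<comment> \<open>An element of \<open>pp2\<close> is an integer combination of 2 and
    \<open>om\<close>, so only these two products need to be integral.\<close>
  have inv: "y \<in> inv_ideal D pp2" if "om * y \<in> Or" "of_int 2 * y \<in> Or" "y \<in> Kf" for y
    unfolding inv_ideal_def
  proof (intro CollectI conjI ballI)
    fix z assume "z \<in> pp2"
    then obtain m n where z: "even m" "z = of_int m + of_int n * om" by (auto simp: pp2_def)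
    then obtain k where "m = 2 * k" by blast
    then have "y * z = of_int k * (of_int 2 * y) + of_int n * (om * y)" using z(2) by (simp add: algebra_simps)
    then show "y * z \<in> Or" using that by simp
  qed fact
  have add: "of_int i + y \<in> inv_ideal D pp2" if "om * y \<in> Or" "of_int 2 * y \<in> Or" "y \<in> Kf" for y i
    by (rule inv) (use that in \<open>simp_all only: distrib_left Or_add Or_mult Or_int Or_om Kf_add Kf_int\<close>)
  let ?u = "(A $ 1 $ 1 - A $ 2 $ 2) / 2"
  have uK: "?u \<in> Kf" using Kf_divide[OF Kf_diff[OF AK AK] Kf_int[of 2]] by simp
  have xx: "om * ?u \<in> Or" "of_int 2 * ?u \<in> Or" "om * A $ 1 $ 2 \<in> Or" "of_int 2 * A $ 1 $ 2 \<in> Or" "om * A $ 2 $ 1 \<in> Or" "of_int 2 * A $ 2 $ 1 \<in> Or"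
    using x unfolding h2 by blast+
  have "A $ 1 $ 1 \<in> inv_ideal D pp2" by (subst s(1)) (rule add[OF xx(1,2) uK])
  moreover have "A $ 2 $ 2 \<in> inv_ideal D pp2"
  proof -
    have "om * (- ?u) \<in> Or" "of_int 2 * (- ?u) \<in> Or" "- ?u \<in> Kf"
      using Or_minus[OF xx(1)] Or_minus[OF xx(2)] Kf_minus[OF uK] by (simp_all only: mult_minus_right)
    from add[OF this, of s] show ?thesis by (subst s(2)) (simp only: diff_conv_add_uminus)
  qed
  ultimately have "A \<in> Mat2 (inv_ideal D pp2)" using inv[OF xx(3,4) AK] inv[OF xx(5,6) AK] by (simp add: Mat2_def forall_2)
  then show False using A(4) by blast
qed

section \<open>The prime ideal above two\<close>

abbreviation OR :: "real ring" where "OR \<equiv> quad_order_ring D"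

lemma OR_simps [simp]: "carrier OR = Or" "x \<otimes>\<^bsub>OR\<^esub> y = x * y" "x \<oplus>\<^bsub>OR\<^esub> y = x + y" "\<one>\<^bsub>OR\<^esub> = 1" "\<zero>\<^bsub>OR\<^esub> = 0"
  by (simp_all add: quad_order_ring_def)

lemma OR_cring: "cring OR" using cring_quad_order_ring D_pos D4 by simp

lemma OR_idealI:
  assumes "I \<subseteq> Or" "0 \<in> I" "\<And>x y. x \<in> I \<Longrightarrow> y \<in> I \<Longrightarrow> x + y \<in> I" "\<And>x a. x \<in> Or \<Longrightarrow> a \<in> I \<Longrightarrow> x * a \<in> I"
  shows "ideal I OR"
proof -
  interpret cring OR by (rule OR_cring)
  have neg: "\<ominus>\<^bsub>OR\<^esub> x = - x" if "x \<in> I" for x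
    using that assms(1) by (intro minus_equality) auto
  have negI: "- x \<in> I" if "x \<in> I" for x using assms(4)[OF Or_int[of "-1"] that] by simp
  show ?thesis
  proof (rule idealI)
    show "subgroup I (add_monoid OR)" by (rule add.subgroupI) (use assms neg negI in auto)
    show "a \<otimes>\<^bsub>OR\<^esub> x \<in> I" if "a \<in> I" "x \<in> carrier OR" for a x using assms(4)[of x a] that by (simp add: mult.commute)
  qed (use assms ring_axioms in simp_all)
qed

text \<open>For \<open>k\<close> dividing \<open>NN\<close> this is the ideal generated by
  \<open>k\<close> and \<open>om\<close>.\<close>

definition cong_ideal :: "int \<Rightarrow> real set" where
  "cong_ideal k = {of_int m + of_int n * om | m n. k dvd m}"

lemma pp2_cong: "pp2 = cong_ideal 2" by (simp add: pp2_def cong_ideal_def)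

lemma Or_mult_coord: "(of_int m + of_int n * om) * (of_int m' + of_int n' * om) =
    of_int (m * m' + n * n' * NN) + of_int (m * n' + n * m' + n * n') * om"
proof -
  have "(of_int m + of_int n * om) * (of_int m' + of_int n' * om) =
    of_int m * of_int m' + (of_int m * of_int n' + of_int n * of_int m') * om + of_int n * of_int n' * (om * om)"
    by (simp add: algebra_simps)
  then show ?thesis unfolding om_sq by (simp add: algebra_simps)
qed

lemma cong_idealI: "k dvd m \<Longrightarrow> of_int m + of_int n * om \<in> cong_ideal k" by (auto simp: cong_ideal_def)

lemma cong_ideal_iff: "of_int m + of_int n * om \<in> cong_ideal k \<longleftrightarrow> k dvd m"
proof
  assume "of_int m + of_int n * om \<in> cong_ideal k"
  then obtain m' n' where e: "of_int m + of_int n * om = of_int m' + of_int n' * om" and k: "k dvd m'"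
    unfolding cong_ideal_def by blast
  show "k dvd m" using Or_parts_unique[OF e] k by simp
qed (rule cong_idealI)

lemma cong_ideal_ideal: assumes "k dvd NN" shows "ideal (cong_ideal k) OR"
proof (rule OR_idealI)
  show "cong_ideal k \<subseteq> Or" using Or_I by (auto simp: cong_ideal_def)
  show "0 \<in> cong_ideal k" using cong_idealI[of k 0 0] by simp
  show "x + y \<in> cong_ideal k" if I: "x \<in> cong_ideal k" "y \<in> cong_ideal k" for x y
  proof -
    obtain m n m' n' where xy: "x = of_int m + of_int n * om" "y = of_int m' + of_int n' * om" "k dvd m" "k dvd m'"
      using I unfolding cong_ideal_def by blast
    have e: "x + y = of_int (m + m') + of_int (n + n') * om" by (simp add: xy algebra_simps)
    show ?thesis unfolding e by (rule cong_idealI) (use xy in simp)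
  qed
  show "x * a \<in> cong_ideal k" if I: "x \<in> Or" "a \<in> cong_ideal k" for x a
  proof -
    obtain m n m' n' where xy: "x = of_int m + of_int n * om" "a = of_int m' + of_int n' * om" "k dvd m'"
      using I unfolding cong_ideal_def quad_order_def by blast
    have "k dvd m * m' + n * n' * NN" using xy(3) assms by simp
    then show ?thesis unfolding xy Or_mult_coord by (rule cong_idealI)
  qed
qed

lemma PIdl_iff: "z \<in> PIdl\<^bsub>OR\<^esub> a \<longleftrightarrow> (\<exists>x\<in>Or. z = x * a)"
  by (auto simp: cgenideal_def)

lemma PIdl_add: "z \<in> PIdl\<^bsub>OR\<^esub> a \<Longrightarrow> z' \<in> PIdl\<^bsub>OR\<^esub> a \<Longrightarrow> z + z' \<in> PIdl\<^bsub>OR\<^esub> a"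
proof -
  assume "z \<in> PIdl\<^bsub>OR\<^esub> a" "z' \<in> PIdl\<^bsub>OR\<^esub> a"
  then obtain x x' where x: "x \<in> Or" "x' \<in> Or" "z = x * a" "z' = x' * a" unfolding PIdl_iff by blast
  have "z + z' = (x + x') * a" unfolding x(3,4) by (rule distrib_right[symmetric])
  then show ?thesis unfolding PIdl_iff using Or_add[OF x(1,2)] by blast
qed

text \<open>Tailored to the two factorizations that follow, where the generator \<open>a\<close> is
  a sum of exactly two products.\<close>

lemma ideal_prod_PIdl:
  assumes "ideal I OR" "\<And>i j. i \<in> I \<Longrightarrow> j \<in> J \<Longrightarrow> i * j \<in> PIdl\<^bsub>OR\<^esub> a"
    and a: "i1 \<in> I" "j1 \<in> J" "i2 \<in> I" "j2 \<in> J" "i1 * j1 + i2 * j2 = a"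
  shows "PIdl\<^bsub>OR\<^esub> a = I \<cdot>\<^bsub>OR\<^esub> J"
proof (intro equalityI subsetI)
  fix z assume "z \<in> PIdl\<^bsub>OR\<^esub> a"
  then obtain x where x: "x \<in> Or" "z = x * a" unfolding PIdl_iff by blast
  have mI: "x * i \<in> I" if "i \<in> I" for i using ideal.I_l_closed[OF assms(1) that, of x] x(1) by simp
  have "z = (x * i1) * j1 + (x * i2) * j2" unfolding x(2) a(5)[symmetric] by (simp add: algebra_simps)
  then show "z \<in> I \<cdot>\<^bsub>OR\<^esub> J"
    using ideal_prod.sum[where R = OR, OF ideal_prod.prod[where R = OR, OF mI[OF a(1)] a(2)] ideal_prod.prod[where R = OR, OF mI[OF a(3)] a(4)]] by simp
next
  fix z assume "z \<in> I \<cdot>\<^bsub>OR\<^esub> J"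
  then show "z \<in> PIdl\<^bsub>OR\<^esub> a"
  proof induction
    case (prod i j)
    then show ?case using assms(2) by simp
  next
    case (sum s1 s2)
    then show ?case using PIdl_add by simp
  qed
qed

lemma pp2_mem: "2 \<in> pp2" "om \<in> pp2"
  unfolding pp2_cong using cong_idealI[of 2 2 0] cong_idealI[of 2 0 1] by simp_all

text \<open>The cofactor is the conjugate ideal \<open>(2, om - 1)\<close>, with
  \<open>2 = om * 2 + (- 2) * (om - 1)\<close>.\<close>

lemma pp2_divides_two: assumes "even NN" shows "ideal_divides D pp2 (PIdl\<^bsub>OR\<^esub> 2)"
proof -
  define H where "H = {of_int m + of_int n * om | m n. even (m + n)}"
  have HI: "of_int m + of_int n * om \<in> H" if "even (m + n)" for m n using that by (auto simp: H_def)
  have "ideal H OR"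
  proof (rule OR_idealI)
    show "H \<subseteq> Or" using Or_I by (auto simp: H_def)
    show "0 \<in> H" using HI[of 0 0] by simp
    show "x + y \<in> H" if I: "x \<in> H" "y \<in> H" for x y
    proof -
      obtain m n m' n' where xy: "x = of_int m + of_int n * om" "y = of_int m' + of_int n' * om" "even (m + n)" "even (m' + n')"
        using I unfolding H_def by blast
      have "even ((m + m') + (n + n'))" using xy(3,4) by presburger
      moreover have e: "x + y = of_int (m + m') + of_int (n + n') * om" by (simp add: xy algebra_simps)
      ultimately show ?thesis unfolding e by (intro HI)
    qed
    show "x * a \<in> H" if I: "x \<in> Or" "a \<in> H" for x a
    proof -
      obtain m n m' n' where xy: "x = of_int m + of_int n * om" "a = of_int m' + of_int n' * om" "even (m' + n')"
        using I unfolding H_def quad_order_def by blast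
      have e: "(m * m' + n * n' * NN) + (m * n' + n * m' + n * n') = (m + n) * (m' + n') + n * n' * NN" by (simp add: algebra_simps)
      have "even ((m + n) * (m' + n') + n * n' * NN)" using xy(3) assms by simp
      then have "even ((m * m' + n * n' * NN) + (m * n' + n * m' + n * n'))" unfolding e .
      then show ?thesis unfolding xy Or_mult_coord by (rule HI)
    qed
  qed
  moreover have "PIdl\<^bsub>OR\<^esub> 2 = pp2 \<cdot>\<^bsub>OR\<^esub> H"
  proof (rule ideal_prod_PIdl)
    show "ideal pp2 OR" unfolding pp2_cong by (rule cong_ideal_ideal) (use assms in simp)
    show "om \<in> pp2" "- 2 \<in> pp2" using pp2_mem cong_idealI[of 2 "-2" 0] by (simp_all add: pp2_cong)
    show "2 \<in> H" "om - 1 \<in> H" using HI[of 2 0] HI[of "-1" 1] by simp_all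
    show "i * j \<in> PIdl\<^bsub>OR\<^esub> 2" if I: "i \<in> pp2" "j \<in> H" for i j
    proof -
      obtain m n m' n' where xy: "i = of_int m + of_int n * om" "j = of_int m' + of_int n' * om" "even m" "even (m' + n')"
        using I unfolding H_def pp2_def by blast
      have "even (m * m' + n * n' * NN)" using xy(3) assms by simp
      moreover have "even (m * n' + n * m' + n * n')"
      proof -
        have "m * n' + n * m' + n * n' = m * n' + n * (m' + n')" by (simp add: algebra_simps)
        then show ?thesis using xy(3,4) by simp
      qed
      ultimately obtain p q where pq: "m * m' + n * n' * NN = 2 * p" "m * n' + n * m' + n * n' = 2 * q" by (elim dvdE)
      have "i * j = (of_int p + of_int q * om) * 2" unfolding xy Or_mult_coord pq by (simp add: algebra_simps)
      then show ?thesis unfolding PIdl_iff using Or_I by blast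
    qed
  qed simp
  ultimately show ?thesis unfolding ideal_divides_def by blast
qed

text \<open>The cofactor is \<open>(NN / 2, om)\<close>, since
  \<open>om * om - 2 * (NN / 2) = om\<close>.\<close>

lemma pp2_divides_om: assumes "even NN" shows "ideal_divides D pp2 (PIdl\<^bsub>OR\<^esub> om)"
proof -
  obtain k where k: "NN = 2 * k" using assms by blast
  have "ideal (cong_ideal k) OR" by (rule cong_ideal_ideal) (simp add: k)
  moreover have "PIdl\<^bsub>OR\<^esub> om = pp2 \<cdot>\<^bsub>OR\<^esub> cong_ideal k"
  proof (rule ideal_prod_PIdl)
    show "ideal pp2 OR" unfolding pp2_cong by (rule cong_ideal_ideal) (use assms in simp)
    show "om \<in> pp2" "- 2 \<in> pp2" using pp2_mem cong_idealI[of 2 "-2" 0] by (simp_all add: pp2_cong)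
    show "om \<in> cong_ideal k" "of_int k \<in> cong_ideal k" using cong_idealI[of k 0 1] cong_idealI[of k k 0] by simp_all
    show "om * om + - 2 * of_int k = om" unfolding om_sq by (simp add: k)
    show "i * j \<in> PIdl\<^bsub>OR\<^esub> om" if I: "i \<in> pp2" "j \<in> cong_ideal k" for i j
    proof -
      obtain m n m' n' where xy: "i = of_int m + of_int n * om" "j = of_int m' + of_int n' * om" "even m" "k dvd m'"
        using I unfolding cong_ideal_def pp2_def by blast
      have "NN dvd m * m' + n * n' * NN" unfolding k using mult_dvd_mono[OF xy(3,4)] by simp
      then obtain p where p: "m * m' + n * n' * NN = NN * p" by blast
      define q where "q = m * n' + n * m' + n * n'"
      have "i * j = of_int (NN * p) + of_int q * om" unfolding xy Or_mult_coord p q_def ..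
      also have "\<dots> = of_int p * (om * om - om) + of_int q * om" unfolding om_sq by simp
      also have "\<dots> = (of_int (q - p) + of_int p * om) * om" by (simp add: algebra_simps)
      finally show ?thesis unfolding PIdl_iff using Or_I by blast
    qed
  qed
  ultimately show ?thesis unfolding ideal_divides_def by blast
qed

text \<open>A common prime divisor contains 2 and \<open>om\<close>, hence \<open>pp2\<close>. As
  \<open>pp2\<close> has index 2 in the order, anything larger would contain 1.\<close>

lemma common_prime_divisor_iff:
  assumes ev: "even NN" shows "common_prime_divisor D \<pp> \<longleftrightarrow> \<pp> = pp2"
proof
  assume p: "\<pp> = pp2"
  have "primeideal pp2 OR"
  proof (rule primeidealI)
    show "ideal pp2 OR" unfolding pp2_cong by (rule cong_ideal_ideal) (use ev in simp)
    have "1 \<notin> pp2" using cong_ideal_iff[of 1 0 2] by (simp add: pp2_cong)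
    then show "carrier OR \<noteq> pp2" using Or_01(2) by auto
    show "a \<in> pp2 \<or> b \<in> pp2" if ab: "a \<in> carrier OR" "b \<in> carrier OR" "a \<otimes>\<^bsub>OR\<^esub> b \<in> pp2" for a b
    proof -
      obtain m n m' n' where xy: "a = of_int m + of_int n * om" "b = of_int m' + of_int n' * om"
        using ab(1,2) unfolding OR_simps quad_order_def by blast
      have "even (m * m' + n * n' * NN)" using ab(3) unfolding OR_simps xy Or_mult_coord pp2_cong cong_ideal_iff .
      then have "even m \<or> even m'" using ev by simp
      then show ?thesis unfolding xy pp2_cong cong_ideal_iff .
    qed
  qed (rule OR_cring)
  then show "common_prime_divisor D \<pp>" unfolding p common_prime_divisor_def using pp2_divides_two[OF ev] pp2_divides_om[OF ev] by blast
next
  assume c: "common_prime_divisor D \<pp>"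
  interpret cring OR by (rule OR_cring)
  have pr: "primeideal \<pp> OR" and d: "ideal_divides D \<pp> (PIdl\<^bsub>OR\<^esub> 2)" "ideal_divides D \<pp> (PIdl\<^bsub>OR\<^esub> om)"
    using c unfolding common_prime_divisor_def by blast+
  interpret P: primeideal \<pp> OR by (rule pr)
  have sub: "PIdl\<^bsub>OR\<^esub> a \<subseteq> \<pp>" if "ideal_divides D \<pp> (PIdl\<^bsub>OR\<^esub> a)" for a
    using that ideal_prod_inter[OF P.is_ideal] unfolding ideal_divides_def by blast
  have "2 \<in> PIdl\<^bsub>OR\<^esub> 2" "om \<in> PIdl\<^bsub>OR\<^esub> om" unfolding PIdl_iff using Or_01(2) by (metis mult_1)+
  then have m2: "2 \<in> \<pp>" "om \<in> \<pp>" using sub d by blast+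
  have mul: "x * a \<in> \<pp>" if "x \<in> Or" "a \<in> \<pp>" for x a using P.I_l_closed[of a x] that by simp
  have add: "x + y \<in> \<pp>" if "x \<in> \<pp>" "y \<in> \<pp>" for x y using P.a_closed[of x y] that by simp
  have in2: "of_int m + of_int n * om \<in> \<pp>" if ev: "even m" for m n
  proof -
    obtain k where "m = 2 * k" using ev by blast
    then have "of_int m + of_int n * om = of_int k * 2 + of_int n * om" by simp
    then show ?thesis using add[OF mul[OF Or_int m2(1)] mul[OF Or_int m2(2)]] by simp
  qed
  have "1 \<notin> \<pp>" using P.one_imp_carrier P.I_notcarr by auto
  show "\<pp> = pp2"
  proof (intro equalityI subsetI)
    fix x assume x: "x \<in> \<pp>"
    then have "x \<in> Or" using P.a_subset by auto
    then obtain m n where mn: "x = of_int m + of_int n * om" unfolding quad_order_def by blast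
    have "even m"
    proof (rule ccontr)
      assume "odd m"
      then have "of_int (1 - m) + of_int (- n) * om \<in> \<pp>" by (intro in2) simp
      from add[OF x this] have "1 \<in> \<pp>" unfolding mn by (simp add: algebra_simps)
      then show False using \<open>1 \<notin> \<pp>\<close> by blast
    qed
    then show "x \<in> pp2" unfolding mn pp2_cong by (rule cong_idealI)
  next
    fix x assume "x \<in> pp2"
    then show "x \<in> \<pp>" using in2 unfolding pp2_def by blast
  qed
qed

end

theorem theorem5p17:
  fixes D :: int
  assumes "D > 0"
    and "\<not> (\<exists>k::int. D = k\<^sup>2)"
    and "D mod 4 = 0 \<or> D mod 4 = 1"
  shows "(D mod 8 = 5 \<longrightarrow> pseudo_parabolic_maximal D (SL_L1 D)) \<and>
         (D mod 8 = 1 \<longrightarrow>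
            (\<exists>!\<pp>. common_prime_divisor D \<pp>) \<and>
            (\<forall>\<pp>. common_prime_divisor D \<pp> \<longrightarrow>
               ideal_pseudo_parabolic_maximal D \<pp> (SL_L1 D)))"
proof (intro conjI impI)
  assume m: "D mod 8 = 5"
  then have "D mod 4 = 1" by presburger
  then interpret quad D using assms by unfold_locales
  have "odd NN" using m D_NN by presburger
  then show "pseudo_parabolic_maximal D (SL_L1 D)" unfolding SL_L1_def by (rule maximal_odd)
next
  assume m: "D mod 8 = 1"
  then have "D mod 4 = 1" by presburger
  then interpret quad D using assms by unfold_locales
  have ev: "even NN" using m D_NN by presburger
  show "\<exists>!\<pp>. common_prime_divisor D \<pp>" using common_prime_divisor_iff[OF ev] by simp
  show "\<forall>\<pp>. common_prime_divisor D \<pp> \<longrightarrow> ideal_pseudo_parabolic_maximal D \<pp> (SL_L1 D)"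
    using common_prime_divisor_iff[OF ev] maximal_even[OF ev] unfolding SL_L1_def by simp
qed

end
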